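(* Let $k$ be a commutative ring, let $A$ be an associative unital $k$-algebra, and let $G$ be a finite group of $k$-algebra automorphisms of $A$ with $|G|$ invertible in $k$. Then there is a (Connes periodicity) long exact sequence $$\cdots \rightarrow HH_n^G(A) \rightarrow HC_n(A \rtimes G) \rightarrow HC_{n-2}(A \rtimes G) \rightarrow HH_{n-1}^G(A) \rightarrow \cdots .$$
   Context: The crossed product algebra $A \rtimes G$ is the free left $A$-module on $G$ with multiplication $(a g)(a' h) = a\, g(a')\, gh$; $HC_*(A \rtimes G)$ is its usual cyclic homology as a $k$-algebra. $A^{(n+1)}$ is the $(n+1)$-fold tensor product of $A$ over $k$; generators of $k[G] \otimes A^{(n+1)}$ are written $(g/a_0,\dots,a_n)$. The group $G$ acts by $h\cdot(g/a_0,\dots,a_n) = (hgh^{-1}/h(a_0),\dots,h(a_n))$, and $\frac{k[G]\otimes A^{(n+1)}}{G}$ denotes the module of coinvariants. The map $b$ is $b(g/a_0,\dots,a_n) = \sum_{i=0}^{n-1}(-1)^i (g/a_0,\dots,a_i a_{i+1},\dots,a_n) + (-1)^n (g/g^{-1}(a_n)a_0, a_1,\dots,a_{n-1})$. The $G$-Hochschild homology $HH_*^G(A)$ is the homology of the chain complex $\bigl(\frac{k[G]\otimes A^{(n+1)}}{G}, b\bigr)$. *)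

theory Defs
  imports "HOL-Algebra.Module" "HOL-Algebra.Bij" "HOL-Algebra.AbelCoset"
begin

section \<open>Modules: homomorphisms, free modules, quotients\<close>

text \<open>
  Modules are records of type \<open>module\<close>, which extends \<open>ring\<close>; their fields \<open>mult\<close> and \<open>one\<close>
  play no role and are left \<open>undefined\<close> in the constructions below.
\<close>

definition mod_hom ::
    "('k, 'r) ring_scheme \<Rightarrow> ('k, 'x, 'm) module_scheme \<Rightarrow> ('k, 'y, 'n) module_scheme \<Rightarrow> ('x \<Rightarrow> 'y) set"
  where "mod_hom R M N =
    {f \<in> carrier M \<rightarrow> carrier N.
       (\<forall>x\<in>carrier M. \<forall>y\<in>carrier M. f (x \<oplus>\<^bsub>M\<^esub> y) = f x \<oplus>\<^bsub>N\<^esub> f y) \<and>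
       (\<forall>c\<in>carrier R. \<forall>x\<in>carrier M. f (c \<odot>\<^bsub>M\<^esub> x) = c \<odot>\<^bsub>N\<^esub> f x)}"

text \<open>The linear map \<open>M \<rightarrow> N\<close> with \<open>e i \<mapsto> v i\<close> for all \<open>i \<in> I\<close>. It is only used where the \<open>e i\<close>
  generate \<open>M\<close> and \<open>v\<close> respects the relations between them, so that there is exactly one
  such map (extensional outside \<open>carrier M\<close>).\<close>

definition lin_ext ::
    "('k, 'r) ring_scheme \<Rightarrow> ('k, 'x, 'm) module_scheme \<Rightarrow> ('k, 'y, 'n) module_scheme \<Rightarrow>
     'i set \<Rightarrow> ('i \<Rightarrow> 'x) \<Rightarrow> ('i \<Rightarrow> 'y) \<Rightarrow> 'x \<Rightarrow> 'y"
  where "lin_ext R M N I e v =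
    (THE f. f \<in> mod_hom R M N \<and> f \<in> extensional (carrier M) \<and> (\<forall>i\<in>I. f (e i) = v i))"

definition mod_span :: "('k, 'r) ring_scheme \<Rightarrow> ('k, 'x, 'm) module_scheme \<Rightarrow> 'x set \<Rightarrow> 'x set"
  where "mod_span R M X = \<Inter>{H. submodule H R M \<and> X \<subseteq> H}"

definition free_mod :: "('k, 'r) ring_scheme \<Rightarrow> 'i set \<Rightarrow> ('k, 'i \<Rightarrow> 'k) module"
  where "free_mod R I =
    \<lparr>carrier = {f \<in> I \<rightarrow>\<^sub>E carrier R. finite {i \<in> I. f i \<noteq> \<zero>\<^bsub>R\<^esub>}},
     mult = undefined, one = undefined,
     zero = (\<lambda>i\<in>I. \<zero>\<^bsub>R\<^esub>),
     add = (\<lambda>f f'. \<lambda>i\<in>I. f i \<oplus>\<^bsub>R\<^esub> f' i),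
     smult = (\<lambda>c f. \<lambda>i\<in>I. c \<otimes>\<^bsub>R\<^esub> f i)\<rparr>"

definition free_gen :: "('k, 'r) ring_scheme \<Rightarrow> 'i set \<Rightarrow> 'i \<Rightarrow> 'i \<Rightarrow> 'k"
  where "free_gen R I j = (\<lambda>i\<in>I. if i = j then \<one>\<^bsub>R\<^esub> else \<zero>\<^bsub>R\<^esub>)"

definition quot_mod :: "('k, 'x, 'm) module_scheme \<Rightarrow> 'x set \<Rightarrow> ('k, 'x set) module"
  where "quot_mod M N =
    \<lparr>carrier = a_rcosets\<^bsub>M\<^esub> N,
     mult = undefined, one = undefined,
     zero = N,
     add = set_add M,
     smult = (\<lambda>c X. set_add M N ((\<lambda>x. c \<odot>\<^bsub>M\<^esub> x) ` X))\<rparr>"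

text \<open>The map \<open>M/N \<rightarrow> M'/N'\<close>, \<open>x + N \<mapsto> f x + N'\<close>, induced by a linear map \<open>f\<close> with \<open>f ` N \<subseteq> N'\<close>.\<close>

definition quot_map ::
    "('k, 'x, 'm) module_scheme \<Rightarrow> 'x set \<Rightarrow> ('k, 'y, 'n) module_scheme \<Rightarrow> 'y set \<Rightarrow>
     ('x \<Rightarrow> 'y) \<Rightarrow> 'x set \<Rightarrow> 'y set"
  where "quot_map M N M' N' f = (\<lambda>X\<in>carrier (quot_mod M N). set_add M' N' (f ` X))"


section \<open>Tensor products\<close>

definition tensor_rels ::
    "('k, 'r) ring_scheme \<Rightarrow> ('k, 'x, 'm) module_scheme \<Rightarrow> ('k, 'y, 'n) module_scheme \<Rightarrow>
     ('x \<times> 'y \<Rightarrow> 'k) set"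
  where "tensor_rels R M N =
    (let I = carrier M \<times> carrier N; F = free_mod R I; e = free_gen R I in mod_span R F
      ({e (x \<oplus>\<^bsub>M\<^esub> x', y) \<ominus>\<^bsub>F\<^esub> (e (x, y) \<oplus>\<^bsub>F\<^esub> e (x', y)) | x x' y.
          x \<in> carrier M \<and> x' \<in> carrier M \<and> y \<in> carrier N} \<union>
       {e (x, y \<oplus>\<^bsub>N\<^esub> y') \<ominus>\<^bsub>F\<^esub> (e (x, y) \<oplus>\<^bsub>F\<^esub> e (x, y')) | x y y'.
          x \<in> carrier M \<and> y \<in> carrier N \<and> y' \<in> carrier N} \<union>
       {e (c \<odot>\<^bsub>M\<^esub> x, y) \<ominus>\<^bsub>F\<^esub> c \<odot>\<^bsub>F\<^esub> e (x, y) | c x y.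
          c \<in> carrier R \<and> x \<in> carrier M \<and> y \<in> carrier N} \<union>
       {e (x, c \<odot>\<^bsub>N\<^esub> y) \<ominus>\<^bsub>F\<^esub> c \<odot>\<^bsub>F\<^esub> e (x, y) | c x y.
          c \<in> carrier R \<and> x \<in> carrier M \<and> y \<in> carrier N}))"

definition tensor ::
    "('k, 'r) ring_scheme \<Rightarrow> ('k, 'x, 'm) module_scheme \<Rightarrow> ('k, 'y, 'n) module_scheme \<Rightarrow>
     ('k, ('x \<times> 'y \<Rightarrow> 'k) set) module"
  where "tensor R M N = quot_mod (free_mod R (carrier M \<times> carrier N)) (tensor_rels R M N)"

definition pure_tensor ::
    "('k, 'r) ring_scheme \<Rightarrow> ('k, 'x, 'm) module_scheme \<Rightarrow> ('k, 'y, 'n) module_scheme \<Rightarrow>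
     'x \<Rightarrow> 'y \<Rightarrow> ('x \<times> 'y \<Rightarrow> 'k) set"
  where "pure_tensor R M N x y =
    tensor_rels R M N +>\<^bsub>free_mod R (carrier M \<times> carrier N)\<^esub>
      free_gen R (carrier M \<times> carrier N) (x, y)"

text \<open>The \<open>m\<close>-fold tensor power of \<open>M\<close> over \<open>R\<close>: the free module on \<open>m\<close>-tuples
  modulo additivity and homogeneity in each entry.\<close>

definition tuples :: "('x, 'm) ring_scheme \<Rightarrow> nat \<Rightarrow> 'x list set"
  where "tuples M m = {xs. length xs = m \<and> set xs \<subseteq> carrier M}"

definition tensor_power_rels ::
    "('k, 'r) ring_scheme \<Rightarrow> ('k, 'x, 'm) module_scheme \<Rightarrow> nat \<Rightarrow> ('x list \<Rightarrow> 'k) set"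
  where "tensor_power_rels R M m =
    (let F = free_mod R (tuples M m); e = free_gen R (tuples M m) in mod_span R F
      ({e (xs[i := x \<oplus>\<^bsub>M\<^esub> y]) \<ominus>\<^bsub>F\<^esub> (e (xs[i := x]) \<oplus>\<^bsub>F\<^esub> e (xs[i := y])) | xs i x y.
          xs \<in> tuples M m \<and> i < m \<and> x \<in> carrier M \<and> y \<in> carrier M} \<union>
       {e (xs[i := c \<odot>\<^bsub>M\<^esub> x]) \<ominus>\<^bsub>F\<^esub> c \<odot>\<^bsub>F\<^esub> e (xs[i := x]) | xs i c x.
          xs \<in> tuples M m \<and> i < m \<and> c \<in> carrier R \<and> x \<in> carrier M}))"

definition tensor_power ::
    "('k, 'r) ring_scheme \<Rightarrow> ('k, 'x, 'm) module_scheme \<Rightarrow> nat \<Rightarrow> ('k, ('x list \<Rightarrow> 'k) set) module"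
  where "tensor_power R M m = quot_mod (free_mod R (tuples M m)) (tensor_power_rels R M m)"

definition power_tensor ::
    "('k, 'r) ring_scheme \<Rightarrow> ('k, 'x, 'm) module_scheme \<Rightarrow> nat \<Rightarrow> 'x list \<Rightarrow> ('x list \<Rightarrow> 'k) set"
  where "power_tensor R M m xs =
    tensor_power_rels R M m +>\<^bsub>free_mod R (tuples M m)\<^esub> free_gen R (tuples M m) xs"


section \<open>Homology of non-negatively graded chain complexes\<close>

text \<open>The differential \<open>d n\<close> maps \<open>C (Suc n)\<close> to \<open>C n\<close>.\<close>

definition cycles :: "(nat \<Rightarrow> ('k, 'x) module) \<Rightarrow> (nat \<Rightarrow> 'x \<Rightarrow> 'x) \<Rightarrow> nat \<Rightarrow> 'x set"
  where "cycles C d n =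
    (case n of 0 \<Rightarrow> carrier (C 0) | Suc m \<Rightarrow> a_kernel (C (Suc m)) (C m) (d m))"

definition cycle_mod :: "(nat \<Rightarrow> ('k, 'x) module) \<Rightarrow> (nat \<Rightarrow> 'x \<Rightarrow> 'x) \<Rightarrow> nat \<Rightarrow> ('k, 'x) module"
  where "cycle_mod C d n = (C n)\<lparr>carrier := cycles C d n\<rparr>"

definition boundaries :: "(nat \<Rightarrow> ('k, 'x) module) \<Rightarrow> (nat \<Rightarrow> 'x \<Rightarrow> 'x) \<Rightarrow> nat \<Rightarrow> 'x set"
  where "boundaries C d n = d n ` carrier (C (Suc n))"

definition homology_mod ::
    "(nat \<Rightarrow> ('k, 'x) module) \<Rightarrow> (nat \<Rightarrow> 'x \<Rightarrow> 'x) \<Rightarrow> nat \<Rightarrow> ('k, 'x set) module"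
  where "homology_mod C d n = quot_mod (cycle_mod C d n) (boundaries C d n)"


section \<open>Algebras, automorphisms and crossed products\<close>

text \<open>The locale \<open>algebra\<close> of HOL-Algebra requires a commutative multiplication.\<close>

locale assoc_algebra = module + ring M +
  assumes smult_mult_left:
      "\<lbrakk>c \<in> carrier R; x \<in> carrier M; y \<in> carrier M\<rbrakk> \<Longrightarrow>
        (c \<odot>\<^bsub>M\<^esub> x) \<otimes>\<^bsub>M\<^esub> y = c \<odot>\<^bsub>M\<^esub> (x \<otimes>\<^bsub>M\<^esub> y)"
    and smult_mult_right:
      "\<lbrakk>c \<in> carrier R; x \<in> carrier M; y \<in> carrier M\<rbrakk> \<Longrightarrow>
        x \<otimes>\<^bsub>M\<^esub> (c \<odot>\<^bsub>M\<^esub> y) = c \<odot>\<^bsub>M\<^esub> (x \<otimes>\<^bsub>M\<^esub> y)"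

definition alg_Aut :: "('k, 'r) ring_scheme \<Rightarrow> ('k, 'a, 'm) module_scheme \<Rightarrow> ('a \<Rightarrow> 'a) monoid"
  where "alg_Aut R A =
    (BijGroup (carrier A))\<lparr>carrier := Bij (carrier A) \<inter> ring_hom A A \<inter> mod_hom R A A\<rparr>"

text \<open>For a finite group \<open>G\<close> of automorphisms, \<open>x\<close> stands for the formal sum of the \<open>(x g) g\<close>
  over \<open>g \<in> G\<close>. The product is the biadditive extension of \<open>(a g)(a' h) = a g(a') gh\<close>.\<close>

definition crossed_product ::
    "('k, 'r) ring_scheme \<Rightarrow> ('k, 'a, 'm) module_scheme \<Rightarrow> ('a \<Rightarrow> 'a) set \<Rightarrow>
     ('k, ('a \<Rightarrow> 'a) \<Rightarrow> 'a) module"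
  where "crossed_product R A G =
    \<lparr>carrier = G \<rightarrow>\<^sub>E carrier A,
     mult = (\<lambda>x y. \<lambda>u\<in>G.
       \<Oplus>\<^bsub>A\<^esub>p\<in>{p \<in> G \<times> G. fst p \<otimes>\<^bsub>alg_Aut R A\<^esub> snd p = u}.
         x (fst p) \<otimes>\<^bsub>A\<^esub> (fst p) (y (snd p))),
     one = (\<lambda>u\<in>G. if u = \<one>\<^bsub>alg_Aut R A\<^esub> then \<one>\<^bsub>A\<^esub> else \<zero>\<^bsub>A\<^esub>),
     zero = (\<lambda>u\<in>G. \<zero>\<^bsub>A\<^esub>),
     add = (\<lambda>x y. \<lambda>u\<in>G. x u \<oplus>\<^bsub>A\<^esub> y u),
     smult = (\<lambda>c x. \<lambda>u\<in>G. c \<odot>\<^bsub>A\<^esub> x u)\<rparr>"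


section \<open>Hochschild and cyclic operators\<close>

definition signed :: "('x, 'm) ring_scheme \<Rightarrow> nat \<Rightarrow> 'x \<Rightarrow> 'x"
  where "signed M i x = (if even i then x else \<ominus>\<^bsub>M\<^esub> x)"

definition contract :: "('a, 'm) ring_scheme \<Rightarrow> nat \<Rightarrow> 'a list \<Rightarrow> 'a list"
  where "contract A i as = take i as @ [as ! i \<otimes>\<^bsub>A\<^esub> as ! Suc i] @ drop (i + 2) as"

definition hoch_mod ::
    "('k, 'r) ring_scheme \<Rightarrow> ('k, 'a, 'm) module_scheme \<Rightarrow> nat \<Rightarrow> ('k, ('a list \<Rightarrow> 'k) set) module"
  where "hoch_mod R A n = tensor_power R A (n + 1)"

definition hoch_gen ::
    "('k, 'r) ring_scheme \<Rightarrow> ('k, 'a, 'm) module_scheme \<Rightarrow> nat \<Rightarrow> 'a list \<Rightarrow> ('a list \<Rightarrow> 'k) set"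
  where "hoch_gen R A n = power_tensor R A (n + 1)"

text \<open>The operators \<open>b'\<close> (without the last face) and \<open>b\<close> from degree \<open>n + 1\<close> to degree \<open>n\<close>.\<close>

definition hoch_b' ::
    "('k, 'r) ring_scheme \<Rightarrow> ('k, 'a, 'm) module_scheme \<Rightarrow> nat \<Rightarrow>
     ('a list \<Rightarrow> 'k) set \<Rightarrow> ('a list \<Rightarrow> 'k) set"
  where "hoch_b' R A n =
    lin_ext R (hoch_mod R A (Suc n)) (hoch_mod R A n) (tuples A (n + 2)) (hoch_gen R A (Suc n))
      (\<lambda>as. \<Oplus>\<^bsub>hoch_mod R A n\<^esub>i\<in>{..n}.
               signed (hoch_mod R A n) i (hoch_gen R A n (contract A i as)))"

definition hoch_b ::
    "('k, 'r) ring_scheme \<Rightarrow> ('k, 'a, 'm) module_scheme \<Rightarrow> nat \<Rightarrow>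
     ('a list \<Rightarrow> 'k) set \<Rightarrow> ('a list \<Rightarrow> 'k) set"
  where "hoch_b R A n =
    lin_ext R (hoch_mod R A (Suc n)) (hoch_mod R A n) (tuples A (n + 2)) (hoch_gen R A (Suc n))
      (\<lambda>as. (\<Oplus>\<^bsub>hoch_mod R A n\<^esub>i\<in>{..n}.
               signed (hoch_mod R A n) i (hoch_gen R A n (contract A i as)))
            \<oplus>\<^bsub>hoch_mod R A n\<^esub>
            signed (hoch_mod R A n) (Suc n)
              (hoch_gen R A n ((as ! Suc n \<otimes>\<^bsub>A\<^esub> as ! 0) # tl (butlast as))))"

definition cyc_t ::
    "('k, 'r) ring_scheme \<Rightarrow> ('k, 'a, 'm) module_scheme \<Rightarrow> nat \<Rightarrow>
     ('a list \<Rightarrow> 'k) set \<Rightarrow> ('a list \<Rightarrow> 'k) set"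
  where "cyc_t R A n =
    lin_ext R (hoch_mod R A n) (hoch_mod R A n) (tuples A (n + 1)) (hoch_gen R A n)
      (\<lambda>as. signed (hoch_mod R A n) n (hoch_gen R A n (last as # butlast as)))"

definition cyc_N ::
    "('k, 'r) ring_scheme \<Rightarrow> ('k, 'a, 'm) module_scheme \<Rightarrow> nat \<Rightarrow>
     ('a list \<Rightarrow> 'k) set \<Rightarrow> ('a list \<Rightarrow> 'k) set"
  where "cyc_N R A n x = (\<Oplus>\<^bsub>hoch_mod R A n\<^esub>i\<in>{..n}. (cyc_t R A n ^^ i) x)"


section \<open>Cyclic homology\<close>

text \<open>
  Cyclic homology is the homology of the total complex of the cyclic bicomplex, whose entry in
  column \<open>p\<close> and row \<open>q\<close> is \<open>hoch_mod R A q\<close>, with vertical differential \<open>b\<close> in even and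
  \<open>- b'\<close> in odd columns, and horizontal differential \<open>1 - t\<close> out of odd and \<open>N\<close> out of positive
  even columns. An element of total degree \<open>n\<close> is the family of its components in columns
  \<open>p \<le> n\<close>, the row being \<open>n - p\<close>.
\<close>

definition tot_mod ::
    "('k, 'r) ring_scheme \<Rightarrow> ('k, 'a, 'm) module_scheme \<Rightarrow> nat \<Rightarrow>
     ('k, nat \<Rightarrow> ('a list \<Rightarrow> 'k) set) module"
  where "tot_mod R A n =
    \<lparr>carrier = (\<Pi>\<^sub>E p\<in>{..n}. carrier (hoch_mod R A (n - p))),
     mult = undefined, one = undefined,
     zero = (\<lambda>p\<in>{..n}. \<zero>\<^bsub>hoch_mod R A (n - p)\<^esub>),
     add = (\<lambda>x y. \<lambda>p\<in>{..n}. x p \<oplus>\<^bsub>hoch_mod R A (n - p)\<^esub> y p),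
     smult = (\<lambda>c x. \<lambda>p\<in>{..n}. c \<odot>\<^bsub>hoch_mod R A (n - p)\<^esub> x p)\<rparr>"

definition tot_d ::
    "('k, 'r) ring_scheme \<Rightarrow> ('k, 'a, 'm) module_scheme \<Rightarrow> nat \<Rightarrow>
     (nat \<Rightarrow> ('a list \<Rightarrow> 'k) set) \<Rightarrow> nat \<Rightarrow> ('a list \<Rightarrow> 'k) set"
  where "tot_d R A n x = (\<lambda>p\<in>{..n}. let q = n - p; C = hoch_mod R A q in
    if even p
    then hoch_b R A q (x p) \<oplus>\<^bsub>C\<^esub> (x (Suc p) \<ominus>\<^bsub>C\<^esub> cyc_t R A q (x (Suc p)))
    else (\<ominus>\<^bsub>C\<^esub> hoch_b' R A q (x p)) \<oplus>\<^bsub>C\<^esub> cyc_N R A q (x (Suc p)))"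

definition HC ::
    "('k, 'r) ring_scheme \<Rightarrow> ('k, 'a, 'm) module_scheme \<Rightarrow> nat \<Rightarrow>
     ('k, (nat \<Rightarrow> ('a list \<Rightarrow> 'k) set) set) module"
  where "HC R A = homology_mod (tot_mod R A) (tot_d R A)"

text \<open>Connes' periodicity operator from degree \<open>n + 2\<close> to degree \<open>n\<close>, induced by deleting the
  first two columns of the cyclic bicomplex.\<close>

definition periodicity ::
    "('k, 'r) ring_scheme \<Rightarrow> ('k, 'a, 'm) module_scheme \<Rightarrow> nat \<Rightarrow>
     (nat \<Rightarrow> ('a list \<Rightarrow> 'k) set) set \<Rightarrow> (nat \<Rightarrow> ('a list \<Rightarrow> 'k) set) set"
  where "periodicity R A n =
    quot_map (cycle_mod (tot_mod R A) (tot_d R A) (n + 2)) (boundaries (tot_mod R A) (tot_d R A) (n + 2))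
             (cycle_mod (tot_mod R A) (tot_d R A) n) (boundaries (tot_mod R A) (tot_d R A) n)
             (\<lambda>x. \<lambda>p\<in>{..n}. x (p + 2))"


section \<open>\<open>G\<close>-Hochschild homology\<close>

type_synonym ('k, 'a) eq_chain = "((('a \<Rightarrow> 'a) \<Rightarrow> 'k) \<times> ('a list \<Rightarrow> 'k) set \<Rightarrow> 'k) set"

definition eq_mod ::
    "('k, 'r) ring_scheme \<Rightarrow> ('k, 'a, 'm) module_scheme \<Rightarrow> ('a \<Rightarrow> 'a) set \<Rightarrow> nat \<Rightarrow>
     ('k, ('k, 'a) eq_chain) module"
  where "eq_mod R A G n = tensor R (free_mod R G) (tensor_power R A (n + 1))"

text \<open>The generator \<open>(g/a\<^sub>0,\<dots>,a\<^sub>n)\<close>.\<close>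

definition eq_gen ::
    "('k, 'r) ring_scheme \<Rightarrow> ('k, 'a, 'm) module_scheme \<Rightarrow> ('a \<Rightarrow> 'a) set \<Rightarrow> nat \<Rightarrow>
     ('a \<Rightarrow> 'a) \<times> 'a list \<Rightarrow> ('k, 'a) eq_chain"
  where "eq_gen R A G n = (\<lambda>(g, as).
    pure_tensor R (free_mod R G) (tensor_power R A (n + 1))
      (free_gen R G g) (power_tensor R A (n + 1) as))"

definition eq_act ::
    "('k, 'r) ring_scheme \<Rightarrow> ('k, 'a, 'm) module_scheme \<Rightarrow> ('a \<Rightarrow> 'a) set \<Rightarrow> nat \<Rightarrow>
     ('a \<Rightarrow> 'a) \<Rightarrow> ('k, 'a) eq_chain \<Rightarrow> ('k, 'a) eq_chain"
  where "eq_act R A G n h =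
    lin_ext R (eq_mod R A G n) (eq_mod R A G n) (G \<times> tuples A (n + 1)) (eq_gen R A G n)
      (\<lambda>(g, as). eq_gen R A G n
        (h \<otimes>\<^bsub>alg_Aut R A\<^esub> g \<otimes>\<^bsub>alg_Aut R A\<^esub> inv\<^bsub>alg_Aut R A\<^esub> h, map h as))"

definition eq_b ::
    "('k, 'r) ring_scheme \<Rightarrow> ('k, 'a, 'm) module_scheme \<Rightarrow> ('a \<Rightarrow> 'a) set \<Rightarrow> nat \<Rightarrow>
     ('k, 'a) eq_chain \<Rightarrow> ('k, 'a) eq_chain"
  where "eq_b R A G n =
    lin_ext R (eq_mod R A G (Suc n)) (eq_mod R A G n) (G \<times> tuples A (n + 2)) (eq_gen R A G (Suc n))
      (\<lambda>(g, as). (\<Oplus>\<^bsub>eq_mod R A G n\<^esub>i\<in>{..n}.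
               signed (eq_mod R A G n) i (eq_gen R A G n (g, contract A i as)))
            \<oplus>\<^bsub>eq_mod R A G n\<^esub>
            signed (eq_mod R A G n) (Suc n)
              (eq_gen R A G n (g, ((inv\<^bsub>alg_Aut R A\<^esub> g) (as ! Suc n) \<otimes>\<^bsub>A\<^esub> as ! 0) # tl (butlast as))))"

definition coinv_rels ::
    "('k, 'r) ring_scheme \<Rightarrow> ('k, 'a, 'm) module_scheme \<Rightarrow> ('a \<Rightarrow> 'a) set \<Rightarrow> nat \<Rightarrow>
     ('k, 'a) eq_chain set"
  where "coinv_rels R A G n =
    mod_span R (eq_mod R A G n)
      {eq_act R A G n h x \<ominus>\<^bsub>eq_mod R A G n\<^esub> x | h x. h \<in> G \<and> x \<in> carrier (eq_mod R A G n)}"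

definition coinv_mod ::
    "('k, 'r) ring_scheme \<Rightarrow> ('k, 'a, 'm) module_scheme \<Rightarrow> ('a \<Rightarrow> 'a) set \<Rightarrow> nat \<Rightarrow>
     ('k, ('k, 'a) eq_chain set) module"
  where "coinv_mod R A G n = quot_mod (eq_mod R A G n) (coinv_rels R A G n)"

definition coinv_b ::
    "('k, 'r) ring_scheme \<Rightarrow> ('k, 'a, 'm) module_scheme \<Rightarrow> ('a \<Rightarrow> 'a) set \<Rightarrow> nat \<Rightarrow>
     ('k, 'a) eq_chain set \<Rightarrow> ('k, 'a) eq_chain set"
  where "coinv_b R A G n =
    quot_map (eq_mod R A G (Suc n)) (coinv_rels R A G (Suc n))
             (eq_mod R A G n) (coinv_rels R A G n) (eq_b R A G n)"

definition HHG ::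
    "('k, 'r) ring_scheme \<Rightarrow> ('k, 'a, 'm) module_scheme \<Rightarrow> ('a \<Rightarrow> 'a) set \<Rightarrow> nat \<Rightarrow>
     ('k, ('k, 'a) eq_chain set set) module"
  where "HHG R A G = homology_mod (coinv_mod R A G) (coinv_b R A G)"


section \<open>Exactness\<close>

definition exact_at ::
    "('k, 'x, 'l) module_scheme \<Rightarrow> ('x \<Rightarrow> 'y) \<Rightarrow> ('k, 'y, 'm) module_scheme \<Rightarrow> ('y \<Rightarrow> 'z) \<Rightarrow>
     ('k, 'z, 'n) module_scheme \<Rightarrow> bool"
  where "exact_at L f M g N \<longleftrightarrow> f ` carrier L = a_kernel M N g"

text \<open>
  The sequence \<open>\<dots> \<rightarrow> H n \<rightarrow> K n \<rightarrow> K (n - 2) \<rightarrow> H (n - 1) \<rightarrow> \<dots>\<close> of linear maps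
  \<open>I n : H n \<rightarrow> K n\<close>, \<open>S n : K (n + 2) \<rightarrow> K n\<close> and \<open>D n : K n \<rightarrow> H (n + 1)\<close> is exact, where
  all modules in negative degrees are zero. The last three conditions are exactness at the
  spots next to a module in negative degree: at \<open>K 1\<close> and \<open>K 0\<close> (surjectivity) and at \<open>H 0\<close>
  (injectivity).
\<close>

definition periodicity_sequence_exact ::
    "('k, 'r) ring_scheme \<Rightarrow> (nat \<Rightarrow> ('k, 'x) module) \<Rightarrow> (nat \<Rightarrow> ('k, 'y) module) \<Rightarrow>
     (nat \<Rightarrow> 'x \<Rightarrow> 'y) \<Rightarrow> (nat \<Rightarrow> 'y \<Rightarrow> 'y) \<Rightarrow> (nat \<Rightarrow> 'y \<Rightarrow> 'x) \<Rightarrow> bool"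
  where "periodicity_sequence_exact R H K I S D \<longleftrightarrow>
    (\<forall>n. I n \<in> mod_hom R (H n) (K n)) \<and>
    (\<forall>n. S n \<in> mod_hom R (K (n + 2)) (K n)) \<and>
    (\<forall>n. D n \<in> mod_hom R (K n) (H (n + 1))) \<and>
    (\<forall>n. exact_at (H (n + 2)) (I (n + 2)) (K (n + 2)) (S n) (K n)) \<and>
    (\<forall>n. exact_at (K (n + 2)) (S n) (K n) (D n) (H (n + 1))) \<and>
    (\<forall>n. exact_at (K n) (D n) (H (n + 1)) (I (n + 1)) (K (n + 1))) \<and>
    I 1 ` carrier (H 1) = carrier (K 1) \<and>
    I 0 ` carrier (H 0) = carrier (K 0) \<and>
    a_kernel (H 0) (K 0) (I 0) = {\<zero>\<^bsub>H 0\<^esub>}"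

end

theory Submission
  imports Defs
begin

text \<open>
  Write \<open>B\<close> for the crossed product and \<open>C\<close> for its Hochschild complex. The group \<open>G\<^bsup>n+1\<^esup>\<close> acts on
  \<open>C\<^sub>n\<close> by \<open>(x\<^sub>0, \<dots>, x\<^sub>n) \<mapsto> (h\<^sub>n\<inverse> x\<^sub>0 h\<^sub>0, h\<^sub>0\<inverse> x\<^sub>1 h\<^sub>1, \<dots>, h\<^sub>n\<^sub>-\<^sub>1\<inverse> x\<^sub>n h\<^sub>n)\<close>. As the order of \<open>G\<close> is
  invertible, the average \<open>P\<close> of this action is defined; it is the product of the averages \<open>E\<^sub>i\<close> over
  the single factors. Inserting a unit behind \<open>x\<^sub>i\<close> and then applying \<open>E\<^sub>0 \<dots> E\<^sub>i\<close> gives a presimplicial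
  homotopy from the identity to \<open>P\<close>, so \<open>P\<close> is a chain map and \<open>C\<close> has the same homology as the
  image of \<open>P\<close>. The map \<open>\<iota>(g/a\<^sub>0, \<dots>, a\<^sub>n) = (g a\<^sub>0, a\<^sub>1, \<dots>, a\<^sub>n)\<close> is a chain map, and \<open>P \<circ> \<iota>\<close> identifies
  the coinvariants with the image of \<open>P\<close>: every monomial \<open>(a\<^sub>0 u\<^sub>0, \<dots>, a\<^sub>n u\<^sub>n)\<close> can be moved into the
  image of \<open>\<iota>\<close> by the action, and moving all group elements to the left gives a map \<open>\<rho>\<close> back. So
  the \<open>G\<close>-Hochschild complex computes the Hochschild homology of \<open>B\<close>.

  Deleting the first two columns of the cyclic bicomplex of \<open>B\<close> is a surjective chain map. Its kernel
  is quasi-isomorphic to \<open>C\<close>, because the column with differential \<open>- b'\<close> is contractible. The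
  sequence is the long exact sequence of this short exact sequence of complexes. The connecting map
  sends the class of \<open>z\<close> to the class of \<open>x\<close> if some \<open>y\<close> over \<open>z\<close> has boundary \<open>(P \<circ> \<iota>) x\<close>.
\<close>

text \<open>The averaging works because \<open>k[G]\<close>, with the order of \<open>G\<close>
  invertible, is a separable subalgebra of \<open>B\<close>. The coinvariants of \<open>C_n\<close>
  under \<open>G^(n+1)\<close> form the Hochschild complex of \<open>B\<close> relative to
  \<open>k[G]\<close>, and averaging turns them into the direct summand \<open>im P\<close>.
  Everything is therefore compared inside the chains of \<open>B\<close>, without resolutions or
  relative tensor products. The delicate point is that all of \<open>G^(n+1)\<close> has to be
  divided out, while the \<open>G\<close>-Hochschild complex remembers one copy of \<open>G\<close>
  only: \<open>n\<close> of the factors are used up in moving group elements to the left, and the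
  last one becomes the conjugation action. This is visible in \<open>\<rho>\<close>, which is blind
  to the first \<open>n\<close> averages and turns the last into the average over that action;
  injectivity on coinvariants follows. The comparison concerns \<open>b\<close> alone. The cyclic
  operators live on \<open>B\<close>, and equivariant chains enter the bicomplex through column
  0.\<close>

lemma mod_homI:
  assumes "\<And>x. x \<in> carrier M \<Longrightarrow> f x \<in> carrier N"
    and "\<And>x y. x \<in> carrier M \<Longrightarrow> y \<in> carrier M \<Longrightarrow> f (x \<oplus>\<^bsub>M\<^esub> y) = f x \<oplus>\<^bsub>N\<^esub> f y"
    and "\<And>c x. c \<in> carrier R \<Longrightarrow> x \<in> carrier M \<Longrightarrow> f (c \<odot>\<^bsub>M\<^esub> x) = c \<odot>\<^bsub>N\<^esub> f x"
  shows "f \<in> mod_hom R M N"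
  using assms by (auto simp: mod_hom_def)

lemma mod_hom_closed: "f \<in> mod_hom R M N \<Longrightarrow> x \<in> carrier M \<Longrightarrow> f x \<in> carrier N"
  by (auto simp: mod_hom_def)

lemma mod_hom_add: "f \<in> mod_hom R M N \<Longrightarrow> x \<in> carrier M \<Longrightarrow> y \<in> carrier M \<Longrightarrow>
    f (x \<oplus>\<^bsub>M\<^esub> y) = f x \<oplus>\<^bsub>N\<^esub> f y"
  by (auto simp: mod_hom_def)

lemma mod_hom_smult: "f \<in> mod_hom R M N \<Longrightarrow> c \<in> carrier R \<Longrightarrow> x \<in> carrier M \<Longrightarrow>
    f (c \<odot>\<^bsub>M\<^esub> x) = c \<odot>\<^bsub>N\<^esub> f x"
  by (auto simp: mod_hom_def)

lemma mod_hom_comp: "f \<in> mod_hom R M N \<Longrightarrow> g \<in> mod_hom R N P \<Longrightarrow> (\<lambda>x. g (f x)) \<in> mod_hom R M P"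
  by (auto simp: mod_hom_def Pi_def)

lemma mod_hom_cong: "f \<in> mod_hom R M N \<Longrightarrow> module R M \<Longrightarrow>
    (\<And>x. x \<in> carrier M \<Longrightarrow> g x = f x) \<Longrightarrow> g \<in> mod_hom R M N"
  by (auto simp: mod_hom_def Pi_def abelian_monoid.a_closed module.axioms abelian_group.axioms module.smult_closed)

lemma mod_hom_id: "(\<lambda>x. x) \<in> mod_hom R M M"
  by (auto simp: mod_hom_def)

text \<open>The operators below are made interpretations of this locale, so that their compatibility
  with zero, signs and finite sums comes for free.\<close>

locale linear_map = M: module R M + N: module R N for R and M and N and f +
  assumes hom: "f \<in> mod_hom R M N"
begin

lemma closed [simp]: "x \<in> carrier M \<Longrightarrow> f x \<in> carrier N"
  using hom by (rule mod_hom_closed)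

lemma add: "x \<in> carrier M \<Longrightarrow> y \<in> carrier M \<Longrightarrow> f (x \<oplus>\<^bsub>M\<^esub> y) = f x \<oplus>\<^bsub>N\<^esub> f y"
  using hom by (rule mod_hom_add)

lemma smult: "c \<in> carrier R \<Longrightarrow> x \<in> carrier M \<Longrightarrow> f (c \<odot>\<^bsub>M\<^esub> x) = c \<odot>\<^bsub>N\<^esub> f x"
  using hom by (rule mod_hom_smult)

text \<open>\<open>mod_hom\<close> demands additivity and homogeneity only; the scalars 0 and -1
  give this lemma and the next.\<close>

lemma zero [simp]: "f \<zero>\<^bsub>M\<^esub> = \<zero>\<^bsub>N\<^esub>"
  using smult[of "\<zero>\<^bsub>R\<^esub>" "\<zero>\<^bsub>M\<^esub>"] by simp

lemma neg: "x \<in> carrier M \<Longrightarrow> f (\<ominus>\<^bsub>M\<^esub> x) = \<ominus>\<^bsub>N\<^esub> f x"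
  using smult[of "\<ominus>\<^bsub>R\<^esub> \<one>\<^bsub>R\<^esub>" x] by (simp add: M.smult_l_minus N.smult_l_minus)

lemma minus: "x \<in> carrier M \<Longrightarrow> y \<in> carrier M \<Longrightarrow> f (x \<ominus>\<^bsub>M\<^esub> y) = f x \<ominus>\<^bsub>N\<^esub> f y"
  by (simp add: a_minus_def add neg)

lemma finsum: "g \<in> I \<rightarrow> carrier M \<Longrightarrow> f (\<Oplus>\<^bsub>M\<^esub>i\<in>I. g i) = (\<Oplus>\<^bsub>N\<^esub>i\<in>I. f (g i))"
proof (induction I rule: infinite_finite_induct)
  case (insert x F)
  then have "f (finsum M g (insert x F)) = f (g x \<oplus>\<^bsub>M\<^esub> finsum M g F)"
    by (subst M.finsum_insert) (auto simp: Pi_def)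
  also have "\<dots> = f (g x) \<oplus>\<^bsub>N\<^esub> f (finsum M g F)"
    using insert by (intro add) (auto simp: Pi_def)
  also have "f (finsum M g F) = (\<Oplus>\<^bsub>N\<^esub>i\<in>F. f (g i))"
    using insert by auto
  finally show ?case
    using insert by (subst N.finsum_insert) (auto simp: Pi_def)
qed auto

lemma signed: "x \<in> carrier M \<Longrightarrow> f (signed M i x) = signed N i (f x)"
  by (simp add: signed_def neg)

end

lemma linear_mapI: "module R M \<Longrightarrow> module R N \<Longrightarrow> f \<in> mod_hom R M N \<Longrightarrow> linear_map R M N f"
  by (simp add: linear_map_def linear_map_axioms_def)

context module
begin

lemma signed_closed [simp]: "x \<in> carrier M \<Longrightarrow> signed M i x \<in> carrier M"
  by (simp add: signed_def)

lemma signed_signed: "x \<in> carrier M \<Longrightarrow> signed M i (signed M j x) = signed M (i + j) x"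
  by (auto simp: signed_def)

lemma signed_add: "x \<in> carrier M \<Longrightarrow> y \<in> carrier M \<Longrightarrow>
    signed M i (x \<oplus>\<^bsub>M\<^esub> y) = signed M i x \<oplus>\<^bsub>M\<^esub> signed M i y"
  by (auto simp: signed_def minus_add)

lemma signed_Suc: "x \<in> carrier M \<Longrightarrow> signed M (Suc i) x = \<ominus>\<^bsub>M\<^esub> signed M i x"
  by (auto simp: signed_def)

lemma signed_zero [simp]: "signed M i \<zero>\<^bsub>M\<^esub> = \<zero>\<^bsub>M\<^esub>"
  by (auto simp: signed_def)

lemma signed_smult: "c \<in> carrier R \<Longrightarrow> x \<in> carrier M \<Longrightarrow> signed M i (c \<odot>\<^bsub>M\<^esub> x) = c \<odot>\<^bsub>M\<^esub> signed M i x"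
  by (auto simp: signed_def smult_r_minus)

lemma neg_smult: "x \<in> carrier M \<Longrightarrow> \<ominus>\<^bsub>M\<^esub> x = (\<ominus>\<^bsub>R\<^esub> \<one>\<^bsub>R\<^esub>) \<odot>\<^bsub>M\<^esub> x"
  by (simp add: smult_l_minus)

lemma submoduleI':
  assumes "H \<subseteq> carrier M" "\<zero>\<^bsub>M\<^esub> \<in> H" "\<And>a b. \<lbrakk>a \<in> H ; b \<in> H\<rbrakk> \<Longrightarrow> a \<oplus>\<^bsub>M\<^esub> b \<in> H"
    "\<And>a x. \<lbrakk>a \<in> carrier R; x \<in> H\<rbrakk> \<Longrightarrow> a \<odot>\<^bsub>M\<^esub> x \<in> H"
  shows "submodule H R M"
  using assms by (intro submoduleI) (auto simp: neg_smult subset_iff)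

lemma finsum_neg:
  assumes "f \<in> I \<rightarrow> carrier M"
  shows "\<ominus>\<^bsub>M\<^esub> (\<Oplus>\<^bsub>M\<^esub>i\<in>I. f i) = (\<Oplus>\<^bsub>M\<^esub>i\<in>I. \<ominus>\<^bsub>M\<^esub> f i)"
proof (cases "finite I")
  case True
  have "(\<Oplus>\<^bsub>M\<^esub>i\<in>I. \<ominus>\<^bsub>M\<^esub> f i) = (\<Oplus>\<^bsub>M\<^esub>i\<in>I. (\<ominus>\<^bsub>R\<^esub> \<one>\<^bsub>R\<^esub>) \<odot>\<^bsub>M\<^esub> f i)"
    using assms by (intro finsum_cong') (auto simp: smult_l_minus Pi_def)
  then show ?thesis
    using assms True by (simp add: finsum_smult_ldistr[symmetric] smult_l_minus)
\<comment> \<open>Over an infinite index set both sums are zero by convention.\<close>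
qed simp

lemma finsum_signed:
  assumes "f \<in> I \<rightarrow> carrier M"
  shows "signed M k (\<Oplus>\<^bsub>M\<^esub>i\<in>I. f i) = (\<Oplus>\<^bsub>M\<^esub>i\<in>I. signed M k (f i))"
  using assms by (simp add: signed_def finsum_neg)

lemma finsum_prod:
  assumes "finite I" "finite J" "f \<in> I \<times> J \<rightarrow> carrier M"
  shows "(\<Oplus>\<^bsub>M\<^esub>i\<in>I. \<Oplus>\<^bsub>M\<^esub>j\<in>J. f (i, j)) = (\<Oplus>\<^bsub>M\<^esub>p\<in>I \<times> J. f p)"
  using assms(1,3)
proof (induction I)
  case (insert x F)
  have "(\<Oplus>\<^bsub>M\<^esub>p\<in>insert x F \<times> J. f p) = (\<Oplus>\<^bsub>M\<^esub>p\<in>({x} \<times> J) \<union> F \<times> J. f p)"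
    by (rule arg_cong[where f = "finsum M f"]) auto
  also have "\<dots> = (\<Oplus>\<^bsub>M\<^esub>p\<in>{x} \<times> J. f p) \<oplus>\<^bsub>M\<^esub> (\<Oplus>\<^bsub>M\<^esub>p\<in>F \<times> J. f p)"
    using insert assms(2) by (intro finsum_Un_disjoint) auto
  also have "{x} \<times> J = Pair x ` J" by auto
  also have "(\<Oplus>\<^bsub>M\<^esub>p\<in>Pair x ` J. f p) = (\<Oplus>\<^bsub>M\<^esub>j\<in>J. f (x, j))"
    using insert by (intro finsum_reindex) (auto simp: inj_on_def)
  finally show ?case using insert
    by (subst finsum_insert) (auto simp: Pi_def)
qed simp

lemma finsum_swap:
  assumes "finite I" "finite J" "\<And>i j. i \<in> I \<Longrightarrow> j \<in> J \<Longrightarrow> f i j \<in> carrier M"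
  shows "(\<Oplus>\<^bsub>M\<^esub>i\<in>I. \<Oplus>\<^bsub>M\<^esub>j\<in>J. f i j) = (\<Oplus>\<^bsub>M\<^esub>j\<in>J. \<Oplus>\<^bsub>M\<^esub>i\<in>I. f i j)"
proof -
  have "(\<Oplus>\<^bsub>M\<^esub>i\<in>I. \<Oplus>\<^bsub>M\<^esub>j\<in>J. f i j) = (\<Oplus>\<^bsub>M\<^esub>p\<in>I \<times> J. f (fst p) (snd p))"
    using finsum_prod[of I J "\<lambda>p. f (fst p) (snd p)"] assms by (simp add: Pi_def)
  also have "I \<times> J = prod.swap ` (J \<times> I)" by auto
  also have "(\<Oplus>\<^bsub>M\<^esub>p\<in>prod.swap ` (J \<times> I). f (fst p) (snd p)) = (\<Oplus>\<^bsub>M\<^esub>p\<in>J \<times> I. f (snd p) (fst p))"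
    using assms by (subst finsum_reindex) (auto simp: inj_on_def)
  also have "\<dots> = (\<Oplus>\<^bsub>M\<^esub>j\<in>J. \<Oplus>\<^bsub>M\<^esub>i\<in>I. f i j)"
    using finsum_prod[of J I "\<lambda>p. f (snd p) (fst p)"] assms by (simp add: Pi_def)
  finally show ?thesis .
qed

lemma finsum_bij:
  assumes "bij_betw h I J" "\<And>i. i \<in> I \<Longrightarrow> f i = g (h i)" "g \<in> J \<rightarrow> carrier M"
  shows "(\<Oplus>\<^bsub>M\<^esub>i\<in>I. f i) = (\<Oplus>\<^bsub>M\<^esub>j\<in>J. g j)"
proof -
  have J: "J = h ` I" and inj: "inj_on h I" using assms(1) by (auto simp: bij_betw_def)
  have "(\<Oplus>\<^bsub>M\<^esub>j\<in>J. g j) = (\<Oplus>\<^bsub>M\<^esub>i\<in>I. g (h i))"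
    unfolding J using assms(3) inj by (intro finsum_reindex) (auto simp: J)
  also have "\<dots> = (\<Oplus>\<^bsub>M\<^esub>i\<in>I. f i)"
    using assms(2,3) J by (intro finsum_cong') auto
  finally show ?thesis by simp
qed

lemma finsum_single:
  assumes "finite I" "j \<in> I" "f j \<in> carrier M" "\<And>i. i \<in> I \<Longrightarrow> i \<noteq> j \<Longrightarrow> f i = \<zero>\<^bsub>M\<^esub>"
  shows "(\<Oplus>\<^bsub>M\<^esub>i\<in>I. f i) = f j"
proof -
  have "(\<Oplus>\<^bsub>M\<^esub>i\<in>I. f i) = (\<Oplus>\<^bsub>M\<^esub>i\<in>insert j (I - {j}). f i)"
    using assms(2) by (simp add: insert_absorb)
  also have "\<dots> = f j \<oplus>\<^bsub>M\<^esub> (\<Oplus>\<^bsub>M\<^esub>i\<in>I - {j}. f i)"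
    using assms by (intro finsum_insert) auto
  also have "(\<Oplus>\<^bsub>M\<^esub>i\<in>I - {j}. f i) = (\<Oplus>\<^bsub>M\<^esub>i\<in>I - {j}. \<zero>\<^bsub>M\<^esub>)"
    using assms by (intro finsum_cong') auto
  finally show ?thesis
    using assms(3) by simp
qed

lemma minus_self [simp]: "x \<in> carrier M \<Longrightarrow> x \<ominus>\<^bsub>M\<^esub> x = \<zero>\<^bsub>M\<^esub>"
  by (simp add: a_minus_def M.r_neg)

lemma minus_eq_iff:
  assumes "x \<in> carrier M" "y \<in> carrier M" "z \<in> carrier M"
  shows "x \<ominus>\<^bsub>M\<^esub> y = z \<longleftrightarrow> x = z \<oplus>\<^bsub>M\<^esub> y"
  using assms by (auto simp: a_minus_def M.a_assoc M.l_neg M.r_neg)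

lemma minus_eq_zero_iff: "x \<in> carrier M \<Longrightarrow> y \<in> carrier M \<Longrightarrow> x \<ominus>\<^bsub>M\<^esub> y = \<zero>\<^bsub>M\<^esub> \<longleftrightarrow> x = y"
  by (simp add: minus_eq_iff)

lemma diff_add_cancel':
  assumes "x \<in> carrier M" "y \<in> carrier M"
  shows "(x \<ominus>\<^bsub>M\<^esub> y) \<oplus>\<^bsub>M\<^esub> y = x" "y \<oplus>\<^bsub>M\<^esub> (x \<ominus>\<^bsub>M\<^esub> y) = x"
proof -
  have *: "x \<ominus>\<^bsub>M\<^esub> y \<in> carrier M" using assms by (rule M.minus_closed)
  show "(x \<ominus>\<^bsub>M\<^esub> y) \<oplus>\<^bsub>M\<^esub> y = x"
    using iffD1[OF minus_eq_iff[OF assms *] refl] by (rule sym)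
  then show "y \<oplus>\<^bsub>M\<^esub> (x \<ominus>\<^bsub>M\<^esub> y) = x"
    using M.a_comm[OF assms(2) *] by (rule trans[rotated])
qed

end

section \<open>Spans\<close>

context module
begin

lemma mod_span_least: "submodule H R M \<Longrightarrow> X \<subseteq> H \<Longrightarrow> mod_span R M X \<subseteq> H"
  by (auto simp: mod_span_def)

lemma mod_span_superset: "X \<subseteq> mod_span R M X"
  by (auto simp: mod_span_def)

lemma submodule_zero: "submodule H R M \<Longrightarrow> \<zero>\<^bsub>M\<^esub> \<in> H"
  using submodule.axioms(1) subgroup.one_closed by fastforce

lemma mod_span_submodule: "X \<subseteq> carrier M \<Longrightarrow> submodule (mod_span R M X) R M"
  using carrier_is_submodule
  by (intro submoduleI') (auto simp: mod_span_def submodule_zero intro: submoduleE(4,5))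

text \<open>The carrier elements satisfying \<open>P\<close> form a submodule containing
  \<open>X\<close>. The induction steps may assume membership in the carrier, not in the
  span.\<close>

lemma mod_span_induct [consumes 2, case_names zero gen add smult]:
  assumes "x \<in> mod_span R M X" "X \<subseteq> carrier M" "P \<zero>\<^bsub>M\<^esub>" "\<And>x. x \<in> X \<Longrightarrow> P x"
    "\<And>x y. x \<in> carrier M \<Longrightarrow> y \<in> carrier M \<Longrightarrow> P x \<Longrightarrow> P y \<Longrightarrow> P (x \<oplus>\<^bsub>M\<^esub> y)"
    "\<And>c x. c \<in> carrier R \<Longrightarrow> x \<in> carrier M \<Longrightarrow> P x \<Longrightarrow> P (c \<odot>\<^bsub>M\<^esub> x)"
  shows "P x"
proof -
  have "submodule {x \<in> carrier M. P x} R M"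
    using assms by (intro submoduleI') auto
  then have "mod_span R M X \<subseteq> {x \<in> carrier M. P x}"
    using assms by (intro mod_span_least) auto
  then show ?thesis using assms(1) by auto
qed

end

lemma mod_hom_eq_on_span:
  assumes "module R M" "module R N" "f \<in> mod_hom R M N" "g \<in> mod_hom R M N"
    and "X \<subseteq> carrier M" "\<And>x. x \<in> X \<Longrightarrow> f x = g x" "x \<in> mod_span R M X"
  shows "f x = g x"
proof -
  interpret F: linear_map R M N f using assms by (intro linear_mapI)
  interpret H: linear_map R M N g using assms by (intro linear_mapI)
  show ?thesis using assms(7,5)
  proof (induction rule: F.M.mod_span_induct)
    case zero then show ?case by simp
  qed (simp_all add: assms(6) F.add H.add F.smult H.smult)
qed

lemma mod_hom_eq_on_gens:
  assumes "module R M" "module R N" "f \<in> mod_hom R M N" "g \<in> mod_hom R M N"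
    and "e \<in> I \<rightarrow> carrier M" "mod_span R M (e ` I) = carrier M"
    and "\<And>i. i \<in> I \<Longrightarrow> f (e i) = g (e i)" "x \<in> carrier M"
  shows "f x = g x"
proof (rule mod_hom_eq_on_span[OF assms(1-4)])
  show "e ` I \<subseteq> carrier M" using assms(5) by blast
  show "x \<in> mod_span R M (e ` I)" using assms(6,8) by simp
qed (use assms(7) in blast)

text \<open>A definite description is of use only once existence and uniqueness are known:
  \<open>f\<close> supplies the first, generation the second. The third conclusion lets any
  convenient linear map with the right values stand in for the operator.\<close>

lemma lin_ext:
  assumes "module R M" "module R N" "e \<in> I \<rightarrow> carrier M" "mod_span R M (e ` I) = carrier M"
    and "f \<in> mod_hom R M N" "\<And>i. i \<in> I \<Longrightarrow> f (e i) = v i"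
  shows "lin_ext R M N I e v \<in> mod_hom R M N"
    and "\<And>i. i \<in> I \<Longrightarrow> lin_ext R M N I e v (e i) = v i"
    and "\<And>x. x \<in> carrier M \<Longrightarrow> lin_ext R M N I e v x = f x"
proof -
  let ?P = "\<lambda>f. f \<in> mod_hom R M N \<and> f \<in> extensional (carrier M) \<and> (\<forall>i\<in>I. f (e i) = v i)"
  \<comment> \<open>\<open>lin_ext\<close> asks for a map that is extensional outside the carrier,
    so \<open>f\<close> is cut down first.\<close>
  let ?f = "restrict f (carrier M)"
  have e: "e i \<in> carrier M" if "i \<in> I" for i using assms(3) that by auto
  have hom: "?f \<in> mod_hom R M N"
    by (rule mod_hom_cong[OF assms(5,1)]) simp
  have val: "?f (e i) = v i" if "i \<in> I" for i
    using e[OF that] assms(6)[OF that] by simp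
  have "g = ?f" if g: "?P g" for g
  proof
    fix x
    show "g x = ?f x"
    proof (cases "x \<in> carrier M")
      case True
      show ?thesis
        by (rule mod_hom_eq_on_gens[OF assms(1,2) _ hom assms(3,4) _ True])
          (use g val in simp_all)
    next
      case False
      then show ?thesis using g by (auto simp: extensional_def)
    qed
  qed
  then have *: "lin_ext R M N I e v = ?f"
    unfolding lin_ext_def using hom val by (intro the_equality) blast+
  show "lin_ext R M N I e v \<in> mod_hom R M N"
    "\<And>i. i \<in> I \<Longrightarrow> lin_ext R M N I e v (e i) = v i"
    "\<And>x. x \<in> carrier M \<Longrightarrow> lin_ext R M N I e v x = f x"
    unfolding * by (rule hom, erule val, simp)
qed

lemma mod_hom_finsum:
  assumes "module R M" "module R N" "\<And>i. i \<in> I \<Longrightarrow> f i \<in> mod_hom R M N"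
  shows "(\<lambda>x. \<Oplus>\<^bsub>N\<^esub>i\<in>I. f i x) \<in> mod_hom R M N"
proof -
  interpret M: module R M by fact
  interpret N: module R N by fact
  show ?thesis
  proof (cases "finite I")
    case True
    show ?thesis
    proof (rule mod_homI)
      fix x y assume xy: "x \<in> carrier M" "y \<in> carrier M"
      have "(\<Oplus>\<^bsub>N\<^esub>i\<in>I'. f i (x \<oplus>\<^bsub>M\<^esub> y)) = (\<Oplus>\<^bsub>N\<^esub>i\<in>I'. f i x) \<oplus>\<^bsub>N\<^esub> (\<Oplus>\<^bsub>N\<^esub>i\<in>I'. f i y)"
        if "I' \<subseteq> I" "finite I'" for I'
        using that(2,1)
      proof (induction I')
        case (insert i F)
        then show ?case
          using xy assms(3) mod_hom_closed[OF assms(3)]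
          by (simp add: Pi_def mod_hom_add[OF assms(3)] subset_iff N.a_ac)
      qed simp
      from this[OF subset_refl True] show "(\<Oplus>\<^bsub>N\<^esub>i\<in>I. f i (x \<oplus>\<^bsub>M\<^esub> y)) = (\<Oplus>\<^bsub>N\<^esub>i\<in>I. f i x) \<oplus>\<^bsub>N\<^esub> (\<Oplus>\<^bsub>N\<^esub>i\<in>I. f i y)" .
    next
      fix c x assume "c \<in> carrier R" "x \<in> carrier M"
      then show "(\<Oplus>\<^bsub>N\<^esub>i\<in>I. f i (c \<odot>\<^bsub>M\<^esub> x)) = c \<odot>\<^bsub>N\<^esub> (\<Oplus>\<^bsub>N\<^esub>i\<in>I. f i x)"
        using assms mod_hom_closed[OF assms(3)] True
        by (subst N.finsum_smult_ldistr) (auto intro!: N.finsum_cong' simp: mod_hom_smult[OF assms(3)])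
    qed (use assms mod_hom_closed[OF assms(3)] in auto)
  next
    case False
    then show ?thesis by (auto simp: mod_hom_def)
  qed
qed

lemma mod_hom_plus:
  assumes "module R M" "module R N" "f \<in> mod_hom R M N" "g \<in> mod_hom R M N"
  shows "(\<lambda>x. f x \<oplus>\<^bsub>N\<^esub> g x) \<in> mod_hom R M N"
proof -
  interpret F: linear_map R M N f using assms by (intro linear_mapI)
  interpret G: linear_map R M N g using assms by (intro linear_mapI)
  show ?thesis
    by (rule mod_homI)
      (simp_all add: F.add G.add F.smult G.smult F.N.smult_r_distr F.N.a_ac)
qed

lemma mod_hom_smultI:
  assumes "module R M" "module R N" "f \<in> mod_hom R M N" "c \<in> carrier R"
  shows "(\<lambda>x. c \<odot>\<^bsub>N\<^esub> f x) \<in> mod_hom R M N"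
proof -
  interpret F: linear_map R M N f using assms by (intro linear_mapI)
  show ?thesis using assms(4)
    by (intro mod_homI)
      (simp_all add: F.add F.smult F.N.smult_r_distr F.N.smult_assoc1[symmetric] F.M.R.m_comm)
qed

lemma mod_hom_signed:
  assumes "module R M" "module R N" "f \<in> mod_hom R M N"
  shows "(\<lambda>x. signed N i (f x)) \<in> mod_hom R M N"
proof -
  interpret F: linear_map R M N f using assms by (intro linear_mapI)
  show ?thesis
    by (intro mod_homI) (simp_all add: F.add F.smult F.N.signed_add F.N.signed_smult)
qed

lemma mod_hom_neg:
  assumes "module R M" "module R N" "f \<in> mod_hom R M N"
  shows "(\<lambda>x. \<ominus>\<^bsub>N\<^esub> f x) \<in> mod_hom R M N"
  using mod_hom_signed[OF assms, of 1] by (simp add: signed_def)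

lemma mod_hom_minus:
  assumes "module R M" "module R N" "f \<in> mod_hom R M N" "g \<in> mod_hom R M N"
  shows "(\<lambda>x. f x \<ominus>\<^bsub>N\<^esub> g x) \<in> mod_hom R M N"
  unfolding a_minus_def
  by (rule mod_hom_plus[OF assms(1-3) mod_hom_neg[OF assms(1,2,4)]])

section \<open>Quotient modules\<close>

context module
begin

lemma coset_eq_iff:
  assumes "submodule H R M" "x \<in> carrier M" "y \<in> carrier M"
  shows "H +>\<^bsub>M\<^esub> x = H +>\<^bsub>M\<^esub> y \<longleftrightarrow> x \<ominus>\<^bsub>M\<^esub> y \<in> H"
proof
  have sg: "subgroup H (add_monoid M)" using assms(1) by (rule submodule.axioms)
  have HM: "H \<subseteq> carrier M" using submoduleE(1)[OF assms(1)] .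
  {
    assume "H +>\<^bsub>M\<^esub> x = H +>\<^bsub>M\<^esub> y"
    then have "H +>\<^bsub>M\<^esub> (x \<ominus>\<^bsub>M\<^esub> y) = H"
      unfolding a_minus_def by (rule M.a_coset_add_inv2[OF _ assms(2,3) HM])
    then show "x \<ominus>\<^bsub>M\<^esub> y \<in> H"
      by (rule M.a_coset_join1[OF _ M.minus_closed[OF assms(2,3)] sg])
  next
    assume "x \<ominus>\<^bsub>M\<^esub> y \<in> H"
    then have "H +>\<^bsub>M\<^esub> (x \<oplus>\<^bsub>M\<^esub> (\<ominus>\<^bsub>M\<^esub> y)) = H"
      unfolding a_minus_def using assms by (intro M.a_coset_join2[OF _ sg]) auto
    then show "H +>\<^bsub>M\<^esub> x = H +>\<^bsub>M\<^esub> y"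
      by (rule M.a_coset_add_inv1[OF _ assms(2,3) HM])
  }
qed

lemma abelian_subgroup_submodule: "submodule H R M \<Longrightarrow> abelian_subgroup H M"
  by (intro abelian_subgroupI3 additive_subgroup.intro M.abelian_group_axioms submodule.axioms(1))

lemma coset_self: "submodule H R M \<Longrightarrow> x \<in> carrier M \<Longrightarrow> x \<in> H +>\<^bsub>M\<^esub> x"
  by (auto simp: a_r_coset_def' intro!: bexI[of _ "\<zero>\<^bsub>M\<^esub>"] submodule_zero)

lemma coset_zero: "submodule H R M \<Longrightarrow> H +>\<^bsub>M\<^esub> \<zero>\<^bsub>M\<^esub> = H"
  by (simp add: submoduleE(1))

lemma carrier_quot_mod: "carrier (quot_mod M H) = (\<lambda>x. H +>\<^bsub>M\<^esub> x) ` carrier M"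
  by (auto simp: quot_mod_def A_RCOSETS_def')

lemma quot_add:
  assumes "submodule H R M" "x \<in> carrier M" "y \<in> carrier M"
  shows "(H +>\<^bsub>M\<^esub> x) \<oplus>\<^bsub>quot_mod M H\<^esub> (H +>\<^bsub>M\<^esub> y) = H +>\<^bsub>M\<^esub> (x \<oplus>\<^bsub>M\<^esub> y)"
proof -
  interpret abelian_subgroup H M using assms(1) by (rule abelian_subgroup_submodule)
  show ?thesis using assms by (simp add: quot_mod_def a_rcos_sum)
qed

text \<open>The set \<open>N' + f (N + x)\<close> occurring in the definitions of \<^const>\<open>quot_mod\<close> and \<^const>\<open>quot_map\<close>.\<close>

lemma set_add_image_coset:
  assumes "module R N" "submodule H R M" "submodule K R N" "x \<in> carrier M"
    and "\<And>x. x \<in> carrier M \<Longrightarrow> f x \<in> carrier N"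
    and "\<And>x y. x \<in> carrier M \<Longrightarrow> y \<in> carrier M \<Longrightarrow> f (x \<oplus>\<^bsub>M\<^esub> y) = f x \<oplus>\<^bsub>N\<^esub> f y"
    and "\<And>h. h \<in> H \<Longrightarrow> f h \<in> K"
  shows "set_add N K (f ` (H +>\<^bsub>M\<^esub> x)) = K +>\<^bsub>N\<^esub> f x"
proof -
  interpret N: module R N by fact
  have HM: "H \<subseteq> carrier M" "K \<subseteq> carrier N"
    using submoduleE(1)[OF assms(2)] N.submoduleE(1)[OF assms(3)] .
  show ?thesis
  proof (intro subset_antisym subsetI)
    fix z assume "z \<in> set_add N K (f ` (H +>\<^bsub>M\<^esub> x))"
    then obtain k h where kh: "k \<in> K" "h \<in> H" "z = k \<oplus>\<^bsub>N\<^esub> f (h \<oplus>\<^bsub>M\<^esub> x)"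
      by (auto simp: set_add_def' a_r_coset_def')
    then have "z = (k \<oplus>\<^bsub>N\<^esub> f h) \<oplus>\<^bsub>N\<^esub> f x"
      using assms(4-6) HM by (simp add: subset_iff N.a_assoc)
    moreover have "k \<oplus>\<^bsub>N\<^esub> f h \<in> K" using kh assms(7) N.submoduleE(5)[OF assms(3)] by blast
    ultimately show "z \<in> K +>\<^bsub>N\<^esub> f x" by (auto simp: a_r_coset_def')
  next
    fix z assume "z \<in> K +>\<^bsub>N\<^esub> f x"
    then obtain k where "k \<in> K" "z = k \<oplus>\<^bsub>N\<^esub> f x" by (auto simp: a_r_coset_def')
    then show "z \<in> set_add N K (f ` (H +>\<^bsub>M\<^esub> x))"
      using coset_self[OF assms(2,4)] by (auto simp: set_add_def')
  qed
qed

lemma quot_smult: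
  assumes "submodule H R M" "c \<in> carrier R" "x \<in> carrier M"
  shows "c \<odot>\<^bsub>quot_mod M H\<^esub> (H +>\<^bsub>M\<^esub> x) = H +>\<^bsub>M\<^esub> (c \<odot>\<^bsub>M\<^esub> x)"
  unfolding quot_mod_def using assms
  by (simp add: set_add_image_coset[OF module_axioms] smult_r_distr submoduleE(4))

lemma quot_zero: "\<zero>\<^bsub>quot_mod M H\<^esub> = H"
  by (simp add: quot_mod_def)

lemma quot_mod_module:
  assumes "submodule H R M"
  shows "module R (quot_mod M H)"
proof -
  note [simp] = carrier_quot_mod quot_add[OF assms] quot_smult[OF assms] quot_zero
  have z: "H +>\<^bsub>M\<^esub> \<zero>\<^bsub>M\<^esub> = H" using assms by (rule coset_zero)
  have ab: "abelian_group (quot_mod M H)"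
  proof (rule abelian_groupI)
    show "\<zero>\<^bsub>quot_mod M H\<^esub> \<in> carrier (quot_mod M H)"
      using z by force
  next
    fix X assume "X \<in> carrier (quot_mod M H)"
    then obtain x where x: "x \<in> carrier M" "X = H +>\<^bsub>M\<^esub> x" by auto
    have "(H +>\<^bsub>M\<^esub> \<zero>\<^bsub>M\<^esub>) \<oplus>\<^bsub>quot_mod M H\<^esub> (H +>\<^bsub>M\<^esub> x) = H +>\<^bsub>M\<^esub> x"
      using x by (subst quot_add[OF assms]) auto
    then show "\<zero>\<^bsub>quot_mod M H\<^esub> \<oplus>\<^bsub>quot_mod M H\<^esub> X = X"
      using x z by simp
    have "H +>\<^bsub>M\<^esub> (\<ominus>\<^bsub>M\<^esub> x) \<in> carrier (quot_mod M H)" using x by simp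
    moreover have "(H +>\<^bsub>M\<^esub> (\<ominus>\<^bsub>M\<^esub> x)) \<oplus>\<^bsub>quot_mod M H\<^esub> X = \<zero>\<^bsub>quot_mod M H\<^esub>"
      using x z by (simp add: M.l_neg)
    ultimately show "\<exists>Y\<in>carrier (quot_mod M H). Y \<oplus>\<^bsub>quot_mod M H\<^esub> X = \<zero>\<^bsub>quot_mod M H\<^esub>" by blast
  qed (auto simp: M.a_ac)
  show ?thesis
    by (rule moduleI[OF _ ab])
      (use assms in \<open>auto simp: R.is_cring smult_r_distr smult_l_distr smult_assoc1\<close>)
qed

lemma quot_proj_hom: "submodule H R M \<Longrightarrow> (\<lambda>x. H +>\<^bsub>M\<^esub> x) \<in> mod_hom R M (quot_mod M H)"
  by (intro mod_homI) (auto simp: carrier_quot_mod quot_add quot_smult)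

lemma quot_map_coset:
  assumes "module R N" "submodule H R M" "submodule K R N" "f \<in> mod_hom R M N"
    and "\<And>h. h \<in> H \<Longrightarrow> f h \<in> K" "x \<in> carrier M"
  shows "quot_map M H N K f (H +>\<^bsub>M\<^esub> x) = K +>\<^bsub>N\<^esub> f x"
  using assms
  by (simp add: quot_map_def carrier_quot_mod set_add_image_coset[OF assms(1)] mod_hom_closed mod_hom_add)

lemma quot_map_hom:
  assumes "module R N" "submodule H R M" "submodule K R N" "f \<in> mod_hom R M N"
    and "\<And>h. h \<in> H \<Longrightarrow> f h \<in> K"
  shows "quot_map M H N K f \<in> mod_hom R (quot_mod M H) (quot_mod N K)"
proof -
  interpret N: module R N by fact
  note q = quot_map_coset[OF assms]
  show ?thesis
    using assms(2-4)
    by (intro mod_homI)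
      (auto simp: carrier_quot_mod quot_add quot_smult N.carrier_quot_mod N.quot_add N.quot_smult q
        mod_hom_closed mod_hom_add mod_hom_smult)
qed

text \<open>\<open>g\<close> evaluates \<open>f\<close> at a chosen representative; two
  representatives differ by an element of \<open>H\<close>, which \<open>f\<close> kills.\<close>

lemma quot_lift:
  assumes "module R N" "submodule H R M" "f \<in> mod_hom R M N" "\<And>h. h \<in> H \<Longrightarrow> f h = \<zero>\<^bsub>N\<^esub>"
  obtains g where "g \<in> mod_hom R (quot_mod M H) N" "\<And>x. x \<in> carrier M \<Longrightarrow> g (H +>\<^bsub>M\<^esub> x) = f x"
proof -
  interpret F: linear_map R M N f using assms module_axioms by (intro linear_mapI)
  define g where "g X = f (SOME x. x \<in> carrier M \<and> X = H +>\<^bsub>M\<^esub> x)" for X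
  have g: "g (H +>\<^bsub>M\<^esub> x) = f x" if x: "x \<in> carrier M" for x
  proof -
    define y where "y = (SOME y. y \<in> carrier M \<and> H +>\<^bsub>M\<^esub> x = H +>\<^bsub>M\<^esub> y)"
    have y: "y \<in> carrier M \<and> H +>\<^bsub>M\<^esub> x = H +>\<^bsub>M\<^esub> y"
      unfolding y_def by (rule someI[of _ x]) (use x in auto)
    then have "x \<ominus>\<^bsub>M\<^esub> y \<in> H" using x assms(2) by (simp add: coset_eq_iff[symmetric])
    then have "f x \<ominus>\<^bsub>N\<^esub> f y = \<zero>\<^bsub>N\<^esub>" using assms(4) x y by (metis F.minus)
    then have "f x = f y" using x y by (simp add: F.N.minus_eq_zero_iff)
    then show ?thesis by (simp only: g_def y_def)
  qed
  show ?thesis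
  proof
    show "g \<in> mod_hom R (quot_mod M H) N"
      using assms(2)
      by (intro mod_homI) (auto simp: carrier_quot_mod quot_add quot_smult g F.add F.smult)
  qed (rule g)
qed

lemma span_quot:
  assumes "submodule H R M" "mod_span R M X = carrier M" "X \<subseteq> carrier M"
  shows "mod_span R (quot_mod M H) ((\<lambda>x. H +>\<^bsub>M\<^esub> x) ` X) = carrier (quot_mod M H)"
proof -
  let ?Q = "quot_mod M H"
  let ?X = "(\<lambda>x. H +>\<^bsub>M\<^esub> x) ` X"
  interpret Q: module R ?Q using assms(1) by (rule quot_mod_module)
  have sub: "?X \<subseteq> carrier ?Q" using assms(3) by (auto simp: carrier_quot_mod)
  note S = Q.mod_span_submodule[OF sub]
  have "H +>\<^bsub>M\<^esub> x \<in> mod_span R ?Q ?X" if "x \<in> mod_span R M X" for x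
    using that assms(3)
  proof (induction rule: mod_span_induct)
    case zero
    then show ?case using Q.submodule_zero[OF S] coset_zero[OF assms(1)] by (simp add: quot_zero)
  next
    case (gen x)
    then show ?case using Q.mod_span_superset[of ?X] by blast
  next
    case (add x y)
    then show ?case using Q.submoduleE(5)[OF S] quot_add[OF assms(1)] by metis
  next
    case (smult c x)
    then show ?case using Q.submoduleE(4)[OF S] quot_smult[OF assms(1)] by metis
  qed
  then show ?thesis
    using Q.submoduleE(1)[OF S] assms(2) by (auto simp: carrier_quot_mod)
qed

end

section \<open>Free modules\<close>

context cring
begin

lemma free_mod_carrierI: "f \<in> I \<rightarrow>\<^sub>E carrier R \<Longrightarrow> finite {i \<in> I. f i \<noteq> \<zero>} \<Longrightarrow> f \<in> carrier (free_mod R I)"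
  by (simp add: free_mod_def)

lemma free_gen_closed: "j \<in> I \<Longrightarrow> free_gen R I j \<in> carrier (free_mod R I)"
  by (auto simp: free_mod_def free_gen_def intro: finite_subset[of _ "{j}"])

lemma free_mod_module: "module R (free_mod R I)"
proof (rule moduleI)
  show "cring R" by (rule is_cring)
  have sm: "(\<lambda>i\<in>I. c \<otimes> f i) \<in> carrier (free_mod R I)"
    if "c \<in> carrier R" "f \<in> carrier (free_mod R I)" for c f
    using that by (auto simp: free_mod_def elim: rev_finite_subset)
  show "abelian_group (free_mod R I)"
  proof (rule abelian_groupI)
    fix f g assume fg: "f \<in> carrier (free_mod R I)" "g \<in> carrier (free_mod R I)"
    then have "finite ({i \<in> I. f i \<noteq> \<zero>} \<union> {i \<in> I. g i \<noteq> \<zero>})"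
      by (auto simp: free_mod_def)
    moreover have "{i \<in> I. (\<lambda>i\<in>I. f i \<oplus> g i) i \<noteq> \<zero>} \<subseteq> {i \<in> I. f i \<noteq> \<zero>} \<union> {i \<in> I. g i \<noteq> \<zero>}"
      using fg by auto
    ultimately have "finite {i \<in> I. (\<lambda>i\<in>I. f i \<oplus> g i) i \<noteq> \<zero>}"
      by (rule rev_finite_subset)
    then show "f \<oplus>\<^bsub>free_mod R I\<^esub> g \<in> carrier (free_mod R I)"
      using fg by (auto simp: free_mod_def PiE_iff)
    show "f \<oplus>\<^bsub>free_mod R I\<^esub> g = g \<oplus>\<^bsub>free_mod R I\<^esub> f"
      using fg by (auto simp: free_mod_def PiE_iff a_comm intro!: restrict_ext)
    fix h assume "h \<in> carrier (free_mod R I)"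
    then show "f \<oplus>\<^bsub>free_mod R I\<^esub> g \<oplus>\<^bsub>free_mod R I\<^esub> h = f \<oplus>\<^bsub>free_mod R I\<^esub> (g \<oplus>\<^bsub>free_mod R I\<^esub> h)"
      using fg by (auto simp: free_mod_def PiE_iff a_assoc intro!: restrict_ext)
  next
    fix f assume f: "f \<in> carrier (free_mod R I)"
    then show "\<zero>\<^bsub>free_mod R I\<^esub> \<oplus>\<^bsub>free_mod R I\<^esub> f = f"
      by (auto simp: free_mod_def PiE_iff extensional_def)
    show "\<exists>g\<in>carrier (free_mod R I). g \<oplus>\<^bsub>free_mod R I\<^esub> f = \<zero>\<^bsub>free_mod R I\<^esub>"
    proof
      show "(\<lambda>i\<in>I. (\<ominus> \<one>) \<otimes> f i) \<in> carrier (free_mod R I)"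
        using f by (intro sm) auto
      show "(\<lambda>i\<in>I. (\<ominus> \<one>) \<otimes> f i) \<oplus>\<^bsub>free_mod R I\<^esub> f = \<zero>\<^bsub>free_mod R I\<^esub>"
        using f by (auto simp: free_mod_def PiE_iff l_minus l_neg intro!: restrict_ext)
    qed
  qed (auto simp: free_mod_def)
  fix a b x y assume ab: "a \<in> carrier R" "b \<in> carrier R"
    and x: "x \<in> carrier (free_mod R I)" and y: "y \<in> carrier (free_mod R I)"
  show "a \<odot>\<^bsub>free_mod R I\<^esub> x \<in> carrier (free_mod R I)"
    using sm[OF ab(1) x] by (simp add: free_mod_def)
  show "(a \<oplus> b) \<odot>\<^bsub>free_mod R I\<^esub> x = a \<odot>\<^bsub>free_mod R I\<^esub> x \<oplus>\<^bsub>free_mod R I\<^esub> b \<odot>\<^bsub>free_mod R I\<^esub> x"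
    using ab x by (auto simp: free_mod_def PiE_iff l_distr intro!: restrict_ext)
  show "a \<odot>\<^bsub>free_mod R I\<^esub> (x \<oplus>\<^bsub>free_mod R I\<^esub> y) = a \<odot>\<^bsub>free_mod R I\<^esub> x \<oplus>\<^bsub>free_mod R I\<^esub> a \<odot>\<^bsub>free_mod R I\<^esub> y"
    using ab x y by (auto simp: free_mod_def PiE_iff r_distr intro!: restrict_ext)
  show "a \<otimes> b \<odot>\<^bsub>free_mod R I\<^esub> x = a \<odot>\<^bsub>free_mod R I\<^esub> (b \<odot>\<^bsub>free_mod R I\<^esub> x)"
    using ab x by (auto simp: free_mod_def PiE_iff m_assoc intro!: restrict_ext)
next
  fix x assume x: "x \<in> carrier (free_mod R I)"
  show "\<one> \<odot>\<^bsub>free_mod R I\<^esub> x = x"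
    using x by (auto simp: free_mod_def PiE_iff extensional_def)
qed

lemma free_mod_span: "mod_span R (free_mod R I) (free_gen R I ` I) = carrier (free_mod R I)"
proof -
  let ?F = "free_mod R I"
  interpret F: module R ?F by (rule free_mod_module)
  have gens: "free_gen R I ` I \<subseteq> carrier ?F" by (auto simp: free_gen_closed)
  note S = F.mod_span_submodule[OF gens]
  have "f \<in> mod_span R ?F (free_gen R I ` I)"
    if "finite J" "f \<in> carrier ?F" "{i \<in> I. f i \<noteq> \<zero>} = J" for f J
    using that
  proof (induction J arbitrary: f)
    case empty
    then have "f = \<zero>\<^bsub>?F\<^esub>" by (auto simp: free_mod_def PiE_iff extensional_def)
    then show ?case using F.submodule_zero[OF S] by simp
  next
    case (insert j J)
    then have j: "j \<in> I" by auto
    have fj: "f j \<in> carrier R" using insert j by (auto simp: free_mod_def)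
    \<comment> \<open>Splitting off coordinate \<open>j\<close> leaves a function with support
      \<open>J\<close>, to which the induction applies.\<close>
    define g where "g = (\<lambda>i\<in>I. if i = j then \<zero> else f i)"
    have supp: "{i \<in> I. g i \<noteq> \<zero>} = J" using insert by (auto simp: g_def)
    have g: "g \<in> carrier ?F"
    proof (rule free_mod_carrierI)
      show "g \<in> I \<rightarrow>\<^sub>E carrier R" using insert by (auto simp: g_def free_mod_def)
      show "finite {i \<in> I. g i \<noteq> \<zero>}" using supp insert by simp
    qed
    have "f = g \<oplus>\<^bsub>?F\<^esub> f j \<odot>\<^bsub>?F\<^esub> free_gen R I j"
      using insert(4) fj by (auto simp: free_mod_def g_def free_gen_def PiE_iff extensional_def)
    moreover have "g \<in> mod_span R ?F (free_gen R I ` I)" using insert.IH[OF g supp] .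
    moreover have "f j \<odot>\<^bsub>?F\<^esub> free_gen R I j \<in> mod_span R ?F (free_gen R I ` I)"
      using F.mod_span_superset j by (intro F.submoduleE(4)[OF S] fj) blast
    ultimately show ?case using F.submoduleE(5)[OF S] by metis
  qed
  then show ?thesis
    using F.submoduleE(1)[OF S] by (auto simp: free_mod_def)
qed

lemma free_mod_lift:
  assumes "module R N" "v \<in> I \<rightarrow> carrier N"
  obtains f where "f \<in> mod_hom R (free_mod R I) N" "\<And>i. i \<in> I \<Longrightarrow> f (free_gen R I i) = v i"
proof -
  interpret N: module R N by fact
  let ?F = "free_mod R I"
  define S where "S f = {i \<in> I. f i \<noteq> \<zero>}" for f
  define F where "F f = (\<Oplus>\<^bsub>N\<^esub>i\<in>S f. f i \<odot>\<^bsub>N\<^esub> v i)" for f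
  have v: "v i \<in> carrier N" if "i \<in> I" for i using assms(2) that by auto
  have fin: "finite (S f)" if "f \<in> carrier ?F" for f using that by (simp add: S_def free_mod_def)
  have val: "f i \<in> carrier R" if "f \<in> carrier ?F" "i \<in> I" for f i using that by (auto simp: free_mod_def)
  have tm: "f i \<odot>\<^bsub>N\<^esub> v i \<in> carrier N" if "f \<in> carrier ?F" "i \<in> I" for f i
    using that by (simp add: val v)
  \<comment> \<open>The sum may run over any finite set containing the support. This lets functions
    with different supports be summed over a common index set.\<close>
  have F: "F f = (\<Oplus>\<^bsub>N\<^esub>i\<in>T. f i \<odot>\<^bsub>N\<^esub> v i)" if "f \<in> carrier ?F" "finite T" "S f \<subseteq> T" "T \<subseteq> I" for f T
    unfolding F_def using that v
    by (intro N.add.finprod_mono_neutral_cong_left) (auto simp: S_def Pi_def intro!: tm)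
  show ?thesis
  proof
    show "F \<in> mod_hom R ?F N"
    proof (rule mod_homI)
      fix f assume "f \<in> carrier ?F"
      then show "F f \<in> carrier N" using tm by (auto simp: F_def S_def Pi_def)
    next
      fix f g assume fg: "f \<in> carrier ?F" "g \<in> carrier ?F"
      interpret FM: module R ?F by (rule free_mod_module)
      let ?T = "S f \<union> S g"
      have T: "finite ?T" "?T \<subseteq> I" using fg fin by (auto simp: S_def)
      have h: "f \<oplus>\<^bsub>?F\<^esub> g \<in> carrier ?F" using fg by simp
      have hi: "(f \<oplus>\<^bsub>?F\<^esub> g) i = f i \<oplus> g i" if "i \<in> I" for i using that by (simp add: free_mod_def)
      have "F (f \<oplus>\<^bsub>?F\<^esub> g) = (\<Oplus>\<^bsub>N\<^esub>i\<in>?T. (f \<oplus>\<^bsub>?F\<^esub> g) i \<odot>\<^bsub>N\<^esub> v i)"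
        using h T by (intro F) (auto simp: S_def hi)
      also have "\<dots> = (\<Oplus>\<^bsub>N\<^esub>i\<in>?T. f i \<odot>\<^bsub>N\<^esub> v i \<oplus>\<^bsub>N\<^esub> g i \<odot>\<^bsub>N\<^esub> v i)"
        using T fg tm by (intro N.finsum_cong') (auto simp: hi S_def N.smult_l_distr val v)
      also have "\<dots> = (\<Oplus>\<^bsub>N\<^esub>i\<in>?T. f i \<odot>\<^bsub>N\<^esub> v i) \<oplus>\<^bsub>N\<^esub> (\<Oplus>\<^bsub>N\<^esub>i\<in>?T. g i \<odot>\<^bsub>N\<^esub> v i)"
        using T fg tm by (intro N.finsum_addf) auto
      also have "\<dots> = F f \<oplus>\<^bsub>N\<^esub> F g" using T fg by (simp add: F[of _ ?T])
      finally show "F (f \<oplus>\<^bsub>?F\<^esub> g) = F f \<oplus>\<^bsub>N\<^esub> F g" .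
    next
      fix c f assume cf: "c \<in> carrier R" "f \<in> carrier ?F"
      interpret FM: module R ?F by (rule free_mod_module)
      have h: "c \<odot>\<^bsub>?F\<^esub> f \<in> carrier ?F" using cf by simp
      have hi: "(c \<odot>\<^bsub>?F\<^esub> f) i = c \<otimes> f i" if "i \<in> I" for i using that by (simp add: free_mod_def)
      have "F (c \<odot>\<^bsub>?F\<^esub> f) = (\<Oplus>\<^bsub>N\<^esub>i\<in>S f. (c \<odot>\<^bsub>?F\<^esub> f) i \<odot>\<^bsub>N\<^esub> v i)"
        using h cf fin by (intro F) (auto simp: S_def hi)
      also have "\<dots> = (\<Oplus>\<^bsub>N\<^esub>i\<in>S f. c \<odot>\<^bsub>N\<^esub> (f i \<odot>\<^bsub>N\<^esub> v i))"
        using cf tm by (intro N.finsum_cong') (auto simp: hi S_def N.smult_assoc1 val v)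
      also have "\<dots> = c \<odot>\<^bsub>N\<^esub> F f"
        unfolding F_def using cf fin tm by (subst N.finsum_smult_ldistr) (auto simp: S_def)
      finally show "F (c \<odot>\<^bsub>?F\<^esub> f) = c \<odot>\<^bsub>N\<^esub> F f" .
    qed
  next
    fix i assume i: "i \<in> I"
    have "F (free_gen R I i) = (\<Oplus>\<^bsub>N\<^esub>j\<in>{i}. free_gen R I i j \<odot>\<^bsub>N\<^esub> v j)"
      using i by (intro F free_gen_closed) (auto simp: S_def free_gen_def)
    also have "\<dots> = v i" using i v by (simp add: free_gen_def)
    finally show "F (free_gen R I i) = v i" .
  qed
qed

end

text \<open>Universal property of a module given by generators and relations. A relation is a
  combination of generators, so its value can only be stated through a linear \<open>f\<close>
  extending \<open>v\<close>; the last hypothesis therefore quantifies over all such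
  \<open>f\<close>.\<close>

lemma (in cring) presented_lift:
  assumes "module R N" "v \<in> I \<rightarrow> carrier N" "X \<subseteq> carrier (free_mod R I)"
    and "\<And>f x. f \<in> mod_hom R (free_mod R I) N \<Longrightarrow> (\<And>i. i \<in> I \<Longrightarrow> f (free_gen R I i) = v i) \<Longrightarrow>
      x \<in> X \<Longrightarrow> f x = \<zero>\<^bsub>N\<^esub>"
  obtains g where "g \<in> mod_hom R (quot_mod (free_mod R I) (mod_span R (free_mod R I) X)) N"
    "\<And>i. i \<in> I \<Longrightarrow> g (mod_span R (free_mod R I) X +>\<^bsub>free_mod R I\<^esub> free_gen R I i) = v i"
proof -
  interpret F: module R "free_mod R I" by (rule free_mod_module)
  interpret N: module R N by fact
  obtain f where f: "f \<in> mod_hom R (free_mod R I) N" "\<And>i. i \<in> I \<Longrightarrow> f (free_gen R I i) = v i"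
    using free_mod_lift[OF assms(1,2)] by blast
  interpret f: linear_map R "free_mod R I" N f
    by (intro linear_mapI F.module_axioms N.module_axioms f(1))
  have "f x = \<zero>\<^bsub>N\<^esub>" if "x \<in> mod_span R (free_mod R I) X" for x
    using that assms(3)
  proof (induction rule: F.mod_span_induct)
    case (gen x)
    then show ?case using assms(4) f by blast
  qed (simp_all add: f.add f.smult)
  then obtain g where g: "g \<in> mod_hom R (quot_mod (free_mod R I) (mod_span R (free_mod R I) X)) N"
     "\<And>x. x \<in> carrier (free_mod R I) \<Longrightarrow> g (mod_span R (free_mod R I) X +>\<^bsub>free_mod R I\<^esub> x) = f x"
    using F.quot_lift[OF assms(1) F.mod_span_submodule[OF assms(3)] f(1)] by blast
  have "g (mod_span R (free_mod R I) X +>\<^bsub>free_mod R I\<^esub> free_gen R I i) = v i" if "i \<in> I" for i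
    using g(2)[OF free_gen_closed[OF that]] f(2)[OF that] by simp
  then show ?thesis using g(1) that by blast
qed

section \<open>Tensor products\<close>

text \<open>Tuples are lists, so linearity in one argument is expressed by updating one position and
  keeping the rest.\<close>

definition multilinear ::
    "('k, 'r) ring_scheme \<Rightarrow> ('k, 'x, 'm) module_scheme \<Rightarrow> nat \<Rightarrow> ('k, 'y, 'n) module_scheme \<Rightarrow>
     ('x list \<Rightarrow> 'y) \<Rightarrow> bool"
  where "multilinear R M m N v \<longleftrightarrow>
    (\<forall>xs\<in>tuples M m. v xs \<in> carrier N \<and> (\<forall>i<m. (\<lambda>x. v (xs[i := x])) \<in> mod_hom R M N))"

lemma tuples_update: "xs \<in> tuples M m \<Longrightarrow> x \<in> carrier M \<Longrightarrow> xs[i := x] \<in> tuples M m"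
  by (auto simp: tuples_def dest: subsetD[OF set_update_subset_insert])

lemma tuples_nth: "xs \<in> tuples M m \<Longrightarrow> i < m \<Longrightarrow> xs ! i \<in> carrier M"
  by (auto simp: tuples_def)

lemma tuples_length: "xs \<in> tuples M m \<Longrightarrow> length xs = m"
  by (auto simp: tuples_def)

lemma tuplesI: "length xs = m \<Longrightarrow> (\<And>i. i < m \<Longrightarrow> xs ! i \<in> carrier M) \<Longrightarrow> xs \<in> tuples M m"
  by (auto simp: tuples_def in_set_conv_nth)

text \<open>In \<open>tensor_power_rels\<close> the generating set occurs only inside the span. With
  a name of its own it is accessible to span induction and to \<open>presented_lift\<close>.\<close>

definition tensor_power_gens ::
    "('k, 'r) ring_scheme \<Rightarrow> ('k, 'x, 'm) module_scheme \<Rightarrow> nat \<Rightarrow> ('x list \<Rightarrow> 'k) set"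
  where "tensor_power_gens R M m =
    (let F = free_mod R (tuples M m); e = free_gen R (tuples M m) in
      {e (xs[i := x \<oplus>\<^bsub>M\<^esub> y]) \<ominus>\<^bsub>F\<^esub> (e (xs[i := x]) \<oplus>\<^bsub>F\<^esub> e (xs[i := y])) | xs i x y.
          xs \<in> tuples M m \<and> i < m \<and> x \<in> carrier M \<and> y \<in> carrier M} \<union>
       {e (xs[i := c \<odot>\<^bsub>M\<^esub> x]) \<ominus>\<^bsub>F\<^esub> c \<odot>\<^bsub>F\<^esub> e (xs[i := x]) | xs i c x.
          xs \<in> tuples M m \<and> i < m \<and> c \<in> carrier R \<and> x \<in> carrier M})"

lemma tensor_power_rels_eq:
  "tensor_power_rels R M m = mod_span R (free_mod R (tuples M m)) (tensor_power_gens R M m)"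
  by (simp add: tensor_power_rels_def tensor_power_gens_def Let_def)

context module
begin

lemma power_gen_closed: "xs \<in> tuples M m \<Longrightarrow> free_gen R (tuples M m) xs \<in> carrier (free_mod R (tuples M m))"
  by (rule R.free_gen_closed)

lemma tensor_power_gens_subset: "tensor_power_gens R M m \<subseteq> carrier (free_mod R (tuples M m))"
proof -
  interpret F: module R "free_mod R (tuples M m)" by (rule R.free_mod_module)
  show ?thesis
    unfolding tensor_power_gens_def Let_def
    by (auto intro!: F.minus_closed F.add.m_closed F.smult_closed power_gen_closed tuples_update)
qed

lemma tensor_power_rels_submodule: "submodule (tensor_power_rels R M m) R (free_mod R (tuples M m))"
  unfolding tensor_power_rels_eq
  by (rule module.mod_span_submodule[OF R.free_mod_module tensor_power_gens_subset])

lemma tensor_power_module: "module R (tensor_power R M m)"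
  unfolding tensor_power_def
  by (rule module.quot_mod_module[OF R.free_mod_module tensor_power_rels_submodule])

lemma power_tensor_closed: "xs \<in> tuples M m \<Longrightarrow> power_tensor R M m xs \<in> carrier (tensor_power R M m)"
  by (simp add: power_tensor_def tensor_power_def module.carrier_quot_mod[OF R.free_mod_module] power_gen_closed)

lemma power_tensor_span: "mod_span R (tensor_power R M m) (power_tensor R M m ` tuples M m) = carrier (tensor_power R M m)"
proof -
  have "free_gen R (tuples M m) ` tuples M m \<subseteq> carrier (free_mod R (tuples M m))"
    using power_gen_closed by blast
  from module.span_quot[OF R.free_mod_module tensor_power_rels_submodule R.free_mod_span this]
  show ?thesis by (simp add: tensor_power_def power_tensor_def image_image)
qed

lemma power_tensor_multilinear: "multilinear R M m (tensor_power R M m) (power_tensor R M m)"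
  unfolding multilinear_def
proof (intro ballI allI conjI impI)
  let ?I = "tuples M m"
  let ?F = "free_mod R ?I"
  let ?N = "tensor_power_rels R M m"
  interpret F: module R ?F by (rule R.free_mod_module)
  note sub = tensor_power_rels_submodule[of m]
  fix xs i assume xs: "xs \<in> ?I" and i: "i < m"
  show "(\<lambda>x. power_tensor R M m (xs[i := x])) \<in> mod_hom R M (tensor_power R M m)"
  proof (rule mod_homI)
    fix x y assume xy: "x \<in> carrier M" "y \<in> carrier M"
    have c: "free_gen R ?I (xs[i := z]) \<in> carrier ?F" if "z \<in> carrier M" for z
      using that xs by (intro power_gen_closed tuples_update)
    have "free_gen R ?I (xs[i := x \<oplus>\<^bsub>M\<^esub> y]) \<ominus>\<^bsub>?F\<^esub> (free_gen R ?I (xs[i := x]) \<oplus>\<^bsub>?F\<^esub> free_gen R ?I (xs[i := y]))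
        \<in> tensor_power_gens R M m"
      unfolding tensor_power_gens_def Let_def using xs i xy by blast
    then have "?N +>\<^bsub>?F\<^esub> free_gen R ?I (xs[i := x \<oplus>\<^bsub>M\<^esub> y]) =
        ?N +>\<^bsub>?F\<^esub> (free_gen R ?I (xs[i := x]) \<oplus>\<^bsub>?F\<^esub> free_gen R ?I (xs[i := y]))"
      using c xy F.mod_span_superset
      by (subst F.coset_eq_iff[OF sub]) (auto simp: tensor_power_rels_eq)
    then show "power_tensor R M m (xs[i := x \<oplus>\<^bsub>M\<^esub> y]) =
        power_tensor R M m (xs[i := x]) \<oplus>\<^bsub>tensor_power R M m\<^esub> power_tensor R M m (xs[i := y])"
      using c xy by (simp add: power_tensor_def tensor_power_def F.quot_add[OF sub])
  next
    fix a x assume ax: "a \<in> carrier R" "x \<in> carrier M"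
    have c: "free_gen R ?I (xs[i := z]) \<in> carrier ?F" if "z \<in> carrier M" for z
      using that xs by (intro power_gen_closed tuples_update)
    have "free_gen R ?I (xs[i := a \<odot>\<^bsub>M\<^esub> x]) \<ominus>\<^bsub>?F\<^esub> a \<odot>\<^bsub>?F\<^esub> free_gen R ?I (xs[i := x])
        \<in> tensor_power_gens R M m"
      unfolding tensor_power_gens_def Let_def using xs i ax by blast
    then have "?N +>\<^bsub>?F\<^esub> free_gen R ?I (xs[i := a \<odot>\<^bsub>M\<^esub> x]) = ?N +>\<^bsub>?F\<^esub> (a \<odot>\<^bsub>?F\<^esub> free_gen R ?I (xs[i := x]))"
      using c ax F.mod_span_superset
      by (subst F.coset_eq_iff[OF sub]) (auto simp: tensor_power_rels_eq)
    then show "power_tensor R M m (xs[i := a \<odot>\<^bsub>M\<^esub> x]) = a \<odot>\<^bsub>tensor_power R M m\<^esub> power_tensor R M m (xs[i := x])"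
      using c ax by (simp add: power_tensor_def tensor_power_def F.quot_smult[OF sub])
  qed (use xs in \<open>auto intro: power_tensor_closed tuples_update\<close>)
qed (rule power_tensor_closed)

lemma tensor_power_lift:
  assumes "module R N" "multilinear R M m N v"
  obtains f where "f \<in> mod_hom R (tensor_power R M m) N"
    "\<And>xs. xs \<in> tuples M m \<Longrightarrow> f (power_tensor R M m xs) = v xs"
proof -
  let ?I = "tuples M m"
  interpret F: module R "free_mod R ?I" by (rule R.free_mod_module)
  interpret N: module R N by fact
  have v: "v \<in> ?I \<rightarrow> carrier N" using assms(2) by (auto simp: multilinear_def)
  have "f x = \<zero>\<^bsub>N\<^esub>"
    if f: "f \<in> mod_hom R (free_mod R ?I) N" "\<And>i. i \<in> ?I \<Longrightarrow> f (free_gen R ?I i) = v i"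
      and x: "x \<in> tensor_power_gens R M m" for f x
  proof -
    interpret f: linear_map R "free_mod R ?I" N f
      by (intro linear_mapI F.module_axioms N.module_axioms f(1))
    note c = power_gen_closed[OF tuples_update]
    have ml: "(\<lambda>x. v (xs[i := x])) \<in> mod_hom R M N" if "xs \<in> ?I" "i < m" for xs i
      using assms(2) that by (auto simp: multilinear_def)
    have vc: "v (xs[i := x]) \<in> carrier N" if "xs \<in> ?I" "x \<in> carrier M" for xs i x
      using v tuples_update[OF that] by blast
    from x consider
        (1) xs i x' y where "x = free_gen R ?I (xs[i := x' \<oplus>\<^bsub>M\<^esub> y]) \<ominus>\<^bsub>free_mod R ?I\<^esub>
              (free_gen R ?I (xs[i := x']) \<oplus>\<^bsub>free_mod R ?I\<^esub> free_gen R ?I (xs[i := y]))"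
            "xs \<in> ?I" "i < m" "x' \<in> carrier M" "y \<in> carrier M"
      | (2) xs i a x' where "x = free_gen R ?I (xs[i := a \<odot>\<^bsub>M\<^esub> x']) \<ominus>\<^bsub>free_mod R ?I\<^esub>
              a \<odot>\<^bsub>free_mod R ?I\<^esub> free_gen R ?I (xs[i := x'])"
            "xs \<in> ?I" "i < m" "a \<in> carrier R" "x' \<in> carrier M"
      unfolding tensor_power_gens_def Let_def by blast
    then show ?thesis
    proof cases
      case 1
      then show ?thesis
        by (simp add: f.minus f.add c f(2) tuples_update mod_hom_add[OF ml] vc)
    next
      case 2
      then show ?thesis
        by (simp add: f.minus f.smult c f(2) tuples_update mod_hom_smult[OF ml] vc)
    qed
  qed
  then obtain g where "g \<in> mod_hom R (quot_mod (free_mod R ?I) (mod_span R (free_mod R ?I) (tensor_power_gens R M m))) N"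
    "\<And>i. i \<in> ?I \<Longrightarrow> g (mod_span R (free_mod R ?I) (tensor_power_gens R M m) +>\<^bsub>free_mod R ?I\<^esub> free_gen R ?I i) = v i"
    using R.presented_lift[OF assms(1) v tensor_power_gens_subset] by blast
  then show ?thesis
    by (intro that[of g]) (auto simp: tensor_power_def power_tensor_def tensor_power_rels_eq)
qed

end

section \<open>Tensor products of two modules\<close>

definition tensor_gens ::
    "('k, 'r) ring_scheme \<Rightarrow> ('k, 'x, 'm) module_scheme \<Rightarrow> ('k, 'y, 'n) module_scheme \<Rightarrow>
     ('x \<times> 'y \<Rightarrow> 'k) set"
  where "tensor_gens R M N =
    (let I = carrier M \<times> carrier N; F = free_mod R I; e = free_gen R I in
      ({e (x \<oplus>\<^bsub>M\<^esub> x', y) \<ominus>\<^bsub>F\<^esub> (e (x, y) \<oplus>\<^bsub>F\<^esub> e (x', y)) | x x' y.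
          x \<in> carrier M \<and> x' \<in> carrier M \<and> y \<in> carrier N} \<union>
       {e (x, y \<oplus>\<^bsub>N\<^esub> y') \<ominus>\<^bsub>F\<^esub> (e (x, y) \<oplus>\<^bsub>F\<^esub> e (x, y')) | x y y'.
          x \<in> carrier M \<and> y \<in> carrier N \<and> y' \<in> carrier N} \<union>
       {e (c \<odot>\<^bsub>M\<^esub> x, y) \<ominus>\<^bsub>F\<^esub> c \<odot>\<^bsub>F\<^esub> e (x, y) | c x y.
          c \<in> carrier R \<and> x \<in> carrier M \<and> y \<in> carrier N} \<union>
       {e (x, c \<odot>\<^bsub>N\<^esub> y) \<ominus>\<^bsub>F\<^esub> c \<odot>\<^bsub>F\<^esub> e (x, y) | c x y.
          c \<in> carrier R \<and> x \<in> carrier M \<and> y \<in> carrier N}))"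

lemma tensor_rels_eq:
  "tensor_rels R M N = mod_span R (free_mod R (carrier M \<times> carrier N)) (tensor_gens R M N)"
  by (simp add: tensor_rels_def tensor_gens_def Let_def)

locale module_pair = M: module R M + N: module R N for R M N
begin

abbreviation "I \<equiv> carrier M \<times> carrier N"
abbreviation "F \<equiv> free_mod R I"
abbreviation "e \<equiv> free_gen R I"
abbreviation "T \<equiv> tensor R M N"
abbreviation "pt \<equiv> pure_tensor R M N"

sublocale F: module R F by (rule M.R.free_mod_module)

lemma e_closed: "x \<in> carrier M \<Longrightarrow> y \<in> carrier N \<Longrightarrow> e (x, y) \<in> carrier F"
  by (intro M.R.free_gen_closed) simp

lemma tensor_gens_subset: "tensor_gens R M N \<subseteq> carrier F"
  unfolding tensor_gens_def Let_def
  by (auto intro!: F.minus_closed F.add.m_closed F.smult_closed e_closed)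

lemma rels_submodule: "submodule (tensor_rels R M N) R F"
  unfolding tensor_rels_eq by (rule F.mod_span_submodule[OF tensor_gens_subset])

lemma tensor_module: "module R T"
  unfolding tensor_def by (rule F.quot_mod_module[OF rels_submodule])

lemma pure_tensor_closed: "x \<in> carrier M \<Longrightarrow> y \<in> carrier N \<Longrightarrow> pt x y \<in> carrier T"
  by (simp add: pure_tensor_def tensor_def F.carrier_quot_mod e_closed)

lemma pure_tensor_span: "mod_span R T (case_prod pt ` I) = carrier T"
proof -
  have "e ` I \<subseteq> carrier F" using e_closed by blast
  from F.span_quot[OF rels_submodule M.R.free_mod_span this]
  show ?thesis by (simp add: tensor_def pure_tensor_def image_image case_prod_unfold)
qed

lemma coset_eqI: "x \<ominus>\<^bsub>F\<^esub> y \<in> tensor_gens R M N \<Longrightarrow> x \<in> carrier F \<Longrightarrow> y \<in> carrier F \<Longrightarrow>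
    tensor_rels R M N +>\<^bsub>F\<^esub> x = tensor_rels R M N +>\<^bsub>F\<^esub> y"
  using F.mod_span_superset by (subst F.coset_eq_iff[OF rels_submodule]) (auto simp: tensor_rels_eq)

lemma pure_tensor_hom1: "y \<in> carrier N \<Longrightarrow> (\<lambda>x. pt x y) \<in> mod_hom R M T"
proof (rule mod_homI)
  fix x x' assume c: "y \<in> carrier N" "x \<in> carrier M" "x' \<in> carrier M"
  have "e (x \<oplus>\<^bsub>M\<^esub> x', y) \<ominus>\<^bsub>F\<^esub> (e (x, y) \<oplus>\<^bsub>F\<^esub> e (x', y)) \<in> tensor_gens R M N"
    unfolding tensor_gens_def Let_def using c by blast
  from coset_eqI[OF this] show "pt (x \<oplus>\<^bsub>M\<^esub> x') y = pt x y \<oplus>\<^bsub>T\<^esub> pt x' y"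
    using c by (simp add: pure_tensor_def tensor_def F.quot_add[OF rels_submodule] e_closed)
next
  fix a x assume c: "y \<in> carrier N" "a \<in> carrier R" "x \<in> carrier M"
  have "e (a \<odot>\<^bsub>M\<^esub> x, y) \<ominus>\<^bsub>F\<^esub> a \<odot>\<^bsub>F\<^esub> e (x, y) \<in> tensor_gens R M N"
    unfolding tensor_gens_def Let_def using c by blast
  from coset_eqI[OF this] show "pt (a \<odot>\<^bsub>M\<^esub> x) y = a \<odot>\<^bsub>T\<^esub> pt x y"
    using c by (simp add: pure_tensor_def tensor_def F.quot_smult[OF rels_submodule] e_closed)
qed (rule pure_tensor_closed)

lemma pure_tensor_hom2: "x \<in> carrier M \<Longrightarrow> (\<lambda>y. pt x y) \<in> mod_hom R N T"
proof (rule mod_homI)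
  fix y y' assume c: "x \<in> carrier M" "y \<in> carrier N" "y' \<in> carrier N"
  have "e (x, y \<oplus>\<^bsub>N\<^esub> y') \<ominus>\<^bsub>F\<^esub> (e (x, y) \<oplus>\<^bsub>F\<^esub> e (x, y')) \<in> tensor_gens R M N"
    unfolding tensor_gens_def Let_def using c by blast
  from coset_eqI[OF this] show "pt x (y \<oplus>\<^bsub>N\<^esub> y') = pt x y \<oplus>\<^bsub>T\<^esub> pt x y'"
    using c by (simp add: pure_tensor_def tensor_def F.quot_add[OF rels_submodule] e_closed)
next
  fix a y assume c: "x \<in> carrier M" "a \<in> carrier R" "y \<in> carrier N"
  have "e (x, a \<odot>\<^bsub>N\<^esub> y) \<ominus>\<^bsub>F\<^esub> a \<odot>\<^bsub>F\<^esub> e (x, y) \<in> tensor_gens R M N"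
    unfolding tensor_gens_def Let_def using c by blast
  from coset_eqI[OF this] show "pt x (a \<odot>\<^bsub>N\<^esub> y) = a \<odot>\<^bsub>T\<^esub> pt x y"
    using c by (simp add: pure_tensor_def tensor_def F.quot_smult[OF rels_submodule] e_closed)
qed (rule pure_tensor_closed)

lemma tensor_lift:
  assumes "module R P" "\<And>y. y \<in> carrier N \<Longrightarrow> (\<lambda>x. \<beta> x y) \<in> mod_hom R M P"
    "\<And>x. x \<in> carrier M \<Longrightarrow> (\<lambda>y. \<beta> x y) \<in> mod_hom R N P"
  obtains f where "f \<in> mod_hom R T P"
    "\<And>x y. x \<in> carrier M \<Longrightarrow> y \<in> carrier N \<Longrightarrow> f (pt x y) = \<beta> x y"
proof -
  interpret P: module R P by fact
  have v: "case_prod \<beta> \<in> I \<rightarrow> carrier P" using mod_hom_closed[OF assms(2)] by auto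
  have "f z = \<zero>\<^bsub>P\<^esub>"
    if f: "f \<in> mod_hom R F P" "\<And>i. i \<in> I \<Longrightarrow> f (e i) = case_prod \<beta> i"
      and z: "z \<in> tensor_gens R M N" for f z
  proof -
    interpret f: linear_map R F P f
      by (intro linear_mapI F.module_axioms P.module_axioms f(1))
    have fe: "f (e (x, y)) = \<beta> x y" if "x \<in> carrier M" "y \<in> carrier N" for x y
      using f(2)[of "(x, y)"] that by simp
    have b: "\<beta> x y \<in> carrier P" if "x \<in> carrier M" "y \<in> carrier N" for x y
      using mod_hom_closed[OF assms(2)] that by blast
    note lin = mod_hom_add[OF assms(2)] mod_hom_add[OF assms(3)] mod_hom_smult[OF assms(2)] mod_hom_smult[OF assms(3)]
    show ?thesis
      using z unfolding tensor_gens_def Let_def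
      by (auto simp: f.minus f.add f.smult fe b e_closed lin)
  qed
  then obtain g where "g \<in> mod_hom R (quot_mod F (mod_span R F (tensor_gens R M N))) P"
    "\<And>i. i \<in> I \<Longrightarrow> g (mod_span R F (tensor_gens R M N) +>\<^bsub>F\<^esub> e i) = case_prod \<beta> i"
    using M.R.presented_lift[OF assms(1) v tensor_gens_subset] by blast
  then show ?thesis
    by (intro that[of g]) (auto simp: tensor_def pure_tensor_def tensor_rels_eq)
qed

end

text \<open>Changing one input letter changes at most one output letter, and does so linearly. The
  other letters may appear as coefficients, several inputs may share an output, and an output such
  as an inserted unit may depend on no input. Composition with such a map keeps multilinear
  functions multilinear.\<close>

definition word_map ::
    "('k, 'r) ring_scheme \<Rightarrow> ('k, 'x, 'm) module_scheme \<Rightarrow> nat \<Rightarrow> ('k, 'y, 'n) module_scheme \<Rightarrow> nat \<Rightarrow>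
     ('x list \<Rightarrow> 'y list) \<Rightarrow> bool"
  where "word_map R M m N n f \<longleftrightarrow> f \<in> tuples M m \<rightarrow> tuples N n \<and>
    (\<forall>xs\<in>tuples M m. \<forall>i<m. \<exists>j<n. \<exists>L\<in>mod_hom R M N. \<forall>x\<in>carrier M. f (xs[i := x]) = (f xs)[j := L x])"

lemma word_map_closed: "word_map R M m N n f \<Longrightarrow> xs \<in> tuples M m \<Longrightarrow> f xs \<in> tuples N n"
  by (auto simp: word_map_def)

lemma word_map_comp:
  assumes "word_map R M m N n f" "word_map R N n P p g"
  shows "word_map R M m P p (\<lambda>xs. g (f xs))"
  unfolding word_map_def
proof (intro conjI ballI allI impI)
  show "(\<lambda>xs. g (f xs)) \<in> tuples M m \<rightarrow> tuples P p"
    using assms by (auto simp: word_map_def)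
  fix xs i assume xs: "xs \<in> tuples M m" "i < m"
  obtain j L where j: "j < n" "L \<in> mod_hom R M N" "\<forall>x\<in>carrier M. f (xs[i := x]) = (f xs)[j := L x]"
    using assms(1) xs unfolding word_map_def by meson
  have "f xs \<in> tuples N n" using assms(1) xs(1) by (rule word_map_closed)
  then obtain l L' where l: "l < p" "L' \<in> mod_hom R N P" "\<forall>y\<in>carrier N. g ((f xs)[j := y]) = (g (f xs))[l := L' y]"
    using assms(2) j(1) unfolding word_map_def by meson
  have "\<forall>x\<in>carrier M. g (f (xs[i := x])) = (g (f xs))[l := L' (L x)]"
    using j l mod_hom_closed[OF j(2)] by simp
  then show "\<exists>j<p. \<exists>L\<in>mod_hom R M P. \<forall>x\<in>carrier M. g (f (xs[i := x])) = (g (f xs))[j := L x]"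
    using l(1) mod_hom_comp[OF j(2) l(2)] by (intro exI[of _ l] conjI bexI[of _ "\<lambda>x. L' (L x)"]) auto
qed

lemma word_mapI:
  assumes "\<And>xs. xs \<in> tuples M m \<Longrightarrow> f xs \<in> tuples N n"
    and "\<And>xs i. xs \<in> tuples M m \<Longrightarrow> i < m \<Longrightarrow> j xs i < n \<and> L xs i \<in> mod_hom R M N \<and>
      (\<forall>x\<in>carrier M. f (xs[i := x]) = (f xs)[j xs i := L xs i x])"
  shows "word_map R M m N n f"
  unfolding word_map_def using assms by blast

lemma multilinear_closed: "multilinear R M m N v \<Longrightarrow> xs \<in> tuples M m \<Longrightarrow> v xs \<in> carrier N"
  by (auto simp: multilinear_def)

lemma multilinear_slot: "multilinear R M m N v \<Longrightarrow> xs \<in> tuples M m \<Longrightarrow> i < m \<Longrightarrow>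
    (\<lambda>x. v (xs[i := x])) \<in> mod_hom R M N"
  by (auto simp: multilinear_def)

lemma multilinear_comp:
  assumes "multilinear R M m N v" "f \<in> mod_hom R N P"
  shows "multilinear R M m P (\<lambda>xs. f (v xs))"
  using mod_hom_comp[OF multilinear_slot[OF assms(1)] assms(2)]
    mod_hom_closed[OF assms(2) multilinear_closed[OF assms(1)]]
  by (auto simp: multilinear_def)

lemma multilinear_word_map:
  assumes "module R M" "word_map R M m N n f" "multilinear R N n P v"
  shows "multilinear R M m P (\<lambda>xs. v (f xs))"
  unfolding multilinear_def
proof (intro ballI allI conjI impI)
  fix xs i assume xs: "xs \<in> tuples M m"
  show "v (f xs) \<in> carrier P"
    by (rule multilinear_closed[OF assms(3) word_map_closed[OF assms(2) xs]])
  assume i: "i < m"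
  obtain j L where j: "j < n" "L \<in> mod_hom R M N" "\<forall>x\<in>carrier M. f (xs[i := x]) = (f xs)[j := L x]"
    using assms(2) xs i unfolding word_map_def by meson
  have "(\<lambda>x. v ((f xs)[j := L x])) \<in> mod_hom R M P"
    by (rule mod_hom_comp[OF j(2) multilinear_slot[OF assms(3) word_map_closed[OF assms(2) xs] j(1)]])
  then show "(\<lambda>x. v (f (xs[i := x]))) \<in> mod_hom R M P"
    using j(3) by (rule_tac mod_hom_cong[OF _ assms(1)]) auto
qed

lemma multilinear_finsum:
  assumes "module R M" "module R N" "\<And>i. i \<in> I \<Longrightarrow> multilinear R M m N (v i)"
  shows "multilinear R M m N (\<lambda>xs. \<Oplus>\<^bsub>N\<^esub>i\<in>I. v i xs)"
proof -
  interpret N: module R N by fact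
  show ?thesis
    unfolding multilinear_def
    by (intro ballI allI conjI impI mod_hom_finsum N.finsum_closed Pi_I assms(1,2)
        multilinear_slot[OF assms(3)] multilinear_closed[OF assms(3)])
qed

lemma multilinear_signed:
  assumes "module R N" "multilinear R M m N v"
  shows "multilinear R M m N (\<lambda>xs. signed N i (v xs))"
  by (rule multilinear_comp[OF assms(2) mod_hom_signed[OF assms(1,1) mod_hom_id]])

text \<open>Letters are expanded one position at a time, each by linearity in its slot.\<close>

lemma (in module) tensor_power_span_words:
  assumes X: "X \<subseteq> carrier M" "mod_span R M X = carrier M"
  shows "mod_span R (tensor_power R M m) (power_tensor R M m ` {xs. length xs = m \<and> set xs \<subseteq> X}) =
    carrier (tensor_power R M m)"
proof -
  let ?T = "tensor_power R M m"
  interpret T: module R ?T by (rule tensor_power_module)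
  let ?W = "{xs. length xs = m \<and> set xs \<subseteq> X}"
  let ?S = "mod_span R ?T (power_tensor R M m ` ?W)"
  have W: "?W \<subseteq> tuples M m" using X(1) by (auto simp: tuples_def)
  have gens: "power_tensor R M m ` ?W \<subseteq> carrier ?T"
    by (intro image_subsetI power_tensor_closed subsetD[OF W])
  note S = T.mod_span_submodule[OF gens]
  \<comment> \<open>\<open>k\<close> counts the leading letters that are still arbitrary; all later
    ones already lie in \<open>X\<close>. At \<open>k = m\<close> no restriction is left.\<close>
  have *: "power_tensor R M m xs \<in> ?S"
    if "k \<le> m" "xs \<in> tuples M m" "\<forall>i. k \<le> i \<and> i < m \<longrightarrow> xs ! i \<in> X" for k xs
    using that
  proof (induction k arbitrary: xs)
    case 0
    then have "xs \<in> ?W" by (auto simp: tuples_def in_set_conv_nth)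
    then show ?case by (intro subsetD[OF T.mod_span_superset] imageI)
  next
    case (Suc k)
    note hom = multilinear_slot[OF power_tensor_multilinear Suc.prems(2), of k]
    have "xs ! k \<in> mod_span R M X"
      using tuples_nth[OF Suc.prems(2)] Suc.prems(1) X(2) by simp
    then have "power_tensor R M m (xs[k := xs ! k]) \<in> ?S"
      using X(1)
    proof (induction rule: mod_span_induct)
      case zero
      have "power_tensor R M m (xs[k := \<zero>\<^bsub>M\<^esub>]) = \<zero>\<^bsub>?T\<^esub>"
        using linear_map.zero[OF linear_mapI[OF module_axioms T.module_axioms hom]] Suc.prems(1) by simp
      then show ?case using T.submodule_zero[OF S] by simp
    next
      case (gen x)
      show ?case
      proof (rule Suc.IH)
        show "xs[k := x] \<in> tuples M m" using gen X(1) Suc.prems(2) by (blast intro: tuples_update)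
        show "\<forall>i. k \<le> i \<and> i < m \<longrightarrow> xs[k := x] ! i \<in> X"
          using gen Suc.prems(1,3) tuples_length[OF Suc.prems(2)] by (simp add: nth_list_update)
      qed (use Suc.prems(1) in simp)
    next
      case (add x y)
      then show ?case using Suc.prems(1) T.submoduleE(5)[OF S] by (simp add: mod_hom_add[OF hom])
    next
      case (smult c x)
      then show ?case using Suc.prems(1) T.submoduleE(4)[OF S] by (simp add: mod_hom_smult[OF hom])
    qed
    then show ?case by simp
  qed
  have "power_tensor R M m ` tuples M m \<subseteq> ?S"
    by (intro image_subsetI *[of m]) (auto dest: leD)
  then have "mod_span R ?T (power_tensor R M m ` tuples M m) \<subseteq> ?S"
    by (rule T.mod_span_least[OF S])
  then have "carrier ?T \<subseteq> ?S" by (simp only: power_tensor_span)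
  with T.submoduleE(1)[OF S] show ?thesis by (rule subset_antisym)
qed

section \<open>The universal property of equivariant chains\<close>

locale eq_chains = module R A
  for R :: "('k, 'r) ring_scheme" and A :: "('k, 'a, 'm) module_scheme" (structure) +
  fixes G :: "('a \<Rightarrow> 'a) set"
  assumes fin: "finite G"
begin

abbreviation "U n \<equiv> tensor_power R A (n + 1)"

lemma module_pair: "module_pair R (free_mod R G) (U n)"
  by (intro module_pair.intro R.free_mod_module tensor_power_module)

lemma eq_mod_module: "module R (eq_mod R A G n)"
  unfolding eq_mod_def by (rule module_pair.tensor_module[OF module_pair])

lemma eq_gen_closed: "g \<in> G \<Longrightarrow> as \<in> tuples A (n + 1) \<Longrightarrow> eq_gen R A G n (g, as) \<in> carrier (eq_mod R A G n)"
  unfolding eq_gen_def eq_mod_def prod.case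
  by (intro module_pair.pure_tensor_closed[OF module_pair] power_tensor_closed R.free_gen_closed)

lemma eq_gen_multilinear:
  assumes "g \<in> G"
  shows "multilinear R A (n + 1) (eq_mod R A G n) (\<lambda>as. eq_gen R A G n (g, as))"
  unfolding eq_gen_def eq_mod_def prod.case
  by (intro multilinear_comp[OF power_tensor_multilinear] module_pair.pure_tensor_hom2[OF module_pair]
      R.free_gen_closed assms)

lemma eq_gen_span:
  "mod_span R (eq_mod R A G n) (eq_gen R A G n ` (G \<times> tuples A (n + 1))) = carrier (eq_mod R A G n)"
proof -
  let ?E = "eq_mod R A G n"
  let ?F = "free_mod R G"
  let ?S = "mod_span R ?E (eq_gen R A G n ` (G \<times> tuples A (n + 1)))"
  interpret P: module_pair R ?F "U n" by (rule module_pair)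
  interpret E: module R ?E by (rule eq_mod_module)
  have gens: "eq_gen R A G n ` (G \<times> tuples A (n + 1)) \<subseteq> carrier ?E"
    by (rule image_subsetI) (auto intro: eq_gen_closed[simplified])
  note S = E.mod_span_submodule[OF gens]
  have Ts: "?E = tensor R ?F (U n)" by (simp add: eq_mod_def)
  \<comment> \<open>Here the second factor is expanded while the first is a basis element of
    \<open>k[G]\<close>; step 2 then expands the first factor.\<close>
  have 1: "P.pt (free_gen R G g) y \<in> ?S" if g: "g \<in> G" and y: "y \<in> carrier (U n)" for g y
  proof -
    have gc: "free_gen R G g \<in> carrier ?F" using g by (rule R.free_gen_closed)
    interpret L: linear_map R "U n" ?E "\<lambda>y. P.pt (free_gen R G g) y"
      unfolding Ts by (intro linear_mapI P.N.module_axioms P.tensor_module P.pure_tensor_hom2 gc)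
    have sp: "power_tensor R A (n + 1) ` tuples A (n + 1) \<subseteq> carrier (U n)"
      by (intro image_subsetI power_tensor_closed)
    have "y \<in> mod_span R (U n) (power_tensor R A (n + 1) ` tuples A (n + 1))"
      using y by (simp only: power_tensor_span)
    then show ?thesis
      using sp
    proof (induction rule: P.N.mod_span_induct)
      case zero
      show ?case unfolding L.zero by (rule E.submodule_zero[OF S])
    next
      case (gen y)
      then obtain as where as: "as \<in> tuples A (n + 1)" "y = power_tensor R A (n + 1) as" by blast
      have "eq_gen R A G n (g, as) \<in> ?S"
        by (intro subsetD[OF E.mod_span_superset] imageI SigmaI g as(1))
      then show ?case by (simp add: eq_gen_def as(2))
    next
      case (add x y)
      show ?case unfolding L.add[OF add(1,2)] by (rule E.submoduleE(5)[OF S add(3,4)])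
    next
      case (smult c x)
      show ?case unfolding L.smult[OF smult(1,2)] by (rule E.submoduleE(4)[OF S smult(1,3)])
    qed
  qed
  have 2: "P.pt f y \<in> ?S" if f: "f \<in> carrier ?F" and y: "y \<in> carrier (U n)" for f y
  proof -
    interpret L: linear_map R ?F ?E "\<lambda>f. P.pt f y"
      unfolding Ts by (intro linear_mapI P.M.module_axioms P.tensor_module P.pure_tensor_hom1 y)
    have sp: "free_gen R G ` G \<subseteq> carrier ?F"
      by (intro image_subsetI R.free_gen_closed)
    have "f \<in> mod_span R ?F (free_gen R G ` G)"
      using f by (simp only: R.free_mod_span)
    then show ?thesis
      using sp
    proof (induction rule: P.M.mod_span_induct)
      case zero
      show ?case unfolding L.zero by (rule E.submodule_zero[OF S])
    next
      case (gen f)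
      then show ?case using 1[OF _ y] by blast
    next
      case (add x y)
      show ?case unfolding L.add[OF add(1,2)] by (rule E.submoduleE(5)[OF S add(3,4)])
    next
      case (smult c x)
      show ?case unfolding L.smult[OF smult(1,2)] by (rule E.submoduleE(4)[OF S smult(1,3)])
    qed
  qed
  have "case_prod P.pt ` P.I \<subseteq> ?S"
    by (rule image_subsetI) (auto intro: 2[simplified])
  then have "mod_span R ?E (case_prod P.pt ` P.I) \<subseteq> ?S"
    by (rule E.mod_span_least[OF S])
  then have "carrier ?E \<subseteq> ?S" by (simp only: P.pure_tensor_span Ts)
  with E.submoduleE(1)[OF S] show ?thesis by (rule subset_antisym)
qed

lemma eq_lift:
  assumes "module R N" "\<And>g. g \<in> G \<Longrightarrow> multilinear R A (n + 1) N (\<lambda>as. v (g, as))"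
  obtains f where "f \<in> mod_hom R (eq_mod R A G n) N"
    "\<And>g as. g \<in> G \<Longrightarrow> as \<in> tuples A (n + 1) \<Longrightarrow> f (eq_gen R A G n (g, as)) = v (g, as)"
proof -
  let ?F = "free_mod R G"
  interpret N: module R N by fact
  interpret P: module_pair R ?F "U n" by (rule module_pair)
  have "\<exists>f. f \<in> mod_hom R (U n) N \<and> (\<forall>as\<in>tuples A (n + 1). f (power_tensor R A (n + 1) as) = v (g, as))"
    if g: "g \<in> G" for g
    by (rule tensor_power_lift[OF assms(1) assms(2)[OF g]]) blast
  then have "\<forall>g\<in>G. \<exists>f. f \<in> mod_hom R (U n) N \<and> (\<forall>as\<in>tuples A (n + 1). f (power_tensor R A (n + 1) as) = v (g, as))"
    by blast
  from bchoice[OF this] obtain V where "\<forall>g\<in>G. V g \<in> mod_hom R (U n) N \<and>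
      (\<forall>as\<in>tuples A (n + 1). V g (power_tensor R A (n + 1) as) = v (g, as))" ..
  then have V: "\<And>g. g \<in> G \<Longrightarrow> V g \<in> mod_hom R (U n) N"
    "\<And>g as. g \<in> G \<Longrightarrow> as \<in> tuples A (n + 1) \<Longrightarrow> V g (power_tensor R A (n + 1) as) = v (g, as)"
    by blast+
  note Vc = mod_hom_closed[OF V(1)]
  \<comment> \<open>A linear function on \<open>k[G]\<close> is a sum over all of \<open>G\<close>,
    which is where finiteness enters. At the basis element of \<open>g\<close> only the summand
    \<open>V g\<close> survives.\<close>
  define \<beta> where "\<beta> f x = (\<Oplus>\<^bsub>N\<^esub>g\<in>G. f g \<odot>\<^bsub>N\<^esub> V g x)" for f x
  have fc: "f g \<in> carrier R" if "f \<in> carrier ?F" "g \<in> G" for f g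
    using that by (auto simp: free_mod_def)
  obtain h where h: "h \<in> mod_hom R (tensor R ?F (U n)) N"
    "\<And>f x. f \<in> carrier ?F \<Longrightarrow> x \<in> carrier (U n) \<Longrightarrow> h (P.pt f x) = \<beta> f x"
  proof (rule P.tensor_lift[OF assms(1)])
    fix x assume x: "x \<in> carrier (U n)"
    have "(\<lambda>f. f g \<odot>\<^bsub>N\<^esub> V g x) \<in> mod_hom R ?F N" if g: "g \<in> G" for g
      using fc Vc[OF g x] g
      by (intro mod_homI) (auto simp: free_mod_def N.smult_l_distr N.smult_assoc1)
    then show "(\<lambda>f. \<beta> f x) \<in> mod_hom R ?F N"
      unfolding \<beta>_def by (intro mod_hom_finsum R.free_mod_module assms(1))
  next
    fix f assume f: "f \<in> carrier ?F"
    show "(\<lambda>x. \<beta> f x) \<in> mod_hom R (U n) N"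
      unfolding \<beta>_def
      by (intro mod_hom_finsum mod_hom_smultI V(1) fc[OF f] tensor_power_module assms(1))
  qed blast
  show ?thesis
  proof
    show "h \<in> mod_hom R (eq_mod R A G n) N" using h(1) by (simp add: eq_mod_def)
    fix g as assume g: "g \<in> G" and as: "as \<in> tuples A (n + 1)"
    have pc: "power_tensor R A (n + 1) as \<in> carrier (U n)" using as by (rule power_tensor_closed)
    have "h (eq_gen R A G n (g, as)) = \<beta> (free_gen R G g) (power_tensor R A (n + 1) as)"
      unfolding eq_gen_def prod.case by (intro h(2) R.free_gen_closed g pc)
    also have "\<dots> = free_gen R G g g \<odot>\<^bsub>N\<^esub> V g (power_tensor R A (n + 1) as)"
      unfolding \<beta>_def using g Vc[OF _ pc] by (intro N.finsum_single fin) (auto simp: free_gen_def)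
    also have "\<dots> = v (g, as)" using g V(2)[OF g as] Vc[OF g pc] by (simp add: free_gen_def)
    finally show "h (eq_gen R A G n (g, as)) = v (g, as)" .
  qed
qed

end

lemma (in module) minus_zero_right [simp]: "x \<in> carrier M \<Longrightarrow> x \<ominus>\<^bsub>M\<^esub> \<zero>\<^bsub>M\<^esub> = x"
  by (simp add: minus_eq_iff)

section \<open>Homology\<close>

locale chain_complex =
  fixes R :: "('k, 'r) ring_scheme" and C :: "nat \<Rightarrow> ('k, 'x) module" and d :: "nat \<Rightarrow> 'x \<Rightarrow> 'x"
  assumes C_module: "module R (C n)"
    and d_hom: "d n \<in> mod_hom R (C (Suc n)) (C n)"
    and d_d: "x \<in> carrier (C (Suc (Suc n))) \<Longrightarrow> d n (d (Suc n) x) = \<zero>\<^bsub>C n\<^esub>"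
begin

sublocale C: module R "C n" for n by (rule C_module)

sublocale d: linear_map R "C (Suc n)" "C n" "d n" for n
  by (intro linear_mapI C_module d_hom)

lemma cycles_0: "cycles C d 0 = carrier (C 0)"
  by (simp add: cycles_def)

lemma cycles_Suc: "cycles C d (Suc n) = {x \<in> carrier (C (Suc n)). d n x = \<zero>\<^bsub>C n\<^esub>}"
  by (simp add: cycles_def a_kernel_def kernel_def)

lemma cycles_submodule: "submodule (cycles C d n) R (C n)"
proof (cases n)
  case 0
  then show ?thesis by (simp add: cycles_0 C.carrier_is_submodule)
next
  case (Suc m)
  show ?thesis unfolding Suc cycles_Suc
    by (rule C.submoduleI') (auto simp: d.add d.smult)
qed

lemma cycles_closed: "x \<in> cycles C d n \<Longrightarrow> x \<in> carrier (C n)"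
  using C.submoduleE(1)[OF cycles_submodule] by blast

lemma boundary_cycle: "x \<in> carrier (C (Suc n)) \<Longrightarrow> d n x \<in> cycles C d n"
  by (cases n) (auto simp: cycles_0 cycles_Suc d_d)

lemma boundaries_submodule: "submodule (boundaries C d n) R (C n)"
proof (rule C.submoduleI')
  show "\<zero>\<^bsub>C n\<^esub> \<in> boundaries C d n"
    unfolding boundaries_def by (rule image_eqI[of _ _ "\<zero>\<^bsub>C (Suc n)\<^esub>"]) auto
qed (auto simp: boundaries_def d.add[symmetric] d.smult[symmetric])

lemma cycle_mod_module: "module R (cycle_mod C d n)"
  unfolding cycle_mod_def by (rule submodule.submodule_is_module[OF cycles_submodule C_module])

lemma boundaries_submodule': "submodule (boundaries C d n) R (cycle_mod C d n)"
proof -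
  interpret Z: module R "cycle_mod C d n" by (rule cycle_mod_module)
  note B = boundaries_submodule
  show ?thesis
    using C.submodule_zero[OF B] C.submoduleE(4,5)[OF B] boundary_cycle
    by (intro Z.submoduleI') (auto simp: cycle_mod_def boundaries_def)
qed

definition cls :: "nat \<Rightarrow> 'x \<Rightarrow> 'x set"
  where "cls n x = boundaries C d n +>\<^bsub>C n\<^esub> x"

text \<open>A coset depends on the addition and not on the carrier, so classes formed in
  \<open>C n\<close> and in the submodule of cycles are the same sets.\<close>

lemma cls_eq: "cls n = (\<lambda>x. boundaries C d n +>\<^bsub>cycle_mod C d n\<^esub> x)"
  by (simp add: cls_def fun_eq_iff cycle_mod_def a_r_coset_def')

lemma homology_module: "module R (homology_mod C d n)"
  unfolding homology_mod_def
  by (rule module.quot_mod_module[OF cycle_mod_module boundaries_submodule'])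

lemma carrier_homology: "carrier (homology_mod C d n) = cls n ` cycles C d n"
  by (simp add: homology_mod_def module.carrier_quot_mod[OF cycle_mod_module] cls_eq)
    (simp add: cycle_mod_def)

lemma cls_add: "x \<in> cycles C d n \<Longrightarrow> y \<in> cycles C d n \<Longrightarrow>
    cls n x \<oplus>\<^bsub>homology_mod C d n\<^esub> cls n y = cls n (x \<oplus>\<^bsub>C n\<^esub> y)"
  using module.quot_add[OF cycle_mod_module boundaries_submodule', of x n y]
  by (simp add: homology_mod_def cls_eq) (simp add: cycle_mod_def)

lemma cls_smult: "c \<in> carrier R \<Longrightarrow> x \<in> cycles C d n \<Longrightarrow>
    c \<odot>\<^bsub>homology_mod C d n\<^esub> cls n x = cls n (c \<odot>\<^bsub>C n\<^esub> x)"
  using module.quot_smult[OF cycle_mod_module boundaries_submodule', of c x n]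
  by (simp add: homology_mod_def cls_eq) (simp add: cycle_mod_def)

lemma cls_eq_iff:
  assumes "x \<in> carrier (C n)" "y \<in> carrier (C n)"
  shows "cls n x = cls n y \<longleftrightarrow> (\<exists>u\<in>carrier (C (Suc n)). x \<ominus>\<^bsub>C n\<^esub> y = d n u)"
  unfolding cls_def C.coset_eq_iff[OF boundaries_submodule assms] by (auto simp: boundaries_def)

lemma zero_homology: "\<zero>\<^bsub>homology_mod C d n\<^esub> = cls n \<zero>\<^bsub>C n\<^esub>"
  by (simp add: homology_mod_def module.quot_zero[OF cycle_mod_module] cls_def C.coset_zero[OF boundaries_submodule])

lemma cls_zero_iff:
  assumes "x \<in> carrier (C n)"
  shows "cls n x = \<zero>\<^bsub>homology_mod C d n\<^esub> \<longleftrightarrow> (\<exists>u\<in>carrier (C (Suc n)). x = d n u)"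
  unfolding zero_homology using assms by (subst cls_eq_iff) auto

end

abbreviation homology_map where
  "homology_map C d n C' d' m f \<equiv>
     quot_map (cycle_mod C d n) (boundaries C d n) (cycle_mod C' d' m) (boundaries C' d' m) f"

text \<open>Source and target degree may differ, because the periodicity operator lowers the degree
  by two. The conditions are what a chain map yields in a single degree.\<close>

locale homology_hom = C: chain_complex R C d + C': chain_complex R C' d' for R C d C' d' +
  fixes n m f
  assumes f_hom: "f \<in> mod_hom R (C n) (C' m)"
    and f_cycles: "x \<in> cycles C d n \<Longrightarrow> f x \<in> cycles C' d' m"
    and f_boundaries: "x \<in> carrier (C (Suc n)) \<Longrightarrow> f (d n x) \<in> boundaries C' d' m"
begin

lemma restr_hom: "f \<in> mod_hom R (cycle_mod C d n) (cycle_mod C' d' m)"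
  using f_cycles C.cycles_closed mod_hom_add[OF f_hom] mod_hom_smult[OF f_hom]
  by (intro mod_homI) (auto simp: cycle_mod_def)

lemma fb: "x \<in> boundaries C d n \<Longrightarrow> f x \<in> boundaries C' d' m"
  using f_boundaries by (auto simp: boundaries_def)

lemma hom: "homology_map C d n C' d' m f \<in> mod_hom R (homology_mod C d n) (homology_mod C' d' m)"
  unfolding homology_mod_def
  by (rule module.quot_map_hom[OF C.cycle_mod_module C'.cycle_mod_module C.boundaries_submodule'
        C'.boundaries_submodule' restr_hom fb])

lemma cls: "x \<in> cycles C d n \<Longrightarrow> homology_map C d n C' d' m f (C.cls n x) = C'.cls m (f x)"
  unfolding C.cls_eq C'.cls_eq
  by (rule module.quot_map_coset[OF C.cycle_mod_module C'.cycle_mod_module C.boundaries_submodule'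
        C'.boundaries_submodule' restr_hom fb]) (auto simp: cycle_mod_def)

end

section \<open>The periodicity sequence of a chain complex\<close>

text \<open>\<open>K\<close> stands for the kernel of the surjective chain map \<open>p\<close>,
  which is never formed as a complex: \<open>quasi_inj\<close> and \<open>quasi_surj\<close> say by
  elements that \<open>\<phi>\<close> induces bijections between the homology of \<open>K\<close>
  and that of the kernel. The guards \<open>n = Suc m\<close> and \<open>n = Suc (Suc m)\<close> are
  there because chains of \<open>T\<close> in degrees 0 and 1 have nowhere to go under
  \<open>p\<close> and all count as kernel elements.\<close>

locale periodic_complex = K: chain_complex R K dK + T: chain_complex R T dT 
  for R :: "('k, 'r) ring_scheme" and K :: "nat \<Rightarrow> ('k, 'x) module" and dK
    and T :: "nat \<Rightarrow> ('k, 'y) module" and dT +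
  fixes \<phi> and p
  assumes \<phi>_hom: "\<phi> n \<in> mod_hom R (K n) (T n)"
    and p_hom: "p n \<in> mod_hom R (T (Suc (Suc n))) (T n)"
    and \<phi>_chain: "x \<in> carrier (K (Suc n)) \<Longrightarrow> \<phi> n (dK n x) = dT n (\<phi> (Suc n) x)"
    and p_chain: "y \<in> carrier (T (Suc (Suc (Suc n)))) \<Longrightarrow> p n (dT (Suc (Suc n)) y) = dT n (p (Suc n) y)"
    and p_surj: "z \<in> carrier (T n) \<Longrightarrow> \<exists>y\<in>carrier (T (Suc (Suc n))). p n y = z"
    and p_\<phi>: "x \<in> carrier (K (Suc (Suc n))) \<Longrightarrow> p n (\<phi> (Suc (Suc n)) x) = \<zero>\<^bsub>T n\<^esub>"
    and quasi_inj: "\<lbrakk>x \<in> carrier (K n); y \<in> carrier (T (Suc n)); \<And>m. n = Suc m \<Longrightarrow> p m y = \<zero>\<^bsub>T m\<^esub>;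
          \<phi> n x = dT n y\<rbrakk> \<Longrightarrow> \<exists>x'\<in>carrier (K (Suc n)). x = dK n x'"
    and quasi_surj: "\<lbrakk>z \<in> cycles T dT n; \<And>m. n = Suc (Suc m) \<Longrightarrow> p m z = \<zero>\<^bsub>T m\<^esub>\<rbrakk> \<Longrightarrow>
          \<exists>x\<in>cycles K dK n. \<exists>y\<in>carrier (T (Suc n)). (\<forall>m. n = Suc m \<longrightarrow> p m y = \<zero>\<^bsub>T m\<^esub>) \<and>
            z = \<phi> n x \<oplus>\<^bsub>T n\<^esub> dT n y"
begin

sublocale \<phi>: linear_map R "K n" "T n" "\<phi> n" for n
  by (intro linear_mapI K.C_module T.C_module \<phi>_hom)

sublocale p: linear_map R "T (Suc (Suc n))" "T n" "p n" for n
  by (intro linear_mapI T.C_module p_hom)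

lemma \<phi>_cycles: "x \<in> cycles K dK n \<Longrightarrow> \<phi> n x \<in> cycles T dT n"
  by (cases n) (auto simp: K.cycles_0 T.cycles_0 K.cycles_Suc T.cycles_Suc \<phi>_chain[symmetric])

lemma p_cycles: "x \<in> cycles T dT (Suc (Suc n)) \<Longrightarrow> p n x \<in> cycles T dT n"
  by (cases n) (auto simp: T.cycles_0 T.cycles_Suc p_chain[symmetric])

sublocale I: homology_hom R K dK T dT n n "\<phi> n" for n
  by unfold_locales (use \<phi>_hom \<phi>_cycles \<phi>_chain in \<open>auto simp: boundaries_def\<close>)

sublocale S: homology_hom R T dT T dT "Suc (Suc n)" n "p n" for n
  by unfold_locales (use p_hom p_cycles p_chain in \<open>auto simp: boundaries_def\<close>)

abbreviation "I n \<equiv> homology_map K dK n T dT n (\<phi> n)"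
abbreviation "S n \<equiv> homology_map T dT (Suc (Suc n)) T dT n (p n)"

text \<open>The connecting map as a relation between chains. Linearity of \<open>D\<close> reduces
  to adding and scaling the witnesses \<open>y\<close>.\<close>

definition rel :: "nat \<Rightarrow> 'y \<Rightarrow> 'x \<Rightarrow> bool"
  where "rel n z x \<longleftrightarrow> (\<exists>y\<in>carrier (T (Suc (Suc n))). p n y = z \<and> dT (Suc n) y = \<phi> (Suc n) x)"

text \<open>The choice ranges over all representatives of \<open>X\<close>, which makes
  \<open>D n\<close> a function of the class. What remains is that the class of the chosen
  \<open>x\<close> is always the same, and this is \<open>rel_unique\<close>.\<close>

definition D :: "nat \<Rightarrow> 'y set \<Rightarrow> 'x set"
  where "D n X = K.cls (Suc n) (SOME x. x \<in> cycles K dK (Suc n) \<and> (\<exists>z\<in>cycles T dT n. X = T.cls n z \<and> rel n z x))"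

text \<open>Lift \<open>z\<close> to \<open>y\<close>. As \<open>z\<close> is a cycle, the boundary
  of \<open>y\<close> is a cycle killed by \<open>p\<close>, hence \<open>\<phi> x\<close> up to the
  boundary of some \<open>w\<close> killed by \<open>p\<close>. Replacing \<open>y\<close> by
  \<open>y - w\<close> keeps the lift and removes the error.\<close>

lemma rel_total:
  assumes z: "z \<in> cycles T dT n"
  shows "\<exists>x\<in>cycles K dK (Suc n). rel n z x"
proof -
  obtain y where y: "y \<in> carrier (T (Suc (Suc n)))" "p n y = z"
    using p_surj T.cycles_closed[OF z] by blast
  have "p m (dT (Suc n) y) = \<zero>\<^bsub>T m\<^esub>" if "Suc n = Suc (Suc m)" for m
    using that y z p_chain[of y m] by (auto simp: T.cycles_Suc)
  then obtain x w where x: "x \<in> cycles K dK (Suc n)" and w: "w \<in> carrier (T (Suc (Suc n)))" "p n w = \<zero>\<^bsub>T n\<^esub>"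
    and e: "dT (Suc n) y = \<phi> (Suc n) x \<oplus>\<^bsub>T (Suc n)\<^esub> dT (Suc n) w"
    using quasi_surj[OF T.boundary_cycle[OF y(1)]] by blast
  have \<phi>x: "\<phi> (Suc n) x \<in> carrier (T (Suc n))" using K.cycles_closed[OF x] by simp
  have "dT (Suc n) (y \<ominus>\<^bsub>T (Suc (Suc n))\<^esub> w) = \<phi> (Suc n) x"
    using T.C.minus_eq_iff[of "dT (Suc n) y" "Suc n" "dT (Suc n) w" "\<phi> (Suc n) x"] e y w \<phi>x
    by (simp add: T.d.minus)
  moreover have "p n (y \<ominus>\<^bsub>T (Suc (Suc n))\<^esub> w) = z"
    using y w z T.cycles_closed[OF z] by (simp add: p.minus)
  ultimately have "rel n z x" using y w unfolding rel_def by (intro bexI[of _ "y \<ominus>\<^bsub>T (Suc (Suc n))\<^esub> w"]) auto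
  then show ?thesis using x by blast
qed

text \<open>If \<open>z - z'\<close> is the boundary of \<open>u\<close> and \<open>v\<close> lifts
  \<open>u\<close>, then \<open>y - y' - d v\<close> is killed by \<open>p\<close> and has boundary
  \<open>\<phi> (x - x')\<close>, so \<open>quasi_inj\<close> applies.\<close>

lemma rel_unique:
  assumes "z \<in> cycles T dT n" "z' \<in> cycles T dT n" "x \<in> cycles K dK (Suc n)" "x' \<in> cycles K dK (Suc n)"
    and "rel n z x" "rel n z' x'" "T.cls n z = T.cls n z'"
  shows "K.cls (Suc n) x = K.cls (Suc n) x'"
proof -
  note zc = T.cycles_closed[OF assms(1)] T.cycles_closed[OF assms(2)]
  note xc = K.cycles_closed[OF assms(3)] K.cycles_closed[OF assms(4)]
  obtain y y' where y: "y \<in> carrier (T (Suc (Suc n)))" "p n y = z" "dT (Suc n) y = \<phi> (Suc n) x"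
    and y': "y' \<in> carrier (T (Suc (Suc n)))" "p n y' = z'" "dT (Suc n) y' = \<phi> (Suc n) x'"
    using assms(5,6) unfolding rel_def by blast
  obtain u where u: "u \<in> carrier (T (Suc n))" "z \<ominus>\<^bsub>T n\<^esub> z' = dT n u"
    using assms(7) T.cls_eq_iff[OF zc] by blast
  obtain v where v: "v \<in> carrier (T (Suc (Suc (Suc n))))" "p (Suc n) v = u"
    using p_surj[OF u(1)] by blast
  let ?T = "T (Suc (Suc n))"
  let ?w = "y \<ominus>\<^bsub>?T\<^esub> y' \<ominus>\<^bsub>?T\<^esub> dT (Suc (Suc n)) v"
  have w: "?w \<in> carrier ?T" using y y' v by simp
  have "p n ?w = \<zero>\<^bsub>T n\<^esub>" using y y' v u by (simp add: p.minus p_chain)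
  moreover have "\<phi> (Suc n) (x \<ominus>\<^bsub>K (Suc n)\<^esub> x') = dT (Suc n) ?w"
    using y y' v xc by (simp add: T.d.minus \<phi>.minus T.d_d)
  ultimately have "\<exists>x''\<in>carrier (K (Suc (Suc n))). x \<ominus>\<^bsub>K (Suc n)\<^esub> x' = dK (Suc n) x''"
    using w xc by (intro quasi_inj[of _ _ ?w]) auto
  then show ?thesis using xc by (simp add: K.cls_eq_iff)
qed

lemma D_cls:
  assumes "z \<in> cycles T dT n" "x \<in> cycles K dK (Suc n)" "rel n z x"
  shows "D n (T.cls n z) = K.cls (Suc n) x"
proof -
  let ?P = "\<lambda>x. x \<in> cycles K dK (Suc n) \<and> (\<exists>z'\<in>cycles T dT n. T.cls n z = T.cls n z' \<and> rel n z' x)"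
  define e where "e = Eps ?P"
  have "?P x" using assms by blast
  then have "?P e" unfolding e_def by (rule someI)
  then obtain z' where e: "e \<in> cycles K dK (Suc n)" "z' \<in> cycles T dT n" "T.cls n z = T.cls n z'" "rel n z' e"
    by blast
  have "K.cls (Suc n) x = K.cls (Suc n) e"
    by (rule rel_unique[OF assms(1) e(2) assms(2) e(1) assms(3) e(4,3)])
  then show ?thesis by (simp only: D_def e_def)
qed

lemma rel_add:
  assumes "x \<in> carrier (K (Suc n))" "x' \<in> carrier (K (Suc n))" "rel n z x" "rel n z' x'"
  shows "rel n (z \<oplus>\<^bsub>T n\<^esub> z') (x \<oplus>\<^bsub>K (Suc n)\<^esub> x')"
proof -
  obtain y y' where "y \<in> carrier (T (Suc (Suc n)))" "p n y = z" "dT (Suc n) y = \<phi> (Suc n) x"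
    "y' \<in> carrier (T (Suc (Suc n)))" "p n y' = z'" "dT (Suc n) y' = \<phi> (Suc n) x'"
    using assms(3,4) unfolding rel_def by blast
  then show ?thesis
    unfolding rel_def using assms(1,2)
    by (intro bexI[of _ "y \<oplus>\<^bsub>T (Suc (Suc n))\<^esub> y'"]) (auto simp: p.add T.d.add \<phi>.add)
qed

lemma rel_smult:
  assumes "x \<in> carrier (K (Suc n))" "c \<in> carrier R" "rel n z x"
  shows "rel n (c \<odot>\<^bsub>T n\<^esub> z) (c \<odot>\<^bsub>K (Suc n)\<^esub> x)"
proof -
  obtain y where "y \<in> carrier (T (Suc (Suc n)))" "p n y = z" "dT (Suc n) y = \<phi> (Suc n) x"
    using assms(3) unfolding rel_def by blast
  then show ?thesis
    unfolding rel_def using assms(1,2)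
    by (intro bexI[of _ "c \<odot>\<^bsub>T (Suc (Suc n))\<^esub> y"]) (auto simp: p.smult T.d.smult \<phi>.smult)
qed

lemma carrier_T_rel:
  assumes "X \<in> carrier (homology_mod T dT n)"
  obtains z x where "z \<in> cycles T dT n" "X = T.cls n z" "x \<in> cycles K dK (Suc n)" "rel n z x"
proof -
  obtain z where "z \<in> cycles T dT n" "X = T.cls n z" using assms by (auto simp: T.carrier_homology)
  moreover obtain x where "x \<in> cycles K dK (Suc n)" "rel n z x" using rel_total[OF calculation(1)] by blast
  ultimately show ?thesis by (rule that)
qed

lemma D_hom: "D n \<in> mod_hom R (homology_mod T dT n) (homology_mod K dK (Suc n))"
proof (rule mod_homI)
  fix X assume "X \<in> carrier (homology_mod T dT n)"
  then obtain z x where "z \<in> cycles T dT n" "X = T.cls n z" "x \<in> cycles K dK (Suc n)" "rel n z x"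
    by (rule carrier_T_rel)
  then show "D n X \<in> carrier (homology_mod K dK (Suc n))"
    by (simp add: D_cls K.carrier_homology)
next
  fix X Y assume X: "X \<in> carrier (homology_mod T dT n)" and Y: "Y \<in> carrier (homology_mod T dT n)"
  obtain z x where z: "z \<in> cycles T dT n" "X = T.cls n z" "x \<in> cycles K dK (Suc n)" "rel n z x"
    using X by (rule carrier_T_rel)
  obtain z' x' where z': "z' \<in> cycles T dT n" "Y = T.cls n z'" "x' \<in> cycles K dK (Suc n)" "rel n z' x'"
    using Y by (rule carrier_T_rel)
  have "rel n (z \<oplus>\<^bsub>T n\<^esub> z') (x \<oplus>\<^bsub>K (Suc n)\<^esub> x')"
    using z z' K.cycles_closed by (intro rel_add) auto
  then have "D n (T.cls n (z \<oplus>\<^bsub>T n\<^esub> z')) = K.cls (Suc n) (x \<oplus>\<^bsub>K (Suc n)\<^esub> x')"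
    using z z' by (intro D_cls K.C.submoduleE(5)[OF K.cycles_submodule] T.C.submoduleE(5)[OF T.cycles_submodule])
  then show "D n (X \<oplus>\<^bsub>homology_mod T dT n\<^esub> Y) = D n X \<oplus>\<^bsub>homology_mod K dK (Suc n)\<^esub> D n Y"
    using z z' by (simp add: D_cls K.cls_add T.cls_add)
next
  fix c X assume c: "c \<in> carrier R" and "X \<in> carrier (homology_mod T dT n)"
  then obtain z x where z: "z \<in> cycles T dT n" "X = T.cls n z" "x \<in> cycles K dK (Suc n)" "rel n z x"
    by (rule_tac carrier_T_rel)
  have "rel n (c \<odot>\<^bsub>T n\<^esub> z) (c \<odot>\<^bsub>K (Suc n)\<^esub> x)"
    using z c K.cycles_closed by (intro rel_smult) auto
  then have "D n (T.cls n (c \<odot>\<^bsub>T n\<^esub> z)) = K.cls (Suc n) (c \<odot>\<^bsub>K (Suc n)\<^esub> x)"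
    using z c by (intro D_cls K.C.submoduleE(4)[OF K.cycles_submodule] T.C.submoduleE(4)[OF T.cycles_submodule])
  then show "D n (c \<odot>\<^bsub>homology_mod T dT n\<^esub> X) = c \<odot>\<^bsub>homology_mod K dK (Suc n)\<^esub> D n X"
    using z c by (simp add: D_cls K.cls_smult T.cls_smult)
qed

section \<open>Exactness at the three kinds of spots and at the low end of the sequence\<close>

lemma exact_atI:
  assumes "\<And>x. x \<in> carrier L \<Longrightarrow> f x \<in> carrier M \<and> g (f x) = \<zero>\<^bsub>N\<^esub>"
    and "\<And>y. y \<in> carrier M \<Longrightarrow> g y = \<zero>\<^bsub>N\<^esub> \<Longrightarrow> \<exists>x\<in>carrier L. y = f x"
  shows "exact_at L f M g N"
  using assms by (fastforce simp: exact_at_def a_kernel_def kernel_def)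

lemma exact_I_S: "exact_at (homology_mod K dK (Suc (Suc n))) (I (Suc (Suc n)))
    (homology_mod T dT (Suc (Suc n))) (S n) (homology_mod T dT n)"
proof (rule exact_atI)
  fix X assume "X \<in> carrier (homology_mod K dK (Suc (Suc n)))"
  then obtain x where x: "x \<in> cycles K dK (Suc (Suc n))" "X = K.cls (Suc (Suc n)) x"
    by (auto simp: K.carrier_homology)
  then show "I (Suc (Suc n)) X \<in> carrier (homology_mod T dT (Suc (Suc n))) \<and>
      S n (I (Suc (Suc n)) X) = \<zero>\<^bsub>homology_mod T dT n\<^esub>"
    using \<phi>_cycles[OF x(1)] K.cycles_closed[OF x(1)]
    by (simp add: I.cls S.cls T.carrier_homology p_\<phi> T.zero_homology)
next
  fix Y assume "Y \<in> carrier (homology_mod T dT (Suc (Suc n)))" and SY: "S n Y = \<zero>\<^bsub>homology_mod T dT n\<^esub>"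
  then obtain z where z: "z \<in> cycles T dT (Suc (Suc n))" "Y = T.cls (Suc (Suc n)) z"
    by (auto simp: T.carrier_homology)
  note zc = T.cycles_closed[OF z(1)]
  obtain u where u: "u \<in> carrier (T (Suc n))" "p n z = dT n u"
    using SY z zc by (auto simp: S.cls T.cls_zero_iff)
  \<comment> \<open>Lifting \<open>u\<close> allows \<open>z\<close> to be corrected by a boundary
    so that \<open>p\<close> kills it; only then does \<open>quasi_surj\<close> apply.\<close>
  obtain v where v: "v \<in> carrier (T (Suc (Suc (Suc n))))" "p (Suc n) v = u"
    using p_surj[OF u(1)] by blast
  let ?T = "T (Suc (Suc n))"
  let ?z = "z \<ominus>\<^bsub>?T\<^esub> dT (Suc (Suc n)) v"
  have "?z \<in> cycles T dT (Suc (Suc n))"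
    using z(1) v by (simp add: T.cycles_Suc T.d.minus T.d_d)
  moreover have "p n ?z = \<zero>\<^bsub>T n\<^esub>"
    using zc u v by (simp add: p.minus p_chain)
  ultimately obtain x y where x: "x \<in> cycles K dK (Suc (Suc n))" and y: "y \<in> carrier (T (Suc (Suc (Suc n))))"
    and e: "?z = \<phi> (Suc (Suc n)) x \<oplus>\<^bsub>?T\<^esub> dT (Suc (Suc n)) y"
    using quasi_surj[of ?z "Suc (Suc n)"] by auto
  have xc: "\<phi> (Suc (Suc n)) x \<in> carrier ?T" using K.cycles_closed[OF x] by simp
  have "z = (\<phi> (Suc (Suc n)) x \<oplus>\<^bsub>?T\<^esub> dT (Suc (Suc n)) y) \<oplus>\<^bsub>?T\<^esub> dT (Suc (Suc n)) v"
    using e zc v y xc by (subst (asm) T.C.minus_eq_iff) auto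
  also have "\<dots> = dT (Suc (Suc n)) (y \<oplus>\<^bsub>T (Suc (Suc (Suc n)))\<^esub> v) \<oplus>\<^bsub>?T\<^esub> \<phi> (Suc (Suc n)) x"
    using v y xc by (simp add: T.d.add T.C.a_ac)
  finally have "z \<ominus>\<^bsub>?T\<^esub> \<phi> (Suc (Suc n)) x = dT (Suc (Suc n)) (y \<oplus>\<^bsub>T (Suc (Suc (Suc n)))\<^esub> v)"
    using v y xc zc by (subst T.C.minus_eq_iff) auto
  then have "T.cls (Suc (Suc n)) z = T.cls (Suc (Suc n)) (\<phi> (Suc (Suc n)) x)"
    using v y xc zc by (subst T.cls_eq_iff) auto
  then show "\<exists>X\<in>carrier (homology_mod K dK (Suc (Suc n))). Y = I (Suc (Suc n)) X"
    using x z by (intro bexI[of _ "K.cls (Suc (Suc n)) x"]) (auto simp: I.cls K.carrier_homology)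
qed

lemma exact_S_D: "exact_at (homology_mod T dT (Suc (Suc n))) (S n)
    (homology_mod T dT n) (D n) (homology_mod K dK (Suc n))"
proof (rule exact_atI)
  fix X assume "X \<in> carrier (homology_mod T dT (Suc (Suc n)))"
  then obtain y where y: "y \<in> cycles T dT (Suc (Suc n))" "X = T.cls (Suc (Suc n)) y"
    by (auto simp: T.carrier_homology)
  have "rel n (p n y) \<zero>\<^bsub>K (Suc n)\<^esub>"
    using y by (auto simp: rel_def T.cycles_Suc)
  then have "D n (T.cls n (p n y)) = K.cls (Suc n) \<zero>\<^bsub>K (Suc n)\<^esub>"
    using p_cycles[OF y(1)] by (intro D_cls) (auto simp: K.cycles_Suc)
  then show "S n X \<in> carrier (homology_mod T dT n) \<and> D n (S n X) = \<zero>\<^bsub>homology_mod K dK (Suc n)\<^esub>"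
    using y p_cycles[OF y(1)] by (simp add: S.cls T.carrier_homology K.zero_homology)
next
  fix Y assume "Y \<in> carrier (homology_mod T dT n)" and DY: "D n Y = \<zero>\<^bsub>homology_mod K dK (Suc n)\<^esub>"
  then obtain z where z: "z \<in> cycles T dT n" "Y = T.cls n z" by (auto simp: T.carrier_homology)
  obtain x where x: "x \<in> cycles K dK (Suc n)" "rel n z x" using rel_total[OF z(1)] by blast
  then have "K.cls (Suc n) x = \<zero>\<^bsub>homology_mod K dK (Suc n)\<^esub>" using DY z by (simp add: D_cls)
  then obtain x' where x': "x' \<in> carrier (K (Suc (Suc n)))" "x = dK (Suc n) x'"
    using K.cls_zero_iff[OF K.cycles_closed[OF x(1)]] by blast
  obtain y where y: "y \<in> carrier (T (Suc (Suc n)))" "p n y = z" "dT (Suc n) y = \<phi> (Suc n) x"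
    using x(2) unfolding rel_def by blast
  \<comment> \<open>The lift \<open>y\<close> and \<open>\<phi> x'\<close> have the same boundary,
    so their difference is a cycle, and \<open>p\<close> does not see the correction.\<close>
  let ?y = "y \<ominus>\<^bsub>T (Suc (Suc n))\<^esub> \<phi> (Suc (Suc n)) x'"
  have "?y \<in> cycles T dT (Suc (Suc n))"
    using y x' by (simp add: T.cycles_Suc T.d.minus \<phi>_chain)
  moreover have "p n ?y = z"
    using y x' T.cycles_closed[OF z(1)] by (simp add: p.minus p_\<phi>)
  ultimately show "\<exists>X\<in>carrier (homology_mod T dT (Suc (Suc n))). Y = S n X"
    using z by (intro bexI[of _ "T.cls (Suc (Suc n)) ?y"]) (auto simp: S.cls T.carrier_homology)
qed

lemma exact_D_I: "exact_at (homology_mod T dT n) (D n)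
    (homology_mod K dK (Suc n)) (I (Suc n)) (homology_mod T dT (Suc n))"
proof (rule exact_atI)
  fix X assume "X \<in> carrier (homology_mod T dT n)"
  then obtain z where z: "z \<in> cycles T dT n" "X = T.cls n z" by (auto simp: T.carrier_homology)
  obtain x where x: "x \<in> cycles K dK (Suc n)" "rel n z x" using rel_total[OF z(1)] by blast
  obtain y where y: "y \<in> carrier (T (Suc (Suc n)))" "dT (Suc n) y = \<phi> (Suc n) x"
    using x(2) unfolding rel_def by blast
  then have "T.cls (Suc n) (\<phi> (Suc n) x) = \<zero>\<^bsub>homology_mod T dT (Suc n)\<^esub>"
    using K.cycles_closed[OF x(1)] by (subst T.cls_zero_iff) (auto intro!: bexI[of _ y])
  then show "D n X \<in> carrier (homology_mod K dK (Suc n)) \<and> I (Suc n) (D n X) = \<zero>\<^bsub>homology_mod T dT (Suc n)\<^esub>"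
    using x z by (simp add: D_cls I.cls K.carrier_homology)
next
  fix Y assume "Y \<in> carrier (homology_mod K dK (Suc n))" and IY: "I (Suc n) Y = \<zero>\<^bsub>homology_mod T dT (Suc n)\<^esub>"
  then obtain x where x: "x \<in> cycles K dK (Suc n)" "Y = K.cls (Suc n) x" by (auto simp: K.carrier_homology)
  note xc = K.cycles_closed[OF x(1)]
  obtain y where y: "y \<in> carrier (T (Suc (Suc n)))" "\<phi> (Suc n) x = dT (Suc n) y"
    using IY x xc by (auto simp: I.cls T.cls_zero_iff)
  \<comment> \<open>The boundary of \<open>y\<close> lies in the image of \<open>\<phi>\<close>,
    which \<open>p\<close> kills. In degree 0 every chain is a cycle.\<close>
  have "p n y \<in> cycles T dT n"
  proof (cases n)
    case 0
    then show ?thesis using y by (simp add: T.cycles_0)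
  next
    case (Suc m)
    have "dT m (p n y) = p m (dT (Suc n) y)" using p_chain[of y m] y Suc by simp
    also have "\<dots> = \<zero>\<^bsub>T m\<^esub>" using p_\<phi>[of x m] xc Suc y(2) by simp
    finally show ?thesis using y Suc by (simp add: T.cycles_Suc)
  qed
  moreover have "rel n (p n y) x" using y by (auto simp: rel_def)
  ultimately show "\<exists>X\<in>carrier (homology_mod T dT n). Y = D n X"
    using x by (intro bexI[of _ "T.cls n (p n y)"]) (auto simp: D_cls T.carrier_homology)
qed

text \<open>Below degree 2 the side condition of \<open>quasi_surj\<close> is void.\<close>

lemma I_surj:
  assumes "n < 2"
  shows "I n ` carrier (homology_mod K dK n) = carrier (homology_mod T dT n)"
proof (intro subset_antisym subsetI)
  fix Y assume "Y \<in> I n ` carrier (homology_mod K dK n)"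
  then show "Y \<in> carrier (homology_mod T dT n)" using mod_hom_closed[OF I.hom] by blast
next
  fix Y assume "Y \<in> carrier (homology_mod T dT n)"
  then obtain z where z: "z \<in> cycles T dT n" "Y = T.cls n z" by (auto simp: T.carrier_homology)
  obtain x y where x: "x \<in> cycles K dK n" and y: "y \<in> carrier (T (Suc n))" and e: "z = \<phi> n x \<oplus>\<^bsub>T n\<^esub> dT n y"
    using quasi_surj[OF z(1)] assms by auto
  have xc: "\<phi> n x \<in> carrier (T n)" using K.cycles_closed[OF x] by simp
  have "z \<ominus>\<^bsub>T n\<^esub> \<phi> n x = dT n y"
    using e xc y T.cycles_closed[OF z(1)] by (subst T.C.minus_eq_iff) (auto simp: T.C.a_comm)
  then have "Y = T.cls n (\<phi> n x)"
    unfolding z(2) using xc y T.cycles_closed[OF z(1)] by (subst T.cls_eq_iff) auto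
  then have "Y = I n (K.cls n x)" using x by (simp add: I.cls)
  then show "Y \<in> I n ` carrier (homology_mod K dK n)" using x by (simp add: K.carrier_homology)
qed

text \<open>In degree 0 the side condition of \<open>quasi_inj\<close> is void, since it concerns a
  chain of degree 1, where \<open>p\<close> is not defined.\<close>

lemma I_0_inj: "a_kernel (homology_mod K dK 0) (homology_mod T dT 0) (I 0) = {\<zero>\<^bsub>homology_mod K dK 0\<^esub>}"
proof -
  interpret HI: linear_map R "homology_mod K dK 0" "homology_mod T dT 0" "I 0"
    by (intro linear_mapI K.homology_module T.homology_module I.hom)
  have "X = \<zero>\<^bsub>homology_mod K dK 0\<^esub>"
    if X: "X \<in> carrier (homology_mod K dK 0)" and IX: "I 0 X = \<zero>\<^bsub>homology_mod T dT 0\<^esub>" for X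
  proof -
    obtain x where x: "x \<in> cycles K dK 0" "X = K.cls 0 x" using X by (auto simp: K.carrier_homology)
    note xc = K.cycles_closed[OF x(1)]
    obtain y where y: "y \<in> carrier (T (Suc 0))" "\<phi> 0 x = dT 0 y"
      using IX x xc by (auto simp: I.cls T.cls_zero_iff)
    have "\<exists>x'\<in>carrier (K (Suc 0)). x = dK 0 x'"
      using y xc by (intro quasi_inj[of _ _ y]) auto
    then show ?thesis unfolding x(2) using xc by (simp add: K.cls_zero_iff)
  qed
  then show ?thesis by (auto simp: a_kernel_def kernel_def)
qed

theorem periodicity_exact:
  "periodicity_sequence_exact R (homology_mod K dK) (homology_mod T dT) I S D"
  unfolding periodicity_sequence_exact_def
  using I.hom S.hom D_hom exact_I_S exact_S_D exact_D_I I_surj[of 0] I_surj[of 1] I_0_inj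
  by simp

end

section \<open>Operations on words\<close>

definition rot :: "'a list \<Rightarrow> 'a list"
  where "rot w = last w # butlast w"

text \<open>The last face merges the last letter into the first, so it is face 0 of the rotated
  word. With all faces in one family the simplicial identities have a single statement.\<close>

definition wface :: "('a, 'm) ring_scheme \<Rightarrow> nat \<Rightarrow> 'a list \<Rightarrow> 'a list"
  where "wface B j w = (if Suc j < length w then contract B j w else contract B 0 (rot w))"

definition ins :: "('a, 'm) ring_scheme \<Rightarrow> nat \<Rightarrow> 'a list \<Rightarrow> 'a list"
  where "ins B i w = take i w @ \<one>\<^bsub>B\<^esub> # drop i w"

definition slot :: "nat \<Rightarrow> ('a \<Rightarrow> 'a) \<Rightarrow> 'a list \<Rightarrow> 'a list"
  where "slot i f w = w[i := f (w ! i)]"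

lemma length_contract: "length w = Suc (Suc n) \<Longrightarrow> i \<le> n \<Longrightarrow> length (contract B i w) = Suc n"
  by (simp add: contract_def)

lemma nth_contract:
  assumes "length w = Suc (Suc n)" "i \<le> n" "k \<le> n"
  shows "contract B i w ! k =
    (if k < i then w ! k else if k = i then w ! i \<otimes>\<^bsub>B\<^esub> w ! Suc i else w ! Suc k)"
proof -
  have "k - i - Suc 0 + (i + 2) = Suc k" if "k > i" using that by simp
  then show ?thesis
    using assms by (auto simp: contract_def nth_append nth_Cons' min_def)
qed

lemma nth_rot:
  assumes "length w = Suc n" "k \<le> n"
  shows "rot w ! k = (if k = 0 then w ! n else w ! (k - 1))"
proof -
  have "w \<noteq> []" using assms by auto
  then show ?thesis using assms by (auto simp: rot_def nth_Cons' last_conv_nth nth_butlast)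
qed

lemma length_wface: "length w = Suc (Suc n) \<Longrightarrow> length (wface B j w) = Suc n"
  by (auto simp: wface_def intro!: length_contract simp: rot_def)

lemma nth_wface:
  assumes "length w = Suc (Suc n)" "k \<le> n"
  shows "wface B j w ! k =
    (if j \<le> n then (if k < j then w ! k else if k = j then w ! j \<otimes>\<^bsub>B\<^esub> w ! Suc j else w ! Suc k)
     else if k = 0 then w ! Suc n \<otimes>\<^bsub>B\<^esub> w ! 0 else w ! k)"
proof -
  have "length (rot w) = Suc (Suc n)" using assms by (auto simp: rot_def)
  then show ?thesis
    using assms by (auto simp: wface_def nth_contract nth_rot)
qed

lemma length_ins: "i \<le> length w \<Longrightarrow> length (ins B i w) = Suc (length w)"
  by (simp add: ins_def)

lemma nth_ins:
  assumes "i \<le> length w" "k \<le> length w"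
  shows "ins B i w ! k = (if k < i then w ! k else if k = i then \<one>\<^bsub>B\<^esub> else w ! (k - 1))"
  using assms by (auto simp: ins_def nth_append nth_Cons' min_def)

lemma length_slot [simp]: "length (slot i f w) = length w"
  by (simp add: slot_def)

lemma nth_slot: "k < length w \<Longrightarrow> slot i f w ! k = (if k = i then f (w ! k) else w ! k)"
  by (simp add: slot_def nth_list_update)

lemma (in module) word_map_slot:
  assumes "f \<in> mod_hom R M M"
  shows "word_map R M m M m (slot i f)"
proof (rule word_mapI[where j = "\<lambda>_ k. k" and L = "\<lambda>_ k. if k = i then f else (\<lambda>x. x)"])
  fix xs assume xs: "xs \<in> tuples M m"
  show "slot i f xs \<in> tuples M m"
    using mod_hom_closed[OF assms] tuples_length[OF xs] tuples_nth[OF xs]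
    by (intro tuplesI) (auto simp: nth_slot)
  fix k assume k: "k < m"
  have "slot i f (xs[k := x]) = (slot i f xs)[k := (if k = i then f else (\<lambda>x. x)) x]" for x
    using tuples_length[OF xs] k by (intro nth_equalityI) (auto simp: nth_slot nth_list_update)
  then show "k < m \<and> (if k = i then f else (\<lambda>x. x)) \<in> mod_hom R M M \<and>
      (\<forall>x\<in>carrier M. slot i f (xs[k := x]) = (slot i f xs)[k := (if k = i then f else (\<lambda>x. x)) x])"
    using k assms mod_hom_id by auto
qed

lemma word_map_rot: "word_map R M (Suc n) M (Suc n) rot"
proof (rule word_mapI[where j = "\<lambda>_ k. if k = n then 0 else Suc k" and L = "\<lambda>_ _ x. x"])
  fix xs assume xs: "xs \<in> tuples M (Suc n)"
  have len: "length (rot xs) = Suc n" using tuples_length[OF xs] by (simp add: rot_def)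
  show "rot xs \<in> tuples M (Suc n)"
    using len tuples_length[OF xs] tuples_nth[OF xs]
    by (intro tuplesI) (auto simp: nth_rot)
  fix k assume k: "k < Suc n"
  have "rot (xs[k := x]) = (rot xs)[(if k = n then 0 else Suc k) := x]" for x
  proof (rule nth_equalityI)
    have "length (rot (xs[k := x])) = Suc n" using tuples_length[OF xs] by (simp add: rot_def)
    then show "length (rot (xs[k := x])) = length ((rot xs)[(if k = n then 0 else Suc k) := x])"
      using len by simp
    fix l assume "l < length (rot (xs[k := x]))"
    then show "rot (xs[k := x]) ! l = (rot xs)[(if k = n then 0 else Suc k) := x] ! l"
      using len tuples_length[OF xs] k \<open>length (rot (xs[k := x])) = Suc n\<close>
      by (auto simp: nth_rot[of _ n] nth_list_update)
  qed
  then show "(if k = n then 0 else Suc k) < Suc n \<and> (\<lambda>x. x) \<in> mod_hom R M M \<and>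
      (\<forall>x\<in>carrier M. rot (xs[k := x]) = (rot xs)[(if k = n then 0 else Suc k) := x])"
    using k mod_hom_id by auto
qed

section \<open>Word operations in an associative algebra and their simplicial identities\<close>

context assoc_algebra
begin

lemma mult_left_hom: "x \<in> carrier M \<Longrightarrow> (\<lambda>y. x \<otimes>\<^bsub>M\<^esub> y) \<in> mod_hom R M M"
  by (intro mod_homI) (auto simp: r_distr smult_mult_right)

lemma mult_right_hom: "x \<in> carrier M \<Longrightarrow> (\<lambda>y. y \<otimes>\<^bsub>M\<^esub> x) \<in> mod_hom R M M"
  by (intro mod_homI) (auto simp: l_distr smult_mult_left)

lemma word_map_contract:
  assumes "p \<le> n"
  shows "word_map R M (Suc (Suc n)) M (Suc n) (contract M p)"
proof (rule word_mapI[where j = "\<lambda>_ k. if k \<le> p then k else k - 1" and L = "\<lambda>xs k.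
      if k = p then (\<lambda>x. x \<otimes>\<^bsub>M\<^esub> xs ! Suc p) else if k = Suc p then (\<lambda>x. xs ! p \<otimes>\<^bsub>M\<^esub> x) else (\<lambda>x. x)"])
  fix xs assume xs: "xs \<in> tuples M (Suc (Suc n))"
  note len = length_contract[where B = M, OF tuples_length[OF xs] assms]
  show "contract M p xs \<in> tuples M (Suc n)"
    using len tuples_length[OF xs] tuples_nth[OF xs] assms
    by (intro tuplesI) (auto simp: nth_contract)
  fix k assume k: "k < Suc (Suc n)"
  let ?L = "if k = p then (\<lambda>x. x \<otimes>\<^bsub>M\<^esub> xs ! Suc p) else if k = Suc p then (\<lambda>x. xs ! p \<otimes>\<^bsub>M\<^esub> x) else (\<lambda>x. x)"
  have "contract M p (xs[k := x]) = (contract M p xs)[(if k \<le> p then k else k - 1) := ?L x]" for x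
  proof (rule nth_equalityI)
    have len': "length (xs[k := x]) = Suc (Suc n)" using tuples_length[OF xs] by simp
    show "length (contract M p (xs[k := x])) = length ((contract M p xs)[(if k \<le> p then k else k - 1) := ?L x])"
      using len length_contract[where B = M, OF len' assms] by simp
    fix l assume "l < length (contract M p (xs[k := x]))"
    then have l: "l \<le> n" using length_contract[where B = M, OF len' assms] by simp
    show "contract M p (xs[k := x]) ! l = (contract M p xs)[(if k \<le> p then k else k - 1) := ?L x] ! l"
      using l k assms len tuples_length[OF xs]
      by (auto simp: nth_contract[OF len' assms l] nth_contract[OF tuples_length[OF xs] assms] nth_list_update)
  qed
  moreover have "?L \<in> mod_hom R M M"
    using mult_left_hom mult_right_hom mod_hom_id tuples_nth[OF xs] assms by auto
  ultimately show "(if k \<le> p then k else k - 1) < Suc n \<and> ?L \<in> mod_hom R M M \<and>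
      (\<forall>x\<in>carrier M. contract M p (xs[k := x]) = (contract M p xs)[(if k \<le> p then k else k - 1) := ?L x])"
    using k assms by auto
qed

lemma word_map_cong:
  assumes "word_map R M m N n f" "\<And>xs. xs \<in> tuples M m \<Longrightarrow> g xs = f xs"
  shows "word_map R M m N n g"
  using assms tuples_update[of _ M m] by (auto simp: word_map_def Pi_def)

lemma word_map_wface: "word_map R M (Suc (Suc n)) M (Suc n) (wface M j)"
proof (cases "j \<le> n")
  case True
  then show ?thesis
    by (rule word_map_cong[OF word_map_contract]) (use True in \<open>simp add: wface_def tuples_length\<close>)
next
  case False
  then show ?thesis
    by (intro word_map_cong[OF word_map_comp[OF word_map_rot word_map_contract[of 0]]])
      (use False in \<open>simp_all add: wface_def tuples_length\<close>)
qed

lemma word_map_ins: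
  assumes "i \<le> m"
  shows "word_map R M m M (Suc m) (ins M i)"
proof (rule word_mapI[where j = "\<lambda>_ k. if k < i then k else Suc k" and L = "\<lambda>_ _ x. x"])
  fix xs assume xs: "xs \<in> tuples M m"
  show "ins M i xs \<in> tuples M (Suc m)"
    using tuples_length[OF xs] tuples_nth[OF xs] assms
    by (intro tuplesI) (auto simp: nth_ins length_ins)
  fix k assume k: "k < m"
  have "ins M i (xs[k := x]) = (ins M i xs)[(if k < i then k else Suc k) := x]" for x
    using tuples_length[OF xs] k assms
    by (intro nth_equalityI) (auto simp: nth_ins length_ins nth_list_update)
  then show "(if k < i then k else Suc k) < Suc m \<and> (\<lambda>x. x) \<in> mod_hom R M M \<and>
      (\<forall>x\<in>carrier M. ins M i (xs[k := x]) = (ins M i xs)[(if k < i then k else Suc k) := x])"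
    using k mod_hom_id by auto
qed

lemma wface_wface:
  assumes w: "w \<in> tuples M (Suc (Suc (Suc n)))" and ij: "i < j" "j \<le> Suc (Suc n)"
  shows "wface M i (wface M j w) = wface M (j - 1) (wface M i w)"
proof (rule nth_equalityI)
  note len = tuples_length[OF w]
  note nth = tuples_nth[OF w]
  note lf = length_wface[where B = M, OF len]
  show "length (wface M i (wface M j w)) = length (wface M (j - 1) (wface M i w))"
    by (simp add: length_wface[where B = M, OF lf])
  fix k assume "k < length (wface M i (wface M j w))"
  then have k: "k \<le> n" by (simp add: length_wface[where B = M, OF lf])
  show "wface M i (wface M j w) ! k = wface M (j - 1) (wface M i w) ! k"
  proof -
    \<comment> \<open>Letters are compared position by position. Associativity enters where both
      faces meet in one letter, which also happens around the end of the word.\<close>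
    consider "j = Suc i" "i \<le> n" | "Suc i < j" "i \<le> n" | "i = Suc n" "j = Suc (Suc n)"
      using ij by linarith
    then show ?thesis
      unfolding nth_wface[OF lf k]
      by cases (use k ij nth in \<open>auto simp: nth_wface[OF len] m_assoc\<close>)
  qed
qed

lemma wface_rot:
  assumes w: "length w = Suc (Suc n)" and i: "i \<le> n"
  shows "wface M (Suc i) (rot w) = rot (wface M i w)"
proof (rule nth_equalityI)
  have lr: "length (rot w) = Suc (Suc n)" using w by (simp add: rot_def)
  note lf = length_wface[where B = M, OF w] length_wface[where B = M, OF lr]
  have lrf: "length (rot (wface M i w)) = Suc n" using lf(1) by (simp add: rot_def)
  show "length (wface M (Suc i) (rot w)) = length (rot (wface M i w))"
    using lf lrf by simp
  fix k assume "k < length (wface M (Suc i) (rot w))"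
  then have k: "k \<le> n" using lf by simp
  show "wface M (Suc i) (rot w) ! k = rot (wface M i w) ! k"
    unfolding nth_wface[OF lr k] nth_rot[OF lf(1) k] using k i
    by (cases "i = n") (auto simp: nth_wface[OF w] nth_rot[OF w])
qed

lemma wface_0_rot:
  assumes w: "length w = Suc (Suc n)"
  shows "wface M 0 (rot w) = wface M (Suc n) w"
  using w by (simp add: wface_def rot_def)

lemma wface_ins_0: "w \<in> tuples M (Suc n) \<Longrightarrow> wface M 0 (ins M 0 w) = w"
proof (rule nth_equalityI)
  assume w: "w \<in> tuples M (Suc n)"
  have li: "length (ins M 0 w) = Suc (Suc n)" using tuples_length[OF w] by (simp add: length_ins)
  show "length (wface M 0 (ins M 0 w)) = length w" using length_wface[where B = M, OF li] tuples_length[OF w] by simp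
  fix k assume "k < length (wface M 0 (ins M 0 w))"
  then have k: "k \<le> n" by (simp add: length_wface[where B = M, OF li])
  show "wface M 0 (ins M 0 w) ! k = w ! k"
    unfolding nth_wface[OF li k] using k tuples_length[OF w] tuples_nth[OF w] by (auto simp: nth_ins)
qed

lemma wface_Suc_ins_0:
  assumes w: "w \<in> tuples M (Suc (Suc n))" and i: "i \<le> n"
  shows "wface M (Suc i) (ins M 0 w) = ins M 0 (wface M i w)"
proof (rule nth_equalityI)
  note len = tuples_length[OF w]
  have li: "length (ins M 0 w) = Suc (Suc (Suc n))" using len by (simp add: length_ins)
  note lf = length_wface[where B = M, OF len]
  show "length (wface M (Suc i) (ins M 0 w)) = length (ins M 0 (wface M i w))"
    using length_wface[where B = M, OF li] lf by (simp add: length_ins)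
  fix k assume "k < length (wface M (Suc i) (ins M 0 w))"
  then have k: "k \<le> Suc n" by (simp add: length_wface[where B = M, OF li])
  show "wface M (Suc i) (ins M 0 w) ! k = ins M 0 (wface M i w) ! k"
    unfolding nth_wface[OF li k] using k i len lf by (auto simp: nth_ins nth_wface[OF len])
qed

lemma wface_ins_same:
  assumes w: "w \<in> tuples M (Suc n)" and i: "i \<le> n" and j: "j = i \<or> j = Suc i"
  shows "wface M j (ins M (Suc i) w) = w"
proof (rule nth_equalityI)
  note len = tuples_length[OF w]
  note nth = tuples_nth[OF w]
  have li: "length (ins M (Suc i) w) = Suc (Suc n)" using len i by (simp add: length_ins)
  show "length (wface M j (ins M (Suc i) w)) = length w" using length_wface[where B = M, OF li] len by simp
  fix k assume "k < length (wface M j (ins M (Suc i) w))"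
  then have k: "k \<le> n" by (simp add: length_wface[where B = M, OF li])
  show "wface M j (ins M (Suc i) w) ! k = w ! k"
    unfolding nth_wface[OF li k] using k i j len nth by (auto simp: nth_ins)
qed

lemma wface_ins_less:
  assumes w: "w \<in> tuples M (Suc (Suc n))" and i: "i \<le> Suc n" "j < i"
  shows "wface M j (ins M (Suc i) w) = ins M i (wface M j w)"
proof (rule nth_equalityI)
  note len = tuples_length[OF w]
  note nth = tuples_nth[OF w]
  note lf = length_wface[where B = M, OF len]
  have li: "length (ins M (Suc i) w) = Suc (Suc (Suc n))" using len i by (simp add: length_ins)
  show "length (wface M j (ins M (Suc i) w)) = length (ins M i (wface M j w))"
    using length_wface[where B = M, OF li] lf i by (simp add: length_ins)
  fix k assume "k < length (wface M j (ins M (Suc i) w))"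
  then have k: "k \<le> Suc n" by (simp add: length_wface[where B = M, OF li])
  show "wface M j (ins M (Suc i) w) ! k = ins M i (wface M j w) ! k"
    unfolding nth_wface[OF li k] using k i len nth lf by (auto simp: nth_ins nth_wface[OF len])
qed

lemma wface_ins_greater:
  assumes w: "w \<in> tuples M (Suc (Suc n))" and i: "Suc i < j" "j \<le> Suc (Suc n)"
  shows "wface M j (ins M (Suc i) w) = ins M (Suc i) (wface M (j - 1) w)"
proof (rule nth_equalityI)
  note len = tuples_length[OF w]
  note nth = tuples_nth[OF w]
  note lf = length_wface[where B = M, OF len]
  have li: "length (ins M (Suc i) w) = Suc (Suc (Suc n))" using len i by (simp add: length_ins)
  show "length (wface M j (ins M (Suc i) w)) = length (ins M (Suc i) (wface M (j - 1) w))"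
    using length_wface[where B = M, OF li] lf i by (simp add: length_ins)
  fix k assume "k < length (wface M j (ins M (Suc i) w))"
  then have k: "k \<le> Suc n" by (simp add: length_wface[where B = M, OF li])
  show "wface M j (ins M (Suc i) w) ! k = ins M (Suc i) (wface M (j - 1) w) ! k"
    unfolding nth_wface[OF li k] using k i len nth lf by (auto simp: nth_ins nth_wface[OF len])
qed

end

text \<open>For the induction the claim is generalised to \<open>xs @ ys\<close>: turning
  \<open>length ys\<close> times brings \<open>ys\<close> to the front. The lemma is the case of
  empty \<open>xs\<close>.\<close>

lemma rot_rotate: "length w = Suc n \<Longrightarrow> (rot ^^ Suc n) w = w"
proof -
  have *: "(rot ^^ length ys) (xs @ ys) = ys @ xs" for xs ys :: "'a list"
  proof (induction ys arbitrary: xs rule: rev_induct)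
    case (snoc y ys)
    have "(rot ^^ length (ys @ [y])) (xs @ ys @ [y]) = (rot ^^ length ys) (rot (xs @ ys @ [y]))"
      by (simp add: funpow_Suc_right del: funpow.simps)
    also have "rot (xs @ ys @ [y]) = (y # xs) @ ys" by (simp add: rot_def butlast_append)
    finally show ?case using snoc[of "y # xs"] by simp
  qed simp
  assume "length w = Suc n"
  then show ?thesis using *[of w "[]"] by simp
qed

text \<open>The action of the \<open>i\<close>-th factor of \<open>G\<^bsup>n+1\<^esup>\<close> on words of length \<open>n + 1\<close>:
  \<open>(\<dots>, w\<^sub>i, w\<^sub>i\<^sub>+\<^sub>1, \<dots>)\<close> goes to \<open>(\<dots>, w\<^sub>i u, v w\<^sub>i\<^sub>+\<^sub>1, \<dots>)\<close>, indices being cyclic, where \<open>v = u\<inverse>\<close>.\<close>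

definition wact :: "('a, 'm) ring_scheme \<Rightarrow> nat \<Rightarrow> 'a \<Rightarrow> 'a \<Rightarrow> 'a list \<Rightarrow> 'a list"
  where "wact B i u v w = slot (Suc i mod length w) (\<lambda>x. v \<otimes>\<^bsub>B\<^esub> x) (slot i (\<lambda>x. x \<otimes>\<^bsub>B\<^esub> u) w)"

lemma length_wact [simp]: "length (wact B i u v w) = length w"
  by (simp add: wact_def)

lemma nth_wact:
  assumes "length w = Suc n" "k \<le> n" "i \<le> n"
  shows "wact B i u v w ! k = (let x = if k = i then w ! k \<otimes>\<^bsub>B\<^esub> u else w ! k in
    if k = (if i = n then 0 else Suc i) then v \<otimes>\<^bsub>B\<^esub> x else x)"
  using assms by (auto simp: wact_def nth_slot Let_def)

context assoc_algebra
begin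

lemma word_map_wact:
  assumes "u \<in> carrier M" "v \<in> carrier M"
  shows "word_map R M m M m (wact M i u v)"
  by (rule word_map_cong[OF word_map_comp[OF word_map_slot[OF mult_right_hom[OF assms(1)], where i = i]
        word_map_slot[OF mult_left_hom[OF assms(2)], where i = "Suc i mod m"]]])
    (simp add: wact_def tuples_length)

text \<open>Factor \<open>l\<close> of the group acts on the gap between letters \<open>l\<close>
  and \<open>l + 1\<close>, taken cyclically, and face \<open>j\<close> closes gap \<open>j\<close>.
  A gap to the left of the closed one keeps its number; one to the right, in
  \<open>wface_wact_greater\<close>, moves down by one.\<close>

lemma wface_wact_less:
  assumes w: "w \<in> tuples M (Suc (Suc n))" and u: "u \<in> carrier M" "v \<in> carrier M" and l: "l < j" "j \<le> Suc n"
  shows "wface M j (wact M l u v w) = wact M l u v (wface M j w)"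
proof (rule nth_equalityI)
  note len = tuples_length[OF w]
  note nth = tuples_nth[OF w]
  note lf = length_wface[where B = M, OF len]
  have la: "length (wact M l u v w) = Suc (Suc n)" using len by simp
  show "length (wface M j (wact M l u v w)) = length (wact M l u v (wface M j w))"
    using length_wface[where B = M, OF la] lf by simp
  fix k assume "k < length (wface M j (wact M l u v w))"
  then have k: "k \<le> n" by (simp add: length_wface[where B = M, OF la])
  have l': "l \<le> n" using l by simp
  show "wface M j (wact M l u v w) ! k = wact M l u v (wface M j w) ! k"
    unfolding nth_wface[OF la k] nth_wact[OF lf k l'] using k l nth u
    by (auto simp: nth_wact[OF len] nth_wface[OF len] m_assoc Let_def)
qed

text \<open>Closing the gap brings \<open>u\<close> and \<open>v\<close> together, where they
  cancel.\<close>

lemma wface_wact_same: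
  assumes w: "w \<in> tuples M (Suc (Suc n))" and u: "u \<in> carrier M" "v \<in> carrier M" "u \<otimes>\<^bsub>M\<^esub> v = \<one>\<^bsub>M\<^esub>" and j: "j \<le> n"
  shows "wface M j (wact M j u v w) = wface M j w"
proof (rule nth_equalityI)
  note len = tuples_length[OF w]
  note nth = tuples_nth[OF w]
  note lf = length_wface[where B = M, OF len]
  have la: "length (wact M j u v w) = Suc (Suc n)" using len by simp
  show "length (wface M j (wact M j u v w)) = length (wface M j w)"
    using length_wface[where B = M, OF la] lf by simp
  fix k assume "k < length (wface M j (wact M j u v w))"
  then have k: "k \<le> n" by (simp add: length_wface[where B = M, OF la])
  have "(x \<otimes>\<^bsub>M\<^esub> u) \<otimes>\<^bsub>M\<^esub> (v \<otimes>\<^bsub>M\<^esub> y) = x \<otimes>\<^bsub>M\<^esub> y" if "x \<in> carrier M" "y \<in> carrier M" for x y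
  proof -
    have "(x \<otimes>\<^bsub>M\<^esub> u) \<otimes>\<^bsub>M\<^esub> (v \<otimes>\<^bsub>M\<^esub> y) = x \<otimes>\<^bsub>M\<^esub> (u \<otimes>\<^bsub>M\<^esub> v) \<otimes>\<^bsub>M\<^esub> y"
      using that u(1,2) by (simp only: m_assoc m_closed)
    then show ?thesis using that u by simp
  qed
  then show "wface M j (wact M j u v w) ! k = wface M j w ! k"
    unfolding nth_wface[OF la k] nth_wface[OF len k] using k j nth
    by (auto simp: nth_wact[OF len] Let_def)
qed

lemma wface_wact_greater:
  assumes w: "w \<in> tuples M (Suc (Suc n))" and u: "u \<in> carrier M" "v \<in> carrier M" and l: "j < l" "l \<le> n"
  shows "wface M j (wact M l u v w) = wact M (l - 1) u v (wface M j w)"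
proof (rule nth_equalityI)
  note len = tuples_length[OF w]
  note nth = tuples_nth[OF w]
  note lf = length_wface[where B = M, OF len]
  have la: "length (wact M l u v w) = Suc (Suc n)" using len by simp
  show "length (wface M j (wact M l u v w)) = length (wact M (l - 1) u v (wface M j w))"
    using length_wface[where B = M, OF la] lf by simp
  fix k assume "k < length (wface M j (wact M l u v w))"
  then have k: "k \<le> n" by (simp add: length_wface[where B = M, OF la])
  have l': "l - 1 \<le> n" using l by simp
  show "wface M j (wact M l u v w) ! k = wact M (l - 1) u v (wface M j w) ! k"
    unfolding nth_wface[OF la k] nth_wact[OF lf k l'] using k l nth u
    by (auto simp: nth_wact[OF len] nth_wface[OF len] m_assoc Let_def)
qed

text \<open>A letter touched by two different gaps is multiplied on opposite sides, so associativity
  is enough.\<close>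

lemma wact_commute:
  assumes w: "w \<in> tuples M (Suc n)" and u: "u \<in> carrier M" "v \<in> carrier M" "u' \<in> carrier M" "v' \<in> carrier M"
    and i: "i \<noteq> j" "i \<le> n" "j \<le> n"
  shows "wact M i u v (wact M j u' v' w) = wact M j u' v' (wact M i u v w)"
proof (rule nth_equalityI)
  note len = tuples_length[OF w]
  note nth = tuples_nth[OF w]
  have la: "length (wact M j u' v' w) = Suc n" "length (wact M i u v w) = Suc n" using len by auto
  show "length (wact M i u v (wact M j u' v' w)) = length (wact M j u' v' (wact M i u v w))" by simp
  fix k assume "k < length (wact M i u v (wact M j u' v' w))"
  then have k: "k \<le> n" using len by simp
  show "wact M i u v (wact M j u' v' w) ! k = wact M j u' v' (wact M i u v w) ! k"
    unfolding nth_wact[OF la(1) k i(2)] nth_wact[OF la(2) k i(3)] nth_wact[OF len k i(2)] nth_wact[OF len k i(3)]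
    using k i u nth[of k] by (auto simp: m_assoc Let_def)
qed

lemma wact_wact:
  assumes w: "w \<in> tuples M (Suc n)" and u: "u \<in> carrier M" "v \<in> carrier M" "u' \<in> carrier M" "v' \<in> carrier M"
    and i: "i \<le> n"
  shows "wact M i u v (wact M i u' v' w) = wact M i (u' \<otimes>\<^bsub>M\<^esub> u) (v \<otimes>\<^bsub>M\<^esub> v') w"
proof (rule nth_equalityI)
  note len = tuples_length[OF w]
  note nth = tuples_nth[OF w]
  have la: "length (wact M i u' v' w) = Suc n" using len by auto
  show "length (wact M i u v (wact M i u' v' w)) = length (wact M i (u' \<otimes>\<^bsub>M\<^esub> u) (v \<otimes>\<^bsub>M\<^esub> v') w)" by simp
  fix k assume "k < length (wact M i u v (wact M i u' v' w))"
  then have k: "k \<le> n" using len by simp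
  show "wact M i u v (wact M i u' v' w) ! k = wact M i (u' \<otimes>\<^bsub>M\<^esub> u) (v \<otimes>\<^bsub>M\<^esub> v') w ! k"
    unfolding nth_wact[OF la k i] nth_wact[OF len k i]
    using k i u nth[of k] by (auto simp: m_assoc Let_def)
qed

end

section \<open>Operators on Hochschild chains\<close>

lemma (in module) finsum_Suc_top:
  "f \<in> {..Suc n} \<rightarrow> carrier M \<Longrightarrow> (\<Oplus>\<^bsub>M\<^esub>i\<in>{..Suc n}. f i) = (\<Oplus>\<^bsub>M\<^esub>i\<in>{..n}. f i) \<oplus>\<^bsub>M\<^esub> f (Suc n)"
  by (subst M.finsum_Suc) (auto intro!: M.a_comm M.finsum_closed)

lemma (in module) finsum_Suc_bot:
  "f \<in> {..Suc n} \<rightarrow> carrier M \<Longrightarrow> (\<Oplus>\<^bsub>M\<^esub>i\<in>{..Suc n}. f i) = f 0 \<oplus>\<^bsub>M\<^esub> (\<Oplus>\<^bsub>M\<^esub>i\<in>{..n}. f (Suc i))"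
  by (subst M.finsum_Suc2) (auto intro!: M.a_comm M.finsum_closed)

text \<open>The term at \<open>(i, j)\<close> with \<open>i < j\<close> is opposite in sign to the
  one at \<open>(j - 1, i)\<close>, and this pairing is a bijection between the halves
  \<open>U\<close> and \<open>L\<close> of the index set. Arbitrary \<open>m\<close> serves
  \<open>b\<close> and \<open>b'\<close> alike.\<close>

lemma (in module) simplicial_sum_zero:
  assumes z: "\<And>i j. i \<le> m \<Longrightarrow> j \<le> Suc m \<Longrightarrow> z i j \<in> carrier M"
    and sym: "\<And>i j. i < j \<Longrightarrow> j \<le> Suc m \<Longrightarrow> z i j = z (j - 1) i"
  shows "(\<Oplus>\<^bsub>M\<^esub>i\<in>{..m}. \<Oplus>\<^bsub>M\<^esub>j\<in>{..Suc m}. signed M (i + j) (z i j)) = \<zero>\<^bsub>M\<^esub>"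
proof -
  define f where "f p = signed M (fst p + snd p) (z (fst p) (snd p))" for p
  define L where "L = {p \<in> {..m} \<times> {..Suc m}. snd p \<le> fst p}"
  define U where "U = {p \<in> {..m} \<times> {..Suc m}. fst p < snd p}"
  have fin: "finite L" "finite U" by (auto simp: L_def U_def)
  have f: "f p \<in> carrier M" if "p \<in> {..m} \<times> {..Suc m}" for p
    using that z by (auto simp: f_def)
  have fL: "f \<in> L \<rightarrow> carrier M" and fU: "f \<in> U \<rightarrow> carrier M"
    using f by (auto simp: L_def U_def)
  have "(\<Oplus>\<^bsub>M\<^esub>i\<in>{..m}. \<Oplus>\<^bsub>M\<^esub>j\<in>{..Suc m}. signed M (i + j) (z i j)) = (\<Oplus>\<^bsub>M\<^esub>p\<in>{..m} \<times> {..Suc m}. f p)"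
    using finsum_prod[of "{..m}" "{..Suc m}" f, OF _ _ Pi_I[OF f]] by (simp add: f_def)
  also have "{..m} \<times> {..Suc m} = L \<union> U" by (auto simp: L_def U_def)
  also have "(\<Oplus>\<^bsub>M\<^esub>p\<in>L \<union> U. f p) = (\<Oplus>\<^bsub>M\<^esub>p\<in>L. f p) \<oplus>\<^bsub>M\<^esub> (\<Oplus>\<^bsub>M\<^esub>p\<in>U. f p)"
    using fin fL fU by (intro M.finsum_Un_disjoint) (auto simp: L_def U_def)
  also have "(\<Oplus>\<^bsub>M\<^esub>p\<in>U. f p) = (\<Oplus>\<^bsub>M\<^esub>p\<in>L. \<ominus>\<^bsub>M\<^esub> f p)"
  proof (rule finsum_bij[where h = "\<lambda>p. (snd p - 1, fst p)"])
    show "bij_betw (\<lambda>p. (snd p - 1, fst p)) U L"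
      by (rule bij_betw_byWitness[where f' = "\<lambda>p. (snd p, Suc (fst p))"]) (auto simp: L_def U_def)
    show "(\<lambda>p. \<ominus>\<^bsub>M\<^esub> f p) \<in> L \<rightarrow> carrier M" using fL by auto
    fix p assume p: "p \<in> U"
    then obtain i j where ij: "p = (i, Suc j)" "i \<le> j" "j \<le> m"
      by (cases p; cases "snd p") (auto simp: U_def)
    then show "f p = \<ominus>\<^bsub>M\<^esub> f (snd p - 1, fst p)"
      using sym[of i "Suc j"] z[of j i] by (simp add: f_def signed_Suc add.commute)
  qed
  also have "\<dots> = \<ominus>\<^bsub>M\<^esub> (\<Oplus>\<^bsub>M\<^esub>p\<in>L. f p)" using fL by (simp add: finsum_neg)
  finally show ?thesis using fL by (simp add: M.r_neg)
qed

context assoc_algebra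
begin

abbreviation "C n \<equiv> hoch_mod R M n"
abbreviation "gen n \<equiv> hoch_gen R M n"

lemma hoch_mod_eq: "C n = tensor_power R M (Suc n)"
  by (simp add: hoch_mod_def)

lemma hoch_gen_eq: "gen n = power_tensor R M (Suc n)"
  by (simp add: hoch_gen_def fun_eq_iff)

lemma hoch_module: "module R (C n)"
  unfolding hoch_mod_eq by (rule tensor_power_module)

end

sublocale assoc_algebra \<subseteq> C: module R "hoch_mod R M n" for n
  by (rule hoch_module)

context assoc_algebra
begin

lemma hoch_gen_closed: "w \<in> tuples M (Suc n) \<Longrightarrow> gen n w \<in> carrier (C n)"
  unfolding hoch_mod_eq hoch_gen_eq by (rule power_tensor_closed)

lemma hoch_gen_funcset: "gen n \<in> tuples M (Suc n) \<rightarrow> carrier (C n)"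
  using hoch_gen_closed by blast

lemma hoch_gen_span: "mod_span R (C n) (gen n ` tuples M (Suc n)) = carrier (C n)"
  unfolding hoch_mod_eq hoch_gen_eq by (rule power_tensor_span)

lemma hoch_gen_multilinear: "multilinear R M (Suc n) (C n) (gen n)"
  unfolding hoch_mod_eq hoch_gen_eq by (rule power_tensor_multilinear)

lemma hoch_hom_eq:
  assumes "module R N" "f \<in> mod_hom R (C n) N" "g \<in> mod_hom R (C n) N"
    and "\<And>w. w \<in> tuples M (Suc n) \<Longrightarrow> f (gen n w) = g (gen n w)" "x \<in> carrier (C n)"
  shows "f x = g x"
  by (rule mod_hom_eq_on_gens[OF hoch_module assms(1-3) hoch_gen_funcset hoch_gen_span assms(4,5)])

lemma hoch_lift:
  assumes "module R N" "multilinear R M (Suc n) N v"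
  obtains f where "f \<in> mod_hom R (C n) N" "\<And>w. w \<in> tuples M (Suc n) \<Longrightarrow> f (gen n w) = v w"
  unfolding hoch_mod_eq hoch_gen_eq using tensor_power_lift[OF assms] by blast

lemma hoch_lin_ext:
  assumes "module R N" "multilinear R M (Suc n) N v"
  shows "lin_ext R (C n) N (tuples M (Suc n)) (gen n) v \<in> mod_hom R (C n) N"
    and "\<And>w. w \<in> tuples M (Suc n) \<Longrightarrow> lin_ext R (C n) N (tuples M (Suc n)) (gen n) v (gen n w) = v w"
proof -
  obtain f where f: "f \<in> mod_hom R (C n) N" "\<And>w. w \<in> tuples M (Suc n) \<Longrightarrow> f (gen n w) = v w"
    using hoch_lift[OF assms] by blast
  note L = lin_ext[OF hoch_module assms(1) hoch_gen_funcset hoch_gen_span f(1), where v = v, OF f(2)]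
  show "lin_ext R (C n) N (tuples M (Suc n)) (gen n) v \<in> mod_hom R (C n) N"
    by (rule L(1))
  show "lin_ext R (C n) N (tuples M (Suc n)) (gen n) v (gen n w) = v w" if "w \<in> tuples M (Suc n)" for w
    by (rule L(2)[OF _ that])
qed

definition wop :: "nat \<Rightarrow> nat \<Rightarrow> ('c list \<Rightarrow> 'c list) \<Rightarrow> ('c list \<Rightarrow> 'a) set \<Rightarrow> ('c list \<Rightarrow> 'a) set"
  where "wop n m f = lin_ext R (C n) (C m) (tuples M (Suc n)) (gen n) (\<lambda>w. gen m (f w))"

lemma wop_hom: "word_map R M (Suc n) M (Suc m) f \<Longrightarrow> wop n m f \<in> mod_hom R (C n) (C m)"
  unfolding wop_def
  by (intro hoch_lin_ext(1) hoch_module multilinear_word_map[OF module_axioms _ hoch_gen_multilinear])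

lemma wop_gen: "word_map R M (Suc n) M (Suc m) f \<Longrightarrow> w \<in> tuples M (Suc n) \<Longrightarrow> wop n m f (gen n w) = gen m (f w)"
  unfolding wop_def
  by (intro hoch_lin_ext(2) hoch_module multilinear_word_map[OF module_axioms _ hoch_gen_multilinear])

text \<open>Chains are spanned by words, so an identity between word operations carries over to the
  operators. The two variants below treat a composite that is a single operation or the
  identity.\<close>

lemma wop_comp:
  assumes f: "word_map R M (Suc n) M (Suc m) f" and g: "word_map R M (Suc m) M (Suc l) g"
    and f': "word_map R M (Suc n) M (Suc m') f'" and g': "word_map R M (Suc m') M (Suc l) g'"
    and "\<And>w. w \<in> tuples M (Suc n) \<Longrightarrow> g (f w) = g' (f' w)" and x: "x \<in> carrier (C n)"
  shows "wop m l g (wop n m f x) = wop m' l g' (wop n m' f' x)"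
  by (rule hoch_hom_eq[OF hoch_module mod_hom_comp[OF wop_hom[OF f] wop_hom[OF g]]
        mod_hom_comp[OF wop_hom[OF f'] wop_hom[OF g']] _ x])
    (simp add: wop_gen f g f' g' word_map_closed[OF f] word_map_closed[OF f'] assms(5))

lemma wop_comp1:
  assumes f: "word_map R M (Suc n) M (Suc m) f" and g: "word_map R M (Suc m) M (Suc l) g"
    and h: "word_map R M (Suc n) M (Suc l) h"
    and "\<And>w. w \<in> tuples M (Suc n) \<Longrightarrow> g (f w) = h w" and x: "x \<in> carrier (C n)"
  shows "wop m l g (wop n m f x) = wop n l h x"
  by (rule hoch_hom_eq[OF hoch_module mod_hom_comp[OF wop_hom[OF f] wop_hom[OF g]] wop_hom[OF h] _ x])
    (simp add: wop_gen f g h word_map_closed[OF f] assms(4))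

lemma wop_comp0:
  assumes f: "word_map R M (Suc n) M (Suc m) f" and g: "word_map R M (Suc m) M (Suc n) g"
    and "\<And>w. w \<in> tuples M (Suc n) \<Longrightarrow> g (f w) = w" and x: "x \<in> carrier (C n)"
  shows "wop m n g (wop n m f x) = x"
  by (rule hoch_hom_eq[OF hoch_module mod_hom_comp[OF wop_hom[OF f] wop_hom[OF g]] mod_hom_id _ x])
    (simp add: wop_gen f g word_map_closed[OF f] assms(3))

definition face :: "nat \<Rightarrow> nat \<Rightarrow> ('c list \<Rightarrow> 'a) set \<Rightarrow> ('c list \<Rightarrow> 'a) set"
  where "face n j = wop (Suc n) n (wface M j)"

definition turn :: "nat \<Rightarrow> ('c list \<Rightarrow> 'a) set \<Rightarrow> ('c list \<Rightarrow> 'a) set"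
  where "turn n = wop n n rot"

text \<open>Position 0 is the extra degeneracy, which contracts \<open>b'\<close>; the positions
  behind a letter give the degeneracies used in the averaging homotopy.\<close>

definition degen :: "nat \<Rightarrow> nat \<Rightarrow> ('c list \<Rightarrow> 'a) set \<Rightarrow> ('c list \<Rightarrow> 'a) set"
  where "degen n i = wop n (Suc n) (ins M i)"

lemma word_map_degen: "i \<le> Suc n \<Longrightarrow> word_map R M (Suc n) M (Suc (Suc n)) (ins M i)"
  by (rule word_map_ins)

lemma face_hom: "face n j \<in> mod_hom R (C (Suc n)) (C n)"
  unfolding face_def by (intro wop_hom word_map_wface)

lemma turn_hom: "turn n \<in> mod_hom R (C n) (C n)"
  unfolding turn_def by (intro wop_hom word_map_rot)

lemma degen_hom: "i \<le> Suc n \<Longrightarrow> degen n i \<in> mod_hom R (C n) (C (Suc n))"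
  unfolding degen_def by (intro wop_hom word_map_degen)

end

sublocale assoc_algebra \<subseteq> face: linear_map R "hoch_mod R M (Suc n)" "hoch_mod R M n" "face n j" for n j
  by (intro linear_mapI hoch_module face_hom)

sublocale assoc_algebra \<subseteq> turn: linear_map R "hoch_mod R M n" "hoch_mod R M n" "turn n" for n
  by (intro linear_mapI hoch_module turn_hom)

context assoc_algebra
begin

lemma face_face: "i < j \<Longrightarrow> j \<le> Suc (Suc n) \<Longrightarrow> x \<in> carrier (C (Suc (Suc n))) \<Longrightarrow>
    face n i (face (Suc n) j x) = face n (j - 1) (face (Suc n) i x)"
  unfolding face_def by (rule wop_comp[OF word_map_wface word_map_wface word_map_wface word_map_wface wface_wface])

lemma face_turn: "i \<le> n \<Longrightarrow> x \<in> carrier (C (Suc n)) \<Longrightarrow>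
    face n (Suc i) (turn (Suc n) x) = turn n (face n i x)"
  unfolding face_def turn_def
  by (rule wop_comp[OF word_map_rot word_map_wface word_map_wface word_map_rot wface_rot[OF tuples_length]])

lemma face_0_turn: "x \<in> carrier (C (Suc n)) \<Longrightarrow> face n 0 (turn (Suc n) x) = face n (Suc n) x"
  unfolding face_def turn_def
  by (rule wop_comp1[OF word_map_rot word_map_wface word_map_wface wface_0_rot[OF tuples_length]])

lemma turn_pow_gen: "w \<in> tuples M (Suc n) \<Longrightarrow> (turn n ^^ k) (gen n w) = gen n ((rot ^^ k) w) \<and> (rot ^^ k) w \<in> tuples M (Suc n)"
  by (induction k) (auto simp: turn_def wop_gen[OF word_map_rot] word_map_closed[OF word_map_rot])

lemma turn_pow_hom: "turn n ^^ k \<in> mod_hom R (C n) (C n)"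
proof (induction k)
  case 0
  then show ?case using mod_hom_id by (simp add: id_def)
next
  case (Suc k)
  then show ?case using mod_hom_comp[OF Suc turn_hom] by (simp add: comp_def)
qed

lemma turn_pow: "x \<in> carrier (C n) \<Longrightarrow> (turn n ^^ Suc n) x = x"
  by (rule hoch_hom_eq[OF hoch_module turn_pow_hom mod_hom_id])
    (simp_all only: turn_pow_gen rot_rotate tuples_length)

lemma face_degen_0: "x \<in> carrier (C n) \<Longrightarrow> face n 0 (degen n 0 x) = x"
  unfolding face_def degen_def
  by (rule wop_comp0[OF word_map_degen word_map_wface wface_ins_0]) simp_all

lemma face_Suc_degen_0: "i \<le> n \<Longrightarrow> x \<in> carrier (C (Suc n)) \<Longrightarrow>
    face (Suc n) (Suc i) (degen (Suc n) 0 x) = degen n 0 (face n i x)"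
  unfolding face_def degen_def
  by (rule wop_comp[OF word_map_degen word_map_wface word_map_wface word_map_degen wface_Suc_ins_0]) simp_all

section \<open>The cyclic bicomplex\<close>

lemma wface_contract: "i \<le> n \<Longrightarrow> length w = Suc (Suc n) \<Longrightarrow> wface M i w = contract M i w"
  by (simp add: wface_def)

lemma wface_last:
  assumes "length w = Suc (Suc n)"
  shows "wface M (Suc n) w = (w ! Suc n \<otimes>\<^bsub>M\<^esub> w ! 0) # tl (butlast w)"
proof -
  have "w \<noteq> []" using assms by auto
  then have "last w = w ! Suc n" using assms by (simp add: last_conv_nth)
  then show ?thesis
    using assms by (simp add: wface_def contract_def rot_def nth_butlast drop_Suc)
qed

lemma signed_face_closed: "x \<in> carrier (C (Suc n)) \<Longrightarrow> (\<lambda>j. signed (C n) j (face n j x)) \<in> J \<rightarrow> carrier (C n)"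
  by auto

lemma signed_faces_hom: "(\<lambda>x. \<Oplus>\<^bsub>C n\<^esub>j\<in>J. signed (C n) j (face n j x)) \<in> mod_hom R (C (Suc n)) (C n)"
  by (intro mod_hom_finsum mod_hom_signed hoch_module face_hom)

text \<open>The alternating sum of faces is linear and has the prescribed values on words, so it may
  replace the definite description. The operators \<open>b\<close> and \<open>t\<close> are treated
  likewise below.\<close>

lemma hoch_b'_eq:
  assumes "x \<in> carrier (C (Suc n))"
  shows "hoch_b' R M n x = (\<Oplus>\<^bsub>C n\<^esub>j\<in>{..n}. signed (C n) j (face n j x))"
  unfolding hoch_b'_def add_2_eq_Suc'
proof (rule lin_ext(3)[OF hoch_module hoch_module hoch_gen_funcset hoch_gen_span signed_faces_hom _ assms])
  fix w assume w: "w \<in> tuples M (Suc (Suc n))"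
  show "(\<Oplus>\<^bsub>C n\<^esub>j\<in>{..n}. signed (C n) j (face n j (gen (Suc n) w))) =
      (\<Oplus>\<^bsub>C n\<^esub>i\<in>{..n}. signed (C n) i (gen n (contract M i w)))"
    using w by (intro C.finsum_cong')
      (auto simp: face_def wop_gen[OF word_map_wface] wface_contract[OF _ tuples_length]
        intro!: C.signed_closed hoch_gen_closed word_map_closed[OF word_map_contract])
qed

lemma hoch_b_eq:
  assumes "x \<in> carrier (C (Suc n))"
  shows "hoch_b R M n x = (\<Oplus>\<^bsub>C n\<^esub>j\<in>{..Suc n}. signed (C n) j (face n j x))"
  unfolding hoch_b_def add_2_eq_Suc'
proof (rule lin_ext(3)[OF hoch_module hoch_module hoch_gen_funcset hoch_gen_span signed_faces_hom _ assms])
  fix w assume w: "w \<in> tuples M (Suc (Suc n))"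
  have g: "gen (Suc n) w \<in> carrier (C (Suc n))" using w by (rule hoch_gen_closed)
  have "(\<Oplus>\<^bsub>C n\<^esub>j\<in>{..n}. signed (C n) j (face n j (gen (Suc n) w))) =
      (\<Oplus>\<^bsub>C n\<^esub>i\<in>{..n}. signed (C n) i (gen n (contract M i w)))"
    using w by (intro C.finsum_cong')
      (auto simp: face_def wop_gen[OF word_map_wface] wface_contract[OF _ tuples_length]
        intro!: C.signed_closed hoch_gen_closed word_map_closed[OF word_map_contract])
  moreover have "face n (Suc n) (gen (Suc n) w) = gen n ((w ! Suc n \<otimes>\<^bsub>M\<^esub> w ! 0) # tl (butlast w))"
    using w by (simp add: face_def wop_gen[OF word_map_wface] wface_last[OF tuples_length])
  ultimately show "(\<Oplus>\<^bsub>C n\<^esub>j\<in>{..Suc n}. signed (C n) j (face n j (gen (Suc n) w))) =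
      (\<Oplus>\<^bsub>C n\<^esub>i\<in>{..n}. signed (C n) i (gen n (contract M i w))) \<oplus>\<^bsub>C n\<^esub>
      signed (C n) (Suc n) (gen n ((w ! Suc n \<otimes>\<^bsub>M\<^esub> w ! 0) # tl (butlast w)))"
    by (subst C.finsum_Suc_top[OF signed_face_closed[OF g]]) simp
qed

lemma cyc_t_eq:
  assumes "x \<in> carrier (C n)"
  shows "cyc_t R M n x = signed (C n) n (turn n x)"
  unfolding cyc_t_def Suc_eq_plus1[symmetric]
  by (rule lin_ext(3)[OF hoch_module hoch_module hoch_gen_funcset hoch_gen_span
        mod_hom_signed[OF hoch_module hoch_module turn_hom] _ assms])
    (simp add: turn_def wop_gen[OF word_map_rot] rot_def)

lemma hoch_b'_hom: "hoch_b' R M n \<in> mod_hom R (C (Suc n)) (C n)"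
  by (rule mod_hom_cong[OF signed_faces_hom hoch_module hoch_b'_eq])

lemma hoch_b_hom: "hoch_b R M n \<in> mod_hom R (C (Suc n)) (C n)"
  by (rule mod_hom_cong[OF signed_faces_hom hoch_module hoch_b_eq])

lemma cyc_t_hom: "cyc_t R M n \<in> mod_hom R (C n) (C n)"
  by (rule mod_hom_cong[OF mod_hom_signed[OF hoch_module hoch_module turn_hom] hoch_module cyc_t_eq])

end

sublocale assoc_algebra \<subseteq> b: linear_map R "hoch_mod R M (Suc n)" "hoch_mod R M n" "hoch_b R M n" for n
  by (intro linear_mapI hoch_module hoch_b_hom)

sublocale assoc_algebra \<subseteq> b': linear_map R "hoch_mod R M (Suc n)" "hoch_mod R M n" "hoch_b' R M n" for n
  by (intro linear_mapI hoch_module hoch_b'_hom)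

sublocale assoc_algebra \<subseteq> t: linear_map R "hoch_mod R M n" "hoch_mod R M n" "cyc_t R M n" for n
  by (intro linear_mapI hoch_module cyc_t_hom)

context assoc_algebra
begin

text \<open>\<open>m = n\<close> is the square of \<open>b'\<close> and \<open>m = Suc n\<close>
  that of \<open>b\<close>.\<close>

lemma faces_faces_zero:
  assumes x: "x \<in> carrier (C (Suc (Suc n)))" and m: "m \<le> Suc n"
  shows "(\<Oplus>\<^bsub>C n\<^esub>i\<in>{..m}. signed (C n) i (face n i
      (\<Oplus>\<^bsub>C (Suc n)\<^esub>j\<in>{..Suc m}. signed (C (Suc n)) j (face (Suc n) j x)))) = \<zero>\<^bsub>C n\<^esub>"
proof -
  have "signed (C n) i (face n i (\<Oplus>\<^bsub>C (Suc n)\<^esub>j\<in>{..Suc m}. signed (C (Suc n)) j (face (Suc n) j x))) =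
      (\<Oplus>\<^bsub>C n\<^esub>j\<in>{..Suc m}. signed (C n) (i + j) (face n i (face (Suc n) j x)))" for i
  proof -
    have "face n i (\<Oplus>\<^bsub>C (Suc n)\<^esub>j\<in>{..Suc m}. signed (C (Suc n)) j (face (Suc n) j x)) =
        (\<Oplus>\<^bsub>C n\<^esub>j\<in>{..Suc m}. face n i (signed (C (Suc n)) j (face (Suc n) j x)))"
      by (rule face.finsum[OF signed_face_closed[OF x]])
    then have "signed (C n) i (face n i (\<Oplus>\<^bsub>C (Suc n)\<^esub>j\<in>{..Suc m}. signed (C (Suc n)) j (face (Suc n) j x))) =
        (\<Oplus>\<^bsub>C n\<^esub>j\<in>{..Suc m}. signed (C n) i (face n i (signed (C (Suc n)) j (face (Suc n) j x))))"
      using x by (simp only:) (rule C.finsum_signed, simp)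
    then show ?thesis using x by (simp add: face.signed C.signed_signed)
  qed
  then show ?thesis
    by (simp only:) (rule C.simplicial_sum_zero; use x m in \<open>simp add: face_face\<close>)
qed

lemma b_b: "x \<in> carrier (C (Suc (Suc n))) \<Longrightarrow> hoch_b R M n (hoch_b R M (Suc n) x) = \<zero>\<^bsub>C n\<^esub>"
  by (subst hoch_b_eq, simp, subst hoch_b_eq, simp, rule faces_faces_zero) simp_all

lemma b'_b': "x \<in> carrier (C (Suc (Suc n))) \<Longrightarrow> hoch_b' R M n (hoch_b' R M (Suc n) x) = \<zero>\<^bsub>C n\<^esub>"
  by (subst hoch_b'_eq, simp, subst hoch_b'_eq, simp, rule faces_faces_zero) simp_all

end

section \<open>Relations between \<open>b\<close>, \<open>b'\<close>, \<open>t\<close> and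
  \<open>N\<close>\<close>

context module
begin

lemma add_left_cancel':
  assumes "x \<in> carrier M" "y \<in> carrier M" "z \<in> carrier M" "x \<oplus>\<^bsub>M\<^esub> y = x \<oplus>\<^bsub>M\<^esub> z"
  shows "y = z"
  by (metis M.r_neg1 assms)

lemma add_diff_add_right:
  assumes "x \<in> carrier M" "y \<in> carrier M" "z \<in> carrier M"
  shows "(x \<oplus>\<^bsub>M\<^esub> z) \<ominus>\<^bsub>M\<^esub> (y \<oplus>\<^bsub>M\<^esub> z) = x \<ominus>\<^bsub>M\<^esub> y"
  using assms by (simp add: minus_eq_iff M.a_assoc[symmetric] diff_add_cancel')

end

context assoc_algebra
begin

lemma b_split: "x \<in> carrier (C (Suc n)) \<Longrightarrow>
    hoch_b R M n x = hoch_b' R M n x \<oplus>\<^bsub>C n\<^esub> signed (C n) (Suc n) (face n (Suc n) x)"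
  by (simp only: hoch_b_eq hoch_b'_eq C.finsum_Suc_top[OF signed_face_closed])

text \<open>After a turn, face 0 is the old last face and face \<open>i + 1\<close> is the turned
  face \<open>i\<close>. The extra term is the one by which \<open>b\<close> differs from
  \<open>b'\<close>, so it cancels in \<open>b_1_t\<close>.\<close>

lemma b_t:
  assumes x: "x \<in> carrier (C (Suc n))"
  shows "hoch_b R M n (cyc_t R M (Suc n) x) =
    cyc_t R M n (hoch_b' R M n x) \<oplus>\<^bsub>C n\<^esub> signed (C n) (Suc n) (face n (Suc n) x)"
proof -
  have "hoch_b R M n (cyc_t R M (Suc n) x) =
      (\<Oplus>\<^bsub>C n\<^esub>j\<in>{..Suc n}. signed (C n) j (face n j (signed (C (Suc n)) (Suc n) (turn (Suc n) x))))"
    using x by (simp only: cyc_t_eq) (rule hoch_b_eq, simp)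
  also have "\<dots> = signed (C n) 0 (face n 0 (signed (C (Suc n)) (Suc n) (turn (Suc n) x))) \<oplus>\<^bsub>C n\<^esub>
      (\<Oplus>\<^bsub>C n\<^esub>i\<in>{..n}. signed (C n) (Suc i) (face n (Suc i) (signed (C (Suc n)) (Suc n) (turn (Suc n) x))))"
    using x by (intro C.finsum_Suc_bot signed_face_closed) simp
  also have "signed (C n) 0 (face n 0 (signed (C (Suc n)) (Suc n) (turn (Suc n) x))) =
      signed (C n) (Suc n) (face n (Suc n) x)"
    using x by (simp add: face.signed C.signed_signed face_0_turn)
  also have "(\<Oplus>\<^bsub>C n\<^esub>i\<in>{..n}. signed (C n) (Suc i) (face n (Suc i) (signed (C (Suc n)) (Suc n) (turn (Suc n) x)))) =
      (\<Oplus>\<^bsub>C n\<^esub>i\<in>{..n}. signed (C n) n (turn n (signed (C n) i (face n i x))))"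
    using x by (intro C.finsum_cong')
      (auto simp: face.signed turn.signed C.signed_signed face_turn, auto simp: signed_def)
  also have "\<dots> = cyc_t R M n (hoch_b' R M n x)"
    using x signed_face_closed[OF x, of "{..n}"]
    by (simp add: cyc_t_eq hoch_b'_eq turn.finsum C.finsum_signed)
  finally show ?thesis using x by (simp add: C.a_comm)
qed

lemma b_1_t:
  assumes x: "x \<in> carrier (C (Suc n))"
  shows "hoch_b R M n (x \<ominus>\<^bsub>C (Suc n)\<^esub> cyc_t R M (Suc n) x) =
    hoch_b' R M n x \<ominus>\<^bsub>C n\<^esub> cyc_t R M n (hoch_b' R M n x)"
proof -
  have "hoch_b R M n (x \<ominus>\<^bsub>C (Suc n)\<^esub> cyc_t R M (Suc n) x) =
      (hoch_b' R M n x \<oplus>\<^bsub>C n\<^esub> signed (C n) (Suc n) (face n (Suc n) x)) \<ominus>\<^bsub>C n\<^esub>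
      (cyc_t R M n (hoch_b' R M n x) \<oplus>\<^bsub>C n\<^esub> signed (C n) (Suc n) (face n (Suc n) x))"
    using x by (simp only: b.minus t.closed b_t[OF x] b_split[OF x])
  also have "\<dots> = hoch_b' R M n x \<ominus>\<^bsub>C n\<^esub> cyc_t R M n (hoch_b' R M n x)"
    using x by (simp add: C.add_diff_add_right)
  finally show ?thesis .
qed

lemma t_pow_hom: "cyc_t R M n ^^ k \<in> mod_hom R (C n) (C n)"
proof (induction k)
  case 0
  then show ?case using mod_hom_id by (simp add: id_def)
next
  case (Suc k)
  then show ?case using mod_hom_comp[OF Suc cyc_t_hom] by (simp add: comp_def)
qed

end

sublocale assoc_algebra \<subseteq> tp: linear_map R "hoch_mod R M n" "hoch_mod R M n" "cyc_t R M n ^^ k" for n k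
  by (intro linear_mapI hoch_module t_pow_hom)

context assoc_algebra
begin

lemma turn_pow_closed: "x \<in> carrier (C n) \<Longrightarrow> (turn n ^^ k) x \<in> carrier (C n)"
  by (rule mod_hom_closed[OF turn_pow_hom])

lemma t_pow_turn: "x \<in> carrier (C n) \<Longrightarrow> (cyc_t R M n ^^ k) x = signed (C n) (n * k) ((turn n ^^ k) x)"
proof (induction k)
  case 0
  then show ?case by (simp add: signed_def)
next
  case (Suc k)
  then show ?case
    using turn_pow_closed[of x n k]
    by (simp add: cyc_t_eq turn.signed C.signed_signed add.commute del: C.signed_Suc)
qed

text \<open>The accumulated sign has exponent \<open>n * (n + 1)\<close>, which is even.\<close>

lemma t_pow_Suc: "x \<in> carrier (C n) \<Longrightarrow> (cyc_t R M n ^^ Suc n) x = x"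
  unfolding t_pow_turn by (simp only: turn_pow) (simp add: signed_def)

lemma cyc_N_hom: "cyc_N R M n \<in> mod_hom R (C n) (C n)"
  unfolding cyc_N_def[abs_def] by (intro mod_hom_finsum hoch_module t_pow_hom)

end

sublocale assoc_algebra \<subseteq> N: linear_map R "hoch_mod R M n" "hoch_mod R M n" "cyc_N R M n" for n
  by (intro linear_mapI hoch_module cyc_N_hom)

context assoc_algebra
begin

lemma t_pow_sum:
  assumes x: "x \<in> carrier (C n)"
  shows "(\<Oplus>\<^bsub>C n\<^esub>i\<in>{..n}. (cyc_t R M n ^^ Suc i) x) = cyc_N R M n x"
proof -
  let ?S = "\<Oplus>\<^bsub>C n\<^esub>i\<in>{..n}. (cyc_t R M n ^^ Suc i) x"
  have f: "(\<lambda>i. (cyc_t R M n ^^ i) x) \<in> {..Suc n} \<rightarrow> carrier (C n)" using x tp.closed by blast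
  have S: "?S \<in> carrier (C n)" using x tp.closed by (intro C.finsum_closed Pi_I) blast
  \<comment> \<open>Adding \<open>x\<close> completes the sum to the exponents
    \<open>0, ..., n + 1\<close>. Splitting off the top term instead leaves \<open>N x\<close>, and
    that top term is \<open>x\<close> again.\<close>
  have "x \<oplus>\<^bsub>C n\<^esub> ?S = (\<Oplus>\<^bsub>C n\<^esub>i\<in>{..Suc n}. (cyc_t R M n ^^ i) x)"
    using C.finsum_Suc_bot[OF f] by simp
  also have "\<dots> = cyc_N R M n x \<oplus>\<^bsub>C n\<^esub> x"
    using C.finsum_Suc_top[OF f] t_pow_Suc[OF x] by (simp only: cyc_N_def)
  also have "\<dots> = x \<oplus>\<^bsub>C n\<^esub> cyc_N R M n x" using x by (simp add: C.a_comm)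
  finally show ?thesis by (rule C.add_left_cancel'[OF x S N.closed[OF x]])
qed

lemma N_t: "x \<in> carrier (C n) \<Longrightarrow> cyc_N R M n (cyc_t R M n x) = cyc_N R M n x"
  by (subst (2) t_pow_sum[symmetric]) (simp_all add: cyc_N_def funpow_swap1)

lemma t_N:
  assumes x: "x \<in> carrier (C n)"
  shows "cyc_t R M n (cyc_N R M n x) = cyc_N R M n x"
proof -
  have "cyc_t R M n (cyc_N R M n x) = (\<Oplus>\<^bsub>C n\<^esub>i\<in>{..n}. cyc_t R M n ((cyc_t R M n ^^ i) x))"
    unfolding cyc_N_def using x tp.closed by (intro t.finsum Pi_I)
  then show ?thesis using t_pow_sum[OF x] by simp
qed

lemma face_t: "i \<le> n \<Longrightarrow> x \<in> carrier (C (Suc n)) \<Longrightarrow>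
    face n (Suc i) (cyc_t R M (Suc n) x) = \<ominus>\<^bsub>C n\<^esub> cyc_t R M n (face n i x)"
  by (simp add: cyc_t_eq face.signed face_turn C.signed_Suc face.neg)

lemma face_0_t: "x \<in> carrier (C (Suc n)) \<Longrightarrow>
    face n 0 (cyc_t R M (Suc n) x) = signed (C n) (Suc n) (face n (Suc n) x)"
  by (simp add: cyc_t_eq face.signed face_0_turn)

lemma face_t_pow_le: "j \<le> i \<Longrightarrow> i \<le> Suc n \<Longrightarrow> x \<in> carrier (C (Suc n)) \<Longrightarrow>
    face n i ((cyc_t R M (Suc n) ^^ j) x) = signed (C n) j ((cyc_t R M n ^^ j) (face n (i - j) x))"
proof (induction j arbitrary: i)
  case 0
  then show ?case by (simp add: signed_def)
next
  case (Suc j)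
  then obtain i' where i': "i = Suc i'" "i' \<le> n" "j \<le> i'" by (cases i) auto
  have "face n i ((cyc_t R M (Suc n) ^^ Suc j) x) = \<ominus>\<^bsub>C n\<^esub> cyc_t R M n (face n i' ((cyc_t R M (Suc n) ^^ j) x))"
    using i' Suc.prems tp.closed[of x "Suc n" j] by (simp add: face_t)
  also have "\<dots> = signed (C n) (Suc j) ((cyc_t R M n ^^ Suc j) (face n (i - Suc j) x))"
    using i' Suc tp.closed[of "face n (i' - j) x" n j] by (simp add: t.signed C.signed_Suc)
  finally show ?case .
qed

text \<open>Moving face \<open>i\<close> past \<open>i\<close> turns makes it face 0; the next turn
  is absorbed and makes it the last face; the remaining \<open>m\<close> turns lower it to
  \<open>Suc n - m\<close>. This is why one turn is lost on the right.\<close>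

lemma face_t_pow_gr:
  assumes m: "m \<le> Suc n" and i: "i \<le> Suc n" and x: "x \<in> carrier (C (Suc n))"
  shows "face n i ((cyc_t R M (Suc n) ^^ (i + Suc m)) x) =
    signed (C n) (i + Suc n + m) ((cyc_t R M n ^^ (i + m)) (face n (Suc n - m) x))"
proof -
  let ?t = "cyc_t R M (Suc n)"
  let ?f = "face n (Suc n - m) x"
  have tm: "(?t ^^ m) x \<in> carrier (C (Suc n))" using x by (rule tp.closed)
  have "(?t ^^ (i + Suc m)) x = (?t ^^ i) (?t ((?t ^^ m) x))"
    by (simp add: funpow_add funpow_swap1)
  then have "face n i ((?t ^^ (i + Suc m)) x) = signed (C n) i ((cyc_t R M n ^^ i) (face n 0 (?t ((?t ^^ m) x))))"
    using face_t_pow_le[of i i n "?t ((?t ^^ m) x)"] i tm by simp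
  also have "face n 0 (?t ((?t ^^ m) x)) = signed (C n) (Suc n) (signed (C n) m ((cyc_t R M n ^^ m) ?f))"
    using face_t_pow_le[OF m order_refl x] tm by (simp add: face_0_t)
  finally show ?thesis
    using tp.closed[of ?f n m] tp.closed[of "(cyc_t R M n ^^ m) ?f" n i] x
    by (simp add: tp.signed C.signed_signed funpow_add ac_simps)
qed

text \<open>Each summand \<open>d_i t^j\<close> of the left side is, sign included, exactly one
  summand \<open>t^m d_l\<close> of the right side; nothing cancels.\<close>

lemma b'_N:
  assumes x: "x \<in> carrier (C (Suc n))"
  shows "hoch_b' R M n (cyc_N R M (Suc n) x) = cyc_N R M n (hoch_b R M n x)"
proof -
  let ?t = "cyc_t R M (Suc n)" and ?u = "cyc_t R M n"
  define f where "f p = signed (C n) (fst p) (face n (fst p) ((?t ^^ snd p) x))" for p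
  define g where "g p = signed (C n) (snd p) ((?u ^^ fst p) (face n (snd p) x))" for p
  have gc: "g p \<in> carrier (C n)" and fc: "f p \<in> carrier (C n)" for p
    using x tp.closed by (simp_all add: f_def g_def)
  have "hoch_b' R M n (cyc_N R M (Suc n) x) = (\<Oplus>\<^bsub>C n\<^esub>i\<in>{..n}. signed (C n) i (face n i (cyc_N R M (Suc n) x)))"
    using x by (simp add: hoch_b'_eq)
  also have "\<dots> = (\<Oplus>\<^bsub>C n\<^esub>i\<in>{..n}. \<Oplus>\<^bsub>C n\<^esub>j\<in>{..Suc n}. f (i, j))"
  proof -
    have "signed (C n) i (face n i (cyc_N R M (Suc n) x)) = (\<Oplus>\<^bsub>C n\<^esub>j\<in>{..Suc n}. f (i, j))" for i
    proof -
      have "face n i (cyc_N R M (Suc n) x) = (\<Oplus>\<^bsub>C n\<^esub>j\<in>{..Suc n}. face n i ((?t ^^ j) x))"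
        unfolding cyc_N_def using x tp.closed by (intro face.finsum Pi_I)
      moreover have "(\<lambda>j. face n i ((?t ^^ j) x)) \<in> {..Suc n} \<rightarrow> carrier (C n)"
        using x tp.closed face.closed by (intro Pi_I) blast
      ultimately show ?thesis by (simp only: C.finsum_signed f_def fst_conv snd_conv)
    qed
    then show ?thesis by simp
  qed
  also have "\<dots> = (\<Oplus>\<^bsub>C n\<^esub>p\<in>{..n} \<times> {..Suc n}. f p)"
    by (rule C.finsum_prod) (use fc in auto)
  also have "\<dots> = (\<Oplus>\<^bsub>C n\<^esub>p\<in>{..n} \<times> {..Suc n}. g p)"
  proof (rule C.finsum_bij)
    \<comment> \<open>The two branches are read off from \<open>face_t_pow_le\<close> and
      \<open>face_t_pow_gr\<close>, the second with \<open>m = j - i - 1\<close>.\<close>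
    let ?h = "\<lambda>(i, j). if j \<le> i then (j, i - j) else (j - 1, Suc (Suc n) + i - j)"
    let ?h' = "\<lambda>(m, l). if m + l \<le> n then (m + l, m) else (m + l - Suc n, Suc m)"
    show "bij_betw ?h ({..n} \<times> {..Suc n}) ({..n} \<times> {..Suc n})"
      by (rule bij_betw_byWitness[where f' = ?h']) (auto split: if_splits)
    show "g \<in> {..n} \<times> {..Suc n} \<rightarrow> carrier (C n)" using gc by auto
    fix p assume p: "p \<in> {..n} \<times> {..Suc n}"
    obtain i j where ij: "p = (i, j)" "i \<le> n" "j \<le> Suc n" using p by auto
    show "f p = g (?h p)"
    proof (cases "j \<le> i")
      case True
      \<comment> \<open>Only the parity of the exponent matters to \<open>signed\<close>.\<close>
      then have "even (i + j) = even (i - j)" by simp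
      then show ?thesis
        using ij x True tp.closed[of "face n (i - j) x" n j]
        by (simp add: f_def g_def face_t_pow_le C.signed_signed) (simp add: signed_def)
    next
      case False
      then obtain m where m: "j = i + Suc m" by (metis less_iff_Suc_add not_le add_Suc_right)
      have eq: "Suc (Suc n) + i - j = Suc n - m" "j - 1 = i + m" and mn: "m \<le> Suc n" using m ij by auto
      have "even (i + (i + Suc n + m)) = even (Suc n - m)" using mn by simp presburger
      then have "signed (C n) (i + (i + Suc n + m)) y = signed (C n) (Suc n - m) y" for y
        by (simp only: signed_def)
      moreover have "f p = signed (C n) (i + (i + Suc n + m)) ((?u ^^ (i + m)) (face n (Suc n - m) x))"
        using ij x mn face_t_pow_gr[OF mn _ x, of i] tp.closed[of "face n (Suc n - m) x" n "i + m"]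
        unfolding f_def ij m fst_conv snd_conv by (simp only: le_SucI C.signed_signed face.closed)
      moreover have "g (?h p) = signed (C n) (Suc n - m) ((?u ^^ (i + m)) (face n (Suc n - m) x))"
        using False by (simp only: ij(1) g_def prod.case if_False eq fst_conv snd_conv)
      ultimately show ?thesis by simp
    qed
  qed
  also have "\<dots> = (\<Oplus>\<^bsub>C n\<^esub>m\<in>{..n}. \<Oplus>\<^bsub>C n\<^esub>l\<in>{..Suc n}. g (m, l))"
    by (rule C.finsum_prod[symmetric]) (use gc in auto)
  also have "\<dots> = cyc_N R M n (hoch_b R M n x)"
  proof -
    have "(\<Oplus>\<^bsub>C n\<^esub>l\<in>{..Suc n}. g (m, l)) = (?u ^^ m) (hoch_b R M n x)" for m
      using x by (simp only: hoch_b_eq tp.finsum[OF signed_face_closed[OF x]] g_def fst_conv snd_conv tp.signed face.closed)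
    then show ?thesis by (simp only: cyc_N_def)
  qed
  finally show ?thesis .
qed

lemma degen_closed: "i \<le> Suc n \<Longrightarrow> x \<in> carrier (C n) \<Longrightarrow> degen n i x \<in> carrier (C (Suc n))"
  by (rule mod_hom_closed[OF degen_hom])

lemma degen_0_zero: "degen n 0 \<zero>\<^bsub>C n\<^esub> = \<zero>\<^bsub>C (Suc n)\<^esub>"
  by (rule linear_map.zero[OF linear_mapI[OF hoch_module hoch_module degen_hom]]) simp

lemma b'_s_0:
  assumes x: "x \<in> carrier (C 0)"
  shows "hoch_b' R M 0 (degen 0 0 x) = x"
  using x degen_closed[of 0 0 x] by (simp add: hoch_b'_eq face_degen_0 signed_def)

text \<open>Face 0 removes the inserted unit; the later faces slip behind it with their index
  shifted by one, hence with opposite sign.\<close>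

lemma b'_s_Suc:
  assumes x: "x \<in> carrier (C (Suc n))"
  shows "hoch_b' R M (Suc n) (degen (Suc n) 0 x) = x \<ominus>\<^bsub>C (Suc n)\<^esub> degen n 0 (hoch_b' R M n x)"
proof -
  interpret s: linear_map R "C n" "C (Suc n)" "degen n 0"
    by (intro linear_mapI hoch_module degen_hom) simp
  let ?y = "degen (Suc n) 0 x"
  have y: "?y \<in> carrier (C (Suc (Suc n)))" using x by (intro degen_closed) simp_all
  have "hoch_b' R M (Suc n) ?y = signed (C (Suc n)) 0 (face (Suc n) 0 ?y) \<oplus>\<^bsub>C (Suc n)\<^esub>
      (\<Oplus>\<^bsub>C (Suc n)\<^esub>i\<in>{..n}. signed (C (Suc n)) (Suc i) (face (Suc n) (Suc i) ?y))"
    unfolding hoch_b'_eq[OF y] by (rule C.finsum_Suc_bot[OF signed_face_closed[OF y]])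
  also have "signed (C (Suc n)) 0 (face (Suc n) 0 ?y) = x"
    using x by (simp add: face_degen_0 signed_def)
  also have "(\<Oplus>\<^bsub>C (Suc n)\<^esub>i\<in>{..n}. signed (C (Suc n)) (Suc i) (face (Suc n) (Suc i) ?y)) =
      (\<Oplus>\<^bsub>C (Suc n)\<^esub>i\<in>{..n}. \<ominus>\<^bsub>C (Suc n)\<^esub> degen n 0 (signed (C n) i (face n i x)))"
    using x by (intro C.finsum_cong') (auto simp: face_Suc_degen_0 s.signed C.signed_Suc)
  also have "\<dots> = \<ominus>\<^bsub>C (Suc n)\<^esub> degen n 0 (hoch_b' R M n x)"
    unfolding hoch_b'_eq[OF x] s.finsum[OF signed_face_closed[OF x]]
    using x by (intro C.finsum_neg[symmetric]) auto
  finally show ?thesis by (simp add: a_minus_def)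
qed

end

section \<open>The total complex\<close>

context assoc_algebra
begin

abbreviation "T n \<equiv> tot_mod R M n"

lemma tot_carrier: "x \<in> carrier (T n) \<longleftrightarrow> x \<in> extensional {..n} \<and> (\<forall>p\<le>n. x p \<in> carrier (C (n - p)))"
  by (auto simp: tot_mod_def PiE_iff)

lemma tot_nth: "x \<in> carrier (T n) \<Longrightarrow> p \<le> n \<Longrightarrow> n - p = q \<Longrightarrow> x p \<in> carrier (C q)"
  by (auto simp: tot_carrier)

lemma tot_eqI: "x \<in> carrier (T n) \<Longrightarrow> y \<in> carrier (T n) \<Longrightarrow> (\<And>p. p \<le> n \<Longrightarrow> x p = y p) \<Longrightarrow> x = y"
  by (rule extensionalityI[of _ "{..n}"]) (auto simp: tot_carrier)

lemma tot_ext: "(\<And>p. p \<le> n \<Longrightarrow> f p = g p) \<Longrightarrow> (\<lambda>p\<in>{..n}. f p) = (\<lambda>p\<in>{..n}. g p)"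
  by (rule restrict_ext) simp

lemma tot_restrict: "(\<And>p. p \<le> n \<Longrightarrow> f p \<in> carrier (C (n - p))) \<Longrightarrow> (\<lambda>p\<in>{..n}. f p) \<in> carrier (T n)"
  by (simp add: tot_carrier)

lemma tot_add: "x \<oplus>\<^bsub>T n\<^esub> y = (\<lambda>p\<in>{..n}. x p \<oplus>\<^bsub>C (n - p)\<^esub> y p)"
  by (simp add: tot_mod_def)

lemma tot_smult: "c \<odot>\<^bsub>T n\<^esub> x = (\<lambda>p\<in>{..n}. c \<odot>\<^bsub>C (n - p)\<^esub> x p)"
  by (simp add: tot_mod_def)

lemma tot_zero: "\<zero>\<^bsub>T n\<^esub> = (\<lambda>p\<in>{..n}. \<zero>\<^bsub>C (n - p)\<^esub>)"
  by (simp add: tot_mod_def)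

lemma tot_module: "module R (T n)"
proof (rule moduleI)
  show "cring R" by (rule R.is_cring)
  show "abelian_group (T n)"
  proof (rule abelian_groupI)
    fix x assume x: "x \<in> carrier (T n)"
    show "\<zero>\<^bsub>T n\<^esub> \<oplus>\<^bsub>T n\<^esub> x = x"
      using x by (intro tot_eqI[of _ n]) (auto simp: tot_carrier tot_add tot_zero)
    show "\<exists>y\<in>carrier (T n). y \<oplus>\<^bsub>T n\<^esub> x = \<zero>\<^bsub>T n\<^esub>"
      using x by (intro bexI[of _ "\<lambda>p\<in>{..n}. \<ominus>\<^bsub>C (n - p)\<^esub> x p"])
        (auto simp: tot_carrier tot_add tot_zero C.l_neg intro!: tot_ext)
  qed (auto simp: tot_carrier tot_add tot_zero C.a_assoc intro!: tot_ext C.a_comm)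
  fix x assume "x \<in> carrier (T n)"
  then show "\<one>\<^bsub>R\<^esub> \<odot>\<^bsub>T n\<^esub> x = x"
    by (intro tot_eqI[of _ n]) (auto simp: tot_carrier tot_smult)
qed (auto simp: tot_carrier tot_add tot_smult C.smult_l_distr C.smult_r_distr C.smult_assoc1 intro!: tot_ext)

text \<open>The differentials of the bicomplex out of column \<open>p\<close>, and into column \<open>p\<close>.\<close>

definition vert :: "nat \<Rightarrow> nat \<Rightarrow> ('c list \<Rightarrow> 'a) set \<Rightarrow> ('c list \<Rightarrow> 'a) set"
  where "vert p q x = (if even p then hoch_b R M q x else \<ominus>\<^bsub>C q\<^esub> hoch_b' R M q x)"

definition horiz :: "nat \<Rightarrow> nat \<Rightarrow> ('c list \<Rightarrow> 'a) set \<Rightarrow> ('c list \<Rightarrow> 'a) set"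
  where "horiz p q x = (if even p then x \<ominus>\<^bsub>C q\<^esub> cyc_t R M q x else cyc_N R M q x)"

lemma vert_hom: "vert p q \<in> mod_hom R (C (Suc q)) (C q)"
  using hoch_b_hom mod_hom_neg[OF hoch_module hoch_module hoch_b'_hom]
  by (cases "even p") (simp_all add: vert_def[abs_def])

lemma horiz_hom: "horiz p q \<in> mod_hom R (C q) (C q)"
  using mod_hom_minus[OF hoch_module hoch_module mod_hom_id cyc_t_hom] cyc_N_hom
  by (cases "even p") (simp_all add: horiz_def[abs_def])

end

sublocale assoc_algebra \<subseteq> vert: linear_map R "hoch_mod R M (Suc q)" "hoch_mod R M q" "vert p q" for p q
  by (intro linear_mapI hoch_module vert_hom)

sublocale assoc_algebra \<subseteq> horiz: linear_map R "hoch_mod R M q" "hoch_mod R M q" "horiz p q" for p q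
  by (intro linear_mapI hoch_module horiz_hom)

context assoc_algebra
begin

lemma vert_vert: "x \<in> carrier (C (Suc (Suc q))) \<Longrightarrow> vert p q (vert p (Suc q) x) = \<zero>\<^bsub>C q\<^esub>"
  by (simp add: vert_def b_b b'_b' b'.neg)

lemma horiz_horiz: "x \<in> carrier (C q) \<Longrightarrow> horiz p q (horiz (Suc p) q x) = \<zero>\<^bsub>C q\<^esub>"
  by (simp add: horiz_def N_t t_N N.minus)

text \<open>The sign of \<open>- b'\<close> in odd columns turns the rules
  \<open>b (1 - t) = (1 - t) b'\<close> and \<open>b' N = N b\<close> into anticommutation, as a
  total complex requires.\<close>

lemma vert_horiz:
  "x \<in> carrier (C (Suc q)) \<Longrightarrow> vert p q (horiz p (Suc q) x) \<oplus>\<^bsub>C q\<^esub> horiz p q (vert (Suc p) q x) = \<zero>\<^bsub>C q\<^esub>"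
proof -
  assume x: "x \<in> carrier (C (Suc q))"
  let ?y = "hoch_b' R M q x"
  have "?y \<ominus>\<^bsub>C q\<^esub> cyc_t R M q ?y \<oplus>\<^bsub>C q\<^esub> (\<ominus>\<^bsub>C q\<^esub> ?y \<ominus>\<^bsub>C q\<^esub> cyc_t R M q (\<ominus>\<^bsub>C q\<^esub> ?y)) =
      (?y \<ominus>\<^bsub>C q\<^esub> cyc_t R M q ?y) \<oplus>\<^bsub>C q\<^esub> \<ominus>\<^bsub>C q\<^esub> (?y \<ominus>\<^bsub>C q\<^esub> cyc_t R M q ?y)"
    using x by (simp add: t.neg a_minus_def C.minus_add)
  also have "\<dots> = \<zero>\<^bsub>C q\<^esub>" using x by (intro C.r_neg) simp
  finally show ?thesis
    using x by (simp add: vert_def horiz_def b_1_t b'_N C.l_neg)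
qed

lemma tot_d_eq: "tot_d R M n x =
    (\<lambda>p\<in>{..n}. vert p (n - p) (x p) \<oplus>\<^bsub>C (n - p)\<^esub> horiz p (n - p) (x (Suc p)))"
  by (auto simp: tot_d_def Let_def vert_def horiz_def intro!: tot_ext)

lemma tot_nth_le: "x \<in> carrier (T (Suc n)) \<Longrightarrow> p \<le> n \<Longrightarrow> x p \<in> carrier (C (Suc (n - p)))"
  by (auto intro: tot_nth simp: Suc_diff_le)

lemma tot_nth_Suc: "x \<in> carrier (T (Suc n)) \<Longrightarrow> p \<le> n \<Longrightarrow> x (Suc p) \<in> carrier (C (n - p))"
  by (auto intro: tot_nth)

lemma tot_d_nth: "p \<le> n \<Longrightarrow> n - p = q \<Longrightarrow>
    tot_d R M n x p = vert p q (x p) \<oplus>\<^bsub>C q\<^esub> horiz p q (x (Suc p))"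
  by (auto simp: tot_d_eq)

lemma tot_d_hom: "tot_d R M n \<in> mod_hom R (T (Suc n)) (T n)"
proof (rule mod_homI)
  fix x assume x: "x \<in> carrier (T (Suc n))"
  show "tot_d R M n x \<in> carrier (T n)"
    unfolding tot_d_eq using x by (intro tot_restrict) (simp add: tot_nth_le tot_nth_Suc)
  fix y assume y: "y \<in> carrier (T (Suc n))"
  show "tot_d R M n (x \<oplus>\<^bsub>T (Suc n)\<^esub> y) = tot_d R M n x \<oplus>\<^bsub>T n\<^esub> tot_d R M n y"
    unfolding tot_add[of n] tot_d_eq[of n "x \<oplus>\<^bsub>T (Suc n)\<^esub> y"]
    using x y by (intro tot_ext)
      (simp add: tot_d_nth tot_nth_le tot_nth_Suc tot_add Suc_diff_le vert.add horiz.add C.a_ac)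
next
  fix c x assume c: "c \<in> carrier R" and x: "x \<in> carrier (T (Suc n))"
  show "tot_d R M n (c \<odot>\<^bsub>T (Suc n)\<^esub> x) = c \<odot>\<^bsub>T n\<^esub> tot_d R M n x"
    unfolding tot_smult[of n] tot_d_eq[of n "c \<odot>\<^bsub>T (Suc n)\<^esub> x"]
    using c x by (intro tot_ext)
      (simp add: tot_d_nth tot_nth_le tot_nth_Suc tot_smult Suc_diff_le vert.smult horiz.smult C.smult_r_distr)
qed

lemma tot_d_tot_d:
  assumes x: "x \<in> carrier (T (Suc (Suc n)))"
  shows "tot_d R M n (tot_d R M (Suc n) x) = \<zero>\<^bsub>T n\<^esub>"
  unfolding tot_d_eq[of n] tot_zero
proof (rule tot_ext)
  fix p assume p: "p \<le> n"
  let ?q = "n - p"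
  have c: "x p \<in> carrier (C (Suc (Suc ?q)))" "x (Suc p) \<in> carrier (C (Suc ?q))" "x (Suc (Suc p)) \<in> carrier (C ?q)"
    using p x by (auto intro!: tot_nth[OF x])
  have 1: "tot_d R M (Suc n) x p = vert p (Suc ?q) (x p) \<oplus>\<^bsub>C (Suc ?q)\<^esub> horiz p (Suc ?q) (x (Suc p))"
    using p by (intro tot_d_nth) auto
  have 2: "tot_d R M (Suc n) x (Suc p) = vert (Suc p) ?q (x (Suc p)) \<oplus>\<^bsub>C ?q\<^esub> horiz (Suc p) ?q (x (Suc (Suc p)))"
    using p by (intro tot_d_nth) auto
  show "vert p ?q (tot_d R M (Suc n) x p) \<oplus>\<^bsub>C ?q\<^esub> horiz p ?q (tot_d R M (Suc n) x (Suc p)) = \<zero>\<^bsub>C ?q\<^esub>"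
    using c by (simp add: 1 2 vert.add horiz.add vert_vert horiz_horiz vert_horiz)
qed

lemma tot_chain_complex: "chain_complex R (tot_mod R M) (tot_d R M)"
  by (intro chain_complex.intro tot_module tot_d_hom tot_d_tot_d)

end

text \<open>The last two assumptions express that \<open>\<sigma>\<close> is a quasi-isomorphism.\<close>

locale hochschild_model = assoc_algebra R M + K: chain_complex R K dK
  for R :: "('k, 'r) ring_scheme" and M :: "('k, 'a, 'm) module_scheme" (structure)
    and K :: "nat \<Rightarrow> ('k, 'x) module" and dK +
  fixes \<sigma> :: "nat \<Rightarrow> 'x \<Rightarrow> ('a list \<Rightarrow> 'k) set"
  assumes \<sigma>_hom: "\<sigma> n \<in> mod_hom R (K n) (hoch_mod R M n)"
    and \<sigma>_chain: "x \<in> carrier (K (Suc n)) \<Longrightarrow> \<sigma> n (dK n x) = hoch_b R M n (\<sigma> (Suc n) x)"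
    and \<sigma>_inj: "\<lbrakk>x \<in> carrier (K n); y \<in> carrier (hoch_mod R M (Suc n)); \<sigma> n x = hoch_b R M n y\<rbrakk> \<Longrightarrow>
          \<exists>x'\<in>carrier (K (Suc n)). x = dK n x'"
    and \<sigma>_surj: "\<lbrakk>z \<in> carrier (hoch_mod R M n); \<And>m. n = Suc m \<Longrightarrow> hoch_b R M m z = \<zero>\<^bsub>hoch_mod R M m\<^esub>\<rbrakk> \<Longrightarrow>
          \<exists>x\<in>cycles K dK n. \<exists>y\<in>carrier (hoch_mod R M (Suc n)). z = \<sigma> n x \<oplus>\<^bsub>hoch_mod R M n\<^esub> hoch_b R M n y"
begin

sublocale \<sigma>: linear_map R "K n" "hoch_mod R M n" "\<sigma> n" for n
  by (intro linear_mapI K.C_module hoch_module \<sigma>_hom)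

text \<open>A chain concentrated in column 0 meets only the differential \<open>b\<close>, so a
  chain map into the Hochschild complex is also one into the total complex.\<close>

definition col0 :: "nat \<Rightarrow> 'x \<Rightarrow> nat \<Rightarrow> ('a list \<Rightarrow> 'k) set"
  where "col0 n x = (\<lambda>p\<in>{..n}. if p = 0 then \<sigma> n x else \<zero>\<^bsub>C (n - p)\<^esub>)"

lemma col0_closed: "x \<in> carrier (K n) \<Longrightarrow> col0 n x \<in> carrier (T n)"
  unfolding col0_def by (rule tot_restrict) auto

lemma vert_0: "vert 0 q x = hoch_b R M q x"
  by (simp add: vert_def)

lemma horiz_0: "horiz 0 q x = x \<ominus>\<^bsub>C q\<^esub> cyc_t R M q x"
  by (simp add: horiz_def)

text \<open>From \<open>1 = b' s + s b'\<close>, where \<open>s\<close> inserts a unit in front: on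
  a \<open>b'\<close>-cycle the second term vanishes. In degree 0 the guard is void and everything
  counts as a cycle.\<close>

lemma b'_onto:
  assumes "y \<in> carrier (C n)" "\<And>m. n = Suc m \<Longrightarrow> hoch_b' R M m y = \<zero>\<^bsub>C m\<^esub>"
  shows "hoch_b' R M n (degen n 0 y) = y"
proof (cases n)
  case 0
  then show ?thesis using assms b'_s_0 by simp
next
  case (Suc m)
  then show ?thesis using assms by (simp add: b'_s_Suc degen_0_zero)
qed

text \<open>As \<open>y\<close> vanishes in column 2, its entry in column 1 is a
  \<open>b'\<close>-cycle, hence of the form \<open>b' u\<close>. Then
  \<open>(1 - t) b' u = b (1 - t) u\<close> moves its contribution into column 0, where
  \<open>\<sigma>_inj\<close> applies.\<close>

lemma model_quasi_inj:
  assumes x: "x \<in> carrier (K n)" and y: "y \<in> carrier (T (Suc n))"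
    and py: "\<And>m. n = Suc m \<Longrightarrow> y 2 = \<zero>\<^bsub>C m\<^esub>" and eq: "col0 n x = tot_d R M n y"
  shows "\<exists>x'\<in>carrier (K (Suc n)). x = dK n x'"
proof -
  have y0: "y 0 \<in> carrier (C (Suc n))" and y1: "y (Suc 0) \<in> carrier (C n)"
    using y by (auto intro!: tot_nth[OF y])
  have s: "\<sigma> n x = hoch_b R M n (y 0) \<oplus>\<^bsub>C n\<^esub> (y (Suc 0) \<ominus>\<^bsub>C n\<^esub> cyc_t R M n (y (Suc 0)))"
    using fun_cong[OF eq, of 0] by (simp add: col0_def tot_d_nth vert_0 horiz_0)
  \<comment> \<open>This comes from column 1 of the equation, where \<open>col0\<close> is zero and
    \<open>N\<close> meets the vanishing \<open>y 2\<close>.\<close>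
  have "hoch_b' R M m (y (Suc 0)) = \<zero>\<^bsub>C m\<^esub>" if n: "n = Suc m" for m
  proof -
    have "\<zero>\<^bsub>C m\<^esub> = (\<ominus>\<^bsub>C m\<^esub> hoch_b' R M m (y (Suc 0))) \<oplus>\<^bsub>C m\<^esub> cyc_N R M m (y 2)"
      using fun_cong[OF eq, of 1] n by (simp add: col0_def tot_d_nth vert_def horiz_def numeral_2_eq_2)
    then have "\<ominus>\<^bsub>C m\<^esub> hoch_b' R M m (y (Suc 0)) = \<zero>\<^bsub>C m\<^esub>" using py[OF n] y1 n by simp
    then have "\<ominus>\<^bsub>C m\<^esub> (\<ominus>\<^bsub>C m\<^esub> hoch_b' R M m (y (Suc 0))) = \<zero>\<^bsub>C m\<^esub>" by (simp add: C.add.inv_one)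
    then show ?thesis using y1 n by simp
  qed
  then have b'u: "hoch_b' R M n (degen n 0 (y (Suc 0))) = y (Suc 0)" using y1 by (intro b'_onto)
  let ?u = "degen n 0 (y (Suc 0))"
  have u: "?u \<in> carrier (C (Suc n))" using y1 by (intro degen_closed) auto
  have "\<sigma> n x = hoch_b R M n (y 0 \<oplus>\<^bsub>C (Suc n)\<^esub> (?u \<ominus>\<^bsub>C (Suc n)\<^esub> cyc_t R M (Suc n) ?u))"
    using y0 u by (simp add: s b.add b_1_t b'u)
  then show ?thesis
    using x y0 u by (intro \<sigma>_inj) auto
qed

lemma tot_cycleD:
  assumes "z \<in> cycles (tot_mod R M) (tot_d R M) (Suc m)" "p \<le> m"
  shows "vert p (m - p) (z p) \<oplus>\<^bsub>C (m - p)\<^esub> horiz p (m - p) (z (Suc p)) = \<zero>\<^bsub>C (m - p)\<^esub>"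
proof -
  have "tot_d R M m z = \<zero>\<^bsub>T m\<^esub>" using assms(1) by (simp add: chain_complex.cycles_Suc[OF tot_chain_complex])
  from fun_cong[OF this, of p] show ?thesis using assms(2) by (simp add: tot_d_nth tot_zero)
qed

text \<open>Column 1 of \<open>z\<close> is a \<open>b'\<close>-cycle, hence of the form
  \<open>b' u\<close>. Adding \<open>(1 - t) u\<close> to column 0 and clearing column 1 gives a
  \<open>b\<close>-cycle homologous to \<open>z\<close>, to which \<open>\<sigma>_surj\<close>
  applies.\<close>

lemma model_quasi_surj:
  assumes z: "z \<in> cycles (tot_mod R M) (tot_d R M) n"
    and pz: "\<And>p. p \<le> n \<Longrightarrow> 2 \<le> p \<Longrightarrow> z p = \<zero>\<^bsub>C (n - p)\<^esub>"
  shows "\<exists>x\<in>cycles K dK n. \<exists>y\<in>carrier (T (Suc n)). (\<forall>p\<le>Suc n. 2 \<le> p \<longrightarrow> y p = \<zero>\<^bsub>C (Suc n - p)\<^esub>) \<and>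
      z = col0 n x \<oplus>\<^bsub>T n\<^esub> tot_d R M n y"
proof -
  note zT = chain_complex.cycles_closed[OF tot_chain_complex z]
  have z0: "z 0 \<in> carrier (C n)" by (rule tot_nth[OF zT]) auto
  have "\<exists>u\<in>carrier (C n). (\<forall>m. n = Suc m \<longrightarrow> hoch_b' R M m u = z (Suc 0) \<and>
      hoch_b R M m (z 0 \<oplus>\<^bsub>C n\<^esub> (u \<ominus>\<^bsub>C n\<^esub> cyc_t R M n u)) = \<zero>\<^bsub>C m\<^esub>)"
  proof (cases n)
    case 0
    \<comment> \<open>There is no column 1 in total degree 0, so any \<open>u\<close> will
      do.\<close>
    then show ?thesis using C.zero_closed by blast
  next
    case (Suc m)
    note zS = z[unfolded Suc]
    have z1: "z (Suc 0) \<in> carrier (C m)" using Suc by (intro tot_nth[OF zT]) auto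
    have "hoch_b' R M l (z (Suc 0)) = \<zero>\<^bsub>C l\<^esub>" if m: "m = Suc l" for l
    proof -
      have "z 2 = \<zero>\<^bsub>C l\<^esub>" using pz[of 2] m Suc by simp
      then have "\<ominus>\<^bsub>C l\<^esub> hoch_b' R M l (z (Suc 0)) = \<zero>\<^bsub>C l\<^esub>"
        using tot_cycleD[OF zS, of 1] m z1 by (simp add: vert_def horiz_def numeral_2_eq_2)
      then have "\<ominus>\<^bsub>C l\<^esub> (\<ominus>\<^bsub>C l\<^esub> hoch_b' R M l (z (Suc 0))) = \<zero>\<^bsub>C l\<^esub>" by (simp add: C.add.inv_one)
      then show ?thesis using z1 m by simp
    qed
    then have b'u: "hoch_b' R M m (degen m 0 (z (Suc 0))) = z (Suc 0)" using z1 by (intro b'_onto)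
    have u: "degen m 0 (z (Suc 0)) \<in> carrier (C n)" unfolding Suc using z1 by (intro degen_closed) auto
    moreover have "hoch_b R M m (z 0 \<oplus>\<^bsub>C n\<^esub> (degen m 0 (z (Suc 0)) \<ominus>\<^bsub>C n\<^esub> cyc_t R M n (degen m 0 (z (Suc 0))))) = \<zero>\<^bsub>C m\<^esub>"
      using tot_cycleD[OF zS, of 0] z0 u Suc by (simp add: b.add b_1_t b'u vert_0 horiz_0)
    ultimately show ?thesis using Suc b'u by (intro bexI[of _ "degen m 0 (z (Suc 0))"]) auto
  qed
  then obtain u where u: "u \<in> carrier (C n)" and b'u: "\<And>m. n = Suc m \<Longrightarrow> hoch_b' R M m u = z (Suc 0)"
    and cyc: "\<And>m. n = Suc m \<Longrightarrow> hoch_b R M m (z 0 \<oplus>\<^bsub>C n\<^esub> (u \<ominus>\<^bsub>C n\<^esub> cyc_t R M n u)) = \<zero>\<^bsub>C m\<^esub>"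
    by blast
  let ?w = "u \<ominus>\<^bsub>C n\<^esub> cyc_t R M n u"
  have w: "?w \<in> carrier (C n)" using u by simp
  obtain x y0 where x: "x \<in> cycles K dK n" and y0: "y0 \<in> carrier (C (Suc n))"
    and e: "z 0 \<oplus>\<^bsub>C n\<^esub> ?w = \<sigma> n x \<oplus>\<^bsub>C n\<^esub> hoch_b R M n y0"
    using \<sigma>_surj[of "z 0 \<oplus>\<^bsub>C n\<^esub> ?w" n] z0 w cyc by auto
  note xc = K.cycles_closed[OF x]
  \<comment> \<open>The entry in column 1 is \<open>- u\<close>, because the vertical differential
    \<open>- b'\<close> takes it to \<open>b' u\<close>, the entry of \<open>z\<close> in column
    1.\<close>
  define y where "y = (\<lambda>p\<in>{..Suc n}. if p = 0 then y0 else if p = 1 then \<ominus>\<^bsub>C n\<^esub> u else \<zero>\<^bsub>C (Suc n - p)\<^esub>)"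
  have y: "y \<in> carrier (T (Suc n))"
    unfolding y_def using y0 u by (intro tot_restrict) auto
  have dy: "tot_d R M n y \<in> carrier (T n)" by (rule mod_hom_closed[OF tot_d_hom y])
  have "z = col0 n x \<oplus>\<^bsub>T n\<^esub> tot_d R M n y"
  proof (rule tot_eqI[OF zT])
    interpret Tn: module R "T n" by (rule tot_module)
    show "col0 n x \<oplus>\<^bsub>T n\<^esub> tot_d R M n y \<in> carrier (T n)" using col0_closed[OF xc] dy by simp
    fix p assume p: "p \<le> n"
    consider "p = 0" | "p = 1" | "2 \<le> p" by linarith
    then show "z p = (col0 n x \<oplus>\<^bsub>T n\<^esub> tot_d R M n y) p"
    proof cases
      case 1
      have neg: "\<ominus>\<^bsub>C n\<^esub> u \<ominus>\<^bsub>C n\<^esub> cyc_t R M n (\<ominus>\<^bsub>C n\<^esub> u) = \<ominus>\<^bsub>C n\<^esub> ?w"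
        using u by (simp add: t.neg a_minus_def C.minus_add)
      have "(\<sigma> n x \<oplus>\<^bsub>C n\<^esub> hoch_b R M n y0) \<ominus>\<^bsub>C n\<^esub> ?w = z 0"
        using e z0 w xc y0 by (subst C.minus_eq_iff) auto
      then have "z 0 = \<sigma> n x \<oplus>\<^bsub>C n\<^esub> (hoch_b R M n y0 \<oplus>\<^bsub>C n\<^esub> \<ominus>\<^bsub>C n\<^esub> ?w)"
        using xc y0 w by (simp add: a_minus_def[of _ _ ?w] C.a_assoc)
      then show ?thesis
        using 1 by (simp add: tot_add col0_def tot_d_nth vert_0 horiz_0 y_def neg)
    next
      case 2
      then obtain m where n: "n = Suc m" using p by (cases n) auto
      have z1: "z (Suc 0) \<in> carrier (C m)" using n by (intro tot_nth[OF zT]) auto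
      show ?thesis
        using 2 n u z1 by (simp add: tot_add col0_def tot_d_nth vert_def horiz_def y_def b'.neg b'u[OF n])
    next
      case 3
      then show ?thesis
        using p by (simp add: tot_add col0_def tot_d_nth y_def pz Suc_diff_le)
    qed
  qed
  then show ?thesis
    using x y by (intro bexI[of _ x] bexI[of _ y]) (auto simp: y_def)
qed

definition drop2 :: "nat \<Rightarrow> (nat \<Rightarrow> ('a list \<Rightarrow> 'k) set) \<Rightarrow> nat \<Rightarrow> ('a list \<Rightarrow> 'k) set"
  where "drop2 n x = (\<lambda>p\<in>{..n}. x (p + 2))"

lemma drop2_zero_iff: "drop2 n x = \<zero>\<^bsub>T n\<^esub> \<longleftrightarrow> (\<forall>p\<le>n. x (Suc (Suc p)) = \<zero>\<^bsub>C (n - p)\<^esub>)"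
  by (auto simp: drop2_def tot_zero fun_eq_iff restrict_def)

sublocale P: periodic_complex R K dK "tot_mod R M" "tot_d R M" col0 drop2
proof (intro periodic_complex.intro periodic_complex_axioms.intro tot_chain_complex K.chain_complex_axioms)
  fix n
  show "col0 n \<in> mod_hom R (K n) (T n)"
    by (rule mod_homI) (auto simp: col0_closed, auto simp: col0_def tot_add tot_smult \<sigma>.add \<sigma>.smult intro!: tot_ext)
  show "drop2 n \<in> mod_hom R (T (Suc (Suc n))) (T n)"
    by (rule mod_homI) (auto simp: drop2_def tot_add tot_smult intro!: tot_restrict tot_ext, auto intro: tot_nth)
  fix x
  show "col0 n (dK n x) = tot_d R M n (col0 (Suc n) x)" if "x \<in> carrier (K (Suc n))"
    using that by (auto simp: col0_def tot_d_eq \<sigma>_chain vert_0 Suc_diff_le intro!: tot_ext)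
  show "drop2 n (col0 (Suc (Suc n)) x) = \<zero>\<^bsub>T n\<^esub>" if "x \<in> carrier (K (Suc (Suc n)))"
    by (auto simp: drop2_def col0_def tot_zero intro!: tot_ext)
next
  fix n y
  show "drop2 n (tot_d R M (Suc (Suc n)) y) = tot_d R M n (drop2 (Suc n) y)" 
    by (auto simp: drop2_def tot_d_eq vert_def horiz_def intro!: tot_ext)
next
  fix n z assume z: "z \<in> carrier (T n)"
  let ?y = "\<lambda>p\<in>{..Suc (Suc n)}. if p < 2 then \<zero>\<^bsub>C (Suc (Suc n) - p)\<^esub> else z (p - 2)"
  have "?y \<in> carrier (T (Suc (Suc n)))" using z by (intro tot_restrict) (auto intro!: tot_nth[OF z])
  moreover have "drop2 n ?y = z"
    using z by (intro tot_eqI[of _ n] ) (auto simp: drop2_def intro!: tot_restrict tot_nth[OF z])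
  ultimately show "\<exists>y\<in>carrier (T (Suc (Suc n))). drop2 n y = z" by blast
next
  fix n x y
  assume "x \<in> carrier (K n)" "y \<in> carrier (T (Suc n))" "\<And>m. n = Suc m \<Longrightarrow> drop2 m y = \<zero>\<^bsub>T m\<^esub>"
    "col0 n x = tot_d R M n y"
  then show "\<exists>x'\<in>carrier (K (Suc n)). x = dK n x'"
    by (intro model_quasi_inj) (auto simp: drop2_zero_iff numeral_2_eq_2)
next
  fix n z
  assume z: "z \<in> cycles (tot_mod R M) (tot_d R M) n" and pz: "\<And>m. n = Suc (Suc m) \<Longrightarrow> drop2 m z = \<zero>\<^bsub>T m\<^esub>"
  have "z p = \<zero>\<^bsub>C (n - p)\<^esub>" if p: "p \<le> n" "2 \<le> p" for p
  proof -
    have n: "n = Suc (Suc (n - 2))" and p': "Suc (Suc (p - 2)) = p" "n - 2 - (p - 2) = n - p" "p - 2 \<le> n - 2"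
      using p by auto
    from pz[OF n] show ?thesis unfolding drop2_zero_iff using p' by metis
  qed
  from model_quasi_surj[OF z this]
  obtain x y where x: "x \<in> cycles K dK n" and y: "y \<in> carrier (T (Suc n))"
    and y2: "\<And>p. p \<le> Suc n \<Longrightarrow> 2 \<le> p \<Longrightarrow> y p = \<zero>\<^bsub>C (Suc n - p)\<^esub>"
    and e: "z = col0 n x \<oplus>\<^bsub>T n\<^esub> tot_d R M n y" by blast
  have "drop2 m y = \<zero>\<^bsub>T m\<^esub>" if "n = Suc m" for m
    using y2 that by (auto simp: drop2_zero_iff)
  then show "\<exists>x\<in>cycles K dK n. \<exists>y\<in>carrier (T (Suc n)). (\<forall>m. n = Suc m \<longrightarrow> drop2 m y = \<zero>\<^bsub>T m\<^esub>) \<and>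
      z = col0 n x \<oplus>\<^bsub>T n\<^esub> tot_d R M n y"
    using x y e by blast
qed

theorem HC_periodicity:
  "\<exists>I D. periodicity_sequence_exact R (homology_mod K dK) (HC R M) I (periodicity R M) D"
proof -
  \<comment> \<open>The abstract map \<open>S\<close> is literally the periodicity operator; the
    other two maps stay existential.\<close>
  have "P.S = periodicity R M"
    by (simp add: fun_eq_iff periodicity_def drop2_def[abs_def])
  then show ?thesis using P.periodicity_exact unfolding HC_def by metis
qed

end

section \<open>Averaging over a finite group of units\<close>

context module
begin

lemma finsum_const_smult:
  assumes "finite S" "x \<in> carrier M"
  shows "(\<Oplus>\<^bsub>M\<^esub>g\<in>S. x) = ([card S] \<cdot>\<^bsub>R\<^esub> \<one>\<^bsub>R\<^esub>) \<odot>\<^bsub>M\<^esub> x"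
  using assms(1)
proof (induction S)
  case empty
  then show ?case using assms(2) by simp
next
  case (insert g S)
  then show ?case
    using assms(2) by (simp add: smult_l_distr M.a_comm)
qed

text \<open>Read \<open>z j i\<close> as \<open>d_j h_i\<close> and \<open>w i j\<close> as
  \<open>h_i d_j\<close>, both applied to a fixed chain. By the identities of a presimplicial
  homotopy the terms off the diagonals \<open>j = i\<close> and \<open>j = i + 1\<close> cancel
  against \<open>w\<close>, and the two diagonals telescope along \<open>F\<close>. The range
  \<open>{..<n}\<close> makes the second double sum empty in degree 0.\<close>

lemma homotopy_sum:
  assumes z: "\<And>i j. i \<le> n \<Longrightarrow> j \<le> Suc n \<Longrightarrow> z j i \<in> carrier M"
    and w: "\<And>i j. i < n \<Longrightarrow> j \<le> n \<Longrightarrow> w i j \<in> carrier M"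
    and F: "\<And>i. i \<le> Suc n \<Longrightarrow> F i \<in> carrier M"
    and less: "\<And>i j. j < i \<Longrightarrow> i \<le> n \<Longrightarrow> z j i = w (i - 1) j"
    and gr: "\<And>i j. Suc i < j \<Longrightarrow> j \<le> Suc n \<Longrightarrow> z j i = w i (j - 1)"
    and eq: "\<And>i. i \<le> n \<Longrightarrow> z i i = F i" "\<And>i. i \<le> n \<Longrightarrow> z (Suc i) i = F (Suc i)"
  shows "(\<Oplus>\<^bsub>M\<^esub>j\<in>{..Suc n}. \<Oplus>\<^bsub>M\<^esub>i\<in>{..n}. signed M (j + i) (z j i)) \<oplus>\<^bsub>M\<^esub>
      (\<Oplus>\<^bsub>M\<^esub>i\<in>{..<n}. \<Oplus>\<^bsub>M\<^esub>j\<in>{..n}. signed M (i + j) (w i j)) = F 0 \<ominus>\<^bsub>M\<^esub> F (Suc n)"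
proof -
  define f where "f p = signed M (fst p + snd p) (z (fst p) (snd p))" for p
  define g where "g p = signed M (fst p + snd p) (w (fst p) (snd p))" for p
  let ?A = "{..Suc n} \<times> {..n}"
  let ?W = "{..<n} \<times> {..n}"
  define B where "B = {p \<in> ?A. fst p < snd p \<or> Suc (snd p) < fst p}"
  let ?d = "\<lambda>i. (i, i)" and ?s = "\<lambda>i. (Suc i, i)"
  have f: "f p \<in> carrier M" if "p \<in> ?A" for p using that z by (auto simp: f_def)
  have g: "g p \<in> carrier M" if "p \<in> ?W" for p using that w by (auto simp: g_def)
  have gW: "g \<in> ?W \<rightarrow> carrier M" using g by blast
  have fd: "f (i, i) = F i" and fs: "f (Suc i, i) = \<ominus>\<^bsub>M\<^esub> F (Suc i)" if "i \<le> n" for i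
    using that eq F by (auto simp: f_def signed_def)
  have "(\<Oplus>\<^bsub>M\<^esub>j\<in>{..Suc n}. \<Oplus>\<^bsub>M\<^esub>i\<in>{..n}. signed M (j + i) (z j i)) = (\<Oplus>\<^bsub>M\<^esub>p\<in>?A. f p)"
    using finsum_prod[of "{..Suc n}" "{..n}" f, OF _ _ Pi_I[OF f]] by (simp add: f_def)
  also have "?A = B \<union> (?d ` {..n} \<union> ?s ` {..n})"
    by (auto simp: B_def image_iff)
  also have "(\<Oplus>\<^bsub>M\<^esub>p\<in>B \<union> (?d ` {..n} \<union> ?s ` {..n}). f p) =
      (\<Oplus>\<^bsub>M\<^esub>p\<in>B. f p) \<oplus>\<^bsub>M\<^esub> (\<Oplus>\<^bsub>M\<^esub>p\<in>?d ` {..n} \<union> ?s ` {..n}. f p)"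
    by (rule M.finsum_Un_disjoint) (auto simp: B_def intro!: f)
  also have "(\<Oplus>\<^bsub>M\<^esub>p\<in>?d ` {..n} \<union> ?s ` {..n}. f p) = (\<Oplus>\<^bsub>M\<^esub>p\<in>?d ` {..n}. f p) \<oplus>\<^bsub>M\<^esub> (\<Oplus>\<^bsub>M\<^esub>p\<in>?s ` {..n}. f p)"
    by (rule M.finsum_Un_disjoint) (auto intro!: f)
  also have "(\<Oplus>\<^bsub>M\<^esub>p\<in>?d ` {..n}. f p) = (\<Oplus>\<^bsub>M\<^esub>i\<in>{..n}. F i)"
    using fd F by (subst M.finsum_reindex) (auto simp: inj_on_def intro!: f M.finsum_cong')
  also have "(\<Oplus>\<^bsub>M\<^esub>p\<in>?s ` {..n}. f p) = (\<Oplus>\<^bsub>M\<^esub>i\<in>{..n}. \<ominus>\<^bsub>M\<^esub> F (Suc i))"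
    using fs F by (subst M.finsum_reindex) (auto simp: inj_on_def intro!: f M.finsum_cong')
  also have "\<dots> = \<ominus>\<^bsub>M\<^esub> (\<Oplus>\<^bsub>M\<^esub>i\<in>{..n}. F (Suc i))"
    using F by (intro finsum_neg[symmetric]) auto
  also have "(\<Oplus>\<^bsub>M\<^esub>p\<in>B. f p) = (\<Oplus>\<^bsub>M\<^esub>p\<in>?W. \<ominus>\<^bsub>M\<^esub> g p)"
  proof (rule finsum_bij)
    let ?h = "\<lambda>(j, i). if j < i then (i - 1, j) else (i, j - 1)"
    let ?h' = "\<lambda>(i, j). if j \<le> i then (j, Suc i) else (Suc j, i)"
    show "bij_betw ?h B ?W"
      by (rule bij_betw_byWitness[where f' = ?h']) (auto simp: B_def split: if_splits)
    show "(\<lambda>p. \<ominus>\<^bsub>M\<^esub> g p) \<in> ?W \<rightarrow> carrier M" using g by blast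
    fix p assume "p \<in> B"
    then obtain j i where ji: "p = (j, i)" "j \<le> Suc n" "i \<le> n" "j < i \<or> Suc i < j"
      by (auto simp: B_def)
    show "f p = \<ominus>\<^bsub>M\<^esub> g (?h p)"
    proof (cases "j < i")
      case True
      then obtain i' where "i = Suc i'" by (cases i) auto
      then show ?thesis
        using True ji less[of j i] w[of i' j] by (simp add: f_def g_def signed_Suc add.commute)
    next
      case False
      then obtain j' where "j = Suc j'" "i < j'" using ji by (cases j) auto
      then show ?thesis
        using False ji gr[of i j] w[of i j'] by (simp add: f_def g_def signed_Suc add.commute)
    qed
  qed
  also have "\<dots> = \<ominus>\<^bsub>M\<^esub> (\<Oplus>\<^bsub>M\<^esub>p\<in>?W. g p)"
    using gW by (rule finsum_neg[symmetric])
  also have "(\<Oplus>\<^bsub>M\<^esub>p\<in>?W. g p) = (\<Oplus>\<^bsub>M\<^esub>i\<in>{..<n}. \<Oplus>\<^bsub>M\<^esub>j\<in>{..n}. signed M (i + j) (w i j))"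
    using finsum_prod[of "{..<n}" "{..n}" g, OF _ _ gW] by (simp add: g_def)
  finally have 1: "(\<Oplus>\<^bsub>M\<^esub>j\<in>{..Suc n}. \<Oplus>\<^bsub>M\<^esub>i\<in>{..n}. signed M (j + i) (z j i)) =
      \<ominus>\<^bsub>M\<^esub> (\<Oplus>\<^bsub>M\<^esub>i\<in>{..<n}. \<Oplus>\<^bsub>M\<^esub>j\<in>{..n}. signed M (i + j) (w i j)) \<oplus>\<^bsub>M\<^esub>
        ((\<Oplus>\<^bsub>M\<^esub>i\<in>{..n}. F i) \<oplus>\<^bsub>M\<^esub> \<ominus>\<^bsub>M\<^esub> (\<Oplus>\<^bsub>M\<^esub>i\<in>{..n}. F (Suc i)))" .
  have FF: "F \<in> {..Suc n} \<rightarrow> carrier M" using F by auto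
  have c: "(\<Oplus>\<^bsub>M\<^esub>i\<in>{..n}. F i) \<in> carrier M" "(\<Oplus>\<^bsub>M\<^esub>i\<in>{..n}. F (Suc i)) \<in> carrier M"
    "(\<Oplus>\<^bsub>M\<^esub>i\<in>{..<n}. \<Oplus>\<^bsub>M\<^esub>j\<in>{..n}. signed M (i + j) (w i j)) \<in> carrier M" "F 0 \<in> carrier M" "F (Suc n) \<in> carrier M"
    using F w by (auto intro!: M.finsum_closed)
  \<comment> \<open>Splitting the sum over \<open>{..Suc n}\<close> once at the top and once at the
    bottom takes the place of a telescoping argument.\<close>
  have "(\<Oplus>\<^bsub>M\<^esub>i\<in>{..n}. F i) \<oplus>\<^bsub>M\<^esub> F (Suc n) = F 0 \<oplus>\<^bsub>M\<^esub> (\<Oplus>\<^bsub>M\<^esub>i\<in>{..n}. F (Suc i))"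
    using finsum_Suc_top[OF FF] finsum_Suc_bot[OF FF] by simp
  then have "(\<Oplus>\<^bsub>M\<^esub>i\<in>{..n}. F i) = F 0 \<oplus>\<^bsub>M\<^esub> (\<Oplus>\<^bsub>M\<^esub>i\<in>{..n}. F (Suc i)) \<ominus>\<^bsub>M\<^esub> F (Suc n)"
    using c by (metis minus_eq_iff M.add.m_closed)
  also have "\<dots> = (F 0 \<ominus>\<^bsub>M\<^esub> F (Suc n)) \<oplus>\<^bsub>M\<^esub> (\<Oplus>\<^bsub>M\<^esub>i\<in>{..n}. F (Suc i))"
    using c by (simp add: a_minus_def M.a_ac)
  finally have 2: "(\<Oplus>\<^bsub>M\<^esub>i\<in>{..n}. F i) = (F 0 \<ominus>\<^bsub>M\<^esub> F (Suc n)) \<oplus>\<^bsub>M\<^esub> (\<Oplus>\<^bsub>M\<^esub>i\<in>{..n}. F (Suc i))" .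
  have e: "(\<ominus>\<^bsub>M\<^esub> X \<oplus>\<^bsub>M\<^esub> (D \<oplus>\<^bsub>M\<^esub> Y \<oplus>\<^bsub>M\<^esub> \<ominus>\<^bsub>M\<^esub> Y)) \<oplus>\<^bsub>M\<^esub> X = D"
    if "X \<in> carrier M" "Y \<in> carrier M" "D \<in> carrier M" for X Y D
    using that by (simp add: M.a_assoc M.r_neg M.a_comm[of _ X] M.r_neg2)
  show ?thesis
    unfolding 1 2 using c by (intro e) auto
qed

end

text \<open>Averaging is set up for any finite group mapped to the units of an algebra, so that the
  crossed product stays out of sight. Multiplicativity makes \<open>u (inv g)\<close> the inverse of
  \<open>u g\<close>, and \<open>\<gamma>\<close> is the inverse of the group order.\<close>

locale unit_group = assoc_algebra R M + \<Gamma>: group \<Gamma>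
  for R :: "('k, 'r) ring_scheme" and M :: "('k, 'a, 'm) module_scheme" (structure)
    and \<Gamma> :: "('g, 'h) monoid_scheme" +
  fixes u :: "'g \<Rightarrow> 'a" and \<gamma> :: 'k
  assumes finite_\<Gamma>: "finite (carrier \<Gamma>)"
    and u_closed: "g \<in> carrier \<Gamma> \<Longrightarrow> u g \<in> carrier M"
    and u_mult: "g \<in> carrier \<Gamma> \<Longrightarrow> h \<in> carrier \<Gamma> \<Longrightarrow> u (g \<otimes>\<^bsub>\<Gamma>\<^esub> h) = u g \<otimes>\<^bsub>M\<^esub> u h"
    and u_one: "u \<one>\<^bsub>\<Gamma>\<^esub> = \<one>\<^bsub>M\<^esub>"
    and \<gamma>_closed: "\<gamma> \<in> carrier R"
    and \<gamma>_inverse: "\<gamma> \<otimes>\<^bsub>R\<^esub> ([card (carrier \<Gamma>)] \<cdot>\<^bsub>R\<^esub> \<one>\<^bsub>R\<^esub>) = \<one>\<^bsub>R\<^esub>"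
begin

definition act :: "nat \<Rightarrow> nat \<Rightarrow> 'g \<Rightarrow> ('a list \<Rightarrow> 'k) set \<Rightarrow> ('a list \<Rightarrow> 'k) set"
  where "act n i g = wop n n (wact M i (u g) (u (inv\<^bsub>\<Gamma>\<^esub> g)))"

lemma wm_act: "g \<in> carrier \<Gamma> \<Longrightarrow> word_map R M m M m (wact M i (u g) (u (inv\<^bsub>\<Gamma>\<^esub> g)))"
  by (intro word_map_wact u_closed \<Gamma>.inv_closed)

lemma act_hom: "g \<in> carrier \<Gamma> \<Longrightarrow> act n i g \<in> mod_hom R (C n) (C n)"
  unfolding act_def by (intro wop_hom wm_act)

lemma act_closed: "g \<in> carrier \<Gamma> \<Longrightarrow> x \<in> carrier (C n) \<Longrightarrow> act n i g x \<in> carrier (C n)"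
  by (rule mod_hom_closed[OF act_hom])

lemma act_gen: "g \<in> carrier \<Gamma> \<Longrightarrow> w \<in> tuples M (Suc n) \<Longrightarrow>
    act n i g (gen n w) = gen n (wact M i (u g) (u (inv\<^bsub>\<Gamma>\<^esub> g)) w)"
  unfolding act_def by (rule wop_gen[OF wm_act])

text \<open>The letter in front of the gap collects its units on the right, so \<open>g\<close>
  after \<open>h\<close> acts through the product of \<open>h\<close> and \<open>g\<close>: this is
  a right action.\<close>

lemma act_act:
  assumes "g \<in> carrier \<Gamma>" "h \<in> carrier \<Gamma>" "i \<le> n" "x \<in> carrier (C n)"
  shows "act n i g (act n i h x) = act n i (h \<otimes>\<^bsub>\<Gamma>\<^esub> g) x"
  unfolding act_def
  by (rule wop_comp1[OF wm_act wm_act wm_act])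
    (use assms in \<open>simp_all add: wact_wact u_closed u_mult \<Gamma>.inv_mult_group\<close>)

lemma act_commute:
  assumes "g \<in> carrier \<Gamma>" "h \<in> carrier \<Gamma>" "i \<noteq> j" "i \<le> n" "j \<le> n" "x \<in> carrier (C n)"
  shows "act n i g (act n j h x) = act n j h (act n i g x)"
  unfolding act_def
  by (rule wop_comp[OF wm_act wm_act wm_act wm_act])
    (use assms in \<open>simp_all add: wact_commute u_closed\<close>)

lemma face_act_less:
  assumes "g \<in> carrier \<Gamma>" "l < j" "j \<le> Suc n" "x \<in> carrier (C (Suc n))"
  shows "face n j (act (Suc n) l g x) = act n l g (face n j x)"
  unfolding act_def face_def
  by (rule wop_comp[OF wm_act word_map_wface word_map_wface wm_act])
    (use assms in \<open>simp_all add: wface_wact_less u_closed\<close>)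

lemma face_act_same:
  assumes "g \<in> carrier \<Gamma>" "j \<le> n" "x \<in> carrier (C (Suc n))"
  shows "face n j (act (Suc n) j g x) = face n j x"
  unfolding act_def face_def
  by (rule wop_comp1[OF wm_act word_map_wface word_map_wface])
    (use assms in \<open>simp_all add: wface_wact_same u_closed u_mult[symmetric] u_one\<close>)

lemma face_act_greater:
  assumes "g \<in> carrier \<Gamma>" "j < l" "l \<le> n" "x \<in> carrier (C (Suc n))"
  shows "face n j (act (Suc n) l g x) = act n (l - 1) g (face n j x)"
  unfolding act_def face_def
  by (rule wop_comp[OF wm_act word_map_wface word_map_wface wm_act])
    (use assms in \<open>simp_all add: wface_wact_greater u_closed\<close>)

lemma average_const:
  assumes "module R N" "x \<in> carrier N"
  shows "\<gamma> \<odot>\<^bsub>N\<^esub> (\<Oplus>\<^bsub>N\<^esub>g\<in>carrier \<Gamma>. x) = x"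
proof -
  interpret N: module R N by fact
  have "\<gamma> \<odot>\<^bsub>N\<^esub> (\<Oplus>\<^bsub>N\<^esub>g\<in>carrier \<Gamma>. x) = (\<gamma> \<otimes>\<^bsub>R\<^esub> ([card (carrier \<Gamma>)] \<cdot>\<^bsub>R\<^esub> \<one>\<^bsub>R\<^esub>)) \<odot>\<^bsub>N\<^esub> x"
    using assms(2) \<gamma>_closed by (simp add: N.finsum_const_smult[OF finite_\<Gamma>] N.smult_assoc1)
  then show ?thesis using assms(2) by (simp add: \<gamma>_inverse)
qed

definition E :: "nat \<Rightarrow> nat \<Rightarrow> ('a list \<Rightarrow> 'k) set \<Rightarrow> ('a list \<Rightarrow> 'k) set"
  where "E n i x = \<gamma> \<odot>\<^bsub>C n\<^esub> (\<Oplus>\<^bsub>C n\<^esub>g\<in>carrier \<Gamma>. act n i g x)"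

lemma E_hom: "E n i \<in> mod_hom R (C n) (C n)"
  unfolding E_def[abs_def]
  by (intro mod_hom_smultI mod_hom_finsum hoch_module act_hom \<gamma>_closed)

end

sublocale unit_group \<subseteq> E: linear_map R "hoch_mod R M n" "hoch_mod R M n" "E n i" for n i
  by (intro linear_mapI hoch_module E_hom)

context unit_group
begin

lemma linear_E:
  assumes "module R N" "f \<in> mod_hom R (C n) N" "x \<in> carrier (C n)"
  shows "f (E n i x) = \<gamma> \<odot>\<^bsub>N\<^esub> (\<Oplus>\<^bsub>N\<^esub>g\<in>carrier \<Gamma>. f (act n i g x))"
proof -
  interpret f: linear_map R "C n" N f by (intro linear_mapI hoch_module assms(1,2))
  show ?thesis
    unfolding E_def using assms(3) \<gamma>_closed act_closed
    by (subst f.smult) (auto simp: f.finsum Pi_iff)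
qed

lemma sum_cong:
  assumes "module R N" "\<And>g. g \<in> carrier \<Gamma> \<Longrightarrow> f g = f' g" "\<And>g. g \<in> carrier \<Gamma> \<Longrightarrow> f' g \<in> carrier N"
  shows "(\<Oplus>\<^bsub>N\<^esub>g\<in>carrier \<Gamma>. f g) = (\<Oplus>\<^bsub>N\<^esub>g\<in>carrier \<Gamma>. f' g)"
proof -
  interpret N: module R N by fact
  show ?thesis using assms(2,3) by (intro N.finsum_cong') auto
qed

text \<open>Translation by \<open>h\<close> permutes the summands of the average.\<close>

lemma E_act_same:
  assumes h: "h \<in> carrier \<Gamma>" and i: "i \<le> n" and x: "x \<in> carrier (C n)"
  shows "E n i (act n i h x) = E n i x"
proof -
  have "(\<Oplus>\<^bsub>C n\<^esub>g\<in>carrier \<Gamma>. act n i g (act n i h x)) = (\<Oplus>\<^bsub>C n\<^esub>g\<in>carrier \<Gamma>. act n i g x)"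
  proof (rule C.finsum_bij)
    show "bij_betw (\<lambda>g. h \<otimes>\<^bsub>\<Gamma>\<^esub> g) (carrier \<Gamma>) (carrier \<Gamma>)"
      by (rule bij_betw_byWitness[where f' = "\<lambda>g. inv\<^bsub>\<Gamma>\<^esub> h \<otimes>\<^bsub>\<Gamma>\<^esub> g"])
        (use h in \<open>auto simp: \<Gamma>.m_assoc[symmetric]\<close>)
    show "(\<lambda>g. act n i g x) \<in> carrier \<Gamma> \<rightarrow> carrier (C n)" using x act_closed by blast
  qed (use act_act h i x in blast)
  then show ?thesis by (simp add: E_def)
qed

lemma E_act_commute:
  assumes "h \<in> carrier \<Gamma>" "i \<noteq> j" "i \<le> n" "j \<le> n" "x \<in> carrier (C n)"
  shows "E n i (act n j h x) = act n j h (E n i x)"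
  unfolding linear_E[OF hoch_module act_hom[OF assms(1)] assms(5)] E_def[of n i "act n j h x"]
  using assms act_closed by (intro arg_cong[where f = "(\<odot>\<^bsub>C n\<^esub>) \<gamma>"] sum_cong hoch_module act_commute) auto

lemma face_E_less:
  assumes "l < j" "j \<le> Suc n" "x \<in> carrier (C (Suc n))"
  shows "face n j (E (Suc n) l x) = E n l (face n j x)"
  unfolding linear_E[OF hoch_module face_hom assms(3)] E_def[of n l]
  using assms by (intro arg_cong[where f = "(\<odot>\<^bsub>C n\<^esub>) \<gamma>"] sum_cong hoch_module face_act_less act_closed) auto

text \<open>All summands agree once the gap is closed, and \<open>\<gamma>\<close> times their
  number is one.\<close>

lemma face_E_same:
  assumes "j \<le> n" "x \<in> carrier (C (Suc n))"
  shows "face n j (E (Suc n) j x) = face n j x"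
proof -
  have "(\<Oplus>\<^bsub>C n\<^esub>g\<in>carrier \<Gamma>. face n j (act (Suc n) j g x)) = (\<Oplus>\<^bsub>C n\<^esub>g\<in>carrier \<Gamma>. face n j x)"
    using assms by (intro sum_cong hoch_module face_act_same) auto
  then show ?thesis
    unfolding linear_E[OF hoch_module face_hom assms(2)]
    using assms(2) by (simp only: average_const[OF hoch_module] face.closed)
qed

lemma face_E_greater:
  assumes "j < l" "l \<le> n" "x \<in> carrier (C (Suc n))"
  shows "face n j (E (Suc n) l x) = E n (l - 1) (face n j x)"
  unfolding linear_E[OF hoch_module face_hom assms(3)] E_def[of n "l - 1"]
  using assms by (intro arg_cong[where f = "(\<odot>\<^bsub>C n\<^esub>) \<gamma>"] sum_cong hoch_module face_act_greater act_closed) auto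

text \<open>\<open>F n m\<close> averages over the gaps \<open>0, ..., m - 1\<close>. It runs from
  the identity at \<open>m = 0\<close> to the full average at \<open>m = n + 1\<close>; these are
  the stages along which the homotopy telescopes.\<close>

primrec F :: "nat \<Rightarrow> nat \<Rightarrow> ('a list \<Rightarrow> 'k) set \<Rightarrow> ('a list \<Rightarrow> 'k) set" where
  "F n 0 x = x"
| "F n (Suc i) x = F n i (E n i x)"

lemma F_hom: "F n i \<in> mod_hom R (C n) (C n)"
proof (induction i)
  case 0
  then show ?case using mod_hom_id by simp
next
  case (Suc i)
  then show ?case using mod_hom_comp[OF E_hom Suc] by simp
qed

end

sublocale unit_group \<subseteq> F: linear_map R "hoch_mod R M n" "hoch_mod R M n" "F n i" for n i
  by (intro linear_mapI hoch_module F_hom)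

context unit_group
begin

lemma F_act:
  assumes h: "h \<in> carrier \<Gamma>"
  shows "i < m \<Longrightarrow> m \<le> Suc n \<Longrightarrow> x \<in> carrier (C n) \<Longrightarrow> F n m (act n i h x) = F n m x"
proof (induction m arbitrary: x)
  case (Suc m)
  show ?case
  proof (cases "i = m")
    case True
    then show ?thesis using Suc.prems h by (simp add: E_act_same)
  next
    case False
    then show ?thesis using Suc h by (simp add: E_act_commute)
  qed
qed simp

lemma F_E:
  assumes "x \<in> carrier (C n)" "i < m" "m \<le> Suc n"
  shows "F n m (E n i x) = F n m x"
proof -
  have "(\<Oplus>\<^bsub>C n\<^esub>g\<in>carrier \<Gamma>. F n m (act n i g x)) = (\<Oplus>\<^bsub>C n\<^esub>g\<in>carrier \<Gamma>. F n m x)"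
    using assms by (intro sum_cong hoch_module F_act) auto
  then show ?thesis
    unfolding linear_E[OF hoch_module F_hom assms(1)]
    using assms(1) by (simp only: average_const[OF hoch_module] F.closed)
qed

lemma F_F:
  assumes "m \<le> Suc n"
  shows "k \<le> m \<Longrightarrow> x \<in> carrier (C n) \<Longrightarrow> F n m (F n k x) = F n m x"
proof (induction k arbitrary: x)
  case (Suc k)
  then show ?case using assms by (simp add: F_E)
qed simp

lemma face_F_le:
  assumes "j \<le> Suc n"
  shows "i \<le> j \<Longrightarrow> x \<in> carrier (C (Suc n)) \<Longrightarrow> face n j (F (Suc n) i x) = F n i (face n j x)"
proof (induction i arbitrary: x)
  case (Suc i)
  then show ?case using assms by (simp add: face_E_less)
qed simp

text \<open>Of the averages over the gaps \<open>0, ..., i\<close> the one over the closed gap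
  \<open>j\<close> disappears and those beyond it shift down by one, which leaves the gaps
  \<open>0, ..., i - 1\<close>.\<close>

lemma face_F_gr:
  assumes "j \<le> i"
  shows "i \<le> n \<Longrightarrow> x \<in> carrier (C (Suc n)) \<Longrightarrow> face n j (F (Suc n) (Suc i) x) = F n i (face n j x)"
  using assms
proof (induction i arbitrary: x rule: dec_induct)
  case base
  then show ?case by (simp add: face_F_le face_E_same)
next
  case (step i)
  have "face n j (F (Suc n) (Suc (Suc i)) x) = face n j (F (Suc n) (Suc i) (E (Suc n) (Suc i) x))"
    by simp
  also have "\<dots> = F n i (face n j (E (Suc n) (Suc i) x))"
    using step by (intro step.IH) auto
  also have "\<dots> = F n (Suc i) (face n j x)"
    using step by (simp add: face_E_greater)
  finally show ?case .
qed

definition P :: "nat \<Rightarrow> ('a list \<Rightarrow> 'k) set \<Rightarrow> ('a list \<Rightarrow> 'k) set"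
  where "P n = F n (Suc n)"

lemma P_hom: "P n \<in> mod_hom R (C n) (C n)"
  unfolding P_def by (rule F_hom)

end

sublocale unit_group \<subseteq> P: linear_map R "hoch_mod R M n" "hoch_mod R M n" "P n" for n
  by (intro linear_mapI hoch_module P_hom)

context unit_group
begin

lemma P_act: "h \<in> carrier \<Gamma> \<Longrightarrow> i \<le> n \<Longrightarrow> x \<in> carrier (C n) \<Longrightarrow> P n (act n i h x) = P n x"
  unfolding P_def by (rule F_act) auto

lemma P_P: "x \<in> carrier (C n) \<Longrightarrow> P n (P n x) = P n x"
  unfolding P_def by (rule F_F) auto

definition htp :: "nat \<Rightarrow> nat \<Rightarrow> ('a list \<Rightarrow> 'k) set \<Rightarrow> ('a list \<Rightarrow> 'k) set"
  where "htp n i x = F (Suc n) (Suc i) (degen n (Suc i) x)"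

lemma htp_hom: "i \<le> n \<Longrightarrow> htp n i \<in> mod_hom R (C n) (C (Suc n))"
  unfolding htp_def[abs_def] by (rule mod_hom_comp[OF degen_hom F_hom]) simp

lemma htp_closed: "i \<le> n \<Longrightarrow> x \<in> carrier (C n) \<Longrightarrow> htp n i x \<in> carrier (C (Suc n))"
  by (rule mod_hom_closed[OF htp_hom])

lemma face_degen_same: "i \<le> n \<Longrightarrow> j = i \<or> j = Suc i \<Longrightarrow> x \<in> carrier (C n) \<Longrightarrow> face n j (degen n (Suc i) x) = x"
  unfolding face_def degen_def
  by (rule wop_comp0[OF word_map_degen word_map_wface wface_ins_same]) simp_all

lemma face_degen_less: "i \<le> Suc n \<Longrightarrow> j < i \<Longrightarrow> x \<in> carrier (C (Suc n)) \<Longrightarrow>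
    face (Suc n) j (degen (Suc n) (Suc i) x) = degen n i (face n j x)"
  unfolding face_def degen_def
  by (rule wop_comp[OF word_map_degen word_map_wface word_map_wface word_map_degen wface_ins_less]) simp_all

lemma face_degen_greater: "Suc i < j \<Longrightarrow> j \<le> Suc (Suc n) \<Longrightarrow> x \<in> carrier (C (Suc n)) \<Longrightarrow>
    face (Suc n) j (degen (Suc n) (Suc i) x) = degen n (Suc i) (face n (j - 1) x)"
  unfolding face_def degen_def
  by (rule wop_comp[OF word_map_degen word_map_wface word_map_wface word_map_degen wface_ins_greater]) simp_all

text \<open>The inserted unit lies between gaps \<open>i\<close> and \<open>i + 1\<close>. Face
  \<open>i\<close> closes the last averaged gap and loses one average; face \<open>i + 1\<close>, in
  the next lemma, closes the gap behind the unit and loses none.\<close>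

lemma face_htp_diag: "i \<le> n \<Longrightarrow> x \<in> carrier (C n) \<Longrightarrow> face n i (htp n i x) = F n i x"
  unfolding htp_def by (simp add: face_F_gr face_degen_same degen_closed del: F.simps)

lemma face_htp_Suc: "i \<le> n \<Longrightarrow> x \<in> carrier (C n) \<Longrightarrow> face n (Suc i) (htp n i x) = F n (Suc i) x"
  unfolding htp_def by (simp add: face_F_le face_degen_same degen_closed del: F.simps)

lemma face_htp_less: "j < i \<Longrightarrow> i \<le> Suc n \<Longrightarrow> x \<in> carrier (C (Suc n)) \<Longrightarrow>
    face (Suc n) j (htp (Suc n) i x) = htp n (i - 1) (face n j x)"
  unfolding htp_def by (simp add: face_F_gr face_degen_less degen_closed del: F.simps)

lemma face_htp_greater: "Suc i < j \<Longrightarrow> j \<le> Suc (Suc n) \<Longrightarrow> x \<in> carrier (C (Suc n)) \<Longrightarrow>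
    face (Suc n) j (htp (Suc n) i x) = htp n i (face n (j - 1) x)"
  unfolding htp_def by (simp add: face_F_le face_degen_greater degen_closed del: F.simps)

definition H :: "nat \<Rightarrow> ('a list \<Rightarrow> 'k) set \<Rightarrow> ('a list \<Rightarrow> 'k) set"
  where "H n x = (\<Oplus>\<^bsub>C (Suc n)\<^esub>i\<in>{..n}. signed (C (Suc n)) i (htp n i x))"

lemma H_hom: "H n \<in> mod_hom R (C n) (C (Suc n))"
  unfolding H_def[abs_def] by (intro mod_hom_finsum mod_hom_signed hoch_module htp_hom) simp

end

sublocale unit_group \<subseteq> H: linear_map R "hoch_mod R M n" "hoch_mod R M (Suc n)" "H n" for n
  by (intro linear_mapI hoch_module H_hom)

context unit_group
begin

lemma b_H:
  assumes x: "x \<in> carrier (C n)"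
  shows "hoch_b R M n (H n x) =
    (\<Oplus>\<^bsub>C n\<^esub>j\<in>{..Suc n}. \<Oplus>\<^bsub>C n\<^esub>i\<in>{..n}. signed (C n) (j + i) (face n j (htp n i x)))"
proof -
  have "signed (C n) j (face n j (H n x)) = (\<Oplus>\<^bsub>C n\<^esub>i\<in>{..n}. signed (C n) (j + i) (face n j (htp n i x)))" for j
  proof -
    have "face n j (H n x) = (\<Oplus>\<^bsub>C n\<^esub>i\<in>{..n}. face n j (signed (C (Suc n)) i (htp n i x)))"
      unfolding H_def using htp_closed[OF _ x] by (intro face.finsum) auto
    then have "signed (C n) j (face n j (H n x)) =
        (\<Oplus>\<^bsub>C n\<^esub>i\<in>{..n}. signed (C n) j (face n j (signed (C (Suc n)) i (htp n i x))))"
      using htp_closed[OF _ x] by (simp only:) (rule C.finsum_signed, auto)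
    also have "\<dots> = (\<Oplus>\<^bsub>C n\<^esub>i\<in>{..n}. signed (C n) (j + i) (face n j (htp n i x)))"
      using htp_closed[OF _ x] by (intro C.finsum_cong') (auto simp: face.signed C.signed_signed)
    finally show ?thesis .
  qed
  then show ?thesis using x by (simp only: hoch_b_eq H.closed)
qed

lemma H_b:
  assumes x: "x \<in> carrier (C (Suc n))"
  shows "H n (hoch_b R M n x) =
    (\<Oplus>\<^bsub>C (Suc n)\<^esub>i\<in>{..n}. \<Oplus>\<^bsub>C (Suc n)\<^esub>j\<in>{..Suc n}. signed (C (Suc n)) (i + j) (htp n i (face n j x)))"
  unfolding H_def
proof (rule C.finsum_cong'[OF refl])
  show "(\<lambda>i. \<Oplus>\<^bsub>C (Suc n)\<^esub>j\<in>{..Suc n}. signed (C (Suc n)) (i + j) (htp n i (face n j x))) \<in> {..n} \<rightarrow> carrier (C (Suc n))"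
    using x by (auto intro!: C.finsum_closed C.signed_closed htp_closed)
  fix i assume "i \<in> {..n}"
  then have i: "i \<le> n" by simp
  interpret h: linear_map R "C n" "C (Suc n)" "htp n i"
    by (intro linear_mapI hoch_module htp_hom i)
  have "htp n i (hoch_b R M n x) = (\<Oplus>\<^bsub>C (Suc n)\<^esub>j\<in>{..Suc n}. htp n i (signed (C n) j (face n j x)))"
    unfolding hoch_b_eq[OF x] by (rule h.finsum[OF signed_face_closed[OF x]])
  then have "signed (C (Suc n)) i (htp n i (hoch_b R M n x)) =
      (\<Oplus>\<^bsub>C (Suc n)\<^esub>j\<in>{..Suc n}. signed (C (Suc n)) i (htp n i (signed (C n) j (face n j x))))"
    using x by (simp only:) (rule C.finsum_signed, auto)
  then show "signed (C (Suc n)) i (htp n i (hoch_b R M n x)) =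
      (\<Oplus>\<^bsub>C (Suc n)\<^esub>j\<in>{..Suc n}. signed (C (Suc n)) (i + j) (htp n i (face n j x)))"
    using x by (simp add: h.signed C.signed_signed)
qed

lemma homotopy_0:
  assumes x: "x \<in> carrier (C 0)"
  shows "hoch_b R M 0 (H 0 x) = x \<ominus>\<^bsub>C 0\<^esub> P 0 x"
proof -
  \<comment> \<open>Degree 0 has no term \<open>H b\<close>. The index set \<open>{..<0}\<close> is
    empty, so zero can be inserted for \<open>w\<close>.\<close>
  have "(\<Oplus>\<^bsub>C 0\<^esub>j\<in>{..Suc 0}. \<Oplus>\<^bsub>C 0\<^esub>i\<in>{..0}. signed (C 0) (j + i) (face 0 j (htp 0 i x))) \<oplus>\<^bsub>C 0\<^esub>
      (\<Oplus>\<^bsub>C 0\<^esub>i\<in>{..<0}. \<Oplus>\<^bsub>C 0\<^esub>j\<in>{..0}. signed (C 0) (i + j) \<zero>\<^bsub>C 0\<^esub>) = F 0 0 x \<ominus>\<^bsub>C 0\<^esub> F 0 (Suc 0) x"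
    by (rule C.homotopy_sum[where w = "\<lambda>_ _. \<zero>\<^bsub>C 0\<^esub>" and F = "\<lambda>i. F 0 i x"])
      (use x in \<open>auto simp: htp_closed face_htp_diag face_htp_Suc simp del: F.simps\<close>)
  moreover have "hoch_b R M 0 (H 0 x) \<in> carrier (C 0)" using x by simp
  ultimately show ?thesis unfolding P_def b_H[OF x] by simp
qed

lemma homotopy_Suc:
  assumes x: "x \<in> carrier (C (Suc n))"
  shows "hoch_b R M (Suc n) (H (Suc n) x) \<oplus>\<^bsub>C (Suc n)\<^esub> H n (hoch_b R M n x) = x \<ominus>\<^bsub>C (Suc n)\<^esub> P (Suc n) x"
proof -
  let ?N = "Suc n"
  have "(\<Oplus>\<^bsub>C ?N\<^esub>j\<in>{..Suc ?N}. \<Oplus>\<^bsub>C ?N\<^esub>i\<in>{..?N}. signed (C ?N) (j + i) (face ?N j (htp ?N i x))) \<oplus>\<^bsub>C ?N\<^esub>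
      (\<Oplus>\<^bsub>C ?N\<^esub>i\<in>{..<?N}. \<Oplus>\<^bsub>C ?N\<^esub>j\<in>{..?N}. signed (C ?N) (i + j) (htp n i (face n j x))) =
      F ?N 0 x \<ominus>\<^bsub>C ?N\<^esub> F ?N (Suc ?N) x"
    by (rule C.homotopy_sum[where F = "\<lambda>i. F ?N i x"])
      (use x in \<open>auto simp: htp_closed face_htp_diag face_htp_Suc face_htp_less face_htp_greater simp del: F.simps\<close>)
  then show ?thesis unfolding P_def b_H[OF x] H_b[OF x] by (simp add: lessThan_Suc_atMost)
qed

text \<open>Applying \<open>b\<close> to the homotopy formula for \<open>x\<close>, and using the
  formula for the cycle \<open>b x\<close>, gives two expressions for
  \<open>b H b x\<close>.\<close>

lemma P_b:
  assumes x: "x \<in> carrier (C (Suc n))"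
  shows "hoch_b R M n (P (Suc n) x) = P n (hoch_b R M n x)"
proof -
  let ?b = "hoch_b R M n x"
  have c: "?b \<in> carrier (C n)" "P (Suc n) x \<in> carrier (C (Suc n))" using x by auto
  have "hoch_b R M n (x \<ominus>\<^bsub>C (Suc n)\<^esub> P (Suc n) x) = hoch_b R M n (H n ?b)"
    using x by (simp add: homotopy_Suc[OF x, symmetric] b.add b_b)
  moreover have "hoch_b R M n (H n ?b) = ?b \<ominus>\<^bsub>C n\<^esub> P n ?b"
  proof (cases n)
    case 0
    then show ?thesis using c homotopy_0 by simp
  next
    case (Suc m)
    then show ?thesis using homotopy_Suc[of ?b m] x by (simp add: b_b)
  qed
  ultimately have "?b \<ominus>\<^bsub>C n\<^esub> hoch_b R M n (P (Suc n) x) = ?b \<ominus>\<^bsub>C n\<^esub> P n ?b"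
    using x by (simp add: b.minus)
  then have "\<ominus>\<^bsub>C n\<^esub> hoch_b R M n (P (Suc n) x) = \<ominus>\<^bsub>C n\<^esub> P n ?b"
    unfolding a_minus_def using x by (rule_tac C.add_left_cancel'[of ?b n]) auto
  then show ?thesis using x C.minus_minus by (metis b.closed P.closed)
qed

end

section \<open>Automorphism groups\<close>

lemma alg_Aut_group:
  assumes "assoc_algebra R A"
  shows "group (alg_Aut R A)"
proof -
  interpret A: assoc_algebra R A by fact
  let ?S = "carrier A"
  let ?X = "Bij ?S \<inter> ring_hom A A \<inter> mod_hom R A A"
  have "subgroup ?X (BijGroup ?S)"
  proof (rule group.subgroupI[OF group_BijGroup])
    show "?X \<subseteq> carrier (BijGroup ?S)" by (auto simp: BijGroup_def)
    have "(\<lambda>x\<in>?S. x) \<in> ?X"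
      by (auto simp: id_Bij ring_hom_def mod_hom_def)
    then show "?X \<noteq> {}" by blast
  next
    fix f assume f: "f \<in> ?X"
    then have fB: "f \<in> Bij ?S" by blast
    have inv: "inv\<^bsub>BijGroup ?S\<^esub> f = (\<lambda>x\<in>?S. inv_into ?S f x)" using inv_BijGroup[OF fB] .
    have im: "f ` ?S = ?S" and inj: "inj_on f ?S" using fB by (auto simp: Bij_def bij_betw_def)
    have ic: "inv_into ?S f x \<in> ?S" if "x \<in> ?S" for x using that im by (simp add: inv_into_into)
    have fi: "f (inv_into ?S f x) = x" if "x \<in> ?S" for x using that im by (simp add: f_inv_into_f)
    \<comment> \<open>By injectivity, identities for the inverse reduce to the corresponding ones
      for \<open>f\<close>.\<close>
    have eqI: "inv_into ?S f y = x" if "x \<in> ?S" "f x = y" for x y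
      using that inj by (auto simp: inv_into_f_f)
    have fh: "f (x \<otimes>\<^bsub>A\<^esub> y) = f x \<otimes>\<^bsub>A\<^esub> f y" "f (x \<oplus>\<^bsub>A\<^esub> y) = f x \<oplus>\<^bsub>A\<^esub> f y" "f \<one>\<^bsub>A\<^esub> = \<one>\<^bsub>A\<^esub>"
      if "x \<in> ?S" "y \<in> ?S" for x y using f that by (auto simp: ring_hom_def)
    have fs: "f (c \<odot>\<^bsub>A\<^esub> x) = c \<odot>\<^bsub>A\<^esub> f x" if "c \<in> carrier R" "x \<in> ?S" for c x
      using f that by (auto simp: mod_hom_def)
    have "(\<lambda>x\<in>?S. inv_into ?S f x) \<in> ring_hom A A"
      using A.one_closed fh(3)[OF A.one_closed A.one_closed]
      by (intro ring_hom_memI) (auto simp: ic intro!: eqI simp: fh fi)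
    moreover have "(\<lambda>x\<in>?S. inv_into ?S f x) \<in> mod_hom R A A"
      by (intro mod_homI) (auto simp: ic intro!: eqI simp: fh fi fs)
    ultimately show "inv\<^bsub>BijGroup ?S\<^esub> f \<in> ?X"
      unfolding inv using restrict_inv_into_Bij[OF fB] by blast
  next
    fix f g assume fg: "f \<in> ?X" "g \<in> ?X"
    then have B: "f \<in> Bij ?S" "g \<in> Bij ?S" by auto
    have fc: "f x \<in> ?S" "g x \<in> ?S" if "x \<in> ?S" for x
      using B that Bij_imp_funcset by blast+
    have "compose ?S f g \<in> ring_hom A A"
      using fg fc by (intro ring_hom_memI) (auto simp: compose_eq ring_hom_def Pi_iff)
    moreover have "compose ?S f g \<in> mod_hom R A A"
      using fg fc by (intro mod_homI) (auto simp: compose_eq mod_hom_def Pi_iff)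
    ultimately show "f \<otimes>\<^bsub>BijGroup ?S\<^esub> g \<in> ?X"
      using B compose_Bij[OF B] by (simp add: BijGroup_def)
  qed
  then show ?thesis
    unfolding alg_Aut_def by (rule subgroup.subgroup_is_group[OF _ group_BijGroup])
qed

section \<open>The crossed product\<close>

locale crossed = assoc_algebra R A
  for R :: "('k, 'r) ring_scheme" and A :: "('k, 'a, 'm) module_scheme" (structure) +
  fixes G :: "('a \<Rightarrow> 'a) set" and \<gamma> :: 'k
  assumes G_subgroup: "subgroup G (alg_Aut R A)"
    and G_finite: "finite G"
    and \<gamma>_closed: "\<gamma> \<in> carrier R"
    and \<gamma>_inverse: "\<gamma> \<otimes>\<^bsub>R\<^esub> ([card G] \<cdot>\<^bsub>R\<^esub> \<one>\<^bsub>R\<^esub>) = \<one>\<^bsub>R\<^esub>"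
begin

text \<open>\<open>G\<close> as a group in its own right. Product and unit are those of
  \<open>alg_Aut\<close> by definition; agreement of the inverses rests on \<open>G\<close> being a
  subgroup.\<close>

definition \<Gamma> :: "('a \<Rightarrow> 'a) monoid" where "\<Gamma> = (alg_Aut R A)\<lparr>carrier := G\<rparr>"

lemma carrier_\<Gamma> [simp]: "carrier \<Gamma> = G"
  by (simp add: \<Gamma>_def)

lemma group_\<Gamma>: "group \<Gamma>"
  unfolding \<Gamma>_def by (rule subgroup.subgroup_is_group[OF G_subgroup alg_Aut_group[OF assoc_algebra_axioms]])

sublocale \<Gamma>: group \<Gamma>
  rewrites "carrier \<Gamma> = G"
  by (rule group_\<Gamma>) simp

abbreviation gm (infixl "\<cdot>" 70) where "g \<cdot> h \<equiv> g \<otimes>\<^bsub>\<Gamma>\<^esub> h"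
abbreviation gi where "gi g \<equiv> inv\<^bsub>\<Gamma>\<^esub> g"
abbreviation ge where "ge \<equiv> \<one>\<^bsub>\<Gamma>\<^esub>"

lemma alg_Aut_mult: "g \<otimes>\<^bsub>alg_Aut R A\<^esub> h = g \<cdot> h"
  by (simp add: \<Gamma>_def)

lemma alg_Aut_one: "\<one>\<^bsub>alg_Aut R A\<^esub> = ge"
  by (simp add: \<Gamma>_def)

lemma alg_Aut_inv: "g \<in> G \<Longrightarrow> inv\<^bsub>alg_Aut R A\<^esub> g = gi g"
  unfolding \<Gamma>_def by (rule group.m_inv_consistent[OF alg_Aut_group[OF assoc_algebra_axioms] G_subgroup, symmetric])

lemma G_memD: "g \<in> G \<Longrightarrow> g \<in> Bij (carrier A) \<and> g \<in> ring_hom A A \<and> g \<in> mod_hom R A A"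
  using subgroup.subset[OF G_subgroup] by (auto simp: alg_Aut_def)

lemma G_hom: "g \<in> G \<Longrightarrow> g \<in> mod_hom R A A"
  using G_memD by blast

lemma G_linear: "g \<in> G \<Longrightarrow> linear_map R A A g"
  by (intro linear_mapI module_axioms G_hom)

lemma G_closed [simp]: "g \<in> G \<Longrightarrow> x \<in> carrier A \<Longrightarrow> g x \<in> carrier A"
  by (rule mod_hom_closed[OF G_hom])

lemma G_mult: "g \<in> G \<Longrightarrow> x \<in> carrier A \<Longrightarrow> y \<in> carrier A \<Longrightarrow> g (x \<otimes> y) = g x \<otimes> g y"
  using G_memD[of g] ring_hom_mult[of g A A x y] by blast

lemma G_one [simp]: "g \<in> G \<Longrightarrow> g \<one> = \<one>"
  using G_memD[of g] ring_hom_one[of g A A] by blast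

lemma G_add: "g \<in> G \<Longrightarrow> x \<in> carrier A \<Longrightarrow> y \<in> carrier A \<Longrightarrow> g (x \<oplus> y) = g x \<oplus> g y"
  by (rule mod_hom_add[OF G_hom])

lemma G_zero [simp]: "g \<in> G \<Longrightarrow> g \<zero> = \<zero>"
  by (rule linear_map.zero[OF G_linear])

lemma G_finsum: "g \<in> G \<Longrightarrow> f \<in> I \<rightarrow> carrier A \<Longrightarrow> g (\<Oplus>i\<in>I. f i) = (\<Oplus>i\<in>I. g (f i))"
  by (rule linear_map.finsum[OF G_linear])

lemma gm_apply [simp]: "g \<in> G \<Longrightarrow> h \<in> G \<Longrightarrow> x \<in> carrier A \<Longrightarrow> (g \<cdot> h) x = g (h x)"
  using G_memD by (simp add: \<Gamma>_def alg_Aut_def BijGroup_def compose_eq)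

lemma ge_apply [simp]: "x \<in> carrier A \<Longrightarrow> ge x = x"
  by (simp add: \<Gamma>_def alg_Aut_def BijGroup_def)

lemma gi_apply [simp]: "g \<in> G \<Longrightarrow> x \<in> carrier A \<Longrightarrow> g (gi g x) = x" "g \<in> G \<Longrightarrow> x \<in> carrier A \<Longrightarrow> gi g (g x) = x"
  using gm_apply[of g "gi g" x] gm_apply[of "gi g" g x] by simp_all

abbreviation "B \<equiv> crossed_product R A G"

lemma B_carrier: "x \<in> carrier B \<longleftrightarrow> x \<in> extensional G \<and> (\<forall>g\<in>G. x g \<in> carrier A)"
  by (auto simp: crossed_product_def PiE_iff)

lemma B_nth [simp]: "x \<in> carrier B \<Longrightarrow> g \<in> G \<Longrightarrow> x g \<in> carrier A"
  by (simp add: B_carrier)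

lemma B_eqI: "x \<in> carrier B \<Longrightarrow> y \<in> carrier B \<Longrightarrow> (\<And>g. g \<in> G \<Longrightarrow> x g = y g) \<Longrightarrow> x = y"
  by (rule extensionalityI[of _ G]) (auto simp: B_carrier)

lemma B_add: "x \<oplus>\<^bsub>B\<^esub> y = (\<lambda>u\<in>G. x u \<oplus> y u)"
  by (simp add: crossed_product_def)

lemma B_smult: "c \<odot>\<^bsub>B\<^esub> x = (\<lambda>u\<in>G. c \<odot> x u)"
  by (simp add: crossed_product_def)

lemma B_zero: "\<zero>\<^bsub>B\<^esub> = (\<lambda>u\<in>G. \<zero>)"
  by (simp add: crossed_product_def)

lemma B_one: "\<one>\<^bsub>B\<^esub> = (\<lambda>u\<in>G. if u = ge then \<one> else \<zero>)"
  by (simp add: crossed_product_def alg_Aut_one)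

text \<open>A pair with product \<open>u\<close> is determined by its first entry.\<close>

lemma B_mult_nth:
  assumes x: "x \<in> carrier B" and y: "y \<in> carrier B" and u: "u \<in> G"
  shows "(x \<otimes>\<^bsub>B\<^esub> y) u = (\<Oplus>g\<in>G. x g \<otimes> g (y (gi g \<cdot> u)))"
proof -
  let ?S = "{p \<in> G \<times> G. fst p \<cdot> snd p = u}"
  have "(x \<otimes>\<^bsub>B\<^esub> y) u = (\<Oplus>p\<in>?S. x (fst p) \<otimes> (fst p) (y (snd p)))"
    using u by (simp add: crossed_product_def alg_Aut_mult)
  also have "\<dots> = (\<Oplus>g\<in>G. x g \<otimes> g (y (gi g \<cdot> u)))"
  proof (rule finsum_bij[where h = fst])
    show "bij_betw fst ?S G"
      by (rule bij_betw_byWitness[where f' = "\<lambda>g. (g, gi g \<cdot> u)"])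
        (use u in \<open>auto simp: \<Gamma>.m_assoc[symmetric]\<close>)
    show "(\<lambda>g. x g \<otimes> g (y (gi g \<cdot> u))) \<in> G \<rightarrow> carrier A"
      using x y u by auto
    fix p assume "p \<in> ?S"
    then have p: "fst p \<in> G" "snd p \<in> G" "fst p \<cdot> snd p = u" by auto
    then have "gi (fst p) \<cdot> u = snd p" by (auto simp: \<Gamma>.m_assoc[symmetric])
    then show "x (fst p) \<otimes> (fst p) (y (snd p)) = x (fst p) \<otimes> (fst p) (y (gi (fst p) \<cdot> u))" by simp
  qed
  finally show ?thesis .
qed

lemma B_mult_closed: "x \<in> carrier B \<Longrightarrow> y \<in> carrier B \<Longrightarrow> x \<otimes>\<^bsub>B\<^esub> y \<in> carrier B"
proof -
  assume xy: "x \<in> carrier B" "y \<in> carrier B"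
  have "x \<otimes>\<^bsub>B\<^esub> y \<in> extensional G" by (simp add: crossed_product_def)
  then show ?thesis using xy by (auto simp: B_carrier[of "x \<otimes>\<^bsub>B\<^esub> y"] B_mult_nth intro!: finsum_closed)
qed

lemma B_module: "module R B"
proof (rule moduleI)
  show "cring R" by (rule R.is_cring)
  show "abelian_group B"
  proof (rule abelian_groupI)
    fix x assume x: "x \<in> carrier B"
    show "\<zero>\<^bsub>B\<^esub> \<oplus>\<^bsub>B\<^esub> x = x"
      using x by (intro B_eqI) (auto simp: B_carrier B_add B_zero)
    show "\<exists>y\<in>carrier B. y \<oplus>\<^bsub>B\<^esub> x = \<zero>\<^bsub>B\<^esub>"
      using x by (intro bexI[of _ "\<lambda>g\<in>G. \<ominus> x g"])
        (auto simp: B_carrier B_add B_zero M.l_neg intro!: restrict_ext)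
  qed (auto simp: B_carrier B_add B_zero M.a_assoc intro!: restrict_ext M.a_comm)
  fix x assume "x \<in> carrier B"
  then show "\<one>\<^bsub>R\<^esub> \<odot>\<^bsub>B\<^esub> x = x"
    by (intro B_eqI) (auto simp: B_carrier B_smult)
qed (auto simp: B_carrier B_add B_smult smult_l_distr smult_r_distr smult_assoc1 intro!: restrict_ext)

lemma B_one_closed: "\<one>\<^bsub>B\<^esub> \<in> carrier B"
  by (simp add: B_carrier B_one)

lemma B_assoc:
  assumes x: "x \<in> carrier B" and y: "y \<in> carrier B" and z: "z \<in> carrier B"
  shows "(x \<otimes>\<^bsub>B\<^esub> y) \<otimes>\<^bsub>B\<^esub> z = x \<otimes>\<^bsub>B\<^esub> (y \<otimes>\<^bsub>B\<^esub> z)"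
proof (rule B_eqI)
  fix u assume u: "u \<in> G"
  let ?t = "\<lambda>g h. x g \<otimes> (g (y (gi g \<cdot> h)) \<otimes> h (z (gi h \<cdot> u)))"
  have tc: "?t g h \<in> carrier A" if "g \<in> G" "h \<in> G" for g h using that x y z u by simp
  have "((x \<otimes>\<^bsub>B\<^esub> y) \<otimes>\<^bsub>B\<^esub> z) u = (\<Oplus>h\<in>G. (x \<otimes>\<^bsub>B\<^esub> y) h \<otimes> h (z (gi h \<cdot> u)))"
    using x y z u by (simp add: B_mult_nth B_mult_closed)
  also have "\<dots> = (\<Oplus>h\<in>G. \<Oplus>g\<in>G. ?t g h)"
  proof (rule M.finsum_cong'[OF refl])
    show "(\<lambda>h. \<Oplus>g\<in>G. ?t g h) \<in> G \<rightarrow> carrier A" using tc by (auto intro!: finsum_closed)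
    fix h assume h: "h \<in> G"
    have "(x \<otimes>\<^bsub>B\<^esub> y) h \<otimes> h (z (gi h \<cdot> u)) = (\<Oplus>g\<in>G. x g \<otimes> g (y (gi g \<cdot> h))) \<otimes> h (z (gi h \<cdot> u))"
      using x y h by (simp add: B_mult_nth)
    also have "\<dots> = (\<Oplus>g\<in>G. x g \<otimes> g (y (gi g \<cdot> h)) \<otimes> h (z (gi h \<cdot> u)))"
      using x y z h u by (intro finsum_ldistr G_finite) auto
    also have "\<dots> = (\<Oplus>g\<in>G. ?t g h)"
      using x y z h u by (intro M.finsum_cong') (auto simp: m_assoc)
    finally show "(x \<otimes>\<^bsub>B\<^esub> y) h \<otimes> h (z (gi h \<cdot> u)) = (\<Oplus>g\<in>G. ?t g h)" .
  qed
  also have "\<dots> = (\<Oplus>g\<in>G. \<Oplus>h\<in>G. ?t g h)"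
    by (rule finsum_swap[OF G_finite G_finite]) (rule tc)
  also have "\<dots> = (\<Oplus>g\<in>G. x g \<otimes> g ((y \<otimes>\<^bsub>B\<^esub> z) (gi g \<cdot> u)))"
  proof (rule M.finsum_cong'[OF refl])
    show "(\<lambda>g. x g \<otimes> g ((y \<otimes>\<^bsub>B\<^esub> z) (gi g \<cdot> u))) \<in> G \<rightarrow> carrier A"
      using x B_mult_closed[OF y z] u by auto
    fix g assume g: "g \<in> G"
    let ?s = "\<lambda>h. y h \<otimes> h (z (gi h \<cdot> (gi g \<cdot> u)))"
    have sc: "?s \<in> G \<rightarrow> carrier A" using y z g u by auto
    have "x g \<otimes> g ((y \<otimes>\<^bsub>B\<^esub> z) (gi g \<cdot> u)) = x g \<otimes> g (\<Oplus>h\<in>G. ?s h)"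
      using y z g u by (simp add: B_mult_nth)
    also have "\<dots> = x g \<otimes> (\<Oplus>h\<in>G. g (?s h))" using g sc by (simp add: G_finsum)
    also have "\<dots> = (\<Oplus>h\<in>G. x g \<otimes> g (?s h))"
      using x y z g u by (intro finsum_rdistr G_finite) auto
    also have "\<dots> = (\<Oplus>h\<in>G. ?t g h)"
    \<comment> \<open>On one side \<open>h\<close> is the group element of the second factor, on the
      other the product of the first two.\<close>
    proof (rule finsum_bij[where h = "\<lambda>h. g \<cdot> h"])
      show "bij_betw (\<lambda>h. g \<cdot> h) G G"
        by (rule bij_betw_byWitness[where f' = "\<lambda>h. gi g \<cdot> h"]) (use g in \<open>auto simp: \<Gamma>.m_assoc[symmetric]\<close>)
      show "(\<lambda>h. ?t g h) \<in> G \<rightarrow> carrier A" using tc g by blast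
      fix h assume h: "h \<in> G"
      have "gi g \<cdot> (g \<cdot> h) = h" "gi (g \<cdot> h) \<cdot> u = gi h \<cdot> (gi g \<cdot> u)"
        using g h u by (auto simp: \<Gamma>.m_assoc[symmetric] \<Gamma>.inv_mult_group)
      then show "x g \<otimes> g (?s h) = ?t g (g \<cdot> h)"
        using g h u y z by (simp add: G_mult)
    qed
    finally show "(\<Oplus>h\<in>G. ?t g h) = x g \<otimes> g ((y \<otimes>\<^bsub>B\<^esub> z) (gi g \<cdot> u))" ..
  qed
  also have "\<dots> = (x \<otimes>\<^bsub>B\<^esub> (y \<otimes>\<^bsub>B\<^esub> z)) u"
    using x y z u by (simp add: B_mult_nth B_mult_closed)
  finally show "((x \<otimes>\<^bsub>B\<^esub> y) \<otimes>\<^bsub>B\<^esub> z) u = (x \<otimes>\<^bsub>B\<^esub> (y \<otimes>\<^bsub>B\<^esub> z)) u" .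
qed (use x y z in \<open>simp_all add: B_mult_closed\<close>)

definition monom :: "'a \<Rightarrow> ('a \<Rightarrow> 'a) \<Rightarrow> ('a \<Rightarrow> 'a) \<Rightarrow> 'a"
  where "monom a g = (\<lambda>u\<in>G. if u = g then a else \<zero>)"

lemma monom_closed: "a \<in> carrier A \<Longrightarrow> monom a g \<in> carrier B"
  by (simp add: B_carrier monom_def)

lemma monom_mult_nth:
  assumes a: "a \<in> carrier A" and g: "g \<in> G" and x: "x \<in> carrier B" and u: "u \<in> G"
  shows "(monom a g \<otimes>\<^bsub>B\<^esub> x) u = a \<otimes> g (x (gi g \<cdot> u))"
proof -
  have "(monom a g \<otimes>\<^bsub>B\<^esub> x) u = (\<Oplus>h\<in>G. monom a g h \<otimes> h (x (gi h \<cdot> u)))"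
    using a x u by (intro B_mult_nth monom_closed)
  also have "\<dots> = monom a g g \<otimes> g (x (gi g \<cdot> u))"
    using a g x u by (intro finsum_single G_finite) (auto simp: monom_def)
  finally show ?thesis using g by (simp add: monom_def)
qed

lemma mult_mono_nth:
  assumes a: "a \<in> carrier A" and g: "g \<in> G" and x: "x \<in> carrier B" and u: "u \<in> G"
  shows "(x \<otimes>\<^bsub>B\<^esub> monom a g) u = x (u \<cdot> gi g) \<otimes> (u \<cdot> gi g) a"
proof -
  have "(x \<otimes>\<^bsub>B\<^esub> monom a g) u = (\<Oplus>h\<in>G. x h \<otimes> h (monom a g (gi h \<cdot> u)))"
    using a x u by (intro B_mult_nth monom_closed)
  also have "\<dots> = x (u \<cdot> gi g) \<otimes> (u \<cdot> gi g) (monom a g (gi (u \<cdot> gi g) \<cdot> u))"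
  proof (rule finsum_single[OF G_finite])
    show "u \<cdot> gi g \<in> G" using u g by simp
    show "x (u \<cdot> gi g) \<otimes> (u \<cdot> gi g) (monom a g (gi (u \<cdot> gi g) \<cdot> u)) \<in> carrier A"
      using a x u g B_nth[OF monom_closed[OF a]] by simp
    fix h assume h: "h \<in> G" "h \<noteq> u \<cdot> gi g"
    have "gi h \<cdot> u \<noteq> g"
    proof
      assume "gi h \<cdot> u = g"
      then have "h \<cdot> g = u" using h(1) u by (auto simp: \<Gamma>.m_assoc[symmetric])
      then have "u \<cdot> gi g = h" using h(1) g by (auto simp: \<Gamma>.m_assoc)
      then show False using h(2) by simp
    qed
    then show "x h \<otimes> h (monom a g (gi h \<cdot> u)) = \<zero>"
      using h(1) x u by (simp add: monom_def)
  qed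
  also have "gi (u \<cdot> gi g) \<cdot> u = g" using u g by (simp add: \<Gamma>.inv_mult_group \<Gamma>.m_assoc)
  also have "monom a g g = a" using g by (simp add: monom_def)
  finally show ?thesis .
qed

lemma B_one_mono: "\<one>\<^bsub>B\<^esub> = monom \<one> ge"
  by (simp add: B_one monom_def)

lemma B_algebra: "assoc_algebra R B"
proof -
  interpret B: module R B by (rule B_module)
  have "monoid B"
  proof (rule monoidI)
    fix x assume x: "x \<in> carrier B"
    show "\<one>\<^bsub>B\<^esub> \<otimes>\<^bsub>B\<^esub> x = x"
      using x B_one_closed by (intro B_eqI) (auto simp: B_one_mono monom_mult_nth B_mult_closed monom_closed)
    show "x \<otimes>\<^bsub>B\<^esub> \<one>\<^bsub>B\<^esub> = x"
      using x B_one_closed by (intro B_eqI) (auto simp: B_one_mono mult_mono_nth B_mult_closed monom_closed)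
  qed (auto simp: B_mult_closed B_one_closed B_assoc)
  moreover have "(x \<oplus>\<^bsub>B\<^esub> y) \<otimes>\<^bsub>B\<^esub> z = x \<otimes>\<^bsub>B\<^esub> z \<oplus>\<^bsub>B\<^esub> y \<otimes>\<^bsub>B\<^esub> z"
    if "x \<in> carrier B" "y \<in> carrier B" "z \<in> carrier B" for x y z
  proof (rule B_eqI)
    fix u assume u: "u \<in> G"
    have "((x \<oplus>\<^bsub>B\<^esub> y) \<otimes>\<^bsub>B\<^esub> z) u = (\<Oplus>g\<in>G. (x \<oplus>\<^bsub>B\<^esub> y) g \<otimes> g (z (gi g \<cdot> u)))"
      using that u by (intro B_mult_nth) auto
    also have "\<dots> = (\<Oplus>g\<in>G. x g \<otimes> g (z (gi g \<cdot> u)) \<oplus> y g \<otimes> g (z (gi g \<cdot> u)))"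
      using that u by (intro M.finsum_cong') (auto simp: B_add l_distr)
    also have "\<dots> = (x \<otimes>\<^bsub>B\<^esub> z) u \<oplus> (y \<otimes>\<^bsub>B\<^esub> z) u"
      using that u by (subst M.finsum_addf) (auto simp: B_mult_nth)
    finally show "((x \<oplus>\<^bsub>B\<^esub> y) \<otimes>\<^bsub>B\<^esub> z) u = (x \<otimes>\<^bsub>B\<^esub> z \<oplus>\<^bsub>B\<^esub> y \<otimes>\<^bsub>B\<^esub> z) u" using u by (simp add: B_add)
  qed (use that in \<open>auto simp: B_mult_closed\<close>)
  moreover have "z \<otimes>\<^bsub>B\<^esub> (x \<oplus>\<^bsub>B\<^esub> y) = z \<otimes>\<^bsub>B\<^esub> x \<oplus>\<^bsub>B\<^esub> z \<otimes>\<^bsub>B\<^esub> y"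
    if "x \<in> carrier B" "y \<in> carrier B" "z \<in> carrier B" for x y z
  proof (rule B_eqI)
    fix u assume u: "u \<in> G"
    have "(z \<otimes>\<^bsub>B\<^esub> (x \<oplus>\<^bsub>B\<^esub> y)) u = (\<Oplus>g\<in>G. z g \<otimes> g ((x \<oplus>\<^bsub>B\<^esub> y) (gi g \<cdot> u)))"
      using that u by (intro B_mult_nth) auto
    also have "\<dots> = (\<Oplus>g\<in>G. z g \<otimes> g (x (gi g \<cdot> u)) \<oplus> z g \<otimes> g (y (gi g \<cdot> u)))"
      using that u by (intro M.finsum_cong') (auto simp: B_add G_add r_distr)
    also have "\<dots> = (z \<otimes>\<^bsub>B\<^esub> x) u \<oplus> (z \<otimes>\<^bsub>B\<^esub> y) u"
      using that u by (subst M.finsum_addf) (auto simp: B_mult_nth)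
    finally show "(z \<otimes>\<^bsub>B\<^esub> (x \<oplus>\<^bsub>B\<^esub> y)) u = (z \<otimes>\<^bsub>B\<^esub> x \<oplus>\<^bsub>B\<^esub> z \<otimes>\<^bsub>B\<^esub> y) u" using u by (simp add: B_add)
  qed (use that in \<open>auto simp: B_mult_closed\<close>)
  ultimately have ring: "ring B"
    by (intro ringI B.M.abelian_group_axioms) auto
  show ?thesis
  proof (intro assoc_algebra.intro B_module ring assoc_algebra_axioms.intro)
    fix c x y assume c: "c \<in> carrier R" and xy: "x \<in> carrier B" "y \<in> carrier B"
    show "(c \<odot>\<^bsub>B\<^esub> x) \<otimes>\<^bsub>B\<^esub> y = c \<odot>\<^bsub>B\<^esub> (x \<otimes>\<^bsub>B\<^esub> y)"
    proof (rule B_eqI)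
      fix u assume u: "u \<in> G"
      have "((c \<odot>\<^bsub>B\<^esub> x) \<otimes>\<^bsub>B\<^esub> y) u = (\<Oplus>g\<in>G. (c \<odot>\<^bsub>B\<^esub> x) g \<otimes> g (y (gi g \<cdot> u)))"
        using xy c u by (intro B_mult_nth) auto
      also have "\<dots> = (\<Oplus>g\<in>G. c \<odot> (x g \<otimes> g (y (gi g \<cdot> u))))"
        using xy c u by (intro M.finsum_cong') (auto simp: B_smult smult_mult_left)
      also have "\<dots> = (c \<odot>\<^bsub>B\<^esub> (x \<otimes>\<^bsub>B\<^esub> y)) u"
        using xy c u by (subst finsum_smult_ldistr[symmetric]) (auto simp: B_mult_nth B_smult G_finite)
      finally show "((c \<odot>\<^bsub>B\<^esub> x) \<otimes>\<^bsub>B\<^esub> y) u = (c \<odot>\<^bsub>B\<^esub> (x \<otimes>\<^bsub>B\<^esub> y)) u" .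
    qed (use c xy in \<open>auto simp: B_mult_closed\<close>)
    show "x \<otimes>\<^bsub>B\<^esub> (c \<odot>\<^bsub>B\<^esub> y) = c \<odot>\<^bsub>B\<^esub> (x \<otimes>\<^bsub>B\<^esub> y)"
    proof (rule B_eqI)
      fix u assume u: "u \<in> G"
      have "(x \<otimes>\<^bsub>B\<^esub> (c \<odot>\<^bsub>B\<^esub> y)) u = (\<Oplus>g\<in>G. x g \<otimes> g ((c \<odot>\<^bsub>B\<^esub> y) (gi g \<cdot> u)))"
        using xy c u by (intro B_mult_nth) auto
      also have "\<dots> = (\<Oplus>g\<in>G. c \<odot> (x g \<otimes> g (y (gi g \<cdot> u))))"
        using xy c u by (intro M.finsum_cong') (auto simp: B_smult smult_mult_right mod_hom_smult[OF G_hom])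
      also have "\<dots> = (c \<odot>\<^bsub>B\<^esub> (x \<otimes>\<^bsub>B\<^esub> y)) u"
        using xy c u by (subst finsum_smult_ldistr[symmetric]) (auto simp: B_mult_nth B_smult G_finite)
      finally show "(x \<otimes>\<^bsub>B\<^esub> (c \<odot>\<^bsub>B\<^esub> y)) u = (c \<odot>\<^bsub>B\<^esub> (x \<otimes>\<^bsub>B\<^esub> y)) u" .
    qed (use c xy in \<open>auto simp: B_mult_closed\<close>)
  qed
qed

lemma monom_mono:
  assumes "a \<in> carrier A" "b \<in> carrier A" "g \<in> G" "h \<in> G"
  shows "monom a g \<otimes>\<^bsub>B\<^esub> monom b h = monom (a \<otimes> g b) (g \<cdot> h)"
proof (rule B_eqI)
  fix u assume u: "u \<in> G"
  have "gi g \<cdot> u = h \<longleftrightarrow> u = g \<cdot> h"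
    using assms(3,4) u by (auto simp: \<Gamma>.m_assoc[symmetric])
  then show "(monom a g \<otimes>\<^bsub>B\<^esub> monom b h) u = monom (a \<otimes> g b) (g \<cdot> h) u"
    using assms u by (simp add: monom_mult_nth monom_closed) (simp add: monom_def)
qed (use assms in \<open>auto intro!: B_mult_closed monom_closed\<close>)

definition unit :: "('a \<Rightarrow> 'a) \<Rightarrow> ('a \<Rightarrow> 'a) \<Rightarrow> 'a"
  where "unit g = monom \<one> g"

text \<open>From here on the Hochschild operators of the crossed product and the averages over
  \<open>G\<close> carry the prefix \<open>B\<close>.\<close>

sublocale B: unit_group R B \<Gamma> unit \<gamma>
  by (intro unit_group.intro unit_group_axioms.intro B_algebra group_\<Gamma>)
    (auto simp: G_finite unit_def monom_closed monom_mono B_one_mono \<gamma>_closed \<gamma>_inverse)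

end

section \<open>Linear maps out of equivariant chains\<close>

lemma (in module) word_map_map:
  assumes "f \<in> mod_hom R M N"
  shows "word_map R M m N m (map f)"
proof (rule word_mapI[where j = "\<lambda>_ k. k" and L = "\<lambda>_ _. f"])
  fix xs assume xs: "xs \<in> tuples M m"
  show "map f xs \<in> tuples N m"
    using mod_hom_closed[OF assms] tuples_length[OF xs] tuples_nth[OF xs] by (intro tuplesI) auto
qed (use assms in \<open>auto simp: map_update\<close>)

lemma multilinear_cong:
  assumes "multilinear R M m N v" "module R M" "\<And>xs. xs \<in> tuples M m \<Longrightarrow> v' xs = v xs"
  shows "multilinear R M m N v'"
  unfolding multilinear_def
proof (intro ballI allI impI conjI)
  fix xs i assume xs: "xs \<in> tuples M m"
  show "v' xs \<in> carrier N" using assms(3)[OF xs] multilinear_closed[OF assms(1) xs] by simp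
  assume "i < m"
  show "(\<lambda>x. v' (xs[i := x])) \<in> mod_hom R M N"
    by (rule mod_hom_cong[OF multilinear_slot[OF assms(1) xs \<open>i < m\<close>] assms(2)])
      (rule assms(3)[OF tuples_update[OF xs]])
qed

context eq_chains
begin

lemma eq_gen_funcset: "eq_gen R A G n \<in> G \<times> tuples A (n + 1) \<rightarrow> carrier (eq_mod R A G n)"
  using eq_gen_closed by (simp add: Pi_iff)

lemma eq_hom_eq:
  assumes "module R N" "f \<in> mod_hom R (eq_mod R A G n) N" "f' \<in> mod_hom R (eq_mod R A G n) N"
    and "\<And>g w. g \<in> G \<Longrightarrow> w \<in> tuples A (n + 1) \<Longrightarrow> f (eq_gen R A G n (g, w)) = f' (eq_gen R A G n (g, w))"
    and "x \<in> carrier (eq_mod R A G n)"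
  shows "f x = f' x"
  by (rule mod_hom_eq_on_gens[OF eq_mod_module assms(1-3) eq_gen_funcset eq_gen_span _ assms(5)])
    (use assms(4) in blast)

lemma eq_lin_ext:
  assumes "module R N" "\<And>g. g \<in> G \<Longrightarrow> multilinear R A (n + 1) N (\<lambda>w. v (g, w))"
  shows "lin_ext R (eq_mod R A G n) N (G \<times> tuples A (n + 1)) (eq_gen R A G n) v \<in> mod_hom R (eq_mod R A G n) N"
    and "\<And>g w. g \<in> G \<Longrightarrow> w \<in> tuples A (n + 1) \<Longrightarrow>
      lin_ext R (eq_mod R A G n) N (G \<times> tuples A (n + 1)) (eq_gen R A G n) v (eq_gen R A G n (g, w)) = v (g, w)"
proof -
  obtain f where f: "f \<in> mod_hom R (eq_mod R A G n) N"
    "\<And>g w. g \<in> G \<Longrightarrow> w \<in> tuples A (n + 1) \<Longrightarrow> f (eq_gen R A G n (g, w)) = v (g, w)"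
    using eq_lift[OF assms] by blast
  have f2: "f (eq_gen R A G n p) = v p" if "p \<in> G \<times> tuples A (n + 1)" for p
    using that f(2) by (cases p) blast
  note L = lin_ext[OF eq_mod_module assms(1) eq_gen_funcset eq_gen_span f(1), where v = v, OF f2]
  show "lin_ext R (eq_mod R A G n) N (G \<times> tuples A (n + 1)) (eq_gen R A G n) v \<in> mod_hom R (eq_mod R A G n) N"
    by (rule L(1))
  show "lin_ext R (eq_mod R A G n) N (G \<times> tuples A (n + 1)) (eq_gen R A G n) v (eq_gen R A G n (g, w)) = v (g, w)"
    if "g \<in> G" "w \<in> tuples A (n + 1)" for g w
    by (rule L(2)) (use that in auto)
qed

end

context crossed
begin

sublocale eq: eq_chains R A G
  by (intro eq_chains.intro eq_chains_axioms.intro module_axioms G_finite)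

abbreviation "Q n \<equiv> eq_mod R A G n"
abbreviation "eg n \<equiv> eq_gen R A G n"
abbreviation "CB n \<equiv> hoch_mod R B n"
abbreviation "genB n \<equiv> hoch_gen R B n"

text \<open>The definitions of the equivariant chains use \<open>n + 1\<close>, the Hochschild side
  uses \<open>Suc n\<close>; the facts are restated in the second form.\<close>

lemmas eq_gen_closed = eq.eq_gen_closed[unfolded Suc_eq_plus1[symmetric]]
lemmas eq_gen_multilinear = eq.eq_gen_multilinear[unfolded Suc_eq_plus1[symmetric]]
lemmas eq_gen_span = eq.eq_gen_span[unfolded Suc_eq_plus1[symmetric]]
lemmas eq_hom_eq = eq.eq_hom_eq[unfolded Suc_eq_plus1[symmetric]]
lemmas eq_lin_ext = eq.eq_lin_ext[unfolded Suc_eq_plus1[symmetric]]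

sublocale Q: module R "eq_mod R A G n" for n
  by (rule eq.eq_mod_module)

lemma eg_word:
  "g \<in> G \<Longrightarrow> word_map R A (Suc m) A (Suc n) f \<Longrightarrow> multilinear R A (Suc m) (Q n) (\<lambda>w. eg n (g, f w))"
  by (rule multilinear_word_map[OF module_axioms _ eq_gen_multilinear])

section \<open>Comparison of equivariant chains with chains of the crossed product\<close>

lemma monom_hom: "(\<lambda>a. monom a g) \<in> mod_hom R A B"
  by (rule mod_homI)
    (auto simp: monom_closed, auto simp: monom_def B_add B_smult intro!: restrict_ext)

text \<open>\<open>g\<close> stands to the left of \<open>a_0\<close>, so the first letter is the
  monomial \<open>g(a_0) g\<close>. This position is dictated by the twist
  \<open>g^-1(a_n) a_0\<close> in the last face of the equivariant complex.\<close>

definition iw :: "('a \<Rightarrow> 'a) \<Rightarrow> 'a list \<Rightarrow> (('a \<Rightarrow> 'a) \<Rightarrow> 'a) list"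
  where "iw g w = slot 0 (\<lambda>x. unit g \<otimes>\<^bsub>B\<^esub> x) (map (\<lambda>a. monom a ge) w)"

lemma word_map_iw: "g \<in> G \<Longrightarrow> word_map R A m B m (iw g)"
  unfolding iw_def
  by (intro word_map_comp[OF word_map_map[OF monom_hom] B.word_map_slot] B.mult_left_hom)
    (simp add: unit_def monom_closed)

lemma length_iw [simp]: "length (iw g w) = length w"
  by (simp add: iw_def)

lemma nth_iw: "g \<in> G \<Longrightarrow> w \<in> tuples A (Suc n) \<Longrightarrow> k \<le> n \<Longrightarrow>
    iw g w ! k = (if k = 0 then monom (g (w ! 0)) g else monom (w ! k) ge)"
  using tuples_length[of w A "Suc n"] tuples_nth[of w A "Suc n" k]
  by (auto simp: iw_def nth_slot unit_def monom_mono)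

definition \<iota> :: "nat \<Rightarrow> ('k, 'a) eq_chain \<Rightarrow> ((('a \<Rightarrow> 'a) \<Rightarrow> 'a) list \<Rightarrow> 'k) set"
  where "\<iota> n = lin_ext R (Q n) (CB n) (G \<times> tuples A (Suc n)) (eg n) (\<lambda>p. genB n (iw (fst p) (snd p)))"

lemma iw_multilinear: "g \<in> G \<Longrightarrow> multilinear R A (Suc n) (CB n) (\<lambda>w. genB n (iw (fst (g, w)) (snd (g, w))))"
  unfolding fst_conv snd_conv
  by (rule multilinear_word_map[OF module_axioms word_map_iw B.hoch_gen_multilinear])

lemma \<iota>_hom: "\<iota> n \<in> mod_hom R (Q n) (CB n)"
  unfolding \<iota>_def by (rule eq_lin_ext(1)[OF B.hoch_module iw_multilinear])

lemma \<iota>_gen: "g \<in> G \<Longrightarrow> w \<in> tuples A (Suc n) \<Longrightarrow> \<iota> n (eg n (g, w)) = genB n (iw g w)"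
  unfolding \<iota>_def
  using eq_lin_ext(2)[OF B.hoch_module iw_multilinear] by simp

sublocale \<iota>: linear_map R "eq_mod R A G n" "hoch_mod R B n" "\<iota> n" for n
  by (intro linear_mapI Q.module_axioms B.hoch_module \<iota>_hom)

text \<open>Treating the twisted last face like the others makes \<open>eq_b\<close> an alternating
  sum of faces over one index, as on the Hochschild side.\<close>

definition eface :: "nat \<Rightarrow> ('a \<Rightarrow> 'a) \<Rightarrow> nat \<Rightarrow> 'a list \<Rightarrow> 'a list"
  where "eface n g j w = wface A j (if j = Suc n then slot (Suc n) (gi g) w else w)"

lemma word_map_eface: "g \<in> G \<Longrightarrow> word_map R A (Suc (Suc n)) A (Suc n) (eface n g j)"
  unfolding eface_def
  using word_map_comp[OF word_map_slot[OF G_hom[of "gi g"]] word_map_wface[of n j]] word_map_wface[of n j]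
  by (cases "j = Suc n") simp_all

lemma eface_contract: "j \<le> n \<Longrightarrow> length w = Suc (Suc n) \<Longrightarrow> eface n g j w = contract A j w"
  by (simp add: eface_def wface_contract)

lemma eface_last:
  assumes "length w = Suc (Suc n)"
  shows "eface n g (Suc n) w = ((gi g) (w ! Suc n) \<otimes> w ! 0) # tl (butlast w)"
proof -
  have l: "length (slot (Suc n) (gi g) w) = Suc (Suc n)" using assms by simp
  have "butlast (slot (Suc n) (gi g) w) = butlast w"
    using assms by (simp add: slot_def butlast_list_update)
  then show ?thesis
    unfolding eface_def using assms by (simp add: wface_last[OF l] nth_slot)
qed

lemma eq_b:
  shows eq_b_hom: "eq_b R A G n \<in> mod_hom R (Q (Suc n)) (Q n)"
    and eq_b_gen: "\<And>g w. g \<in> G \<Longrightarrow> w \<in> tuples A (Suc (Suc n)) \<Longrightarrow>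
      eq_b R A G n (eg (Suc n) (g, w)) = (\<Oplus>\<^bsub>Q n\<^esub>j\<in>{..Suc n}. signed (Q n) j (eg n (g, eface n g j w)))"
proof -
  \<comment> \<open>\<open>v\<close> repeats the values in the definition of \<open>eq_b\<close>, so
    that the next equation holds by unfolding.\<close>
  define v where "v = (\<lambda>(g, as). (\<Oplus>\<^bsub>Q n\<^esub>i\<in>{..n}. signed (Q n) i (eg n (g, contract A i as)))
            \<oplus>\<^bsub>Q n\<^esub> signed (Q n) (Suc n)
              (eg n (g, ((inv\<^bsub>alg_Aut R A\<^esub> g) (as ! Suc n) \<otimes> as ! 0) # tl (butlast as))))"
  have eqb: "eq_b R A G n = lin_ext R (Q (Suc n)) (Q n) (G \<times> tuples A (Suc (Suc n))) (eg (Suc n)) v"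
    by (simp add: eq_b_def v_def)
  have gc: "eg n (g, eface n g j w) \<in> carrier (Q n)" if "g \<in> G" "w \<in> tuples A (Suc (Suc n))" for g j w
    using that by (intro eq_gen_closed word_map_closed[OF word_map_eface])
  have veq: "v (g, w) = (\<Oplus>\<^bsub>Q n\<^esub>j\<in>{..Suc n}. signed (Q n) j (eg n (g, eface n g j w)))"
    if g: "g \<in> G" and w: "w \<in> tuples A (Suc (Suc n))" for g w
  proof -
    have "(\<Oplus>\<^bsub>Q n\<^esub>i\<in>{..n}. signed (Q n) i (eg n (g, contract A i w))) =
        (\<Oplus>\<^bsub>Q n\<^esub>j\<in>{..n}. signed (Q n) j (eg n (g, eface n g j w)))"
    proof (rule Q.finsum_cong'[OF refl])
      show "(\<lambda>j. signed (Q n) j (eg n (g, eface n g j w))) \<in> {..n} \<rightarrow> carrier (Q n)"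
        using gc[OF g w] by auto
    qed (simp add: eface_contract[OF _ tuples_length[OF w]])
    moreover have "((inv\<^bsub>alg_Aut R A\<^esub> g) (w ! Suc n) \<otimes> w ! 0) # tl (butlast w) = eface n g (Suc n) w"
      using g by (simp add: eface_last[OF tuples_length[OF w]] alg_Aut_inv)
    ultimately show ?thesis
      using gc[OF g w] by (subst Q.finsum_Suc_top) (simp_all add: v_def)
  qed
  have ml: "multilinear R A (Suc (Suc n)) (Q n) (\<lambda>w. v (g, w))" if g: "g \<in> G" for g
  proof -
    have "multilinear R A (Suc (Suc n)) (Q n)
        (\<lambda>w. \<Oplus>\<^bsub>Q n\<^esub>j\<in>{..Suc n}. signed (Q n) j (eg n (g, eface n g j w)))"
      by (intro multilinear_finsum multilinear_signed eg_word word_map_eface g module_axioms Q.module_axioms)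
    then show ?thesis by (rule multilinear_cong[OF _ module_axioms veq[OF g]])
  qed
  show "eq_b R A G n \<in> mod_hom R (Q (Suc n)) (Q n)"
    unfolding eqb by (rule eq_lin_ext(1)[OF Q.module_axioms ml])
  show "eq_b R A G n (eg (Suc n) (g, w)) = (\<Oplus>\<^bsub>Q n\<^esub>j\<in>{..Suc n}. signed (Q n) j (eg n (g, eface n g j w)))"
    if "g \<in> G" "w \<in> tuples A (Suc (Suc n))" for g w
    unfolding eqb veq[OF that, symmetric] by (rule eq_lin_ext(2)[OF Q.module_axioms ml that])
qed

text \<open>The last face in \<open>B\<close> becomes the twisted one because
  \<open>a_n (g a_0) = g (g^-1(a_n) a_0)\<close>.\<close>

lemma wface_iw:
  assumes g: "g \<in> G" and w: "w \<in> tuples A (Suc (Suc n))" and j: "j \<le> Suc n"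
  shows "wface B j (iw g w) = iw g (eface n g j w)"
proof (rule nth_equalityI)
  note len = tuples_length[OF w]
  note nth = tuples_nth[OF w]
  have li: "length (iw g w) = Suc (Suc n)" using len by simp
  note ef = word_map_closed[OF word_map_eface[OF g] w, of j]
  show "length (wface B j (iw g w)) = length (iw g (eface n g j w))"
    using length_wface[OF li, where B = B] tuples_length[OF ef] by simp
  fix k assume "k < length (wface B j (iw g w))"
  then have k: "k \<le> n" using length_wface[OF li, where B = B] by simp
  have ls: "length (slot (Suc n) (gi g) w) = Suc (Suc n)" using len by simp
  show "wface B j (iw g w) ! k = iw g (eface n g j w) ! k"
  proof (cases "j = Suc n")
    case True
    then show ?thesis
      unfolding nth_wface[OF li k] nth_iw[OF g ef k] unfolding eface_def
      using k g nth len by (auto simp: nth_iw[OF g w] nth_wface[OF ls] nth_slot monom_mono G_mult)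
  next
    case False
    then show ?thesis
      unfolding nth_wface[OF li k] nth_iw[OF g ef k] unfolding eface_def
      using k g nth j by (auto simp: nth_iw[OF g w] nth_wface[OF len] monom_mono G_mult)
  qed
qed

lemma \<iota>_chain:
  assumes x: "x \<in> carrier (Q (Suc n))"
  shows "\<iota> n (eq_b R A G n x) = hoch_b R B n (\<iota> (Suc n) x)"
proof (rule eq_hom_eq[OF B.hoch_module mod_hom_comp[OF eq_b_hom \<iota>_hom] mod_hom_comp[OF \<iota>_hom B.hoch_b_hom] _ x])
  fix g w assume g: "g \<in> G" and w: "w \<in> tuples A (Suc (Suc n))"
  note ef = word_map_closed[OF word_map_eface[OF g] w]
  note iww = word_map_closed[OF word_map_iw[OF g] w]
  have "\<iota> n (eq_b R A G n (eg (Suc n) (g, w))) =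
      (\<Oplus>\<^bsub>CB n\<^esub>j\<in>{..Suc n}. \<iota> n (signed (Q n) j (eg n (g, eface n g j w))))"
    unfolding eq_b_gen[OF g w] using eq_gen_closed[OF g ef] by (intro \<iota>.finsum) auto
  also have "\<dots> = (\<Oplus>\<^bsub>CB n\<^esub>j\<in>{..Suc n}. signed (CB n) j (B.face n j (genB (Suc n) (iw g w))))"
    using eq_gen_closed[OF g ef] B.hoch_gen_closed[OF iww]
    by (intro B.C.finsum_cong')
      (auto simp: \<iota>.signed \<iota>_gen[OF g ef] B.face_def B.wop_gen[OF B.word_map_wface iww] wface_iw[OF g w]
        intro!: B.C.signed_closed B.hoch_gen_closed word_map_closed[OF word_map_iw[OF g] ef])
  also have "\<dots> = hoch_b R B n (\<iota> (Suc n) (eg (Suc n) (g, w)))"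
    by (simp only: \<iota>_gen[OF g w] B.hoch_b_eq[OF B.hoch_gen_closed[OF iww]])
  finally show "\<iota> n (eq_b R A G n (eg (Suc n) (g, w))) = hoch_b R B n (\<iota> (Suc n) (eg (Suc n) (g, w)))" .
qed

section \<open>The action of \<open>G\<close> and its absorption by the average\<close>

lemma eq_act:
  assumes h: "h \<in> G"
  shows eq_act_hom: "eq_act R A G n h \<in> mod_hom R (Q n) (Q n)"
    and eq_act_gen: "\<And>g w. g \<in> G \<Longrightarrow> w \<in> tuples A (Suc n) \<Longrightarrow>
      eq_act R A G n h (eg n (g, w)) = eg n (h \<cdot> g \<cdot> gi h, map h w)"
proof -
  define v where "v = (\<lambda>(g, as). eg n (h \<otimes>\<^bsub>alg_Aut R A\<^esub> g \<otimes>\<^bsub>alg_Aut R A\<^esub> inv\<^bsub>alg_Aut R A\<^esub> h, map h as))"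
  have eqa: "eq_act R A G n h = lin_ext R (Q n) (Q n) (G \<times> tuples A (Suc n)) (eg n) v"
    by (simp add: eq_act_def v_def)
  have v: "v (g, w) = eg n (h \<cdot> g \<cdot> gi h, map h w)" for g w
    using h by (simp add: v_def alg_Aut_inv alg_Aut_mult)
  have ml: "multilinear R A (Suc n) (Q n) (\<lambda>w. v (g, w))" if "g \<in> G" for g
    unfolding v using h that by (intro eg_word word_map_map G_hom) auto
  show "eq_act R A G n h \<in> mod_hom R (Q n) (Q n)"
    unfolding eqa by (rule eq_lin_ext(1)[OF Q.module_axioms ml])
  show "eq_act R A G n h (eg n (g, w)) = eg n (h \<cdot> g \<cdot> gi h, map h w)"
    if "g \<in> G" "w \<in> tuples A (Suc n)" for g w
    unfolding eqa v[symmetric] by (rule eq_lin_ext(2)[OF Q.module_axioms ml that])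
qed

text \<open>The result of applying the first \<open>m\<close> of the actions \<open>wact\<close> with \<open>h\<inverse>\<close> to \<open>w\<close>; for \<open>m = n + 1\<close>
  all letters are conjugated by \<open>h\<close>.\<close>

definition cword :: "('a \<Rightarrow> 'a) \<Rightarrow> nat \<Rightarrow> nat \<Rightarrow> (('a \<Rightarrow> 'a) \<Rightarrow> 'a) list \<Rightarrow> (('a \<Rightarrow> 'a) \<Rightarrow> 'a) list"
  where "cword h n m w = map (\<lambda>k. let x = if k < m then w ! k \<otimes>\<^bsub>B\<^esub> unit (gi h) else w ! k in
      if (0 < k \<and> k \<le> m) \<or> (k = 0 \<and> m = Suc n) then unit h \<otimes>\<^bsub>B\<^esub> x else x) [0..<Suc n]"

lemma nth_cword: "k \<le> n \<Longrightarrow> cword h n m w ! k = (let x = if k < m then w ! k \<otimes>\<^bsub>B\<^esub> unit (gi h) else w ! k in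
      if (0 < k \<and> k \<le> m) \<or> (k = 0 \<and> m = Suc n) then unit h \<otimes>\<^bsub>B\<^esub> x else x)"
  unfolding cword_def by (subst nth_map) (simp_all del: upt_Suc)

lemma length_cword [simp]: "length (cword h n m w) = Suc n"
  by (simp add: cword_def)

lemma cword_closed: "h \<in> G \<Longrightarrow> w \<in> tuples B (Suc n) \<Longrightarrow> cword h n m w \<in> tuples B (Suc n)"
  using tuples_nth[of w B "Suc n"] B.u_closed
  by (intro tuplesI) (auto simp: nth_cword Let_def)

text \<open>Acting on gap \<open>m\<close> with the inverse of \<open>h\<close> multiplies letter
  \<open>m\<close> by that inverse on the right and the cyclically next letter by \<open>h\<close>
  on the left; \<open>gi (gi h)\<close> is the shape in which \<open>act\<close> produces this
  \<open>h\<close>. For \<open>m = n\<close> the next letter is letter 0.\<close>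

lemma cword_Suc:
  assumes h: "h \<in> G" and w: "w \<in> tuples B (Suc n)" and m: "m \<le> n"
  shows "cword h n (Suc m) w = wact B m (unit (gi h)) (unit (gi (gi h))) (cword h n m w)"
proof (rule nth_equalityI)
  show "length (cword h n (Suc m) w) = length (wact B m (unit (gi h)) (unit (gi (gi h))) (cword h n m w))"
    by simp
  fix k assume "k < length (cword h n (Suc m) w)"
  then have k: "k \<le> n" by simp
  have u: "unit h \<in> carrier B" "unit (gi h) \<in> carrier B" using h B.u_closed by auto
  have wk: "w ! k \<in> carrier B" using k tuples_nth[OF w] by simp
  show "cword h n (Suc m) w ! k = wact B m (unit (gi h)) (unit (gi (gi h))) (cword h n m w) ! k"
    unfolding nth_wact[OF length_cword k m] nth_cword[OF k]
    using m k u wk h by (auto simp: Let_def B.m_assoc)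
qed

lemma P_cword:
  assumes h: "h \<in> G" and w: "w \<in> tuples B (Suc n)"
  shows "m \<le> Suc n \<Longrightarrow> B.P n (genB n (cword h n m w)) = B.P n (genB n w)"
proof (induction m)
  case 0
  have "cword h n 0 w = w"
    using tuples_length[OF w] by (intro nth_equalityI) (auto simp: nth_cword Let_def)
  then show ?case by simp
next
  case (Suc m)
  have c: "cword h n m w \<in> tuples B (Suc n)" by (rule cword_closed[OF h w])
  have "B.P n (B.act n m (gi h) (genB n (cword h n m w))) = B.P n (genB n (cword h n m w))"
    using h Suc.prems by (intro B.P_act B.hoch_gen_closed c) auto
  moreover have "B.act n m (gi h) (genB n (cword h n m w)) = genB n (cword h n (Suc m) w)"
    using h Suc.prems by (simp add: B.act_gen[OF _ c] cword_Suc[OF h w])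
  ultimately show ?case using Suc by simp
qed

text \<open>Conjugation in \<open>B\<close> realises the action: \<open>h a h^-1 = h(a)\<close> and
  \<open>h (g a_0) h^-1 = (h g h^-1) h(a_0)\<close>.\<close>

lemma cword_iw:
  assumes h: "h \<in> G" and g: "g \<in> G" and w: "w \<in> tuples A (Suc n)"
  shows "cword h n (Suc n) (iw g w) = iw (h \<cdot> g \<cdot> gi h) (map h w)"
proof (rule nth_equalityI)
  show "length (cword h n (Suc n) (iw g w)) = length (iw (h \<cdot> g \<cdot> gi h) (map h w))"
    using tuples_length[OF w] by simp
  fix k assume "k < length (cword h n (Suc n) (iw g w))"
  then have k: "k \<le> n" by simp
  have hg: "h \<cdot> g \<cdot> gi h \<in> G" using h g by simp
  have mw: "map h w \<in> tuples A (Suc n)" by (rule word_map_closed[OF word_map_map[OF G_hom[OF h]] w])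
  have wk: "w ! k \<in> carrier A" using tuples_nth[OF w] k by simp
  show "cword h n (Suc n) (iw g w) ! k = iw (h \<cdot> g \<cdot> gi h) (map h w) ! k"
    unfolding nth_cword[OF k] nth_iw[OF g w k] nth_iw[OF hg mw k]
    using h g k wk tuples_length[OF w]
    by (auto simp: Let_def unit_def monom_mono \<Gamma>.m_assoc)
qed

text \<open>On generators the two chains differ by the diagonal of \<open>G^(n+1)\<close>, which
  \<open>P\<close> absorbs. Hence \<open>P \<circ> \<iota>\<close> passes to coinvariants.\<close>

lemma P_\<iota>_act:
  assumes h: "h \<in> G" and x: "x \<in> carrier (Q n)"
  shows "B.P n (\<iota> n (eq_act R A G n h x)) = B.P n (\<iota> n x)"
proof (rule eq_hom_eq[OF B.hoch_module mod_hom_comp[OF mod_hom_comp[OF eq_act_hom[OF h] \<iota>_hom] B.P_hom]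
      mod_hom_comp[OF \<iota>_hom B.P_hom] _ x])
  fix g w assume g: "g \<in> G" and w: "w \<in> tuples A (Suc n)"
  have hg: "h \<cdot> g \<cdot> gi h \<in> G" using h g by simp
  have mw: "map h w \<in> tuples A (Suc n)" by (rule word_map_closed[OF word_map_map[OF G_hom[OF h]] w])
  show "B.P n (\<iota> n (eq_act R A G n h (eg n (g, w)))) = B.P n (\<iota> n (eg n (g, w)))"
    using P_cword[OF h word_map_closed[OF word_map_iw[OF g] w], of "Suc n"]
    by (simp add: eq_act_gen[OF h g w] \<iota>_gen[OF hg mw] \<iota>_gen[OF g w] cword_iw[OF h g w])
qed

text \<open>A product \<open>(x\<^sub>0, \<dots>, x\<^sub>n)\<close> of chains in \<open>B\<close> is expanded into monomials
  \<open>(a\<^sub>0 u\<^sub>0, \<dots>, a\<^sub>n u\<^sub>n)\<close>, and all group elements are moved to the left. The summands are indexed by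
  the families \<open>v\<^sub>j = u\<^sub>j \<dots> u\<^sub>n\<close>, so that \<open>u\<^sub>j = v\<^sub>j v\<^sub>j\<^sub>+\<^sub>1\<inverse>\<close> with \<open>v\<^sub>n\<^sub>+\<^sub>1 = 1\<close>.\<close>

definition nxt :: "nat \<Rightarrow> (nat \<Rightarrow> 'a \<Rightarrow> 'a) \<Rightarrow> nat \<Rightarrow> 'a \<Rightarrow> 'a"
  where "nxt n v j = (if j = n then ge else v (Suc j))"

definition rword :: "nat \<Rightarrow> (nat \<Rightarrow> 'a \<Rightarrow> 'a) \<Rightarrow> (('a \<Rightarrow> 'a) \<Rightarrow> 'a) list \<Rightarrow> 'a list"
  where "rword n v w = map (\<lambda>j. (gi (v j)) ((w ! j) (v j \<cdot> gi (nxt n v j)))) [0..<Suc n]"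

abbreviation "V (n::nat) \<equiv> {..n} \<rightarrow>\<^sub>E G"

lemma V_finite: "finite (V n)"
  by (intro finite_PiE finite_atMost G_finite)

lemma V_mem: "v \<in> V n \<Longrightarrow> j \<le> n \<Longrightarrow> v j \<in> G"
  by (auto simp: PiE_iff)

lemma nxt_mem: "v \<in> V n \<Longrightarrow> j \<le> n \<Longrightarrow> nxt n v j \<in> G"
  by (auto simp: nxt_def V_mem)

lemma length_rword [simp]: "length (rword n v w) = Suc n"
  by (simp add: rword_def)

lemma nth_rword: "j \<le> n \<Longrightarrow> rword n v w ! j = (gi (v j)) ((w ! j) (v j \<cdot> gi (nxt n v j)))"
  unfolding rword_def by (subst nth_map) (simp_all del: upt_Suc)

lemma eval_hom: "g \<in> G \<Longrightarrow> (\<lambda>x. x g) \<in> mod_hom R B A"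
  by (rule mod_homI) (auto simp: B_add B_smult)

lemma word_map_rword:
  assumes v: "v \<in> V n"
  shows "word_map R B (Suc n) A (Suc n) (rword n v)"
proof (rule word_mapI[where j = "\<lambda>_ k. k" and L = "\<lambda>_ k x. (gi (v k)) (x (v k \<cdot> gi (nxt n v k)))"])
  fix xs assume xs: "xs \<in> tuples B (Suc n)"
  have "rword n v xs ! i \<in> carrier A" if "i \<le> n" for i
    using V_mem[OF v that] nxt_mem[OF v that] tuples_nth[OF xs, of i] that by (simp add: nth_rword)
  then show "rword n v xs \<in> tuples A (Suc n)"
    by (intro tuplesI) auto
  fix k assume k: "k < Suc n"
  then have vk: "v k \<in> G" "nxt n v k \<in> G" using V_mem[OF v] nxt_mem[OF v] by auto
  have "rword n v (xs[k := x]) = (rword n v xs)[k := (gi (v k)) (x (v k \<cdot> gi (nxt n v k)))]" for x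
    using tuples_length[OF xs] k by (intro nth_equalityI) (auto simp: nth_rword nth_list_update)
  moreover have "(\<lambda>x. (gi (v k)) (x (v k \<cdot> gi (nxt n v k)))) \<in> mod_hom R B A"
    using vk by (intro mod_hom_comp[OF eval_hom G_hom]) auto
  ultimately show "k < Suc n \<and> (\<lambda>x. (gi (v k)) (x (v k \<cdot> gi (nxt n v k)))) \<in> mod_hom R B A \<and>
      (\<forall>x\<in>carrier B. rword n v (xs[k := x]) = (rword n v xs)[k := (gi (v k)) (x (v k \<cdot> gi (nxt n v k)))])"
    using k by simp
qed

definition \<rho> :: "nat \<Rightarrow> ((('a \<Rightarrow> 'a) \<Rightarrow> 'a) list \<Rightarrow> 'k) set \<Rightarrow> ('k, 'a) eq_chain"
  where "\<rho> n = lin_ext R (CB n) (Q n) (tuples B (Suc n)) (genB n) (\<lambda>w. \<Oplus>\<^bsub>Q n\<^esub>v\<in>V n. eg n (v 0, rword n v w))"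

lemma \<rho>_multilinear: "multilinear R B (Suc n) (Q n) (\<lambda>w. \<Oplus>\<^bsub>Q n\<^esub>v\<in>V n. eg n (v 0, rword n v w))"
  by (intro multilinear_finsum multilinear_word_map[OF B_module word_map_rword eq_gen_multilinear]
      B_module Q.module_axioms) (simp_all add: V_mem)

lemma \<rho>_hom: "\<rho> n \<in> mod_hom R (CB n) (Q n)"
  unfolding \<rho>_def by (rule B.hoch_lin_ext(1)[OF Q.module_axioms \<rho>_multilinear])

lemma \<rho>_gen: "w \<in> tuples B (Suc n) \<Longrightarrow> \<rho> n (genB n w) = (\<Oplus>\<^bsub>Q n\<^esub>v\<in>V n. eg n (v 0, rword n v w))"
  unfolding \<rho>_def by (rule B.hoch_lin_ext(2)[OF Q.module_axioms \<rho>_multilinear])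

sublocale \<rho>: linear_map R "hoch_mod R B n" "eq_mod R A G n" "\<rho> n" for n
  by (intro linear_mapI Q.module_axioms B.hoch_module \<rho>_hom)

lemma rterm_closed: "v \<in> V n \<Longrightarrow> w \<in> tuples B (Suc n) \<Longrightarrow> eg n (v 0, rword n v w) \<in> carrier (Q n)"
  by (intro eq_gen_closed word_map_closed[OF word_map_rword]) (simp_all add: V_mem)

lemma unit_mult_nth: "g \<in> G \<Longrightarrow> x \<in> carrier B \<Longrightarrow> u \<in> G \<Longrightarrow> (unit g \<otimes>\<^bsub>B\<^esub> x) u = g (x (gi g \<cdot> u))"
  by (simp add: unit_def monom_mult_nth)

lemma mult_unit_nth: "g \<in> G \<Longrightarrow> x \<in> carrier B \<Longrightarrow> u \<in> G \<Longrightarrow> (x \<otimes>\<^bsub>B\<^esub> unit g) u = x (u \<cdot> gi g)"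
  by (simp add: unit_def mult_mono_nth)

text \<open>Passing \<open>h\<close> across gap \<open>i\<close> replaces \<open>u_i\<close> by
  \<open>u_i h\<close> and \<open>u_(i+1)\<close> by \<open>h^-1 u_(i+1)\<close>, which among the
  products \<open>u_j ... u_n\<close> changes only the one at \<open>i + 1\<close>. At gap
  \<open>n\<close>, which is excluded, every product would be affected.\<close>

lemma rword_wact:
  assumes v: "v \<in> V n" and w: "w \<in> tuples B (Suc n)" and h: "h \<in> G" and i: "i < n"
  shows "rword n v (wact B i (unit h) (unit (gi h)) w) = rword n (v(Suc i := h \<cdot> v (Suc i))) w"
proof (rule nth_equalityI)
  fix k assume "k < length (rword n v (wact B i (unit h) (unit (gi h)) w))"
  then have k: "k \<le> n" by simp
  have vk: "v k \<in> G" "nxt n v k \<in> G" "v (Suc i) \<in> G" "v i \<in> G" using V_mem[OF v] nxt_mem[OF v k] k i by auto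
  have wk: "w ! k \<in> carrier B" using tuples_nth[OF w] k by simp
  have i': "i \<le> n" using i by simp
  show "rword n v (wact B i (unit h) (unit (gi h)) w) ! k = rword n (v(Suc i := h \<cdot> v (Suc i))) w ! k"
    unfolding nth_rword[OF k] nth_wact[OF tuples_length[OF w] k i']
    using i vk wk h
    by (auto simp: nxt_def unit_mult_nth mult_unit_nth \<Gamma>.m_assoc \<Gamma>.inv_mult_group)
qed simp

lemma \<rho>_act:
  assumes h: "h \<in> G" and i: "i < n" and x: "x \<in> carrier (CB n)"
  shows "\<rho> n (B.act n i h x) = \<rho> n x"
proof (rule B.hoch_hom_eq[OF Q.module_axioms mod_hom_comp[OF B.act_hom \<rho>_hom] \<rho>_hom _ x])
  show "h \<in> carrier \<Gamma>" using h by simp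
  fix w assume w: "w \<in> tuples B (Suc n)"
  let ?w = "wact B i (unit h) (unit (gi h)) w"
  have hc: "h \<in> carrier \<Gamma>" using h by simp
  have w': "?w \<in> tuples B (Suc n)" by (rule word_map_closed[OF B.wm_act w]) (use h in simp)
  have "\<rho> n (B.act n i h (genB n w)) = (\<Oplus>\<^bsub>Q n\<^esub>v\<in>V n. eg n (v 0, rword n v ?w))"
    using h by (simp add: B.act_gen[OF _ w] \<rho>_gen[OF w'])
  also have "\<dots> = (\<Oplus>\<^bsub>Q n\<^esub>v\<in>V n. eg n (v 0, rword n v w))"
  proof (rule Q.finsum_bij[where h = "\<lambda>v. v(Suc i := h \<cdot> v (Suc i))"])
    have up: "v(Suc i := k \<cdot> v (Suc i)) \<in> V n" if "v \<in> V n" "k \<in> G" for v k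
      using that i V_mem[OF that(1)] by (auto simp: PiE_iff extensional_def)
    have canc: "gi h \<cdot> (h \<cdot> v (Suc i)) = v (Suc i)" "h \<cdot> (gi h \<cdot> v (Suc i)) = v (Suc i)" if "v \<in> V n" for v
      using V_mem[OF that, of "Suc i"] h i by (simp_all add: \<Gamma>.m_assoc[symmetric])
    show "bij_betw (\<lambda>v. v(Suc i := h \<cdot> v (Suc i))) (V n) (V n)"
    proof (rule bij_betw_byWitness[where f' = "\<lambda>v. v(Suc i := gi h \<cdot> v (Suc i))"])
      show "\<forall>v\<in>V n. (v(Suc i := h \<cdot> v (Suc i)))(Suc i := gi h \<cdot> (v(Suc i := h \<cdot> v (Suc i))) (Suc i)) = v"
        by (simp add: canc)
      show "\<forall>v\<in>V n. (v(Suc i := gi h \<cdot> v (Suc i)))(Suc i := h \<cdot> (v(Suc i := gi h \<cdot> v (Suc i))) (Suc i)) = v"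
        by (simp add: canc)
    qed (use up h in auto)
    show "(\<lambda>v. eg n (v 0, rword n v w)) \<in> V n \<rightarrow> carrier (Q n)"
      by (intro Pi_I rterm_closed w)
    show "eg n (v 0, rword n v ?w) =
        eg n ((v(Suc i := h \<cdot> v (Suc i))) 0, rword n (v(Suc i := h \<cdot> v (Suc i))) w)" if "v \<in> V n" for v
      using rword_wact[OF that w h i] by simp
  qed
  also have "\<dots> = \<rho> n (genB n w)" by (rule \<rho>_gen[OF w, symmetric])
  finally show "\<rho> n (B.act n i h (genB n w)) = \<rho> n (genB n w)" .
qed

text \<open>Under \<open>\<rho>\<close> every operator on one of the first \<open>n\<close> gaps
  acts trivially, and so does its average; the average over gap \<open>n\<close> is the one that is
  left.\<close>

lemma \<rho>_F: "m \<le> n \<Longrightarrow> x \<in> carrier (CB n) \<Longrightarrow> \<rho> n (B.F n m x) = \<rho> n x"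
proof (induction m arbitrary: x)
  case (Suc m)
  have "(\<Oplus>\<^bsub>Q n\<^esub>g\<in>carrier \<Gamma>. \<rho> n (B.act n m g x)) = (\<Oplus>\<^bsub>Q n\<^esub>g\<in>carrier \<Gamma>. \<rho> n x)"
    using Suc.prems by (intro B.sum_cong Q.module_axioms \<rho>_act) auto
  then have "\<rho> n (B.E n m x) = \<rho> n x"
    unfolding B.linear_E[OF Q.module_axioms \<rho>_hom Suc.prems(2)]
    using Suc.prems(2) by (simp only: B.average_const[OF Q.module_axioms] \<rho>.closed)
  then show ?case using Suc by simp
qed simp

lemma eq_gen_zero:
  assumes g: "g \<in> G" and w: "w \<in> tuples A (Suc n)" and j: "j \<le> n" "w ! j = \<zero>"
  shows "eg n (g, w) = \<zero>\<^bsub>Q n\<^esub>"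
proof -
  have "(\<lambda>x. eg n (g, w[j := x])) \<in> mod_hom R A (Q n)"
    using multilinear_slot[OF eq_gen_multilinear[OF g] w] j by simp
  from linear_map.zero[OF linear_mapI[OF module_axioms Q.module_axioms this]]
  have "eg n (g, w[j := \<zero>]) = \<zero>\<^bsub>Q n\<^esub>" .
  moreover have "w[j := \<zero>] = w" using list_update_id[of w j] j(2) by simp
  ultimately show ?thesis by simp
qed

text \<open>On a word of monomials a summand can be nonzero only if its family satisfies
  \<open>v_j = s_j v_(j+1)\<close>, and this recursion determines the family downwards from
  \<open>v_n = s_n\<close>.\<close>

lemma \<rho>_mono:
  assumes w: "w \<in> tuples B (Suc n)" and v: "v \<in> V n"
    and wj: "\<And>j. j \<le> n \<Longrightarrow> w ! j = monom (c j) (s j)" and s: "\<And>j. j \<le> n \<Longrightarrow> s j \<in> G"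
    and vs: "\<And>j. j \<le> n \<Longrightarrow> v j = s j \<cdot> nxt n v j"
  shows "\<rho> n (genB n w) = eg n (v 0, rword n v w)"
proof -
  have "eg n (v' 0, rword n v' w) = \<zero>\<^bsub>Q n\<^esub>" if v': "v' \<in> V n" "v' \<noteq> v" for v'
  proof -
    have "\<exists>j\<le>n. v' j \<noteq> s j \<cdot> nxt n v' j"
    proof (rule ccontr)
      assume "\<not> ?thesis"
      then have v's: "\<And>j. j \<le> n \<Longrightarrow> v' j = s j \<cdot> nxt n v' j" by blast
      have "v' j = v j" if "j \<le> n" for j
        using that
      proof (induction j rule: inc_induct)
        case base
        then show ?case using vs[of n] v's[of n] by (simp add: nxt_def)
      next
        case (step j)
        then show ?case using vs[of j] v's[of j] by (simp add: nxt_def)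
      qed
      then have "v' = v" using v v'(1) by (intro PiE_ext) auto
      then show False using v'(2) by simp
    qed
    then obtain j where j: "j \<le> n" "v' j \<noteq> s j \<cdot> nxt n v' j" by blast
    have vj: "v' j \<in> G" "nxt n v' j \<in> G" using V_mem[OF v'(1) j(1)] nxt_mem[OF v'(1) j(1)] by auto
    have "v' j \<cdot> gi (nxt n v' j) \<noteq> s j"
      using j(2) vj by (metis \<Gamma>.inv_closed \<Gamma>.m_assoc \<Gamma>.l_inv \<Gamma>.r_one)
    then have "rword n v' w ! j = \<zero>"
      using vj by (simp add: nth_rword[OF j(1)] wj[OF j(1)] monom_def)
    then show ?thesis
      using v'(1) j(1) by (intro eq_gen_zero word_map_closed[OF word_map_rword] w) (simp_all add: V_mem)
  qed
  then show ?thesis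
    unfolding \<rho>_gen[OF w] by (intro Q.finsum_single V_finite v rterm_closed w) auto
qed

text \<open>Gap \<open>n\<close> joins the last letter to the first, so \<open>h\<close> enters at
  both ends: \<open>h^-1 g a_0\<close> in front and \<open>a_n h\<close> at the back. Moving the
  \<open>h\<close> at the back to the left through the word conjugates everything by it.\<close>

lemma \<rho>_act_\<iota>:
  assumes h: "h \<in> G" and x: "x \<in> carrier (Q n)"
  shows "\<rho> n (B.act n n h (\<iota> n x)) = eq_act R A G n (gi h) x"
proof -
  have hc: "h \<in> carrier \<Gamma>" using h by simp
  have hi: "gi h \<in> G" using h by simp
  show ?thesis
  proof (rule eq_hom_eq[OF Q.module_axioms mod_hom_comp[OF mod_hom_comp[OF \<iota>_hom B.act_hom[OF hc]] \<rho>_hom]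
        eq_act_hom[OF hi] _ x])
    fix g a assume g: "g \<in> G" and a: "a \<in> tuples A (Suc n)"
    note iwa = word_map_closed[OF word_map_iw[OF g] a]
    let ?w = "wact B n (unit h) (unit (gi h)) (iw g a)"
    \<comment> \<open>These are the group parts of the letters. For \<open>n = 0\<close> the single
      letter is first and last at once, hence the nested case.\<close>
    let ?s = "\<lambda>j. if j = 0 then if n = 0 then gi h \<cdot> g \<cdot> h else gi h \<cdot> g else if j = n then h else ge"
    let ?c = "\<lambda>j. if j = 0 then (gi h) (g (a ! 0)) else a ! j"
    \<comment> \<open>The products of the group parts from position \<open>j\<close> on, which
      single out the surviving summand.\<close>
    define v where "v = (\<lambda>j\<in>{..n}. if j = 0 then gi h \<cdot> g \<cdot> h else h)"
    have w: "?w \<in> tuples B (Suc n)" using word_map_closed[OF B.wm_act iwa] h by simp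
    have an: "a ! j \<in> carrier A" if "j \<le> n" for j using tuples_nth[OF a] that by simp
    have v: "v \<in> V n" using h g by (auto simp: v_def)
    have wj: "?w ! j = monom (?c j) (?s j)" if "j \<le> n" for j
      unfolding nth_wact[OF tuples_length[OF iwa] that order_refl] nth_iw[OF g a that]
      using h g an[OF that] an[of 0]
      by (auto simp: Let_def unit_def monom_mono \<Gamma>.m_assoc)
    have "\<rho> n (genB n ?w) = eg n (v 0, rword n v ?w)"
      using h g by (intro \<rho>_mono[OF w v wj]) (auto simp: v_def nxt_def \<Gamma>.m_assoc)
    also have "rword n v ?w = map (gi h) a"
    proof (rule nth_equalityI)
      show "length (rword n v ?w) = length (map (gi h) a)" using tuples_length[OF a] by simp
      fix j assume "j < length (rword n v ?w)"
      then have j: "j \<le> n" by simp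
      have "v j \<cdot> gi (nxt n v j) = ?s j"
        using h g j by (auto simp: v_def nxt_def \<Gamma>.m_assoc)
      moreover have "?s j \<in> G" using h g by auto
      ultimately have "rword n v ?w ! j = (gi (v j)) (?c j)"
        by (simp only: nth_rword[OF j] wj[OF j]) (simp add: monom_def)
      also have "\<dots> = (gi h) (a ! j)"
        using h g j an[OF j] an[of 0] by (auto simp: v_def \<Gamma>.inv_mult_group)
      finally show "rword n v ?w ! j = map (gi h) a ! j" using tuples_length[OF a] j by simp
    qed
    also have "v 0 = gi h \<cdot> g \<cdot> gi (gi h)" using h by (simp add: v_def)
    finally show "\<rho> n (B.act n n h (\<iota> n (eg n (g, a)))) = eq_act R A G n (gi h) (eg n (g, a))"
      using h by (simp add: \<iota>_gen[OF g a] B.act_gen[OF _ iwa] eq_act_gen[OF hi g a])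
  qed
qed

text \<open>Modulo the coinvariant relations the right side is \<open>x\<close>, so
  \<open>\<rho>\<close> is a left inverse of \<open>P \<circ> \<iota>\<close> up to these
  relations.\<close>

lemma \<rho>_P_\<iota>:
  assumes x: "x \<in> carrier (Q n)"
  shows "\<rho> n (B.P n (\<iota> n x)) = \<gamma> \<odot>\<^bsub>Q n\<^esub> (\<Oplus>\<^bsub>Q n\<^esub>h\<in>G. eq_act R A G n (gi h) x)"
proof -
  have "\<rho> n (B.P n (\<iota> n x)) = \<rho> n (B.E n n (\<iota> n x))"
    using x by (simp add: B.P_def \<rho>_F)
  also have "\<dots> = \<gamma> \<odot>\<^bsub>Q n\<^esub> (\<Oplus>\<^bsub>Q n\<^esub>h\<in>G. \<rho> n (B.act n n h (\<iota> n x)))"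
    using x by (simp add: B.linear_E[OF Q.module_axioms \<rho>_hom])
  also have "(\<Oplus>\<^bsub>Q n\<^esub>h\<in>G. \<rho> n (B.act n n h (\<iota> n x))) = (\<Oplus>\<^bsub>Q n\<^esub>h\<in>G. eq_act R A G n (gi h) x)"
    using x by (intro Q.finsum_cong') (auto simp: \<rho>_act_\<iota> mod_hom_closed[OF eq_act_hom])
  finally show ?thesis .
qed

section \<open>Coinvariants\<close>

abbreviation "cr n \<equiv> coinv_rels R A G n"

lemma cr_gens_subset: "{eq_act R A G n h x \<ominus>\<^bsub>Q n\<^esub> x | h x. h \<in> G \<and> x \<in> carrier (Q n)} \<subseteq> carrier (Q n)"
  by (auto simp: mod_hom_closed[OF eq_act_hom])

lemma cr_submodule: "submodule (cr n) R (Q n)"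
  unfolding coinv_rels_def by (rule Q.mod_span_submodule[OF cr_gens_subset])

text \<open>The relations are killed because \<open>P\<close> absorbs the action. Conversely, modulo
  the relations \<open>\<rho>_P_\<iota>\<close> recovers \<open>x\<close> from
  \<open>P (\<iota> x)\<close>: every translate of \<open>x\<close> has the class of
  \<open>x\<close>, and \<open>\<gamma>\<close> normalises their number.\<close>

lemma cr_iff:
  assumes x: "x \<in> carrier (Q n)"
  shows "x \<in> cr n \<longleftrightarrow> B.P n (\<iota> n x) = \<zero>\<^bsub>CB n\<^esub>"
proof
  assume "x \<in> cr n"
  then have "x \<in> mod_span R (Q n) {eq_act R A G n h x \<ominus>\<^bsub>Q n\<^esub> x | h x. h \<in> G \<and> x \<in> carrier (Q n)}"
    by (simp add: coinv_rels_def)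
  then show "B.P n (\<iota> n x) = \<zero>\<^bsub>CB n\<^esub>"
    using cr_gens_subset
  proof (induction rule: Q.mod_span_induct)
    case (gen x)
    then show ?case
      by (auto simp: \<iota>.minus B.P.minus P_\<iota>_act mod_hom_closed[OF eq_act_hom])
  qed (simp_all add: \<iota>.add \<iota>.smult B.P.add B.P.smult)
next
  assume P: "B.P n (\<iota> n x) = \<zero>\<^bsub>CB n\<^esub>"
  let ?q = "\<lambda>x. cr n +>\<^bsub>Q n\<^esub> x"
  interpret K: module R "quot_mod (Q n) (cr n)" by (rule Q.quot_mod_module[OF cr_submodule])
  interpret q: linear_map R "Q n" "quot_mod (Q n) (cr n)" ?q
    by (intro linear_mapI Q.module_axioms K.module_axioms Q.quot_proj_hom cr_submodule)
  have ac: "eq_act R A G n (gi h) x \<in> carrier (Q n)" if "h \<in> G" for h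
    using that x by (intro mod_hom_closed[OF eq_act_hom]) auto
  have qa: "?q (eq_act R A G n (gi h) x) = ?q x" if h: "h \<in> G" for h
  proof -
    have "eq_act R A G n (gi h) x \<ominus>\<^bsub>Q n\<^esub> x \<in> cr n"
      unfolding coinv_rels_def
      by (rule subsetD[OF Q.mod_span_superset]) (use h x in \<open>auto intro!: exI[of _ "gi h"]\<close>)
    then show ?thesis using ac[OF h] x by (simp add: Q.coset_eq_iff[OF cr_submodule])
  qed
  have "?q \<zero>\<^bsub>Q n\<^esub> = ?q (\<gamma> \<odot>\<^bsub>Q n\<^esub> (\<Oplus>\<^bsub>Q n\<^esub>h\<in>G. eq_act R A G n (gi h) x))"
    using \<rho>_P_\<iota>[OF x] by (simp only: P \<rho>.zero)
  also have "\<dots> = \<gamma> \<odot>\<^bsub>quot_mod (Q n) (cr n)\<^esub> (\<Oplus>\<^bsub>quot_mod (Q n) (cr n)\<^esub>h\<in>G. ?q (eq_act R A G n (gi h) x))"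
    using ac \<gamma>_closed by (simp add: q.smult q.finsum Pi_iff Q.finsum_closed)
  also have "(\<Oplus>\<^bsub>quot_mod (Q n) (cr n)\<^esub>h\<in>G. ?q (eq_act R A G n (gi h) x)) = (\<Oplus>\<^bsub>quot_mod (Q n) (cr n)\<^esub>h\<in>G. ?q x)"
    using x qa by (intro K.finsum_cong') auto
  also have "\<gamma> \<odot>\<^bsub>quot_mod (Q n) (cr n)\<^esub> \<dots> = ?q x"
    using B.average_const[OF K.module_axioms q.closed[OF x]] by simp
  finally have "x \<ominus>\<^bsub>Q n\<^esub> \<zero>\<^bsub>Q n\<^esub> \<in> cr n"
    using Q.coset_eq_iff[OF cr_submodule x Q.zero_closed] by simp
  then show "x \<in> cr n" using x by simp
qed

section \<open>Every value of \<open>P\<close> comes from equivariant chains\<close>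

lemma monom_span: "mod_span R B {monom a g | a g. a \<in> carrier A \<and> g \<in> G} = carrier B"
proof -
  let ?X = "{monom a g | a g. a \<in> carrier A \<and> g \<in> G}"
  have X: "?X \<subseteq> carrier B" by (auto simp: monom_closed)
  note S = B.mod_span_submodule[OF X]
  have *: "x \<in> mod_span R B ?X" if "finite J" "J \<subseteq> G" "x \<in> carrier B" "\<And>g. g \<in> G - J \<Longrightarrow> x g = \<zero>" for x J
    using that
  proof (induction J arbitrary: x)
    case empty
    have "x = \<zero>\<^bsub>B\<^esub>"
      using empty by (intro B_eqI) (auto simp: B_carrier B_zero)
    then show ?case using B.submodule_zero[OF S] by simp
  next
    case (insert g J)
    let ?y = "\<lambda>u\<in>G. if u = g then \<zero> else x u"
    have g: "g \<in> G" using insert by auto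
    have y: "?y \<in> carrier B" using insert by (auto simp: B_carrier)
    have xg: "x g \<in> carrier A" using insert g by auto
    have e: "x = ?y \<oplus>\<^bsub>B\<^esub> monom (x g) g"
      using insert y monom_closed[OF xg] by (intro B_eqI B.M.add.m_closed) (auto simp: B_add monom_def)
    have y': "?y \<in> mod_span R B ?X"
      using insert.prems by (intro insert.IH[OF _ y]) auto
    have "monom (x g) g \<in> mod_span R B ?X"
      by (rule subsetD[OF B.mod_span_superset]) (use xg g in blast)
    from B.submoduleE(5)[OF S y' this] show ?case by (subst e)
  qed
  show ?thesis
    using B.submoduleE(1)[OF S] *[OF G_finite subset_refl] by (intro subset_antisym subsetI) auto
qed

text \<open>Induction on the last position \<open>m\<close> at which a group element may remain. If
  letter \<open>m + 1\<close> is \<open>a s\<close>, acting with \<open>s\<close> on gap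
  \<open>m\<close> pushes \<open>s\<close> into letter \<open>m\<close> and leaves
  \<open>s^-1(a)\<close> behind, which \<open>P\<close> does not notice.\<close>

lemma P_mono_word:
  assumes "m \<le> n" "w \<in> tuples B (Suc n)"
    and "\<And>j. j \<le> m \<Longrightarrow> \<exists>a g. a \<in> carrier A \<and> g \<in> G \<and> w ! j = monom a g"
    and "\<And>j. m < j \<Longrightarrow> j \<le> n \<Longrightarrow> \<exists>a. a \<in> carrier A \<and> w ! j = monom a ge"
  shows "\<exists>y\<in>carrier (Q n). B.P n (genB n w) = B.P n (\<iota> n y)"
  using assms
proof (induction m arbitrary: w)
  case 0
  obtain a0 g where a0: "a0 \<in> carrier A" "g \<in> G" "w ! 0 = monom a0 g" using 0(3)[of 0] by auto
  have "\<forall>j. \<exists>a. 0 < j \<and> j \<le> n \<longrightarrow> a \<in> carrier A \<and> w ! j = monom a ge" using 0(4) by blast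
  then obtain a where a: "\<And>j. 0 < j \<Longrightarrow> j \<le> n \<Longrightarrow> a j \<in> carrier A \<and> w ! j = monom (a j) ge" by metis
  \<comment> \<open>The first entry is \<open>g^-1(a0)\<close> because \<open>\<iota>\<close> puts
    \<open>g\<close> in front of it.\<close>
  define as where "as = map (\<lambda>j. if j = 0 then (gi g) a0 else a j) [0..<Suc n]"
  have asn: "as ! j = (if j = 0 then (gi g) a0 else a j)" if "j \<le> n" for j
    unfolding as_def using that by (subst nth_map) (simp_all del: upt_Suc)
  have as: "as \<in> tuples A (Suc n)"
    using asn a a0 by (intro tuplesI) (auto simp: as_def)
  have "iw g as = w"
    using tuples_length[OF 0(2)] tuples_length[OF as]
    by (intro nth_equalityI) (auto simp: nth_iw[OF a0(2) as] asn a a0)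
  then have "\<iota> n (eg n (g, as)) = genB n w" using \<iota>_gen[OF a0(2) as] by simp
  then show ?case using eq_gen_closed[OF a0(2) as] by metis
next
  case (Suc m)
  obtain a s where as: "a \<in> carrier A" "s \<in> G" "w ! Suc m = monom a s" using Suc.prems(3)[of "Suc m"] by auto
  obtain c r where cr: "c \<in> carrier A" "r \<in> G" "w ! m = monom c r" using Suc.prems(3)[of m] by auto
  let ?w = "wact B m (unit s) (unit (gi s)) w"
  have mn: "m \<le> n" "m \<noteq> n" using Suc.prems(1) by auto
  have sc: "s \<in> carrier \<Gamma>" using as by simp
  have w: "?w \<in> tuples B (Suc n)" using word_map_closed[OF B.wm_act[OF sc] Suc.prems(2)] by simp
  note nth = nth_wact[OF tuples_length[OF Suc.prems(2)] _ mn(1)]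
  have 1: "?w ! m = monom c (r \<cdot> s)" using mn as cr by (simp add: nth unit_def monom_mono)
  have 2: "?w ! Suc m = monom ((gi s) a) ge" using Suc.prems(1) mn as by (simp add: nth unit_def monom_mono)
  have 3: "?w ! j = w ! j" if "j \<le> n" "j \<noteq> m" "j \<noteq> Suc m" for j using that mn by (simp add: nth)
  have "\<exists>y\<in>carrier (Q n). B.P n (genB n ?w) = B.P n (\<iota> n y)"
  proof (rule Suc.IH[OF mn(1) w])
    fix j assume j: "j \<le> m"
    show "\<exists>a g. a \<in> carrier A \<and> g \<in> G \<and> ?w ! j = monom a g"
    proof (cases "j = m")
      case True
      then show ?thesis using 1 as cr by blast
    next
      case False
      then show ?thesis using 3[of j] Suc.prems(3)[of j] j mn by simp
    qed
  next
    fix j assume j: "m < j" "j \<le> n"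
    show "\<exists>a. a \<in> carrier A \<and> ?w ! j = monom a ge"
    proof (cases "j = Suc m")
      case True
      then show ?thesis using 2 as by (intro exI[of _ "(gi s) a"]) simp
    next
      case False
      then show ?thesis using 3[of j] Suc.prems(4)[of j] j by simp
    qed
  qed
  moreover have "B.P n (genB n ?w) = B.P n (genB n w)"
    using B.P_act[OF sc mn(1) B.hoch_gen_closed[OF Suc.prems(2)]] by (simp add: B.act_gen[OF sc Suc.prems(2)])
  ultimately show ?case by simp
qed

lemma P_image:
  assumes "x \<in> carrier (CB n)"
  shows "\<exists>y\<in>carrier (Q n). B.P n x = B.P n (\<iota> n y)"
proof -
  let ?X = "{monom a g | a g. a \<in> carrier A \<and> g \<in> G}"
  let ?W = "{w. length w = Suc n \<and> set w \<subseteq> ?X}"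
  have X: "?X \<subseteq> carrier B" by (auto simp: monom_closed)
  have "x \<in> mod_span R (CB n) (genB n ` ?W)"
    using B.tensor_power_span_words[OF X monom_span, of "Suc n"] assms
    unfolding B.hoch_mod_eq B.hoch_gen_eq by simp
  moreover have W: "?W \<subseteq> tuples B (Suc n)" using X by (auto simp: tuples_def)
  have "genB n ` ?W \<subseteq> carrier (CB n)"
    by (intro image_subsetI B.hoch_gen_closed subsetD[OF W])
  ultimately show ?thesis
  proof (induction rule: B.C.mod_span_induct)
    case zero
    show ?case by (rule bexI[of _ "\<zero>\<^bsub>Q n\<^esub>"]) simp_all
  next
    case (gen x)
    then obtain w where w: "w \<in> ?W" "x = genB n w" by blast
    have "\<exists>a g. a \<in> carrier A \<and> g \<in> G \<and> w ! j = monom a g" if "j \<le> n" for j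
    proof -
      have "w ! j \<in> set w" using w(1) that by simp
      then have "w ! j \<in> ?X" using w(1) by blast
      then show ?thesis by blast
    qed
    then show ?case
      unfolding w(2) by (intro P_mono_word[OF order_refl subsetD[OF W w(1)]]) auto
  next
    case (add x y)
    then obtain x' y' where "x' \<in> carrier (Q n)" "B.P n x = B.P n (\<iota> n x')"
      "y' \<in> carrier (Q n)" "B.P n y = B.P n (\<iota> n y')" by blast
    then show ?case using add(1,2)
      by (intro bexI[of _ "x' \<oplus>\<^bsub>Q n\<^esub> y'"]) (simp_all add: B.P.add \<iota>.add)
  next
    case (smult c x)
    then obtain x' where "x' \<in> carrier (Q n)" "B.P n x = B.P n (\<iota> n x')" by blast
    then show ?case using smult(1,2)
      by (intro bexI[of _ "c \<odot>\<^bsub>Q n\<^esub> x'"]) (simp_all add: B.P.smult \<iota>.smult)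
  qed
qed

section \<open>The coinvariant complex as a model of Hochschild homology\<close>

abbreviation "K n \<equiv> coinv_mod R A G n"
abbreviation "\<pi> n x \<equiv> cr n +>\<^bsub>Q n\<^esub> x"

lemma K_module: "module R (K n)"
  unfolding coinv_mod_def by (rule Q.quot_mod_module[OF cr_submodule])

lemma K_carrier: "carrier (K n) = \<pi> n ` carrier (Q n)"
  unfolding coinv_mod_def by (rule Q.carrier_quot_mod)

text \<open>Identities between coinvariants can now be tested in the chains of \<open>B\<close>; the
  complex of coinvariants is established in this way.\<close>

lemma \<pi>_eq_iff:
  assumes "x \<in> carrier (Q n)" "y \<in> carrier (Q n)"
  shows "\<pi> n x = \<pi> n y \<longleftrightarrow> B.P n (\<iota> n x) = B.P n (\<iota> n y)"
  using assms
  by (simp add: Q.coset_eq_iff[OF cr_submodule] cr_iff \<iota>.minus B.P.minus B.C.minus_eq_zero_iff)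

lemma K_zero: "\<zero>\<^bsub>K n\<^esub> = \<pi> n \<zero>\<^bsub>Q n\<^esub>"
  unfolding coinv_mod_def Q.quot_zero by (rule Q.coset_zero[OF cr_submodule, symmetric])

lemma eq_b_closed: "x \<in> carrier (Q (Suc n)) \<Longrightarrow> eq_b R A G n x \<in> carrier (Q n)"
  by (rule mod_hom_closed[OF eq_b_hom])

lemma P_\<iota>_eq_b: "x \<in> carrier (Q (Suc n)) \<Longrightarrow>
    B.P n (\<iota> n (eq_b R A G n x)) = hoch_b R B n (B.P (Suc n) (\<iota> (Suc n) x))"
  by (simp add: \<iota>_chain B.P_b)

text \<open>By way of \<open>cr_iff\<close> this reduces to \<open>\<iota>\<close> and
  \<open>P\<close> being chain maps.\<close>

lemma eq_b_cr: "x \<in> cr (Suc n) \<Longrightarrow> eq_b R A G n x \<in> cr n"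
  using Q.submoduleE(1)[OF cr_submodule, of "Suc n"]
  by (subst cr_iff) (auto simp: eq_b_closed P_\<iota>_eq_b cr_iff[THEN iffD1])

lemma coinv_b_hom: "coinv_b R A G n \<in> mod_hom R (K (Suc n)) (K n)"
  unfolding coinv_b_def coinv_mod_def
  by (rule Q.quot_map_hom[OF Q.module_axioms cr_submodule cr_submodule eq_b_hom eq_b_cr])

lemma coinv_b_\<pi>: "x \<in> carrier (Q (Suc n)) \<Longrightarrow> coinv_b R A G n (\<pi> (Suc n) x) = \<pi> n (eq_b R A G n x)"
  unfolding coinv_b_def
  by (rule Q.quot_map_coset[OF Q.module_axioms cr_submodule cr_submodule eq_b_hom eq_b_cr])

text \<open>\<open>b b = 0\<close> is imported from the Hochschild complex of \<open>B\<close>, into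
  which \<open>P \<circ> \<iota>\<close> embeds the coinvariants.\<close>

lemma coinv_chain_complex: "chain_complex R (coinv_mod R A G) (coinv_b R A G)"
proof (intro chain_complex.intro K_module coinv_b_hom)
  fix n X assume "X \<in> carrier (K (Suc (Suc n)))"
  then obtain x where x: "x \<in> carrier (Q (Suc (Suc n)))" "X = \<pi> (Suc (Suc n)) x" by (auto simp: K_carrier)
  have "\<pi> n (eq_b R A G n (eq_b R A G (Suc n) x)) = \<pi> n \<zero>\<^bsub>Q n\<^esub>"
    using x(1) by (subst \<pi>_eq_iff) (simp_all add: eq_b_closed P_\<iota>_eq_b B.b_b)
  then show "coinv_b R A G n (coinv_b R A G (Suc n) X) = \<zero>\<^bsub>K n\<^esub>"
    using x by (simp add: coinv_b_\<pi> eq_b_closed K_zero)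
qed

sublocale K: chain_complex R "coinv_mod R A G" "coinv_b R A G"
  by (rule coinv_chain_complex)

lemma ex_\<sigma>: "\<exists>f. f \<in> mod_hom R (K n) (CB n) \<and> (\<forall>x\<in>carrier (Q n). f (\<pi> n x) = B.P n (\<iota> n x))"
proof -
  have h: "(\<lambda>x. B.P n (\<iota> n x)) \<in> mod_hom R (Q n) (CB n)" by (rule mod_hom_comp[OF \<iota>_hom B.P_hom])
  have z: "B.P n (\<iota> n x) = \<zero>\<^bsub>CB n\<^esub>" if "x \<in> cr n" for x
    using that Q.submoduleE(1)[OF cr_submodule, of n] by (subst cr_iff[symmetric]) auto
  show ?thesis
    unfolding coinv_mod_def by (rule Q.quot_lift[OF B.hoch_module cr_submodule h z]) blast+
qed

definition \<sigma> :: "nat \<Rightarrow> ('k, 'a) eq_chain set \<Rightarrow> ((('a \<Rightarrow> 'a) \<Rightarrow> 'a) list \<Rightarrow> 'k) set"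
  where "\<sigma> n = (SOME f. f \<in> mod_hom R (K n) (CB n) \<and> (\<forall>x\<in>carrier (Q n). f (\<pi> n x) = B.P n (\<iota> n x)))"

lemma \<sigma>: "\<sigma> n \<in> mod_hom R (K n) (CB n)" "x \<in> carrier (Q n) \<Longrightarrow> \<sigma> n (\<pi> n x) = B.P n (\<iota> n x)"
  using someI_ex[OF ex_\<sigma>[of n]] unfolding \<sigma>_def[symmetric] by blast+

sublocale model: hochschild_model R B "coinv_mod R A G" "coinv_b R A G" \<sigma>
proof (intro hochschild_model.intro hochschild_model_axioms.intro B_algebra coinv_chain_complex \<sigma>(1))
  fix n X assume "X \<in> carrier (K (Suc n))"
  then obtain x where x: "x \<in> carrier (Q (Suc n))" "X = \<pi> (Suc n) x" by (auto simp: K_carrier)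
  then show "\<sigma> n (coinv_b R A G n X) = hoch_b R B n (\<sigma> (Suc n) X)"
    by (simp add: coinv_b_\<pi> \<sigma>(2) eq_b_closed P_\<iota>_eq_b)
next
  fix n X y assume "X \<in> carrier (K n)" and y: "y \<in> carrier (CB (Suc n))" and eq: "\<sigma> n X = hoch_b R B n y"
  then obtain x where x: "x \<in> carrier (Q n)" "X = \<pi> n x" by (auto simp: K_carrier)
  obtain y' where y': "y' \<in> carrier (Q (Suc n))" "B.P (Suc n) y = B.P (Suc n) (\<iota> (Suc n) y')"
    using P_image[OF y] by blast
  \<comment> \<open>\<open>P (\<iota> x)\<close> is fixed by \<open>P\<close>, so the bounding chain
    \<open>y\<close> may be replaced by \<open>P y\<close>, which comes from equivariant
    chains.\<close>
  have "B.P n (\<iota> n x) = B.P n (B.P n (\<iota> n x))" using x by (simp add: B.P_P)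
  also have "B.P n (\<iota> n x) = hoch_b R B n y" using eq x by (simp add: \<sigma>(2))
  also have "B.P n (hoch_b R B n y) = B.P n (\<iota> n (eq_b R A G n y'))"
    using y y' by (simp add: P_\<iota>_eq_b B.P_b[symmetric])
  finally have "X = \<pi> n (eq_b R A G n y')"
    unfolding x(2) using x(1) y' eq x by (subst \<pi>_eq_iff) (simp_all add: eq_b_closed \<sigma>(2))
  then show "\<exists>x'\<in>carrier (K (Suc n)). X = coinv_b R A G n x'"
    using y'(1) by (intro bexI[of _ "\<pi> (Suc n) y'"]) (auto simp: coinv_b_\<pi> K_carrier)
next
  fix n z assume z: "z \<in> carrier (CB n)" and bz: "\<And>m. n = Suc m \<Longrightarrow> hoch_b R B m z = \<zero>\<^bsub>CB m\<^esub>"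
  obtain y where y: "y \<in> carrier (Q n)" "B.P n z = B.P n (\<iota> n y)" using P_image[OF z] by blast
  have "\<pi> n y \<in> cycles (coinv_mod R A G) (coinv_b R A G) n"
  proof (cases n)
    case 0
    then show ?thesis using y(1) by (simp add: K.cycles_0 K_carrier)
  next
    case (Suc m)
    \<comment> \<open>The class of \<open>y\<close> is a cycle because \<open>P\<close> is a chain
      map and \<open>z\<close> is a cycle.\<close>
    have "B.P m (\<iota> m (eq_b R A G m y)) = hoch_b R B m (B.P n z)"
      using y Suc by (simp add: P_\<iota>_eq_b)
    also have "\<dots> = \<zero>\<^bsub>CB m\<^esub>"
      using z bz[OF Suc] Suc by (simp add: B.P_b)
    finally have "\<pi> m (eq_b R A G m y) = \<pi> m \<zero>\<^bsub>Q m\<^esub>"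
      using y Suc by (subst \<pi>_eq_iff) (simp_all add: eq_b_closed)
    then show ?thesis
      using y Suc by (simp add: K.cycles_Suc K_carrier coinv_b_\<pi> K_zero)
  qed
  moreover have "z = \<sigma> n (\<pi> n y) \<oplus>\<^bsub>CB n\<^esub> hoch_b R B n (B.H n z)"
  proof -
    \<comment> \<open>For a cycle \<open>z\<close> the term \<open>H b z\<close> drops out of the
      homotopy formula, so \<open>z\<close> and \<open>P z\<close> are homologous.\<close>
    have H: "hoch_b R B n (B.H n z) = z \<ominus>\<^bsub>CB n\<^esub> B.P n z"
    proof (cases n)
      case 0
      then show ?thesis using z B.homotopy_0 by simp
    next
      case (Suc m)
      then show ?thesis using z bz[OF Suc] B.homotopy_Suc[of z m] by simp
    qed
    have S: "\<sigma> n (\<pi> n y) = B.P n z" using \<sigma>(2)[OF y(1)] y(2) by simp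
    show ?thesis
      unfolding H S by (rule B.C.diff_add_cancel'(2)[OF z B.P.closed[OF z], symmetric])
  qed
  ultimately show "\<exists>x\<in>cycles (coinv_mod R A G) (coinv_b R A G) n. \<exists>y\<in>carrier (CB (Suc n)).
      z = \<sigma> n x \<oplus>\<^bsub>CB n\<^esub> hoch_b R B n y"
    using z by (intro bexI[of _ "\<pi> n y"] bexI[of _ "B.H n z"]) auto
qed

end

theorem mainTheorem4:
  fixes k :: "('k, 'r) ring_scheme"
    and A :: "('k, 'a, 'm) module_scheme"
    and G :: "('a \<Rightarrow> 'a) set"
  assumes "cring k"
    and "assoc_algebra k A"
    and "subgroup G (alg_Aut k A)"
    and "finite G"
    and "[card G] \<cdot>\<^bsub>k\<^esub> \<one>\<^bsub>k\<^esub> \<in> Units k"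
  shows "\<exists>I D. periodicity_sequence_exact k
            (HHG k A G) (HC k (crossed_product k A G))
            I (periodicity k (crossed_product k A G)) D"
proof -
  interpret k: cring k by fact
  \<comment> \<open>The constant \<open>\<gamma>\<close> is the inverse of the order of
    \<open>G\<close>, which exists because the order is a unit.\<close>
  interpret crossed k A G "inv\<^bsub>k\<^esub> ([card G] \<cdot>\<^bsub>k\<^esub> \<one>\<^bsub>k\<^esub>)"
    using assms by (intro crossed.intro crossed_axioms.intro) auto
  show ?thesis
    using model.HC_periodicity unfolding HHG_def by blast
qed

end
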